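(* Let $\alpha\ge 1/2$, $\beta<0$, $x_0<0$, $\Omega=\Omega_{\alpha,\beta}$, $\sigma=\sigma_{\alpha,\beta}$, and let $\lambda_0>0$ be the principal eigenvalue of the Tricomi operator $\widetilde T_{AC\cup\sigma}$ (see context). Let $u=\Re u+i\,\Im u$, with $\Re u,\Im u\in\widetilde W^1_{AC\cup\sigma}(\Omega)$, be a solution, not vanishing almost everywhere, of $$Tu=\lambda u\ \text{ in }\Omega,\qquad u=0\ \text{ on }AC\cup\sigma,\qquad \lambda\in[\lambda_0,+\infty),$$ and assume that $u_y,\ xu_x,\ yu_x\in C^1(\overline\Omega)$, $xu\in C^2(\Omega)$, $u\in L^2(BC)$ and $|y|^{1/2}u_x,\ u_y\in L^2(BC)\cap L^2(\sigma)$ (spaces of complex valued functions). Then, for all $\varepsilon_1,\varepsilon_2>0$, $$\begin{aligned}0<2\lambda^{1/2}\|u\|_{L^2(\Omega)}\le\Big\{&C_1(x_0,\varepsilon_1)\||y|^{1/2}u_x\|_{L^2(BC)}^2+C_2(x_0,\varepsilon_1)\|u_y\|_{L^2(BC)}^2\\&+C_3(x_0)\big[\|\Re u\|_{L^2(BC)}+\|\Im u\|_{L^2(BC)}\big]\big[\||y|^{1/2}u_x\|_{L^2(BC)}+\|u_y\|_{L^2(BC)}\big]\\&+C_{25}(\alpha,\beta,x_0,\varepsilon_2)\||y|^{1/2}u_x\|_{L^2(\sigma)}^2+C_{26}(\alpha,\beta,x_0,\varepsilon_2)\|u_y\|_{L^2(\sigma)}^2\Big\}^{1/2},\end{aligned}$$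 where $$C_1(x_0,\varepsilon)=\frac{6|x_0|(1+\varepsilon)}{[1+(3|x_0|/2)^{2/3}]^{1/2}},\quad C_2(x_0,\varepsilon)=\frac{6|x_0|(1+\varepsilon^{-1})}{[1+(3|x_0|/2)^{2/3}]^{1/2}},\quad C_3(x_0)=\frac{(3|x_0|/2)^{1/3}}{[1+(3|x_0|/2)^{2/3}]^{1/2}},$$ and the explicit constants $C_{25},C_{26}$ are defined in the context.
   Context: **Geometry.** Fix $x_0<0$. $T=-y\partial_x^2-\partial_y^2$ is the Tricomi operator on $\mathbb R^2$. Let $A=(2x_0,0)$, $B=(0,0)$, $C=(x_0,y_C)$, $y_C=-(3|x_0|/2)^{2/3}$, $AC=\{(x,y): y_C\le y\le 0,\ 3(x-2x_0)=2(-y)^{3/2}\}$, $BC=\{(x,y): y_C\le y\le 0,\ 3x=-2(-y)^{3/2}\}$. For $\alpha>0>\beta$ let $g_{\alpha,\beta}(x)=\big[\tfrac{(\alpha+1)|\beta|x(2x_0-x)}{2}\big]^{1/(\alpha+1)}$, $x\in[2x_0,0]$, $\sigma_{\alpha,\beta}=\{(x,g_{\alpha,\beta}(x)):x\in[2x_0,0]\}$, and let $\Omega_{\alpha,\beta}$ be the bounded, open, simply connected region with boundary $AC\cup BC\cup\sigma_{\alpha,\beta}$. For a curve $\Gamma$, $\|\psi\|_{L^2(\Gamma)}^2=\int_\Gamma|\psi|^2\,ds$ ($ds$ arclength). **Function spaces and $\lambda_0$.** For $\Gamma\subset\partial\Omega$ connected, $C^\infty_{0,\Gamma}(\overline\Omega)$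 is the set of real functions in $C^\infty(\overline\Omega)$ vanishing in a neighbourhood (in $\Omega$) of $\Gamma$; $\widetilde W^1_\Gamma(\Omega)$ is its closure in the norm $\big(\int_\Omega(|y|\psi_x^2+\psi_y^2+\psi^2)\,dx\,dy\big)^{1/2}$; its dual $\widetilde W^{-1}_\Gamma(\Omega)$ is the completion of $L^2(\Omega)$ in the norm $\sup\{|(w,\psi)_{L^2}|:\|\psi\|_{\widetilde W^1_\Gamma}=1\}$. $\widetilde T_{AC\cup\sigma}:\widetilde W^1_{AC\cup\sigma}(\Omega)\to\widetilde W^{-1}_{BC\cup\sigma}(\Omega)$ is the continuous extension of $T$ from $C^\infty_{0,AC\cup\sigma}(\overline\Omega)$. A generalized solution of $Tu=h\in L^2(\Omega)$ in $\Omega$, $u=0$ on $AC\cup\sigma$, is a $u\in\widetilde W^1_{AC\cup\sigma}(\Omega)$ that is the limit in $\widetilde W^1_{AC\cup\sigma}(\Omega)$ of $u_n\in C^\infty_{0,AC\cup\sigma}(\overline\Omega)$ with $Tu_n\to h$ in $\widetilde W^{-1}_{BC\cup\sigma}(\Omega)$. It is known that for the domains $\Omega_{\alpha,\beta}$ there is an eigenvalue $\lambda_0>0$ of $\widetilde T_{AC\cup\sigma}$ with $\lambda_0\le|\lambda|$ for every $\lambda$ in the spectrum of $\widetilde T_{AC\cup\sigma}$ and having an a.e. nonnegative eigenfunction; this $\lambda_0$ is the principal eigenvalue. **Auxiliary functions** ($x\in[2x_0,0]$): $h_{\alpha,\beta}(x)=\{(x-x_0)^2+\beta^{-2}[g_{\alpha,\beta}(x)]^{2\alpha}\}^{1/2}$;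 $d_\alpha=\frac{5+2\alpha}{4+\alpha}$; $\theta_\alpha(x)=(4+\alpha)x(x-d_\alpha x_0)$; $\Theta_{\alpha,\beta}=\theta_\alpha/h_{\alpha,\beta}$; $\varphi_{\alpha,\beta}(x)=6|\beta|^{-1}x[g_{\alpha,\beta}(x)]^{(2\alpha-1)/2}$; $\phi_{\alpha,\beta}(x)=4(x-x_0)[g_{\alpha,\beta}(x)]^{3/2}$; $\psi_{\alpha,\beta}=\varphi_{\alpha,\beta}+\phi_{\alpha,\beta}$; $\Psi_{\alpha,\beta}=\psi_{\alpha,\beta}/h_{\alpha,\beta}$. **Numbers** ($\alpha\ne1$): $\gamma_\alpha=\frac{\alpha+1}{\alpha-1}$, $c_{\alpha,\beta}=2(\alpha+1)^{-1}\alpha^{-\gamma_\alpha}|\beta|^{\gamma_\alpha-1}$, $M_{\alpha,\beta}=c_{\alpha,\beta}^{1/2}$, $D_{\alpha,\beta}=[2^\alpha(\alpha+1)^{-\alpha}|\beta|]^{1/(\alpha-1)}$, $E_{\alpha,\beta}=M_{\alpha,\beta}[d_\alpha(2-d_\alpha)]^{-1/2}$, $L_{\alpha,\beta}=D_{\alpha,\beta}[d_\alpha(2-d_\alpha)]^{-1/2}$. **Points:** $x_{\alpha,\beta;\pm}=x_0\pm(x_0^2-c_{\alpha,\beta})^{1/2}$ (for $x_0<-M_{\alpha,\beta}$); $x_\alpha=d_\alpha x_0$; $\widetilde x_\alpha=x_\alpha/2$; $\overline x_\alpha=\frac{(4\alpha+1)x_0}{3\alpha}$; $\overline x_{\alpha;-}=x_0-\big(\frac{\alpha+1}{\alpha+4}\big)^{1/2}|x_0|$;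 $\widetilde x_{\beta;-}=x_0-\frac{(6+3|\beta|^2x_0^2)^{1/2}}{3|\beta|}$; $\widehat x_{\beta;-}=\frac{(9+8|\beta|)x_0-[8(3+2|\beta|)^2+9]^{1/2}|x_0|}{4(3+2|\beta|)}$. **Constants bounding $\Theta_{\alpha,\beta}$.** - $C_6(\beta,x_0)=\theta_1(\widetilde x_1)/h_{1,\beta}(x_0)$ if $\beta\le-1$, $=\theta_1(\widetilde x_1)/h_{1,\beta}(0)$ if $\beta\in(-1,0)$. - $C_7(\beta,x_0)=\theta_1(2x_0)/h_{1,\beta}(x_1)$ (with $x_1=d_1x_0$) if $\beta\le-1$, $=\Theta_{1,\beta}(2x_0)$ if $\beta\in(-1,0)$. - For $\alpha>1$: $C_8(\alpha,\beta,x_0)=\theta_\alpha(\widetilde x_\alpha)/h_{\alpha,\beta}(x_0)$ if $x_0\in[-M_{\alpha,\beta},0)$, $=\theta_\alpha(\widetilde x_\alpha)/h_{\alpha,\beta}(x_{\alpha,\beta;+})$ if $x_0<-M_{\alpha,\beta}$; $C_9(\alpha,\beta,x_0)=\theta_\alpha(2x_0)/h_{\alpha,\beta}(x_\alpha)$ if $x_0\in(-E_{\alpha,\beta},0)$, $=\theta_\alpha(2x_0)/h_{\alpha,\beta}(x_{\alpha,\beta;-})$ if $x_0\le-E_{\alpha,\beta}$. - For $\alpha\in(0,1)$: $C_{10}(\alpha,\beta,x_0)=\theta_\alpha(\widetilde x_\alpha)/h_{\alpha,\beta}(0)$ if $x_0\in[-D_{\alpha,\beta},0)$, $=\theta_\alpha(\widetilde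 x_\alpha)/h_{\alpha,\beta}(x_0)$ if $x_0<-D_{\alpha,\beta}$; $C_{11}(\alpha,\beta,x_0)=\Theta_{\alpha,\beta}(2x_0)$ if $x_0\in[-L_{\alpha,\beta},0)$, $=\theta_\alpha(2x_0)/h_{\alpha,\beta}(x_\alpha)$ if $x_0<-L_{\alpha,\beta}$. **Constant $C_{24}(\alpha,\beta,x_0)$** (bounding $|\Psi_{\alpha,\beta}|$): it equals $|C_{12}|$ if $\alpha=1/2$, $x_0\in[-|\beta|^{-1},0)$; $|C_{14}|$ if $\alpha=1/2$, $x_0<-|\beta|^{-1}$; $|C_{16}|$ if $\alpha\in(1/2,1)$; $|C_{18}|$ if $\alpha=1$; $|C_{20}|$ if $\alpha\in(1,2)\cup(2,\infty)$; $|C_{22}|$ if $\alpha=2$, where - $C_{12}=\Psi_{1/2,\beta}(2x_0)$ if $\beta\in[-3/4,0)$, or if $\beta<-3/4$ and $x_0\in[-D_{1/2,\beta},0)$; $C_{12}=\psi_{1/2,\beta}(2x_0)/h_{1/2,\beta}(x_0)$ if $\beta<-3/4$ and $x_0\in[-|\beta|^{-1},-D_{1/2,\beta})$ (here $D_{1/2,\beta}=\frac34|\beta|^{-2}$); - $C_{14}=\psi_{1/2,\beta}(\widetilde x_{\beta;-})/h_{1/2,\beta}(2x_0)$ if $\beta\in(-3/4,0)$ and $x_0\in[-D_{1/2,\beta},-|\beta|^{-1})$; $C_{14}=\psi_{1/2,\beta}(\widetilde x_{\beta;-})/h_{1/2,\beta}(x_0)$ if $\beta\in(-3/4,0)$ and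 $x_0<-D_{1/2,\beta}$, or if $\beta\le-3/4$; - with $S=\varphi_{\alpha,\beta}(\overline x_\alpha)+\phi_{\alpha,\beta}(\overline x_{\alpha;-})$: $C_{16}=S/h_{\alpha,\beta}(2x_0)$ if $x_0\in[-D_{\alpha,\beta},0)$, $=S/h_{\alpha,\beta}(x_0)$ if $x_0<-D_{\alpha,\beta}$; $C_{18}$ (with $\alpha=1$) $=S/h_{1,\beta}(2x_0)$ if $\beta\in(-1,0)$, $=S/h_{1,\beta}(x_0)$ if $\beta\le-1$; $C_{20}=S/h_{\alpha,\beta}(x_0)$ if $x_0\in[-M_{\alpha,\beta},0)$, $=S/h_{\alpha,\beta}(x_{\alpha,\beta;-})$ if $x_0<-M_{\alpha,\beta}$; - $C_{22}=\psi_{2,\beta}(\widehat x_{\beta;-})/h_{2,\beta}(x_0)$ if $x_0\in[-M_{2,\beta},0)$, $=\psi_{2,\beta}(\widehat x_{\beta;-})/h_{2,\beta}(x_{2,\beta;-})$ if $x_0<-M_{2,\beta}$. **Constants $C_{25},C_{26}$** ($\varepsilon>0$): - if $\alpha\in[1/2,1)$: $C_{25}=C_{11}(\alpha,\beta,x_0)+\frac{\varepsilon}{2}C_{24}$, $C_{26}=-C_{10}(\alpha,\beta,x_0)+\frac1{2\varepsilon}C_{24}$; - if $\alpha=1$: $C_{25}=C_7(\beta,x_0)+\frac\varepsilon2C_{24}$, $C_{26}=-C_6(\beta,x_0)+\frac1{2\varepsilon}C_{24}$; - if $\alpha>1$: $C_{25}=C_9(\alpha,\beta,x_0)+\frac\varepsilon2C_{24}$,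 $C_{26}=-C_8(\alpha,\beta,x_0)+\frac1{2\varepsilon}C_{24}$. *)

theory Defs
  imports "HOL-Analysis.Analysis"
begin

section \<open>Geometry\<close>

text \<open>
  The plane is the type \<^typ>\<open>real \<times> real\<close>. Real powers are written with \<open>powr\<close>; all bases below are
  nonnegative, and \<open>0 powr a = 0\<close> is the intended value since \<open>a > 0\<close> wherever the base can vanish
  (the only exception is treated in \<open>varphi_fun\<close>).
\<close>

definition y_C :: "real \<Rightarrow> real" where
  "y_C x0 = - ((3 * \<bar>x0\<bar> / 2) powr (2/3))"

definition AC :: "real \<Rightarrow> (real \<times> real) set" where
  "AC x0 = {(x, y). y_C x0 \<le> y \<and> y \<le> 0 \<and> 3 * (x - 2 * x0) = 2 * (- y) powr (3/2)}"

definition BC :: "real \<Rightarrow> (real \<times> real) set" where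
  "BC x0 = {(x, y). y_C x0 \<le> y \<and> y \<le> 0 \<and> 3 * x = - 2 * (- y) powr (3/2)}"

definition g_fun :: "real \<Rightarrow> real \<Rightarrow> real \<Rightarrow> real \<Rightarrow> real" where
  "g_fun \<alpha> \<beta> x0 x = ((\<alpha> + 1) * \<bar>\<beta>\<bar> * x * (2 * x0 - x) / 2) powr (1 / (\<alpha> + 1))"

definition sigma_arc :: "real \<Rightarrow> real \<Rightarrow> real \<Rightarrow> (real \<times> real) set" where
  "sigma_arc \<alpha> \<beta> x0 = {(x, g_fun \<alpha> \<beta> x0 x) | x. x \<in> {2 * x0..0}}"

definition is_tricomi_domain :: "(real \<times> real) set \<Rightarrow> real \<Rightarrow> real \<Rightarrow> real \<Rightarrow> bool" where
  "is_tricomi_domain \<Omega> \<alpha> \<beta> x0 \<longleftrightarrow>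
     bounded \<Omega> \<and> open \<Omega> \<and> simply_connected \<Omega> \<and>
     frontier \<Omega> = AC x0 \<union> BC x0 \<union> sigma_arc \<alpha> \<beta> x0"


section \<open>Classical differentiability\<close>

definition dx :: "(real \<times> real \<Rightarrow> 'a::real_normed_vector) \<Rightarrow> real \<times> real \<Rightarrow> 'a" where
  "dx f p = frechet_derivative f (at p) (1, 0)"

definition dy :: "(real \<times> real \<Rightarrow> 'a::real_normed_vector) \<Rightarrow> real \<times> real \<Rightarrow> 'a" where
  "dy f p = frechet_derivative f (at p) (0, 1)"

fun Ck_open :: "nat \<Rightarrow> (real \<times> real) set \<Rightarrow> (real \<times> real \<Rightarrow> 'a::real_normed_vector) \<Rightarrow> bool" where
  "Ck_open 0 \<Omega> f \<longleftrightarrow> continuous_on \<Omega> f"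
| "Ck_open (Suc k) \<Omega> f \<longleftrightarrow>
     f differentiable_on \<Omega> \<and> Ck_open k \<Omega> (dx f) \<and> Ck_open k \<Omega> (dy f)"

text \<open>
  \<open>Ck_closure k \<Omega> f\<close> is \<open>f \<in> C\<^sup>k\<close> on the closure of the open set \<open>\<Omega>\<close>: all partial derivatives of
  order at most \<open>k\<close> exist in \<open>\<Omega>\<close> and extend continuously to the closure. The values of \<open>f\<close> outside
  \<open>\<Omega>\<close> play no role.
\<close>

fun Ck_closure :: "nat \<Rightarrow> (real \<times> real) set \<Rightarrow> (real \<times> real \<Rightarrow> 'a::real_normed_vector) \<Rightarrow> bool" where
  "Ck_closure 0 \<Omega> f \<longleftrightarrow> (\<exists>F. continuous_on (closure \<Omega>) F \<and> (\<forall>p\<in>\<Omega>. F p = f p))"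
| "Ck_closure (Suc k) \<Omega> f \<longleftrightarrow>
     Ck_closure 0 \<Omega> f \<and> f differentiable_on \<Omega> \<and>
     Ck_closure k \<Omega> (dx f) \<and> Ck_closure k \<Omega> (dy f)"

definition Tric :: "(real \<times> real \<Rightarrow> real) \<Rightarrow> real \<times> real \<Rightarrow> real" where
  "Tric f p = - snd p * dx (dx f) p - dy (dy f) p"


section \<open>Function spaces\<close>

definition L2 :: "(real \<times> real) set \<Rightarrow> (real \<times> real \<Rightarrow> 'a::{real_normed_vector,second_countable_topology}) \<Rightarrow> bool" where
  "L2 \<Omega> f \<longleftrightarrow>
     f \<in> borel_measurable (lebesgue_on \<Omega>) \<and> integrable (lebesgue_on \<Omega>) (\<lambda>p. (norm (f p))\<^sup>2)"

definition L2_norm :: "(real \<times> real) set \<Rightarrow> (real \<times> real \<Rightarrow> 'a::real_normed_vector) \<Rightarrow> real" where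
  "L2_norm \<Omega> f = sqrt (\<integral>p. (norm (f p))\<^sup>2 \<partial>lebesgue_on \<Omega>)"

definition C0_inf :: "(real \<times> real) set \<Rightarrow> (real \<times> real) set \<Rightarrow> (real \<times> real \<Rightarrow> real) set" where
  "C0_inf \<Omega> \<Gamma> = {f. (\<forall>k. Ck_closure k \<Omega> f) \<and>
     (\<exists>U. open U \<and> \<Gamma> \<subseteq> U \<and> (\<forall>p \<in> U \<inter> \<Omega>. f p = 0))}"

text \<open>
  An element of the closure of \<^const>\<open>C0_inf\<close> in the weighted norm is represented by a triple
  \<open>(u, v, w)\<close>, where \<open>v\<close> and \<open>w\<close> are the limits of the \<open>x\<close>- and \<open>y\<close>-derivatives of an approximating
  sequence. The weight \<open>\<bar>y\<bar>\<close> vanishes only on a null set, so \<open>v\<close> and \<open>w\<close> are determined almost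
  everywhere by \<open>u\<close>, and the closure is identified with a space of functions \<open>u\<close> on \<open>\<Omega>\<close>.
  The squared norm is an \<^typ>\<open>ennreal\<close> integral, so that convergence to zero includes finiteness.
\<close>

definition W1_conv ::
  "(real \<times> real) set \<Rightarrow> (nat \<Rightarrow> real \<times> real \<Rightarrow> real) \<Rightarrow>
   (real \<times> real \<Rightarrow> real) \<Rightarrow> (real \<times> real \<Rightarrow> real) \<Rightarrow> (real \<times> real \<Rightarrow> real) \<Rightarrow> bool" where
  "W1_conv \<Omega> f u v w \<longleftrightarrow>
     u \<in> borel_measurable (lebesgue_on \<Omega>) \<and>
     v \<in> borel_measurable (lebesgue_on \<Omega>) \<and>
     w \<in> borel_measurable (lebesgue_on \<Omega>) \<and>
     (\<lambda>n. \<integral>\<^sup>+p. ennreal (\<bar>snd p\<bar> * (dx (f n) p - v p)\<^sup>2 + (dy (f n) p - w p)\<^sup>2 + (f n p - u p)\<^sup>2)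
            \<partial>lebesgue_on \<Omega>) \<longlonglongrightarrow> 0"

definition W1_jet ::
  "(real \<times> real) set \<Rightarrow> (real \<times> real) set \<Rightarrow>
   (real \<times> real \<Rightarrow> real) \<Rightarrow> (real \<times> real \<Rightarrow> real) \<Rightarrow> (real \<times> real \<Rightarrow> real) \<Rightarrow> bool" where
  "W1_jet \<Omega> \<Gamma> u v w \<longleftrightarrow> (\<exists>f. (\<forall>n. f n \<in> C0_inf \<Omega> \<Gamma>) \<and> W1_conv \<Omega> f u v w)"

definition W1 :: "(real \<times> real) set \<Rightarrow> (real \<times> real) set \<Rightarrow> (real \<times> real \<Rightarrow> real) set" where
  "W1 \<Omega> \<Gamma> = {u. \<exists>v w. W1_jet \<Omega> \<Gamma> u v w}"

definition jet_norm ::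
  "(real \<times> real) set \<Rightarrow>
   (real \<times> real \<Rightarrow> real) \<Rightarrow> (real \<times> real \<Rightarrow> real) \<Rightarrow> (real \<times> real \<Rightarrow> real) \<Rightarrow> real" where
  "jet_norm \<Omega> u v w =
     sqrt (\<integral>p. (\<bar>snd p\<bar> * (v p)\<^sup>2 + (w p)\<^sup>2 + (u p)\<^sup>2) \<partial>lebesgue_on \<Omega>)"

text \<open>
  The dual norm on \<open>L\<^sup>2(\<Omega>)\<close>. Its completion is never needed, because only differences of
  \<open>L\<^sup>2\<close> functions are measured in it.
\<close>

definition Wm1_norm :: "(real \<times> real) set \<Rightarrow> (real \<times> real) set \<Rightarrow> (real \<times> real \<Rightarrow> real) \<Rightarrow> real" where
  "Wm1_norm \<Omega> \<Gamma> f =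
     Sup {\<bar>\<integral>p. f p * u p \<partial>lebesgue_on \<Omega>\<bar> | u v w. W1_jet \<Omega> \<Gamma> u v w \<and> jet_norm \<Omega> u v w = 1}"


section \<open>Generalized solutions, spectrum and principal eigenvalue\<close>

definition gen_solution_real ::
  "(real \<times> real) set \<Rightarrow> real \<Rightarrow> real \<Rightarrow> real \<Rightarrow>
   (real \<times> real \<Rightarrow> real) \<Rightarrow> (real \<times> real \<Rightarrow> real) \<Rightarrow> bool" where
  "gen_solution_real \<Omega> \<alpha> \<beta> x0 u h \<longleftrightarrow>
     L2 \<Omega> h \<and>
     (\<exists>f v w. (\<forall>n. f n \<in> C0_inf \<Omega> (AC x0 \<union> sigma_arc \<alpha> \<beta> x0)) \<and>
        W1_conv \<Omega> f u v w \<and>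
        (\<lambda>n. Wm1_norm \<Omega> (BC x0 \<union> sigma_arc \<alpha> \<beta> x0) (\<lambda>p. Tric (f n) p - h p)) \<longlonglongrightarrow> 0)"

definition gen_solution ::
  "(real \<times> real) set \<Rightarrow> real \<Rightarrow> real \<Rightarrow> real \<Rightarrow>
   (real \<times> real \<Rightarrow> complex) \<Rightarrow> (real \<times> real \<Rightarrow> complex) \<Rightarrow> bool" where
  "gen_solution \<Omega> \<alpha> \<beta> x0 u h \<longleftrightarrow>
     gen_solution_real \<Omega> \<alpha> \<beta> x0 (\<lambda>p. Re (u p)) (\<lambda>p. Re (h p)) \<and>
     gen_solution_real \<Omega> \<alpha> \<beta> x0 (\<lambda>p. Im (u p)) (\<lambda>p. Im (h p))"

text \<open>
  For \<open>h \<in> L\<^sup>2(\<Omega>)\<close>, \<open>gen_solution\<close> expresses that the continuous extension of the Tricomi operator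
  maps \<open>u\<close> to \<open>h\<close>. The spectrum is that of the induced (complexified) closed operator on \<open>L\<^sup>2(\<Omega>)\<close>,
  whose domain consists of the \<open>u\<close> in \<open>W1\<close> that this extension maps into \<open>L\<^sup>2(\<Omega>)\<close>.
\<close>

definition tricomi_resolvent_set ::
  "(real \<times> real) set \<Rightarrow> real \<Rightarrow> real \<Rightarrow> real \<Rightarrow> complex set" where
  "tricomi_resolvent_set \<Omega> \<alpha> \<beta> x0 = {\<mu>. \<exists>K. \<forall>h. L2 \<Omega> h \<longrightarrow>
     (\<exists>u. gen_solution \<Omega> \<alpha> \<beta> x0 u (\<lambda>p. \<mu> * u p + h p) \<and>
          L2_norm \<Omega> u \<le> K * L2_norm \<Omega> h \<and>
          (\<forall>u'. gen_solution \<Omega> \<alpha> \<beta> x0 u' (\<lambda>p. \<mu> * u' p + h p) \<longrightarrow>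
                (AE p in lebesgue_on \<Omega>. u' p = u p)))}"

definition tricomi_spectrum ::
  "(real \<times> real) set \<Rightarrow> real \<Rightarrow> real \<Rightarrow> real \<Rightarrow> complex set" where
  "tricomi_spectrum \<Omega> \<alpha> \<beta> x0 = - tricomi_resolvent_set \<Omega> \<alpha> \<beta> x0"

definition is_principal_eigenvalue ::
  "(real \<times> real) set \<Rightarrow> real \<Rightarrow> real \<Rightarrow> real \<Rightarrow> real \<Rightarrow> bool" where
  "is_principal_eigenvalue \<Omega> \<alpha> \<beta> x0 lam0 \<longleftrightarrow>
     lam0 > 0 \<and>
     (\<exists>u. gen_solution_real \<Omega> \<alpha> \<beta> x0 u (\<lambda>p. lam0 * u p) \<and>
          \<not> (AE p in lebesgue_on \<Omega>. u p = 0) \<and>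
          (AE p in lebesgue_on \<Omega>. u p \<ge> 0)) \<and>
     (\<forall>\<mu> \<in> tricomi_spectrum \<Omega> \<alpha> \<beta> x0. lam0 \<le> cmod \<mu>)"


section \<open>Square integrability on boundary arcs\<close>

text \<open>
  A function on the open set \<open>\<Omega>\<close> is evaluated at a boundary point by its limit from inside \<open>\<Omega>\<close>.
\<close>

definition bvalue ::
  "(real \<times> real) set \<Rightarrow> (real \<times> real \<Rightarrow> 'a::real_normed_vector) \<Rightarrow> real \<times> real \<Rightarrow> 'a" where
  "bvalue \<Omega> f p = Lim (at p within \<Omega>) f"

text \<open>
  Integrals with respect to arclength along the arc \<open>c\<close> parametrized by the interval from \<open>a\<close> to \<open>b\<close>;
  \<open>c\<close> may fail to be differentiable at the endpoints.
\<close>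

definition arc_L2 ::
  "(real \<times> real) set \<Rightarrow> (real \<Rightarrow> real \<times> real) \<Rightarrow> real \<Rightarrow> real \<Rightarrow>
   (real \<times> real \<Rightarrow> 'a::{real_normed_vector,second_countable_topology}) \<Rightarrow> bool" where
  "arc_L2 \<Omega> c a b f \<longleftrightarrow>
     (AE t in lebesgue_on {a<..<b}. \<exists>l. (f \<longlongrightarrow> l) (at (c t) within \<Omega>)) \<and>
     (\<lambda>t. bvalue \<Omega> f (c t)) \<in> borel_measurable (lebesgue_on {a<..<b}) \<and>
     integrable (lebesgue_on {a<..<b})
       (\<lambda>t. (norm (bvalue \<Omega> f (c t)))\<^sup>2 * norm (vector_derivative c (at t)))"

definition arc_norm ::
  "(real \<times> real) set \<Rightarrow> (real \<Rightarrow> real \<times> real) \<Rightarrow> real \<Rightarrow> real \<Rightarrow>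
   (real \<times> real \<Rightarrow> 'a::real_normed_vector) \<Rightarrow> real" where
  "arc_norm \<Omega> c a b f =
     sqrt (\<integral>t. (norm (bvalue \<Omega> f (c t)))\<^sup>2 * norm (vector_derivative c (at t)) \<partial>lebesgue_on {a<..<b})"

definition BC_param :: "real \<Rightarrow> real \<times> real" where
  "BC_param y = (- (2/3) * (- y) powr (3/2), y)"

definition sigma_param :: "real \<Rightarrow> real \<Rightarrow> real \<Rightarrow> real \<Rightarrow> real \<times> real" where
  "sigma_param \<alpha> \<beta> x0 x = (x, g_fun \<alpha> \<beta> x0 x)"

abbreviation "L2_BC \<Omega> x0 \<equiv> arc_L2 \<Omega> BC_param (y_C x0) 0"
abbreviation "norm_BC \<Omega> x0 \<equiv> arc_norm \<Omega> BC_param (y_C x0) 0"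
abbreviation "L2_sigma \<Omega> \<alpha> \<beta> x0 \<equiv> arc_L2 \<Omega> (sigma_param \<alpha> \<beta> x0) (2 * x0) 0"
abbreviation "norm_sigma \<Omega> \<alpha> \<beta> x0 \<equiv> arc_norm \<Omega> (sigma_param \<alpha> \<beta> x0) (2 * x0) 0"

definition wdx :: "(real \<times> real \<Rightarrow> 'a::real_normed_vector) \<Rightarrow> real \<times> real \<Rightarrow> 'a" where
  "wdx u p = sqrt \<bar>snd p\<bar> *\<^sub>R dx u p"


section \<open>Auxiliary functions and points\<close>

definition h_fun :: "real \<Rightarrow> real \<Rightarrow> real \<Rightarrow> real \<Rightarrow> real" where
  "h_fun \<alpha> \<beta> x0 x = sqrt ((x - x0)\<^sup>2 + (g_fun \<alpha> \<beta> x0 x) powr (2 * \<alpha>) / \<beta>\<^sup>2)"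

definition d_num :: "real \<Rightarrow> real" where
  "d_num \<alpha> = (5 + 2 * \<alpha>) / (4 + \<alpha>)"

definition theta_fun :: "real \<Rightarrow> real \<Rightarrow> real \<Rightarrow> real" where
  "theta_fun \<alpha> x0 x = (4 + \<alpha>) * x * (x - d_num \<alpha> * x0)"

definition Theta_fun :: "real \<Rightarrow> real \<Rightarrow> real \<Rightarrow> real \<Rightarrow> real" where
  "Theta_fun \<alpha> \<beta> x0 x = theta_fun \<alpha> x0 x / h_fun \<alpha> \<beta> x0 x"

text \<open>
  For \<open>\<alpha> = 1/2\<close> the exponent of \<open>g\<close> is zero and the power is \<open>1\<close>, also at the end points where
  \<open>g\<close> vanishes, whereas \<open>0 powr 0 = 0\<close>.
\<close>

definition varphi_fun :: "real \<Rightarrow> real \<Rightarrow> real \<Rightarrow> real \<Rightarrow> real" where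
  "varphi_fun \<alpha> \<beta> x0 x =
     6 / \<bar>\<beta>\<bar> * x * (if \<alpha> = 1/2 then 1 else (g_fun \<alpha> \<beta> x0 x) powr ((2 * \<alpha> - 1) / 2))"

definition phi_fun :: "real \<Rightarrow> real \<Rightarrow> real \<Rightarrow> real \<Rightarrow> real" where
  "phi_fun \<alpha> \<beta> x0 x = 4 * (x - x0) * (g_fun \<alpha> \<beta> x0 x) powr (3/2)"

definition psi_fun :: "real \<Rightarrow> real \<Rightarrow> real \<Rightarrow> real \<Rightarrow> real" where
  "psi_fun \<alpha> \<beta> x0 x = varphi_fun \<alpha> \<beta> x0 x + phi_fun \<alpha> \<beta> x0 x"

definition Psi_fun :: "real \<Rightarrow> real \<Rightarrow> real \<Rightarrow> real \<Rightarrow> real" where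
  "Psi_fun \<alpha> \<beta> x0 x = psi_fun \<alpha> \<beta> x0 x / h_fun \<alpha> \<beta> x0 x"

definition gamma_num :: "real \<Rightarrow> real" where
  "gamma_num \<alpha> = (\<alpha> + 1) / (\<alpha> - 1)"

definition c_num :: "real \<Rightarrow> real \<Rightarrow> real" where
  "c_num \<alpha> \<beta> = 2 / (\<alpha> + 1) * \<alpha> powr (- gamma_num \<alpha>) * \<bar>\<beta>\<bar> powr (gamma_num \<alpha> - 1)"

definition M_num :: "real \<Rightarrow> real \<Rightarrow> real" where
  "M_num \<alpha> \<beta> = sqrt (c_num \<alpha> \<beta>)"

definition D_num :: "real \<Rightarrow> real \<Rightarrow> real" where
  "D_num \<alpha> \<beta> = (2 powr \<alpha> * (\<alpha> + 1) powr (- \<alpha>) * \<bar>\<beta>\<bar>) powr (1 / (\<alpha> - 1))"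

definition E_num :: "real \<Rightarrow> real \<Rightarrow> real" where
  "E_num \<alpha> \<beta> = M_num \<alpha> \<beta> * (d_num \<alpha> * (2 - d_num \<alpha>)) powr (- 1/2)"

definition L_num :: "real \<Rightarrow> real \<Rightarrow> real" where
  "L_num \<alpha> \<beta> = D_num \<alpha> \<beta> * (d_num \<alpha> * (2 - d_num \<alpha>)) powr (- 1/2)"

definition x_plus :: "real \<Rightarrow> real \<Rightarrow> real \<Rightarrow> real" where
  "x_plus \<alpha> \<beta> x0 = x0 + sqrt (x0\<^sup>2 - c_num \<alpha> \<beta>)"

definition x_minus :: "real \<Rightarrow> real \<Rightarrow> real \<Rightarrow> real" where
  "x_minus \<alpha> \<beta> x0 = x0 - sqrt (x0\<^sup>2 - c_num \<alpha> \<beta>)"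

definition x_al :: "real \<Rightarrow> real \<Rightarrow> real" where
  "x_al \<alpha> x0 = d_num \<alpha> * x0"

definition x_al_tilde :: "real \<Rightarrow> real \<Rightarrow> real" where
  "x_al_tilde \<alpha> x0 = x_al \<alpha> x0 / 2"

definition x_al_bar :: "real \<Rightarrow> real \<Rightarrow> real" where
  "x_al_bar \<alpha> x0 = (4 * \<alpha> + 1) * x0 / (3 * \<alpha>)"

definition x_al_bar_minus :: "real \<Rightarrow> real \<Rightarrow> real" where
  "x_al_bar_minus \<alpha> x0 = x0 - sqrt ((\<alpha> + 1) / (\<alpha> + 4)) * \<bar>x0\<bar>"

definition x_be_tilde_minus :: "real \<Rightarrow> real \<Rightarrow> real" where
  "x_be_tilde_minus \<beta> x0 = x0 - sqrt (6 + 3 * \<bar>\<beta>\<bar>\<^sup>2 * x0\<^sup>2) / (3 * \<bar>\<beta>\<bar>)"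

definition x_be_hat_minus :: "real \<Rightarrow> real \<Rightarrow> real" where
  "x_be_hat_minus \<beta> x0 =
     ((9 + 8 * \<bar>\<beta>\<bar>) * x0 - sqrt (8 * (3 + 2 * \<bar>\<beta>\<bar>)\<^sup>2 + 9) * \<bar>x0\<bar>) / (4 * (3 + 2 * \<bar>\<beta>\<bar>))"


section \<open>The constants of the estimate\<close>

definition C1 :: "real \<Rightarrow> real \<Rightarrow> real" where
  "C1 x0 \<epsilon> = 6 * \<bar>x0\<bar> * (1 + \<epsilon>) / sqrt (1 + (3 * \<bar>x0\<bar> / 2) powr (2/3))"

definition C2 :: "real \<Rightarrow> real \<Rightarrow> real" where
  "C2 x0 \<epsilon> = 6 * \<bar>x0\<bar> * (1 + 1 / \<epsilon>) / sqrt (1 + (3 * \<bar>x0\<bar> / 2) powr (2/3))"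

definition C3 :: "real \<Rightarrow> real" where
  "C3 x0 = (3 * \<bar>x0\<bar> / 2) powr (1/3) / sqrt (1 + (3 * \<bar>x0\<bar> / 2) powr (2/3))"

text \<open>
  The case distinctions below are those for \<open>\<beta> < 0\<close> and \<open>x0 < 0\<close>; values outside the parameter
  range of a constant are never used.
\<close>

definition C6 :: "real \<Rightarrow> real \<Rightarrow> real" where
  "C6 \<beta> x0 = theta_fun 1 x0 (x_al_tilde 1 x0) / h_fun 1 \<beta> x0 (if \<beta> \<le> -1 then x0 else 0)"

definition C7 :: "real \<Rightarrow> real \<Rightarrow> real" where
  "C7 \<beta> x0 = (if \<beta> \<le> -1 then theta_fun 1 x0 (2 * x0) / h_fun 1 \<beta> x0 (x_al 1 x0)
              else Theta_fun 1 \<beta> x0 (2 * x0))"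

definition C8 :: "real \<Rightarrow> real \<Rightarrow> real \<Rightarrow> real" where
  "C8 \<alpha> \<beta> x0 = theta_fun \<alpha> x0 (x_al_tilde \<alpha> x0) /
     h_fun \<alpha> \<beta> x0 (if x0 \<ge> - M_num \<alpha> \<beta> then x0 else x_plus \<alpha> \<beta> x0)"

definition C9 :: "real \<Rightarrow> real \<Rightarrow> real \<Rightarrow> real" where
  "C9 \<alpha> \<beta> x0 = theta_fun \<alpha> x0 (2 * x0) /
     h_fun \<alpha> \<beta> x0 (if x0 > - E_num \<alpha> \<beta> then x_al \<alpha> x0 else x_minus \<alpha> \<beta> x0)"

definition C10 :: "real \<Rightarrow> real \<Rightarrow> real \<Rightarrow> real" where
  "C10 \<alpha> \<beta> x0 = theta_fun \<alpha> x0 (x_al_tilde \<alpha> x0) /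
     h_fun \<alpha> \<beta> x0 (if x0 \<ge> - D_num \<alpha> \<beta> then 0 else x0)"

definition C11 :: "real \<Rightarrow> real \<Rightarrow> real \<Rightarrow> real" where
  "C11 \<alpha> \<beta> x0 = (if x0 \<ge> - L_num \<alpha> \<beta> then Theta_fun \<alpha> \<beta> x0 (2 * x0)
                 else theta_fun \<alpha> x0 (2 * x0) / h_fun \<alpha> \<beta> x0 (x_al \<alpha> x0))"

definition C12 :: "real \<Rightarrow> real \<Rightarrow> real" where
  "C12 \<beta> x0 = (if \<beta> \<ge> -3/4 \<or> x0 \<ge> - D_num (1/2) \<beta> then Psi_fun (1/2) \<beta> x0 (2 * x0)
               else psi_fun (1/2) \<beta> x0 (2 * x0) / h_fun (1/2) \<beta> x0 x0)"

definition C14 :: "real \<Rightarrow> real \<Rightarrow> real" where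
  "C14 \<beta> x0 = psi_fun (1/2) \<beta> x0 (x_be_tilde_minus \<beta> x0) /
     h_fun (1/2) \<beta> x0 (if \<beta> > -3/4 \<and> x0 \<ge> - D_num (1/2) \<beta> then 2 * x0 else x0)"

definition S_num :: "real \<Rightarrow> real \<Rightarrow> real \<Rightarrow> real" where
  "S_num \<alpha> \<beta> x0 = varphi_fun \<alpha> \<beta> x0 (x_al_bar \<alpha> x0) + phi_fun \<alpha> \<beta> x0 (x_al_bar_minus \<alpha> x0)"

definition C16 :: "real \<Rightarrow> real \<Rightarrow> real \<Rightarrow> real" where
  "C16 \<alpha> \<beta> x0 = S_num \<alpha> \<beta> x0 / h_fun \<alpha> \<beta> x0 (if x0 \<ge> - D_num \<alpha> \<beta> then 2 * x0 else x0)"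

definition C18 :: "real \<Rightarrow> real \<Rightarrow> real" where
  "C18 \<beta> x0 = S_num 1 \<beta> x0 / h_fun 1 \<beta> x0 (if \<beta> > -1 then 2 * x0 else x0)"

definition C20 :: "real \<Rightarrow> real \<Rightarrow> real \<Rightarrow> real" where
  "C20 \<alpha> \<beta> x0 = S_num \<alpha> \<beta> x0 /
     h_fun \<alpha> \<beta> x0 (if x0 \<ge> - M_num \<alpha> \<beta> then x0 else x_minus \<alpha> \<beta> x0)"

definition C22 :: "real \<Rightarrow> real \<Rightarrow> real" where
  "C22 \<beta> x0 = psi_fun 2 \<beta> x0 (x_be_hat_minus \<beta> x0) /
     h_fun 2 \<beta> x0 (if x0 \<ge> - M_num 2 \<beta> then x0 else x_minus 2 \<beta> x0)"

definition C24 :: "real \<Rightarrow> real \<Rightarrow> real \<Rightarrow> real" where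
  "C24 \<alpha> \<beta> x0 =
     (if \<alpha> = 1/2 then (if x0 \<ge> - (1 / \<bar>\<beta>\<bar>) then \<bar>C12 \<beta> x0\<bar> else \<bar>C14 \<beta> x0\<bar>)
      else if \<alpha> < 1 then \<bar>C16 \<alpha> \<beta> x0\<bar>
      else if \<alpha> = 1 then \<bar>C18 \<beta> x0\<bar>
      else if \<alpha> = 2 then \<bar>C22 \<beta> x0\<bar>
      else \<bar>C20 \<alpha> \<beta> x0\<bar>)"

definition C25 :: "real \<Rightarrow> real \<Rightarrow> real \<Rightarrow> real \<Rightarrow> real" where
  "C25 \<alpha> \<beta> x0 \<epsilon> =
     (if \<alpha> < 1 then C11 \<alpha> \<beta> x0 else if \<alpha> = 1 then C7 \<beta> x0 else C9 \<alpha> \<beta> x0)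
     + \<epsilon> / 2 * C24 \<alpha> \<beta> x0"

definition C26 :: "real \<Rightarrow> real \<Rightarrow> real \<Rightarrow> real \<Rightarrow> real" where
  "C26 \<alpha> \<beta> x0 \<epsilon> =
     - (if \<alpha> < 1 then C10 \<alpha> \<beta> x0 else if \<alpha> = 1 then C6 \<beta> x0 else C8 \<alpha> \<beta> x0)
     + 1 / (2 * \<epsilon>) * C24 \<alpha> \<beta> x0"

end

theory Submission
  imports Defs
begin

text \<open>
  Multiply \<open>y u\<^sub>x\<^sub>x + u\<^sub>y\<^sub>y = - \<lambda> u\<close> by \<open>2 (3 x u\<^sub>x + 2 y u\<^sub>y) + u\<close>, the generator of the anisotropic
  dilations under which the Tricomi operator is homogeneous, and integrate by parts. The interior terms
  add up to \<open>4 \<lambda>\<close> times the integral of \<open>u\<^sup>2\<close>. On \<open>AC\<close> the flux vanishes, because \<open>u = 0\<close> there forces the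
  derivative along this characteristic to vanish. On \<open>BC\<close> the flux only involves \<open>u\<close> and the derivative
  along the characteristic, and on \<open>\<sigma>\<close> it is a quadratic form in \<open>(\<bar>y\<bar>\<^sup>1\<^sup>/\<^sup>2 u\<^sub>x, u\<^sub>y)\<close> with coefficients
  \<open>\<Theta>\<close> and \<open>\<Psi>\<close>, which are bounded by maximizing the numerators and minimizing the common
  denominator \<open>h\<close>. To apply this to a generalized solution, testing against smooth bumps shows that the
  equation holds pointwise, and a Poincare inequality on thin strips along \<open>AC\<close> and \<open>\<sigma>\<close> shows that the
  continuous extension of \<open>u\<close> vanishes there.
\<close>

text \<open>The operator changes type across y = 0, so no energy is coercive. Integrating by parts
  against the dilation generator alone leaves the indefinite integral of y u_x^2 + u_y^2; the extra
  summand u in the multiplier removes exactly this integral, so that only u^2 survives inside. The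
  dilations are (x, y) -> (t^3 x, t^2 y), and BC, but not AC, is invariant under them. The domain is
  given only by its frontier. It is identified with a region that is simple in both coordinate
  directions, so that each half of the divergence theorem is Fubini plus the fundamental theorem of
  calculus on slices, followed by a change of variables along the arcs. Only open parameter
  intervals occur: the vertices, where \<sigma> has infinite slope, are never evaluated. The
  derivative u_xx may blow up at the origin. In the flux it appears only as y u_xx, which stays
  bounded. The equation and the boundary condition are real-linear, so the identity is proved for
  the real and imaginary parts separately and summed.\<close>

section \<open>Gradients and symmetry of second derivatives\<close>

definition has_grad :: "(real \<times> real \<Rightarrow> 'a::real_normed_vector) \<Rightarrow> 'a \<Rightarrow> 'a \<Rightarrow> real \<times> real \<Rightarrow> bool" where
  "has_grad f a b p \<longleftrightarrow> (f has_derivative (\<lambda>h. fst h *\<^sub>R a + snd h *\<^sub>R b)) (at p)"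

lemma has_grad_dx_dy:
  assumes "f differentiable (at p)"
  shows "has_grad f (dx f p) (dy f p) p"
proof -
  have D: "(f has_derivative frechet_derivative f (at p)) (at p)"
    using assms frechet_derivative_works by blast
  then interpret L: linear "frechet_derivative f (at p)"
    using has_derivative_linear by blast
  have "frechet_derivative f (at p) = (\<lambda>h. fst h *\<^sub>R dx f p + snd h *\<^sub>R dy f p)"
  proof
    fix h :: "real \<times> real"
    have "h = fst h *\<^sub>R (1, 0) + snd h *\<^sub>R (0, 1)" by (cases h) simp
    then have "frechet_derivative f (at p) h = frechet_derivative f (at p) (fst h *\<^sub>R (1, 0) + snd h *\<^sub>R (0, 1))"
      by simp
    also have "\<dots> = fst h *\<^sub>R dx f p + snd h *\<^sub>R dy f p"
      by (simp only: L.add L.scaleR dx_def dy_def)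
    finally show "frechet_derivative f (at p) h = fst h *\<^sub>R dx f p + snd h *\<^sub>R dy f p" .
  qed
  with D show ?thesis unfolding has_grad_def by simp
qed

text \<open>\<open>dx\<close> and \<open>dy\<close> come from a choice operator, so they say nothing
  until some derivative is exhibited. A known gradient pins them down, and the calculus rules for
  \<open>has_grad\<close> then compute them.\<close>

lemma has_grad_unique:
  assumes "has_grad f a b p"
  shows "dx f p = a" "dy f p = b"
proof -
  have "frechet_derivative f (at p) = (\<lambda>h. fst h *\<^sub>R a + snd h *\<^sub>R b)"
    using frechet_derivative_at[OF assms[unfolded has_grad_def], symmetric] .
  then show "dx f p = a" "dy f p = b" by (auto simp: dx_def dy_def)
qed

lemma has_grad_differentiable: "has_grad f a b p \<Longrightarrow> f differentiable (at p)"
  unfolding has_grad_def differentiable_def by blast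

lemma has_grad_cong_open:
  assumes "has_grad f a b p" "open S" "p \<in> S" "\<And>q. q \<in> S \<Longrightarrow> f q = g q"
  shows "has_grad g a b p"
  using assms unfolding has_grad_def by (rule has_derivative_transform_within_open)

lemma has_grad_const: "has_grad (\<lambda>p. c) 0 0 p"
  unfolding has_grad_def by simp

lemma has_grad_add:
  "has_grad f a b p \<Longrightarrow> has_grad g c d p \<Longrightarrow> has_grad (\<lambda>q. f q + g q) (a + c) (b + d) p"
  unfolding has_grad_def
  by (erule (1) has_derivative_eq_rhs[OF has_derivative_add]) (simp add: algebra_simps)

lemma has_grad_mult:
  fixes f g :: "real \<times> real \<Rightarrow> real"
  shows "has_grad f a b p \<Longrightarrow> has_grad g c d p \<Longrightarrow>
    has_grad (\<lambda>q. f q * g q) (f p * c + a * g p) (f p * d + b * g p) p"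
  unfolding has_grad_def
  by (erule (1) has_derivative_eq_rhs[OF has_derivative_mult]) (simp add: algebra_simps)

lemma has_grad_scaleR:
  fixes f :: "real \<times> real \<Rightarrow> real" and g :: "real \<times> real \<Rightarrow> 'a::real_normed_vector"
  shows "has_grad f a b p \<Longrightarrow> has_grad g c d p \<Longrightarrow>
    has_grad (\<lambda>q. f q *\<^sub>R g q) (f p *\<^sub>R c + a *\<^sub>R g p) (f p *\<^sub>R d + b *\<^sub>R g p) p"
  unfolding has_grad_def
  by (erule (1) has_derivative_eq_rhs[OF has_derivative_scaleR]) (simp add: algebra_simps)

lemma has_grad_bounded_linear:
  assumes "bounded_linear F" "has_grad f a b p"
  shows "has_grad (\<lambda>q. F (f q)) (F a) (F b) p"
proof -
  interpret bounded_linear F by fact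
  show ?thesis using has_derivative[OF assms(2)[unfolded has_grad_def]]
    unfolding has_grad_def by (simp add: add scaleR)
qed

lemma has_grad_fst: "has_grad fst 1 0 p" and has_grad_snd: "has_grad snd 0 1 p"
  unfolding has_grad_def by (auto intro!: derivative_eq_intros)

lemma has_grad_slice_x:
  assumes "has_grad f a b (x, y)"
  shows "((\<lambda>t. f (t, y)) has_vector_derivative a) (at x)"
proof -
  have "((\<lambda>t. f (t, y)) has_derivative (\<lambda>h. fst (h, 0::real) *\<^sub>R a + snd (h, 0::real) *\<^sub>R b)) (at x)"
    by (rule has_derivative_compose[where g=f and f="\<lambda>t. (t, y)" and f'="\<lambda>h. (h, 0)"])
       (use assms in \<open>auto simp: has_grad_def intro!: derivative_eq_intros\<close>)
  then show ?thesis unfolding has_vector_derivative_def by simp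
qed

lemma has_grad_slice_y:
  assumes "has_grad f a b (x, y)"
  shows "((\<lambda>t. f (x, t)) has_vector_derivative b) (at y)"
proof -
  have "((\<lambda>t. f (x, t)) has_derivative (\<lambda>h. fst (0::real, h) *\<^sub>R a + snd (0::real, h) *\<^sub>R b)) (at y)"
    by (rule has_derivative_compose[where g=f and f="\<lambda>t. (x, t)" and f'="\<lambda>h. (0, h)"])
       (use assms in \<open>auto simp: has_grad_def intro!: derivative_eq_intros\<close>)
  then show ?thesis unfolding has_vector_derivative_def by simp
qed

lemma has_grad_curve:
  assumes "has_grad f a b (c t, d t)"
    and "(c has_real_derivative c') (at t)" "(d has_real_derivative d') (at t)"
  shows "((\<lambda>t. f (c t, d t)) has_vector_derivative c' *\<^sub>R a + d' *\<^sub>R b) (at t)"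
proof -
  have "((\<lambda>t. f (c t, d t)) has_derivative (\<lambda>h. fst (c' * h, d' * h) *\<^sub>R a + snd (c' * h, d' * h) *\<^sub>R b)) (at t)"
    by (rule has_derivative_compose[where g=f and f="\<lambda>t. (c t, d t)" and f'="\<lambda>h. (c' * h, d' * h)"])
       (use assms in \<open>auto simp: has_grad_def has_field_derivative_def intro!: has_derivative_Pair\<close>)
  then show ?thesis unfolding has_vector_derivative_def by (simp add: algebra_simps)
qed

lemma has_grad_continuous: "has_grad f a b p \<Longrightarrow> isCont f p"
  unfolding has_grad_def by (rule has_derivative_continuous)

text \<open>The mean value theorem in x, applied to the difference of two horizontal slices, is
  followed by the mean value theorem in y for \<open>fx\<close>. Only partial derivatives along
  lines are required.\<close>

lemma mixed_difference_mean_value: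
  fixes f fx fxy :: "real \<times> real \<Rightarrow> real"
  assumes "a < b" "c < d" and S: "{a..b} \<times> {c..d} \<subseteq> S"
    and fx: "\<And>x y. (x, y) \<in> S \<Longrightarrow> ((\<lambda>t. f (t, y)) has_real_derivative fx (x, y)) (at x)"
    and fxy: "\<And>x y. (x, y) \<in> S \<Longrightarrow> ((\<lambda>t. fx (x, t)) has_real_derivative fxy (x, y)) (at y)"
  obtains \<xi> \<eta> where "\<xi> \<in> {a..b}" "\<eta> \<in> {c..d}"
    "f (b, d) - f (b, c) - f (a, d) + f (a, c) = (b - a) * (d - c) * fxy (\<xi>, \<eta>)"
proof -
  have S': "(x, y) \<in> S" if "a \<le> x" "x \<le> b" "c \<le> y" "y \<le> d" for x y
    using S that by auto
  have "((\<lambda>t. f (t, d) - f (t, c)) has_real_derivative fx (x, d) - fx (x, c)) (at x)"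
    if "a \<le> x" "x \<le> b" for x
    by (intro DERIV_diff fx S') (use that \<open>c < d\<close> in auto)
  from MVT2[OF \<open>a < b\<close> this] obtain z where z: "a < z" "z < b"
    "(f (b, d) - f (b, c)) - (f (a, d) - f (a, c)) = (b - a) * (fx (z, d) - fx (z, c))" by blast
  have "((\<lambda>t. fx (z, t)) has_real_derivative fxy (z, y)) (at y)" if "c \<le> y" "y \<le> d" for y
    by (intro fxy S') (use that z in auto)
  from MVT2[OF \<open>c < d\<close> this] obtain w where w: "c < w" "w < d"
    "fx (z, d) - fx (z, c) = (d - c) * fxy (z, w)" by blast
  show thesis using z w by (intro that[of z w]) auto
qed

text \<open>The mixed second difference over a small square does not depend on the order of
  differencing, so some value of \<open>fxy\<close> and some value of \<open>fyx\<close> near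
  \<open>p\<close> coincide. Continuity of both carries this to \<open>p\<close>.\<close>

lemma mixed_partials_eq:
  fixes f fx fy fxy fyx :: "real \<times> real \<Rightarrow> real"
  assumes S: "open S" "p \<in> S"
    and fx: "\<And>x y. (x, y) \<in> S \<Longrightarrow> ((\<lambda>t. f (t, y)) has_real_derivative fx (x, y)) (at x)"
    and fy: "\<And>x y. (x, y) \<in> S \<Longrightarrow> ((\<lambda>t. f (x, t)) has_real_derivative fy (x, y)) (at y)"
    and fxy: "\<And>x y. (x, y) \<in> S \<Longrightarrow> ((\<lambda>t. fx (x, t)) has_real_derivative fxy (x, y)) (at y)"
    and fyx: "\<And>x y. (x, y) \<in> S \<Longrightarrow> ((\<lambda>t. fy (t, y)) has_real_derivative fyx (x, y)) (at x)"
    and cont: "continuous_on S fxy" "continuous_on S fyx"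
  shows "fxy p = fyx p"
proof (rule ccontr)
  assume ne: "fxy p \<noteq> fyx p"
  define e where "e = \<bar>fxy p - fyx p\<bar> / 2"
  have e: "e > 0" using ne by (simp add: e_def)
  have c1: "isCont fxy p" and c2: "isCont fyx p"
    using cont S by (simp_all add: continuous_on_eq_continuous_at)
  obtain d1 where d1: "d1 > 0" "\<And>q. dist q p < d1 \<Longrightarrow> dist (fxy q) (fxy p) < e"
    using c1 e unfolding continuous_at_eps_delta by blast
  obtain d2 where d2: "d2 > 0" "\<And>q. dist q p < d2 \<Longrightarrow> dist (fyx q) (fyx p) < e"
    using c2 e unfolding continuous_at_eps_delta by blast
  obtain d3 where d3: "d3 > 0" "ball p d3 \<subseteq> S" using S open_contains_ball by blast
  define r where "r = min d1 (min d2 d3) / 4"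
  have r: "r > 0" using d1 d2 d3 by (simp add: r_def)
  obtain x0 y0 where p: "p = (x0, y0)" by (cases p)
  have near: "dist (x, y) p < d1 \<and> dist (x, y) p < d2 \<and> (x, y) \<in> S"
    if "x \<in> {x0..x0+r}" "y \<in> {y0..y0+r}" for x y
  proof -
    have "dist (x, y) p \<le> \<bar>x - x0\<bar> + \<bar>y - y0\<bar>"
      unfolding p dist_Pair_Pair dist_real_def power2_abs by (rule sqrt_sum_squares_le_sum_abs)
    also have "\<dots> \<le> 2 * r" using that by auto
    finally have le: "dist (x, y) p \<le> 2 * r" .
    have "2 * r < d1" "2 * r < d2" "2 * r < d3" using d1(1) d2(1) d3(1) by (auto simp: r_def min_def)
    with le have "dist (x, y) p < d1" "dist (x, y) p < d2" "(x, y) \<in> ball p d3"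
      by (auto simp: mem_ball dist_commute)
    then show ?thesis using d3(2) by blast
  qed
  have r1: "x0 < x0 + r" and r2: "y0 < y0 + r" using r by auto
  have sub: "{x0..x0+r} \<times> {y0..y0+r} \<subseteq> S" using near by auto
  obtain \<xi> \<eta> where A: "\<xi> \<in> {x0..x0+r}" "\<eta> \<in> {y0..y0+r}"
    "f (x0+r, y0+r) - f (x0+r, y0) - f (x0, y0+r) + f (x0, y0) = (x0+r - x0) * (y0+r - y0) * fxy (\<xi>, \<eta>)"
    by (rule mixed_difference_mean_value[OF r1 r2 sub fx fxy])
  \<comment> \<open>With the coordinates exchanged the same mean value lemma differences in y before
    x, and so produces a value of \<open>fyx\<close>.\<close>
  have sub': "{y0..y0+r} \<times> {x0..x0+r} \<subseteq> {(y, x). (x, y) \<in> S}" using near by auto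
  obtain \<eta>' \<xi>' where B: "\<eta>' \<in> {y0..y0+r}" "\<xi>' \<in> {x0..x0+r}"
    "f (x0+r, y0+r) - f (x0, y0+r) - f (x0+r, y0) + f (x0, y0) = (y0+r - y0) * (x0+r - x0) * fyx (\<xi>', \<eta>')"
    by (rule mixed_difference_mean_value[OF r2 r1 sub', of "\<lambda>(y,x). f (x,y)" "\<lambda>(y,x). fy (x,y)" "\<lambda>(y,x). fyx (x,y)"])
       (use fy fyx in auto)
  have "fxy (\<xi>, \<eta>) = fyx (\<xi>', \<eta>')"
    using A(3) B(3) r by (simp add: algebra_simps)
  moreover have "\<bar>fxy (\<xi>, \<eta>) - fxy p\<bar> < e" "\<bar>fyx (\<xi>', \<eta>') - fyx p\<bar> < e"
    using near[OF A(1,2)] near[OF B(2,1)] d1 d2 by (auto simp: dist_real_def)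
  ultimately show False using e_def by argo
qed

section \<open>Smooth bumps\<close>

text \<open>The flat function exp(-1/x), times x^(-k), extended by 0. Keeping every power k makes
  the family stable under differentiation up to linear combinations, so smoothness follows from one
  derivative formula.\<close>

definition bump_gen :: "nat \<Rightarrow> real \<Rightarrow> real" where
  "bump_gen k x = (if x > 0 then exp (- inverse x) * inverse x ^ k else 0)"

lemma bump_gen_tendsto_0: "(bump_gen k \<longlongrightarrow> 0) (at 0)"
proof -
  have "((\<lambda>t::real. t ^ k / exp t) \<longlongrightarrow> 0) at_top" by (rule tendsto_power_div_exp_0)
  then have "((\<lambda>x::real. (inverse x) ^ k / exp (inverse x)) \<longlongrightarrow> 0) (at_right 0)"
    by (rule filterlim_compose[OF _ filterlim_inverse_at_top_right])
  then have R: "(bump_gen k \<longlongrightarrow> 0) (at_right 0)"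
    by (rule Lim_transform_eventually)
       (auto simp: eventually_at_filter bump_gen_def exp_minus divide_inverse)
  have L: "(bump_gen k \<longlongrightarrow> 0) (at_left 0)"
    by (rule Lim_transform_eventually[OF tendsto_const])
       (auto simp: eventually_at_filter bump_gen_def)
  from L R show ?thesis by (simp add: filterlim_at_split)
qed

lemma bump_gen_deriv:
  "(bump_gen k has_real_derivative bump_gen (k + 2) x - real k * bump_gen (k + 1) x) (at x)"
proof -
  consider "x > 0" | "x < 0" | "x = 0" by linarith
  then show ?thesis
  proof cases
    case 1
    have "((\<lambda>x. exp (- inverse x) * inverse x ^ k) has_real_derivative
        exp (- inverse x) * inverse x ^ 2 * inverse x ^ k
          + exp (- inverse x) * (real k * inverse x ^ (k - 1) * - (inverse x ^ 2))) (at x)"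
      using 1 by (auto intro!: derivative_eq_intros simp: power2_eq_square)
    also have "exp (- inverse x) * inverse x ^ 2 * inverse x ^ k
          + exp (- inverse x) * (real k * inverse x ^ (k - 1) * - (inverse x ^ 2))
        = bump_gen (k + 2) x - real k * bump_gen (k + 1) x"
      using 1 by (cases k) (simp_all add: bump_gen_def power2_eq_square algebra_simps)
    finally have "((\<lambda>x. exp (- inverse x) * inverse x ^ k) has_real_derivative
        bump_gen (k + 2) x - real k * bump_gen (k + 1) x) (at x)" .
    then show ?thesis
      by (rule has_field_derivative_transform_within_open[of _ _ _ "{0<..}"]) (use 1 in \<open>auto simp: bump_gen_def\<close>)
  next
    case 2
    have "((\<lambda>x. 0) has_real_derivative bump_gen (k + 2) x - real k * bump_gen (k + 1) x) (at x)"
      using 2 by (simp add: bump_gen_def)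
    then show ?thesis
      by (rule has_field_derivative_transform_within_open[of _ _ _ "{..<0}"]) (use 2 in \<open>auto simp: bump_gen_def\<close>)
  next
    case 3
    \<comment> \<open>The difference quotient at the origin is \<open>bump_gen (Suc k)\<close>
      itself, whose limit is already known to be 0.\<close>
    have "((\<lambda>h. (bump_gen k (0 + h) - bump_gen k 0) / h) \<longlongrightarrow> 0) (at 0)"
      by (rule Lim_transform_eventually[OF bump_gen_tendsto_0[of "Suc k"]])
         (auto simp: bump_gen_def eventually_at_filter divide_inverse mult_ac)
    then show ?thesis using 3 unfolding DERIV_def by (simp add: bump_gen_def)
  qed
qed

text \<open>An algebra of functions on the whole plane that is closed under both partial
  derivatives. Membership alone therefore gives differentiability of every order by induction, and
  all bumps are built inside it.\<close>

inductive_set test_alg :: "(real \<times> real \<Rightarrow> real) set" where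
  test_const: "(\<lambda>p. c) \<in> test_alg"
| test_x: "(\<lambda>p. bump_gen k (a * fst p + b)) \<in> test_alg"
| test_y: "(\<lambda>p. bump_gen k (a * snd p + b)) \<in> test_alg"
| test_add: "f \<in> test_alg \<Longrightarrow> g \<in> test_alg \<Longrightarrow> (\<lambda>p. f p + g p) \<in> test_alg"
| test_mult: "f \<in> test_alg \<Longrightarrow> g \<in> test_alg \<Longrightarrow> (\<lambda>p. f p * g p) \<in> test_alg"

lemma test_alg_has_grad:
  assumes "f \<in> test_alg"
  shows "\<exists>fx\<in>test_alg. \<exists>fy\<in>test_alg. \<forall>p. has_grad f (fx p) (fy p) p"
  using assms
proof induction
  case (test_const c)
  show ?case
    by (intro bexI[of _ "\<lambda>p. 0"] allI has_grad_const test_alg.test_const)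
next
  case (test_x k a b)
  let ?d = "\<lambda>p::real\<times>real. a * (bump_gen (k + 2) (a * fst p + b) + (- real k) * bump_gen (k + 1) (a * fst p + b))"
  have "?d \<in> test_alg" by (intro test_alg.intros)
  moreover have "has_grad (\<lambda>p. bump_gen k (a * fst p + b)) (?d p) 0 p" for p
  proof -
    have "((\<lambda>p::real\<times>real. bump_gen k (a * fst p + b)) has_derivative
       (\<lambda>h. (a * fst h) * (bump_gen (k + 2) (a * fst p + b) - real k * bump_gen (k + 1) (a * fst p + b)))) (at p)"
      by (rule has_derivative_compose[where g="bump_gen k" and f="\<lambda>p. a * fst p + b" and f'="\<lambda>h. a * fst h",
          OF _ bump_gen_deriv[unfolded has_field_derivative_def, THEN has_derivative_eq_rhs]])
         (auto intro!: derivative_eq_intros)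
    then show ?thesis unfolding has_grad_def
      by (rule has_derivative_eq_rhs) (auto simp: algebra_simps)
  qed
  ultimately show ?case using test_alg.test_const[of 0]
    by (intro bexI[of _ ?d] bexI[of _ "\<lambda>p. 0"] allI) assumption+
next
  case (test_y k a b)
  let ?d = "\<lambda>p::real\<times>real. a * (bump_gen (k + 2) (a * snd p + b) + (- real k) * bump_gen (k + 1) (a * snd p + b))"
  have "?d \<in> test_alg" by (intro test_alg.intros)
  moreover have "has_grad (\<lambda>p. bump_gen k (a * snd p + b)) 0 (?d p) p" for p
  proof -
    have "((\<lambda>p::real\<times>real. bump_gen k (a * snd p + b)) has_derivative
       (\<lambda>h. (a * snd h) * (bump_gen (k + 2) (a * snd p + b) - real k * bump_gen (k + 1) (a * snd p + b)))) (at p)"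
      by (rule has_derivative_compose[where g="bump_gen k" and f="\<lambda>p. a * snd p + b" and f'="\<lambda>h. a * snd h",
          OF _ bump_gen_deriv[unfolded has_field_derivative_def, THEN has_derivative_eq_rhs]])
         (auto intro!: derivative_eq_intros)
    then show ?thesis unfolding has_grad_def
      by (rule has_derivative_eq_rhs) (auto simp: algebra_simps)
  qed
  ultimately show ?case using test_alg.test_const[of 0]
    by (intro bexI[of _ "\<lambda>p. 0"] bexI[of _ ?d] allI) assumption+
next
  case (test_add f g)
  then obtain fx fy gx gy where *: "fx \<in> test_alg" "fy \<in> test_alg" "gx \<in> test_alg" "gy \<in> test_alg"
    "\<And>p. has_grad f (fx p) (fy p) p" "\<And>p. has_grad g (gx p) (gy p) p" by blast
  show ?case
    by (rule bexI[of _ "\<lambda>p. fx p + gx p"], rule bexI[of _ "\<lambda>p. fy p + gy p"])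
       (intro allI has_grad_add test_alg.test_add *)+
next
  case (test_mult f g)
  then obtain fx fy gx gy where *: "fx \<in> test_alg" "fy \<in> test_alg" "gx \<in> test_alg" "gy \<in> test_alg"
    "\<And>p. has_grad f (fx p) (fy p) p" "\<And>p. has_grad g (gx p) (gy p) p" by blast
  show ?case
    by (rule bexI[of _ "\<lambda>p. f p * gx p + fx p * g p"], rule bexI[of _ "\<lambda>p. f p * gy p + fy p * g p"])
       (intro allI has_grad_mult test_alg.test_add test_alg.test_mult * test_mult(1,2))+
qed

lemma test_alg_dx_dy:
  assumes "f \<in> test_alg"
  shows "dx f \<in> test_alg" "dy f \<in> test_alg" "has_grad f (dx f p) (dy f p) p"
proof -
  obtain fx fy where *: "fx \<in> test_alg" "fy \<in> test_alg" "\<And>p. has_grad f (fx p) (fy p) p"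
    using test_alg_has_grad[OF assms] by blast
  have "dx f = fx" "dy f = fy" by (intro ext has_grad_unique[OF *(3)])+
  with * show "dx f \<in> test_alg" "dy f \<in> test_alg" "has_grad f (dx f p) (dy f p) p" by simp_all
qed

lemma test_alg_continuous: "f \<in> test_alg \<Longrightarrow> continuous_on S f"
  by (intro continuous_at_imp_continuous_on ballI has_grad_continuous[OF test_alg_dx_dy(3)])

lemma test_alg_Ck_closure: "f \<in> test_alg \<Longrightarrow> Ck_closure k \<Omega> f"
proof (induction k arbitrary: f)
  case 0
  then show ?case using test_alg_continuous[of f "closure \<Omega>"]
    unfolding Ck_closure.simps by (intro exI[of _ f]) simp
next
  case (Suc k)
  have "f differentiable_on \<Omega>"
    unfolding differentiable_on_def
    by (rule ballI, rule differentiable_at_withinI,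
        rule has_grad_differentiable[OF test_alg_dx_dy(3)[OF Suc.prems]])
  moreover have "\<exists>F. continuous_on (closure \<Omega>) F \<and> (\<forall>p\<in>\<Omega>. F p = f p)"
    using test_alg_continuous[OF Suc.prems] by (intro exI[of _ f]) simp
  ultimately show ?case
    unfolding Ck_closure.simps using Suc.IH test_alg_dx_dy(1,2)[OF Suc.prems] by blast
qed

text \<open>One flat factor for each side of the box. The arguments are spelled as
  \<open>a * fst p + b\<close> so that the introduction rules of \<open>test_alg\<close> match them
  literally.\<close>

definition box_bump :: "real \<Rightarrow> real \<Rightarrow> real \<Rightarrow> real \<Rightarrow> real \<times> real \<Rightarrow> real" where
  "box_bump a b c d = (\<lambda>p. (bump_gen 0 (1 * fst p + - a) * bump_gen 0 (-1 * fst p + b)) *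
     (bump_gen 0 (1 * snd p + - c) * bump_gen 0 (-1 * snd p + d)))"

lemma box_bump_test_alg: "box_bump a b c d \<in> test_alg"
  unfolding box_bump_def by (intro test_mult test_x test_y)

lemma box_bump_pos: "a < x \<Longrightarrow> x < b \<Longrightarrow> c < y \<Longrightarrow> y < d \<Longrightarrow> box_bump a b c d (x, y) > 0"
  by (auto simp: box_bump_def bump_gen_def)

lemma box_bump_zero: "\<not> (a < x \<and> x < b \<and> c < y \<and> y < d) \<Longrightarrow> box_bump a b c d (x, y) = 0"
  by (auto simp: box_bump_def bump_gen_def)

lemma box_bump_grad_zero:
  assumes "\<not> (a < x \<and> x < b \<and> c < y \<and> y < d)"
  shows "dx (box_bump a b c d) (x, y) = 0" "dy (box_bump a b c d) (x, y) = 0"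
proof -
  have nn: "box_bump a b c d p \<ge> 0" for p by (simp add: box_bump_def bump_gen_def)
  have G: "has_grad (box_bump a b c d) (dx (box_bump a b c d) (x, y)) (dy (box_bump a b c d) (x, y)) (x, y)"
    using test_alg_dx_dy(3)[OF box_bump_test_alg] .
  have z: "box_bump a b c d (x, y) = 0" using box_bump_zero[OF assms] .
  \<comment> \<open>a nonnegative function has a critical point wherever it vanishes\<close>
  show "dx (box_bump a b c d) (x, y) = 0"
    using nn z
    by (intro DERIV_local_min[OF has_grad_slice_x[OF G,
          folded has_real_derivative_iff_has_vector_derivative] zero_less_one]) simp
  show "dy (box_bump a b c d) (x, y) = 0"
    using nn z
    by (intro DERIV_local_min[OF has_grad_slice_y[OF G,
          folded has_real_derivative_iff_has_vector_derivative] zero_less_one]) simp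
qed

text \<open>The complement of the closed box serves as the neighbourhood of \<open>\<Gamma>\<close>:
  the box lies in \<open>\<Omega>\<close>, which \<open>\<Gamma>\<close> avoids.\<close>

lemma box_bump_C0_inf:
  assumes "cbox (a, c) (b, d) \<subseteq> \<Omega>" "\<Gamma> \<inter> \<Omega> = {}"
  shows "box_bump a b c d \<in> C0_inf \<Omega> \<Gamma>"
proof -
  have "\<exists>U. open U \<and> \<Gamma> \<subseteq> U \<and> (\<forall>p\<in>U \<inter> \<Omega>. box_bump a b c d p = 0)"
  proof (intro exI[of _ "- cbox (a, c) (b, d)"] conjI ballI)
    show "open (- cbox (a, c) (b, d))" by (simp add: open_Compl closed_cbox)
    show "\<Gamma> \<subseteq> - cbox (a, c) (b, d)" using assms by blast
    fix p assume "p \<in> - cbox (a, c) (b, d) \<inter> \<Omega>"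
    then show "box_bump a b c d p = 0"
      by (cases p) (auto simp: cbox_Pair_eq intro: box_bump_zero)
  qed
  then show ?thesis
    using test_alg_Ck_closure[OF box_bump_test_alg] by (simp add: C0_inf_def)
qed

lemma has_grad_slice_x_real:
  fixes f :: "real \<times> real \<Rightarrow> real"
  shows "has_grad f a b (x, y) \<Longrightarrow> ((\<lambda>t. f (t, y)) has_real_derivative a) (at x)"
  unfolding has_real_derivative_iff_has_vector_derivative by (rule has_grad_slice_x)

lemma has_grad_slice_y_real:
  fixes f :: "real \<times> real \<Rightarrow> real"
  shows "has_grad f a b (x, y) \<Longrightarrow> ((\<lambda>t. f (x, t)) has_real_derivative b) (at y)"
  unfolding has_real_derivative_iff_has_vector_derivative by (rule has_grad_slice_y)

section \<open>Integration along slices\<close>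

text \<open>Fubini is applied to the product of two copies of \<open>lborel\<close>, while the norms
  are integrals over \<open>lebesgue\<close>. This is the passage to the completion.\<close>

lemma set_integrable_lebesgue_of_lborel:
  fixes f :: "'a::euclidean_space \<Rightarrow> real"
  assumes "set_integrable lborel S f"
  shows "set_integrable lebesgue S f" "(LINT x:S|lebesgue. f x) = (LINT x:S|lborel. f x)"
  using assms integrable_completion[of "\<lambda>x. indicator S x *\<^sub>R f x" lborel]
    integral_completion[of "\<lambda>x. indicator S x *\<^sub>R f x" lborel]
  unfolding set_integrable_def set_lebesgue_integral_def
  by (auto dest: borel_measurable_integrable)

lemma set_integrable_bounded_continuous:
  fixes f :: "'a::euclidean_space \<Rightarrow> real"
  assumes "open S" "bounded S" "continuous_on S f" "\<And>x. x \<in> S \<Longrightarrow> \<bar>f x\<bar> \<le> K"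
  shows "set_integrable lborel S f"
proof -
  have "emeasure lborel S < \<infinity>" using emeasure_bounded_finite[OF assms(2)] .
  then have "integrable lborel (\<lambda>x. indicator S x * K)"
    using assms(1) by (intro integrable_mult_left) (auto intro!: integrable_real_indicator)
  moreover have "(\<lambda>x. indicator S x *\<^sub>R f x) \<in> borel_measurable lborel"
    using borel_measurable_continuous_on_indicator[OF _ assms(3)] assms(1) by simp
  ultimately show ?thesis unfolding set_integrable_def
    by (rule Bochner_Integration.integrable_bound)
       (use assms(4) in \<open>fastforce simp: indicator_def\<close>)
qed

text \<open>A slice of the domain ends on its boundary, where only continuity of \<open>F\<close> is
  known. The derivative is therefore required in the open interval alone, with a bound that makes it
  integrable.\<close>

lemma interior_FTC_set_integral:
  fixes F f :: "real \<Rightarrow> real"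
  assumes "l \<le> r" "continuous_on {l..r} F"
    and D: "\<And>x. l < x \<Longrightarrow> x < r \<Longrightarrow> (F has_real_derivative f x) (at x)"
    and "continuous_on {l<..<r} f" "\<And>x. l < x \<Longrightarrow> x < r \<Longrightarrow> \<bar>f x\<bar> \<le> K"
  shows "(LINT x:{l<..<r}|lborel. f x) = F r - F l"
proof -
  have "(f has_integral (F r - F l)) {l..r}"
    using assms by (intro fundamental_theorem_of_calculus_interior)
      (auto simp: has_real_derivative_iff_has_vector_derivative)
  then have "integral {l<..<r} f = F r - F l"
    by (simp add: has_integral_Icc_iff_Ioo integral_unique)
  moreover have "set_integrable lborel {l<..<r} f"
    using assms by (intro set_integrable_bounded_continuous[of _ _ K]) auto
  ultimately show ?thesis by (simp add: set_borel_integral_eq_integral)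
qed

text \<open>Fubini, with each inner integral evaluated by the fundamental theorem of calculus.
  Integrability of the difference of end values over \<open>Y\<close> is a result of Fubini, so
  nothing about the dependence of \<open>l\<close> and \<open>r\<close> on y is assumed.\<close>

lemma slice_integral_x:
  fixes P Px :: "real \<times> real \<Rightarrow> real"
  assumes R: "open R" "bounded R" "\<And>x y. (x, y) \<in> R \<longleftrightarrow> y \<in> Y \<and> l y < x \<and> x < r y"
    and lr: "\<And>y. y \<in> Y \<Longrightarrow> l y \<le> r y"
    and P: "\<And>y. y \<in> Y \<Longrightarrow> continuous_on {l y..r y} (\<lambda>x. P (x, y))"
    and D: "\<And>x y. (x, y) \<in> R \<Longrightarrow> ((\<lambda>t. P (t, y)) has_real_derivative Px (x, y)) (at x)"
    and Px: "continuous_on R Px" "\<And>p. p \<in> R \<Longrightarrow> \<bar>Px p\<bar> \<le> K"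
  shows "set_integrable lebesgue R Px"
    and "set_integrable lebesgue Y (\<lambda>y. P (r y, y) - P (l y, y))"
    and "(LINT p:R|lebesgue. Px p) = (LINT y:Y|lebesgue. P (r y, y) - P (l y, y))"
proof -
  have I: "set_integrable lborel R Px"
    using R(1,2) Px by (rule set_integrable_bounded_continuous)
  then have I': "integrable (lborel \<Otimes>\<^sub>M lborel) (case_prod (\<lambda>x y. indicator R (x, y) *\<^sub>R Px (x, y)))"
    unfolding set_integrable_def by (simp add: lborel_prod case_prod_beta')
  have inner: "(\<integral>x. indicator R (x, y) *\<^sub>R Px (x, y) \<partial>lborel) = indicator Y y *\<^sub>R (P (r y, y) - P (l y, y))" for y
  proof (cases "y \<in> Y")
    case True
    have "continuous_on {l y<..<r y} (\<lambda>x. Px (x, y))"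
      by (rule continuous_on_compose2[OF Px(1)]) (use R(3) True in \<open>auto intro!: continuous_intros\<close>)
    then have "(LINT x:{l y<..<r y}|lborel. Px (x, y)) = P (r y, y) - P (l y, y)"
      using lr[OF True] P[OF True] D Px(2) R(3) True
      by (intro interior_FTC_set_integral[of _ _ _ _ K]) auto
    moreover have "(\<integral>x. indicator R (x, y) *\<^sub>R Px (x, y) \<partial>lborel) = (LINT x:{l y<..<r y}|lborel. Px (x, y))"
      unfolding set_lebesgue_integral_def using R(3) True
      by (intro Bochner_Integration.integral_cong) (auto simp: indicator_def)
    ultimately show ?thesis using True by simp
  next
    case False
    then show ?thesis using R(3) by (simp add: indicator_def)
  qed
  have J: "set_integrable lborel Y (\<lambda>y. P (r y, y) - P (l y, y))"
    using lborel_pair.integrable_snd[OF I'] unfolding set_integrable_def by (simp only: inner)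
  show "set_integrable lebesgue R Px" using set_integrable_lebesgue_of_lborel(1)[OF I] .
  show "set_integrable lebesgue Y (\<lambda>y. P (r y, y) - P (l y, y))"
    using set_integrable_lebesgue_of_lborel(1)[OF J] .
  have "(LINT p:R|lborel. Px p) = (LINT y:Y|lborel. P (r y, y) - P (l y, y))"
    using lborel_pair.integral_snd[OF I'] unfolding set_lebesgue_integral_def
    by (simp add: inner[unfolded real_scaleR_def] lborel_prod case_prod_beta')
  then show "(LINT p:R|lebesgue. Px p) = (LINT y:Y|lebesgue. P (r y, y) - P (l y, y))"
    by (simp add: set_integrable_lebesgue_of_lborel(2)[OF I] set_integrable_lebesgue_of_lborel(2)[OF J])
qed

lemma slice_integral_y:
  fixes Q Qy :: "real \<times> real \<Rightarrow> real"
  assumes R: "open R" "bounded R" "\<And>x y. (x, y) \<in> R \<longleftrightarrow> x \<in> X \<and> l x < y \<and> y < r x"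
    and lr: "\<And>x. x \<in> X \<Longrightarrow> l x \<le> r x"
    and Q: "\<And>x. x \<in> X \<Longrightarrow> continuous_on {l x..r x} (\<lambda>y. Q (x, y))"
    and D: "\<And>x y. (x, y) \<in> R \<Longrightarrow> ((\<lambda>t. Q (x, t)) has_real_derivative Qy (x, y)) (at y)"
    and Qy: "continuous_on R Qy" "\<And>p. p \<in> R \<Longrightarrow> \<bar>Qy p\<bar> \<le> K"
  shows "set_integrable lebesgue R Qy"
    and "set_integrable lebesgue X (\<lambda>x. Q (x, r x) - Q (x, l x))"
    and "(LINT p:R|lebesgue. Qy p) = (LINT x:X|lebesgue. Q (x, r x) - Q (x, l x))"
proof -
  have I: "set_integrable lborel R Qy"
    using R(1,2) Qy by (rule set_integrable_bounded_continuous)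
  then have I': "integrable (lborel \<Otimes>\<^sub>M lborel) (\<lambda>p. indicator R p *\<^sub>R Qy p)"
    unfolding set_integrable_def by (simp add: lborel_prod)
  have inner: "(\<integral>y. indicator R (x, y) *\<^sub>R Qy (x, y) \<partial>lborel) = indicator X x *\<^sub>R (Q (x, r x) - Q (x, l x))" for x
  proof (cases "x \<in> X")
    case True
    have "continuous_on {l x<..<r x} (\<lambda>y. Qy (x, y))"
      by (rule continuous_on_compose2[OF Qy(1)]) (use R(3) True in \<open>auto intro!: continuous_intros\<close>)
    then have "(LINT y:{l x<..<r x}|lborel. Qy (x, y)) = Q (x, r x) - Q (x, l x)"
      using lr[OF True] Q[OF True] D Qy(2) R(3) True
      by (intro interior_FTC_set_integral[of _ _ _ _ K]) auto
    moreover have "(\<integral>y. indicator R (x, y) *\<^sub>R Qy (x, y) \<partial>lborel) = (LINT y:{l x<..<r x}|lborel. Qy (x, y))"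
      unfolding set_lebesgue_integral_def using R(3) True
      by (intro Bochner_Integration.integral_cong) (auto simp: indicator_def)
    ultimately show ?thesis using True by simp
  next
    case False
    then show ?thesis using R(3) by (simp add: indicator_def)
  qed
  have J: "set_integrable lborel X (\<lambda>x. Q (x, r x) - Q (x, l x))"
    using lborel_pair.integrable_fst'[OF I'] unfolding set_integrable_def by (simp only: inner)
  show "set_integrable lebesgue R Qy" using set_integrable_lebesgue_of_lborel(1)[OF I] .
  show "set_integrable lebesgue X (\<lambda>x. Q (x, r x) - Q (x, l x))"
    using set_integrable_lebesgue_of_lborel(1)[OF J] .
  have "(LINT p:R|lborel. Qy p) = (LINT x:X|lborel. Q (x, r x) - Q (x, l x))"
    using lborel_pair.integral_fst'[OF I'] unfolding set_lebesgue_integral_def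
    by (simp add: inner[unfolded real_scaleR_def] lborel_prod)
  then show "(LINT p:R|lebesgue. Qy p) = (LINT x:X|lebesgue. Q (x, r x) - Q (x, l x))"
    by (simp add: set_integrable_lebesgue_of_lborel(2)[OF I] set_integrable_lebesgue_of_lborel(2)[OF J])
qed

text \<open>The second hypothesis only asks that \<open>f\<close> vanishes somewhere on each slice.\<close>

lemma slice_Poincare:
  fixes f fy :: "real \<times> real \<Rightarrow> real"
  assumes R: "open R" "bounded R" "\<And>x y. (x, y) \<in> R \<longleftrightarrow> x \<in> X \<and> l x < y \<and> y < r x"
    and zero: "\<And>x. x \<in> X \<Longrightarrow> \<exists>y. (x, y) \<in> R \<and> f (x, y) = 0"
    and len: "\<And>x. x \<in> X \<Longrightarrow> r x - l x \<le> \<delta>"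
    and D: "\<And>x y. (x, y) \<in> R \<Longrightarrow> ((\<lambda>t. f (x, t)) has_real_derivative fy (x, y)) (at y)"
    and f: "continuous_on R f" "\<And>p. p \<in> R \<Longrightarrow> \<bar>f p\<bar> \<le> K"
    and fy: "continuous_on R fy" "\<And>p. p \<in> R \<Longrightarrow> \<bar>fy p\<bar> \<le> K"
  shows "(LINT p:R|lebesgue. \<bar>f p\<bar>) \<le> \<delta> * (LINT p:R|lebesgue. \<bar>fy p\<bar>)"
proof -
  have cf: "continuous_on R (\<lambda>p. \<bar>f p\<bar>)" and cfy: "continuous_on R (\<lambda>p. \<bar>fy p\<bar>)"
    using f(1) fy(1) by (auto intro: continuous_on_rabs)
  have I: "set_integrable lborel R (\<lambda>p. \<bar>f p\<bar>)" and J: "set_integrable lborel R (\<lambda>p. \<bar>fy p\<bar>)"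
    using set_integrable_bounded_continuous[OF R(1,2) cf, of K]
      set_integrable_bounded_continuous[OF R(1,2) cfy, of K] f(2) fy(2) by auto
  have I': "integrable (lborel \<Otimes>\<^sub>M lborel) (\<lambda>p. indicator R p *\<^sub>R \<bar>f p\<bar>)"
    and J': "integrable (lborel \<Otimes>\<^sub>M lborel) (\<lambda>p. indicator R p *\<^sub>R \<bar>fy p\<bar>)"
    using I J unfolding set_integrable_def by (simp_all add: lborel_prod)
  have inner: "(\<integral>y. indicator R (x, y) *\<^sub>R \<bar>f (x, y)\<bar> \<partial>lborel) \<le> \<delta> * (\<integral>y. indicator R (x, y) *\<^sub>R \<bar>fy (x, y)\<bar> \<partial>lborel)" for x
  proof (cases "x \<in> X")
    case True
    let ?S = "{l x<..<r x}"
    obtain y0 where y0: "l x < y0" "y0 < r x" "f (x, y0) = 0" using zero[OF True] R(3) by blast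
    have c: "continuous_on ?S (\<lambda>y. \<bar>fy (x, y)\<bar>)" "continuous_on ?S (\<lambda>y. fy (x, y))"
      by (rule continuous_on_compose2[OF cfy] continuous_on_compose2[OF fy(1)];
          use R(3) True in \<open>auto intro!: continuous_intros\<close>)+
    have cf': "continuous_on ?S (\<lambda>y. \<bar>f (x, y)\<bar>)"
      by (rule continuous_on_compose2[OF cf]) (use R(3) True in \<open>auto intro!: continuous_intros\<close>)
    have int: "set_integrable lborel ?S (\<lambda>y. \<bar>fy (x, y)\<bar>)"
      by (rule set_integrable_bounded_continuous[OF _ _ c(1), of K]) (use fy(2) R(3) True in auto)
    have intf: "set_integrable lborel ?S (\<lambda>y. \<bar>f (x, y)\<bar>)"
      by (rule set_integrable_bounded_continuous[OF _ _ cf', of K]) (use f(2) R(3) True in auto)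
    \<comment> \<open>\<open>W\<close> is the variation of \<open>f\<close> along the slice. As
      \<open>f\<close> vanishes at \<open>y0\<close>, it bounds the modulus of \<open>f\<close> on
      the whole slice, and integration over the slice costs its length.\<close>
    define W where "W = (LINT y:?S|lborel. \<bar>fy (x, y)\<bar>)"
    have W0: "W \<ge> 0" unfolding W_def set_lebesgue_integral_def by simp
    have bound: "\<bar>f (x, y2) - f (x, y1)\<bar> \<le> W" if "l x < y1" "y1 \<le> y2" "y2 < r x" for y1 y2
    proof -
      have sub: "{y1<..<y2} \<subseteq> ?S" using that by auto
      have "(LINT y:{y1<..<y2}|lborel. fy (x, y)) = f (x, y2) - f (x, y1)"
      proof (rule interior_FTC_set_integral[of _ _ _ _ K])
        show "continuous_on {y1..y2} (\<lambda>y. f (x, y))"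
          by (intro continuous_at_imp_continuous_on ballI DERIV_isCont[OF D]) (use R(3) True that in auto)
        show "continuous_on {y1<..<y2} (\<lambda>y. fy (x, y))" using c(2) sub continuous_on_subset by blast
      qed (use that D R(3) True fy(2) in auto)
      moreover have "\<bar>LINT y:{y1<..<y2}|lborel. fy (x, y)\<bar> \<le> (LINT y:{y1<..<y2}|lborel. \<bar>fy (x, y)\<bar>)"
        unfolding set_lebesgue_integral_def by (rule order_trans[OF integral_abs_bound]) (simp add: abs_mult)
      moreover have "(LINT y:{y1<..<y2}|lborel. \<bar>fy (x, y)\<bar>) \<le> W" unfolding W_def
        unfolding set_lebesgue_integral_def
        using set_integrable_subset[OF int _ sub] int sub
        by (intro integral_mono) (auto simp: set_integrable_def indicator_def)
      ultimately show ?thesis by linarith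
    qed
    have fW: "\<bar>f (x, y)\<bar> \<le> W" if "y \<in> ?S" for y
      using bound[of y y0] bound[of y0 y] that y0 by (cases "y \<le> y0") auto
    have eqs: "(\<integral>y. indicator R (x, y) *\<^sub>R \<bar>f (x, y)\<bar> \<partial>lborel) = (LINT y:?S|lborel. \<bar>f (x, y)\<bar>)"
      "(\<integral>y. indicator R (x, y) *\<^sub>R \<bar>fy (x, y)\<bar> \<partial>lborel) = W"
      unfolding set_lebesgue_integral_def W_def using R(3) True
      by (intro Bochner_Integration.integral_cong; auto simp: indicator_def)+
    have "(LINT y:?S|lborel. \<bar>f (x, y)\<bar>) \<le> (LINT y:?S|lborel. W)"
      by (rule set_integral_mono[OF intf set_integrable_bounded_continuous[of _ "\<lambda>_. W" "\<bar>W\<bar>"]])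
         (use fW in auto)
    moreover have "(LINT y:?S|lborel. W) = (r x - l x) * W"
      using y0 by (simp add: set_lebesgue_integral_def)
    moreover have "(r x - l x) * W \<le> \<delta> * W" using len[OF True] W0 by (rule mult_right_mono)
    ultimately show ?thesis unfolding eqs by linarith
  next
    case False
    then show ?thesis using R(3) by (simp add: indicator_def)
  qed
  have "(LINT p:R|lborel. \<bar>f p\<bar>) \<le> \<delta> * (LINT p:R|lborel. \<bar>fy p\<bar>)"
  proof -
    have "(LINT p:R|lborel. \<bar>f p\<bar>) = (\<integral>x. (\<integral>y. indicator R (x, y) *\<^sub>R \<bar>f (x, y)\<bar> \<partial>lborel) \<partial>lborel)"
      using lborel_pair.integral_fst'[OF I'] by (simp add: set_lebesgue_integral_def lborel_prod)
    also have "\<dots> \<le> (\<integral>x. \<delta> * (\<integral>y. indicator R (x, y) *\<^sub>R \<bar>fy (x, y)\<bar> \<partial>lborel) \<partial>lborel)"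
      by (intro integral_mono lborel_pair.integrable_fst'[OF I'] integrable_mult_right
          lborel_pair.integrable_fst'[OF J'] inner)
    also have "\<dots> = \<delta> * (LINT p:R|lborel. \<bar>fy p\<bar>)"
      using lborel_pair.integral_fst'[OF J'] by (simp add: set_lebesgue_integral_def lborel_prod)
    finally show ?thesis .
  qed
  then show ?thesis
    by (simp add: set_integrable_lebesgue_of_lborel(2)[OF I] set_integrable_lebesgue_of_lborel(2)[OF J])
qed

section \<open>Green's formula for the Tricomi operator on a box\<close>

lemma Ck_open_2_has_grad:
  fixes w :: "real \<times> real \<Rightarrow> 'a::real_normed_vector"
  assumes "open \<Omega>" "Ck_open 2 \<Omega> w" "p \<in> \<Omega>"
  shows "has_grad w (dx w p) (dy w p) p" "has_grad (dx w) (dx (dx w) p) (dy (dx w) p) p"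
    "has_grad (dy w) (dx (dy w) p) (dy (dy w) p) p"
  using assms unfolding numeral_2_eq_2
  by (auto intro!: has_grad_dx_dy simp: differentiable_on_eq_differentiable_at)

lemma Ck_open_2_continuous:
  assumes "open \<Omega>" "Ck_open 2 \<Omega> w"
  shows "continuous_on \<Omega> w" "continuous_on \<Omega> (dx w)" "continuous_on \<Omega> (dy w)"
    "continuous_on \<Omega> (dx (dx w))" "continuous_on \<Omega> (dy (dx w))"
    "continuous_on \<Omega> (dx (dy w))" "continuous_on \<Omega> (dy (dy w))"
  using assms unfolding numeral_2_eq_2
  by (auto intro: differentiable_imp_continuous_on)

lemma test_alg_Ck_open: "f \<in> test_alg \<Longrightarrow> Ck_open k \<Omega> f"
proof (induction k arbitrary: f)
  case 0
  then show ?case using test_alg_continuous by simp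
next
  case (Suc k)
  have "f differentiable_on \<Omega>"
    unfolding differentiable_on_def
    by (rule ballI, rule differentiable_at_withinI,
        rule has_grad_differentiable[OF test_alg_dx_dy(3)[OF Suc.prems]])
  then show ?case
    unfolding Ck_open.simps using Suc.IH test_alg_dx_dy(1,2)[OF Suc.prems] by blast
qed

lemma bounded_on_compact:
  fixes f :: "'a::metric_space \<Rightarrow> real"
  assumes "compact S" "continuous_on S f"
  obtains K where "K > 0" "\<And>p. p \<in> S \<Longrightarrow> \<bar>f p\<bar> \<le> K"
proof -
  have "bounded (f ` S)" using compact_continuous_image[OF assms(2,1)] compact_imp_bounded by blast
  then show ?thesis using that unfolding bounded_pos by auto
qed

lemma set_integrable_open_box:
  fixes f :: "real \<times> real \<Rightarrow> real"
  assumes "continuous_on (cbox (a, c) (b, d)) f"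
  shows "set_integrable lebesgue ({a<..<b} \<times> {c<..<d}) f"
proof -
  have sub: "{a<..<b} \<times> {c<..<d} \<subseteq> cbox (a, c) (b, d)" by (auto simp: cbox_Pair_eq)
  obtain L where L: "\<And>q. q \<in> cbox (a, c) (b, d) \<Longrightarrow> \<bar>f q\<bar> \<le> L"
    using bounded_on_compact[OF compact_cbox assms] by blast
  show ?thesis
  proof (rule set_integrable_lebesgue_of_lborel(1)[OF set_integrable_bounded_continuous])
    show "continuous_on ({a<..<b} \<times> {c<..<d}) f" using assms sub by (rule continuous_on_subset)
    show "\<bar>f q\<bar> \<le> L" if "q \<in> {a<..<b} \<times> {c<..<d}" for q using L sub that by blast
  qed (auto intro!: open_Times bounded_Times)
qed

text \<open>The operator is formally self-adjoint, because its coefficient y does not depend on x.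
  The bump and its gradient vanish on all four sides, so no boundary terms remain and
  \<open>w\<close> needs no boundary condition.\<close>

lemma green_box_bump:
  fixes w :: "real \<times> real \<Rightarrow> real"
  assumes \<Omega>: "open \<Omega>" "Ck_open 2 \<Omega> w" "cbox (a, c) (b, d) \<subseteq> \<Omega>" and ab: "a < b" "c < d"
  defines "\<phi> \<equiv> box_bump a b c d" and "R \<equiv> {a<..<b} \<times> {c<..<d}"
  shows "set_integrable lebesgue R (\<lambda>p. Tric w p * \<phi> p)"
    and "set_integrable lebesgue R (\<lambda>p. w p * Tric \<phi> p)"
    and "(LINT p:R|lebesgue. Tric w p * \<phi> p) = (LINT p:R|lebesgue. w p * Tric \<phi> p)"
proof -
  let ?C = "cbox (a, c) (b, d)"
  have RC: "R \<subseteq> ?C" by (auto simp: R_def cbox_Pair_eq)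
  have R: "open R" "bounded R"
    unfolding R_def by (auto intro!: open_Times bounded_Times)
  have \<phi>T: "Ck_open 2 \<Omega> \<phi>" unfolding \<phi>_def by (rule test_alg_Ck_open[OF box_bump_test_alg])
  note gw = Ck_open_2_has_grad[OF \<Omega>(1,2)] and g\<phi> = Ck_open_2_has_grad[OF \<Omega>(1) \<phi>T]
  note cw = Ck_open_2_continuous[OF \<Omega>(1,2), THEN continuous_on_subset, OF \<Omega>(3)]
  note c\<phi> = Ck_open_2_continuous[OF \<Omega>(1) \<phi>T, THEN continuous_on_subset, OF \<Omega>(3)]
  note cRC = continuous_on_subset[OF _ RC]
  have int: "set_integrable lebesgue R f" if "continuous_on ?C f" for f :: "real \<times> real \<Rightarrow> real"
    unfolding R_def by (rule set_integrable_open_box[OF that])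
  show i1: "set_integrable lebesgue R (\<lambda>p. Tric w p * \<phi> p)"
    unfolding Tric_def by (intro int continuous_intros cw c\<phi>)
  show i2: "set_integrable lebesgue R (\<lambda>p. w p * Tric \<phi> p)"
    unfolding Tric_def by (intro int continuous_intros cw c\<phi>)
  \<comment> \<open>\<open>(P, Q)\<close> is the Green field: its divergence \<open>Px + Qy\<close>
    equals \<open>Tric w * \<phi> - w * Tric \<phi>\<close>.\<close>
  define P where "P = (\<lambda>p. - snd p * (dx w p * \<phi> p - w p * dx \<phi> p))"
  define Px where "Px = (\<lambda>p. - snd p * (dx (dx w) p * \<phi> p - w p * dx (dx \<phi>) p))"
  define Q where "Q = (\<lambda>p. - (dy w p * \<phi> p - w p * dy \<phi> p))"
  define Qy where "Qy = (\<lambda>p. - (dy (dy w) p * \<phi> p - w p * dy (dy \<phi>) p))"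
  have cP: "continuous_on ?C P" "continuous_on ?C Px" "continuous_on ?C Q" "continuous_on ?C Qy"
    unfolding P_def Px_def Q_def Qy_def by (intro continuous_intros cw c\<phi>)+
  obtain K where K: "\<And>p. p \<in> ?C \<Longrightarrow> \<bar>Px p\<bar> \<le> K" using bounded_on_compact[OF compact_cbox cP(2)] by blast
  obtain L where L: "\<And>p. p \<in> ?C \<Longrightarrow> \<bar>Qy p\<bar> \<le> L" using bounded_on_compact[OF compact_cbox cP(4)] by blast
  have in\<Omega>: "(x, y) \<in> \<Omega>" if "(x, y) \<in> R" for x y using that RC \<Omega>(3) by blast
  have DP: "((\<lambda>t. P (t, y)) has_real_derivative Px (x, y)) (at x)" if "(x, y) \<in> R" for x y
  proof -
    note s = has_grad_slice_x_real
    show ?thesis unfolding P_def Px_def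
      using s[OF gw(1)[OF in\<Omega>[OF that]]] s[OF gw(2)[OF in\<Omega>[OF that]]]
        s[OF g\<phi>(1)[OF in\<Omega>[OF that]]] s[OF g\<phi>(2)[OF in\<Omega>[OF that]]]
      by (auto intro!: derivative_eq_intros simp: algebra_simps)
  qed
  have DQ: "((\<lambda>t. Q (x, t)) has_real_derivative Qy (x, y)) (at y)" if "(x, y) \<in> R" for x y
  proof -
    note s = has_grad_slice_y_real
    show ?thesis unfolding Q_def Qy_def
      using s[OF gw(1)[OF in\<Omega>[OF that]]] s[OF gw(3)[OF in\<Omega>[OF that]]]
        s[OF g\<phi>(1)[OF in\<Omega>[OF that]]] s[OF g\<phi>(3)[OF in\<Omega>[OF that]]]
      by (auto intro!: derivative_eq_intros simp: algebra_simps)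
  qed
  have z: "P (a, y) = 0" "P (b, y) = 0" "Q (x, c) = 0" "Q (x, d) = 0" for x y
    unfolding P_def Q_def \<phi>_def by (simp_all add: box_bump_zero box_bump_grad_zero)
  have memR: "(x, y) \<in> R \<longleftrightarrow> y \<in> {c<..<d} \<and> a < x \<and> x < b"
    "(x, y) \<in> R \<longleftrightarrow> x \<in> {a<..<b} \<and> c < y \<and> y < d" for x y by (auto simp: R_def)
  have sl: "continuous_on {a..b} (\<lambda>x. P (x, y))" if "y \<in> {c<..<d}" for y
    by (rule continuous_on_compose2[OF cP(1)]) (use that in \<open>auto intro!: continuous_intros simp: cbox_Pair_eq\<close>)
  have sl': "continuous_on {c..d} (\<lambda>y. Q (x, y))" if "x \<in> {a<..<b}" for x
    by (rule continuous_on_compose2[OF cP(3)]) (use that in \<open>auto intro!: continuous_intros simp: cbox_Pair_eq\<close>)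
  have A: "set_integrable lebesgue R Px" "(LINT p:R|lebesgue. Px p) = 0"
    using slice_integral_x[OF R memR(1) less_imp_le[OF ab(1)] sl DP cRC[OF cP(2)], of K] K RC z
    by (auto simp: subset_iff)
  have B: "set_integrable lebesgue R Qy" "(LINT p:R|lebesgue. Qy p) = 0"
    using slice_integral_y[OF R memR(2) less_imp_le[OF ab(2)] sl' DQ cRC[OF cP(4)], of L] L RC z
    by (auto simp: subset_iff)
  have "(LINT p:R|lebesgue. Tric w p * \<phi> p) - (LINT p:R|lebesgue. w p * Tric \<phi> p)
      = (LINT p:R|lebesgue. Tric w p * \<phi> p - w p * Tric \<phi> p)"
    by (rule set_integral_diff(2)[OF i1 i2, symmetric])
  also have "\<dots> = (LINT p:R|lebesgue. Px p + Qy p)"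
    by (rule arg_cong[where f="set_lebesgue_integral lebesgue R"])
       (auto simp: fun_eq_iff Tric_def Px_def Qy_def algebra_simps)
  also have "\<dots> = 0" using set_integral_add(2)[OF A(1) B(1)] A(2) B(2) by simp
  finally show "(LINT p:R|lebesgue. Tric w p * \<phi> p) = (LINT p:R|lebesgue. w p * Tric \<phi> p)" by simp
qed

section \<open>Generalized solutions\<close>

lemma Ck_closure_imp_Ck_open:
  fixes f :: "real \<times> real \<Rightarrow> 'a::real_normed_vector"
  shows "Ck_closure k \<Omega> f \<Longrightarrow> Ck_open k \<Omega> f"
proof (induction k arbitrary: f)
  case 0
  then obtain F where F: "continuous_on (closure \<Omega>) F" "\<And>p. p \<in> \<Omega> \<Longrightarrow> F p = f p" by auto
  have "continuous_on \<Omega> F" using F(1) closure_subset by (rule continuous_on_subset)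
  then have "continuous_on \<Omega> f" by (rule continuous_on_eq) (rule F(2))
  then show ?case by simp
next
  case (Suc k)
  then show ?case by simp
qed

lemma Ck_closure_0_bounded:
  fixes f :: "real \<times> real \<Rightarrow> 'a::real_normed_vector"
  assumes "bounded \<Omega>" "Ck_closure 0 \<Omega> f"
  shows "\<exists>K>0. \<forall>p\<in>\<Omega>. norm (f p) \<le> K"
proof -
  obtain F where F: "continuous_on (closure \<Omega>) F" "\<And>p. p \<in> \<Omega> \<Longrightarrow> F p = f p" using assms(2) by auto
  have "compact (closure \<Omega>)" using assms(1) by (simp add: compact_closure)
  then have "bounded (F ` closure \<Omega>)"
    using compact_continuous_image[OF F(1)] compact_imp_bounded by blast
  then obtain K where "K > 0" "\<And>p. p \<in> closure \<Omega> \<Longrightarrow> norm (F p) \<le> K" unfolding bounded_pos by auto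
  then show ?thesis using F(2) closure_subset[of \<Omega>] by (intro exI[of _ K]) (metis subsetD)
qed

lemma Ck_closure_mono_0: "Ck_closure k \<Omega> f \<Longrightarrow> Ck_closure 0 \<Omega> f"
  by (cases k) auto

lemma C0_inf_regular:
  fixes f :: "real \<times> real \<Rightarrow> real"
  assumes "open \<Omega>" "bounded \<Omega>" "f \<in> C0_inf \<Omega> \<Gamma>"
  shows "Ck_open 2 \<Omega> f"
    and "\<exists>K>0. \<forall>p\<in>\<Omega>. \<bar>f p\<bar> \<le> K \<and> \<bar>dx f p\<bar> \<le> K \<and> \<bar>dy f p\<bar> \<le> K \<and> \<bar>Tric f p\<bar> \<le> K"
    and "\<And>p. p \<in> \<Omega> \<Longrightarrow> has_grad f (dx f p) (dy f p) p"
proof -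
  have C: "Ck_closure k \<Omega> f" for k using assms(3) by (simp add: C0_inf_def)
  show O: "Ck_open 2 \<Omega> f" using Ck_closure_imp_Ck_open[OF C] .
  show "has_grad f (dx f p) (dy f p) p" if "p \<in> \<Omega>" for p
    using Ck_open_2_has_grad(1)[OF assms(1) O that] .
  have C1: "Ck_closure 1 \<Omega> (dx f)" "Ck_closure 1 \<Omega> (dy f)" using C[of 2] by (simp_all add: numeral_2_eq_2)
  have C2: "Ck_closure 0 \<Omega> (dx (dx f))" "Ck_closure 0 \<Omega> (dy (dy f))"
    using C1 by simp_all+
  obtain K0 where K0: "K0 > 0" "\<And>p. p \<in> \<Omega> \<Longrightarrow> norm (f p) \<le> K0"
    using Ck_closure_0_bounded[OF assms(2) C[of 0]] by blast
  obtain K1 where K1: "K1 > 0" "\<And>p. p \<in> \<Omega> \<Longrightarrow> norm (dx f p) \<le> K1"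
    using Ck_closure_0_bounded[OF assms(2) Ck_closure_mono_0[OF C1(1)]] by blast
  obtain K2 where K2: "K2 > 0" "\<And>p. p \<in> \<Omega> \<Longrightarrow> norm (dy f p) \<le> K2"
    using Ck_closure_0_bounded[OF assms(2) Ck_closure_mono_0[OF C1(2)]] by blast
  obtain K3 where K3: "K3 > 0" "\<And>p. p \<in> \<Omega> \<Longrightarrow> norm (dx (dx f) p) \<le> K3"
    using Ck_closure_0_bounded[OF assms(2) C2(1)] by blast
  obtain K4 where K4: "K4 > 0" "\<And>p. p \<in> \<Omega> \<Longrightarrow> norm (dy (dy f) p) \<le> K4"
    using Ck_closure_0_bounded[OF assms(2) C2(2)] by blast
  obtain B where B: "B > 0" "\<And>p. p \<in> \<Omega> \<Longrightarrow> norm p \<le> B" using assms(2) unfolding bounded_pos by blast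
  have T: "\<bar>Tric f p\<bar> \<le> B * K3 + K4" if "p \<in> \<Omega>" for p
  proof -
    have "\<bar>snd p\<bar> \<le> B" using order_trans[OF norm_snd_le[of "snd p" "fst p"]] B(2)[OF that] by simp
    then have "\<bar>snd p * dx (dx f) p\<bar> \<le> B * K3"
      unfolding abs_mult using K3(2)[OF that] B(1) by (intro mult_mono) auto
    then show ?thesis using K4(2)[OF that] unfolding Tric_def real_norm_def by linarith
  qed
  have "B * K3 > 0" using B(1) K3(1) by simp
  show "\<exists>K>0. \<forall>p\<in>\<Omega>. \<bar>f p\<bar> \<le> K \<and> \<bar>dx f p\<bar> \<le> K \<and> \<bar>dy f p\<bar> \<le> K \<and> \<bar>Tric f p\<bar> \<le> K"
  proof (intro exI[of _ "K0 + K1 + K2 + (B * K3 + K4)"] conjI ballI)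
    fix p assume p: "p \<in> \<Omega>"
    show "\<bar>f p\<bar> \<le> K0 + K1 + K2 + (B * K3 + K4)" "\<bar>dx f p\<bar> \<le> K0 + K1 + K2 + (B * K3 + K4)"
      "\<bar>dy f p\<bar> \<le> K0 + K1 + K2 + (B * K3 + K4)" "\<bar>Tric f p\<bar> \<le> K0 + K1 + K2 + (B * K3 + K4)"
      using K0(2)[OF p] K1(2)[OF p] K2(2)[OF p] T[OF p] K0(1) K1(1) K2(1) K4(1) \<open>B * K3 > 0\<close>
      unfolding real_norm_def by linarith+
  qed (use K0(1) K1(1) K2(1) K4(1) \<open>B * K3 > 0\<close> in linarith)
qed

lemma integrable_bounded_continuous_on:
  fixes f :: "'a::euclidean_space \<Rightarrow> real"
  assumes "open S" "bounded S" "continuous_on S f" "\<And>x. x \<in> S \<Longrightarrow> \<bar>f x\<bar> \<le> K"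
  shows "integrable (lebesgue_on S) f"
  using set_integrable_lebesgue_of_lborel(1)[OF set_integrable_bounded_continuous[OF assms]]
    integrable_restrict_space[of S lebesgue f] assms(1)
  by (simp add: set_integrable_def)

lemma set_lebesgue_integral_restrict:
  fixes f :: "'a::euclidean_space \<Rightarrow> real"
  assumes "S \<in> sets lebesgue"
  shows "integral\<^sup>L (lebesgue_on S) f = (LINT x:S|lebesgue. f x)"
  using integral_restrict_space[of S lebesgue f] assms by (simp add: set_lebesgue_integral_def)

lemma measurable_bounded_continuous_on:
  fixes f :: "'a::euclidean_space \<Rightarrow> real"
  assumes "open S" "continuous_on S f"
  shows "f \<in> borel_measurable (lebesgue_on S)"
  using assms by (intro continuous_imp_measurable_on_sets_lebesgue) auto

text \<open>Young's inequality with a free weight \<open>k\<close>. Integrated over a set of finite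
  measure it plays the part of Cauchy-Schwarz, with \<open>k\<close> chosen afterwards.\<close>

lemma abs_le_square_weighted:
  fixes a k :: real
  assumes "k > 0"
  shows "\<bar>a\<bar> \<le> (k + a\<^sup>2 / k) / 2"
proof -
  have "0 \<le> (\<bar>a\<bar> - k)\<^sup>2 / k" using assms by simp
  also have "\<dots> = a\<^sup>2 / k - 2 * \<bar>a\<bar> + k"
    using assms by (simp add: power2_diff field_simps power2_eq_square)
  finally show ?thesis by simp
qed

lemma power2_abs_bound:
  fixes a K :: real
  assumes "\<bar>a\<bar> \<le> K"
  shows "a\<^sup>2 \<le> K\<^sup>2"
  using power_mono[OF assms, of 2] by simp

text \<open>These are the two consequences of convergence that are exploited later. The
  x-derivatives are left aside: their weight degenerates on the axis, whereas the y-derivatives are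
  controlled without weight.\<close>

lemma W1_conv_bounds:
  fixes u :: "real \<times> real \<Rightarrow> real"
  assumes \<Omega>: "open \<Omega>" "bounded \<Omega>" and f: "\<And>n. f n \<in> C0_inf \<Omega> \<Gamma>"
    and conv: "W1_conv \<Omega> f u v w"
  shows "(\<lambda>n. integral\<^sup>L (lebesgue_on \<Omega>) (\<lambda>p. (f n p - u p)\<^sup>2)) \<longlonglongrightarrow> 0"
    and "\<exists>B\<ge>0. \<forall>\<^sub>F n in sequentially. integral\<^sup>L (lebesgue_on \<Omega>) (\<lambda>p. (dy (f n) p)\<^sup>2) \<le> B"
proof -
  let ?M = "lebesgue_on \<Omega>"
  define I where "I n = (\<integral>\<^sup>+p. ennreal (\<bar>snd p\<bar> * (dx (f n) p - v p)\<^sup>2 + (dy (f n) p - w p)\<^sup>2 + (f n p - u p)\<^sup>2) \<partial>?M)" for n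
  have um[measurable]: "u \<in> borel_measurable ?M" and wm[measurable]: "w \<in> borel_measurable ?M"
    and I0: "I \<longlonglongrightarrow> 0"
    using conv by (simp_all add: W1_conv_def I_def[abs_def])
  note reg = C0_inf_regular[OF \<Omega> f]
  note cont = Ck_open_2_continuous[OF \<Omega>(1) reg(1)]
  have fm[measurable]: "f n \<in> borel_measurable ?M" "dy (f n) \<in> borel_measurable ?M" for n
    by (intro measurable_bounded_continuous_on \<Omega> cont)+
  have "(\<lambda>n. \<integral>\<^sup>+p. ennreal ((f n p - u p)\<^sup>2) \<partial>?M) \<longlonglongrightarrow> 0"
  proof (rule tendsto_sandwich[OF _ _ tendsto_const I0])
    show "\<forall>\<^sub>F n in sequentially. (\<integral>\<^sup>+p. ennreal ((f n p - u p)\<^sup>2) \<partial>?M) \<le> I n"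
      unfolding I_def by (intro always_eventually allI nn_integral_mono ennreal_leI) simp
  qed simp
  then have "(\<lambda>n. enn2real (\<integral>\<^sup>+p. ennreal ((f n p - u p)\<^sup>2) \<partial>?M)) \<longlonglongrightarrow> 0"
    using tendsto_enn2real[of _ 0] by simp
  then show "(\<lambda>n. integral\<^sup>L ?M (\<lambda>p. (f n p - u p)\<^sup>2)) \<longlonglongrightarrow> 0"
    by (simp add: integral_eq_nn_integral)
  have ev: "\<forall>\<^sub>F n in sequentially. I n < 1"
    using I0 by (rule order_tendstoD) simp
  \<comment> \<open>The limit \<open>w\<close> comes without a norm bound. One fixed index
    \<open>N\<close> supplies it: \<open>dy (f N)\<close> is bounded, and both
    \<open>dy (f n)\<close> and \<open>dy (f N)\<close> are close to \<open>w\<close>.\<close>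
  then obtain N where N: "I N < 1" by (auto simp: eventually_sequentially)
  obtain K where K: "\<And>p. p \<in> \<Omega> \<Longrightarrow> \<bar>dy (f N) p\<bar> \<le> K" "K > 0" using reg(2)[of N] by blast
  have intd: "integrable ?M (\<lambda>p. (dy (f N) p)\<^sup>2)"
    by (rule integrable_bounded_continuous_on[OF \<Omega>, of _ "K\<^sup>2"])
       (use K in \<open>auto intro!: continuous_intros cont power2_abs_bound simp del: abs_power2\<close>)
  define C where "C = integral\<^sup>L ?M (\<lambda>p. (dy (f N) p)\<^sup>2)"
  have C: "(\<integral>\<^sup>+p. ennreal ((dy (f N) p)\<^sup>2) \<partial>?M) = ennreal C" "C \<ge> 0"
    unfolding C_def using nn_integral_eq_integral[OF intd] by simp_all
  have sq: "ennreal (a\<^sup>2) \<le> 4 * ennreal ((a - b)\<^sup>2) + 4 * ennreal ((c - b)\<^sup>2) + 2 * ennreal (c\<^sup>2)" for a b c :: real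
  proof -
    \<comment> \<open>By the parallelogram identity for \<open>a - c = (a - b) - (c - b)\<close>,
      this sum of squares is exactly the right side minus the left side of the inequality that
      follows.\<close>
    have "0 \<le> ((a - b) + (c - b))\<^sup>2 * 2 + (a - 2 * c)\<^sup>2" by simp
    then have "a\<^sup>2 \<le> 4 * (a - b)\<^sup>2 + 4 * (c - b)\<^sup>2 + 2 * c\<^sup>2"
      by (simp add: power2_eq_square algebra_simps)
    then have "ennreal (a\<^sup>2) \<le> ennreal (4 * (a - b)\<^sup>2 + 4 * (c - b)\<^sup>2 + 2 * c\<^sup>2)" by (rule ennreal_leI)
    then show ?thesis by (simp add: ennreal_mult)
  qed
  have J: "(\<integral>\<^sup>+p. ennreal ((dy (f n) p - w p)\<^sup>2) \<partial>?M) \<le> I n" for n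
    unfolding I_def by (intro nn_integral_mono ennreal_leI) simp
  have "\<forall>\<^sub>F n in sequentially. integral\<^sup>L ?M (\<lambda>p. (dy (f n) p)\<^sup>2) \<le> 8 + 2 * C"
    using ev
  proof eventually_elim
    case (elim n)
    have "(\<integral>\<^sup>+p. ennreal ((dy (f n) p)\<^sup>2) \<partial>?M)
        \<le> (\<integral>\<^sup>+p. 4 * ennreal ((dy (f n) p - w p)\<^sup>2) + 4 * ennreal ((dy (f N) p - w p)\<^sup>2) + 2 * ennreal ((dy (f N) p)\<^sup>2) \<partial>?M)"
      by (intro nn_integral_mono sq)
    also have "\<dots> = 4 * (\<integral>\<^sup>+p. ennreal ((dy (f n) p - w p)\<^sup>2) \<partial>?M)
        + 4 * (\<integral>\<^sup>+p. ennreal ((dy (f N) p - w p)\<^sup>2) \<partial>?M) + 2 * ennreal C"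
      unfolding C(1)[symmetric] by (simp add: nn_integral_add nn_integral_cmult)
    also have "\<dots> \<le> 4 * 1 + 4 * 1 + 2 * ennreal C"
      using J[of n] J[of N] elim N by (intro add_mono mult_left_mono order_refl) auto
    also have "\<dots> = ennreal (8 + 2 * C)"
      using C(2) by (simp add: ennreal_plus ennreal_mult)
    finally show ?case
      using C(2) by (subst integral_eq_nn_integral) (auto intro!: enn2real_leI)
  qed
  then show "\<exists>B\<ge>0. \<forall>\<^sub>F n in sequentially. integral\<^sup>L ?M (\<lambda>p. (dy (f n) p)\<^sup>2) \<le> B"
    using C(2) by (intro exI[of _ "8 + 2 * C"]) auto
qed

section \<open>The dual norm and the pointwise equation\<close>

lemma integral_pos_open:
  fixes g :: "'a::euclidean_space \<Rightarrow> real"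
  assumes "open R" "R \<noteq> {}" "R \<subseteq> S" "S \<in> sets lebesgue" "integrable (lebesgue_on S) g"
    and "\<And>p. p \<in> S \<Longrightarrow> g p \<ge> 0" "\<And>p. p \<in> R \<Longrightarrow> g p > 0"
  shows "integral\<^sup>L (lebesgue_on S) g > 0"
proof (rule ccontr)
  assume neg: "\<not> integral\<^sup>L (lebesgue_on S) g > 0"
  have ae: "AE p in lebesgue_on S. 0 \<le> g p" using assms(6) by (intro AE_I2) simp
  have "integral\<^sup>L (lebesgue_on S) g = 0" using neg integral_nonneg_AE[OF ae] by linarith
  then have "AE p in lebesgue_on S. g p = 0"
    using integral_nonneg_eq_0_iff_AE[OF assms(5) ae] by simp
  then have "AE p in lebesgue. p \<in> S \<longrightarrow> g p = 0"
    using assms(4) by (simp add: AE_restrict_space_iff)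
  then have "AE p in lebesgue. p \<notin> R"
    by eventually_elim (use assms(3,7) in force)
  then have "negligible R"
    by (simp add: negligible_iff_null_sets AE_iff_null_sets[symmetric] assms(1))
  then show False using open_not_negligible[OF assms(1,2)] by contradiction
qed

text \<open>\<open>Wm1_norm\<close> is a supremum of reals and has its intended value only if the
  set is bounded above. The inequality 2|Fu| \<le> F^2 + u^2 gives such a bound, since jet norm 1
  makes the \<open>L2\<close> norm of \<open>u\<close> at most 1.\<close>

lemma Wm1_norm_bound:
  fixes F :: "real \<times> real \<Rightarrow> real"
  assumes \<Omega>: "open \<Omega>" "bounded \<Omega>"
    and F: "continuous_on \<Omega> F" "\<And>p. p \<in> \<Omega> \<Longrightarrow> \<bar>F p\<bar> \<le> K"
    and jet: "W1_jet \<Omega> \<Gamma> u v w" "jet_norm \<Omega> u v w = 1"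
  shows "\<bar>integral\<^sup>L (lebesgue_on \<Omega>) (\<lambda>p. F p * u p)\<bar> \<le> Wm1_norm \<Omega> \<Gamma> F"
proof -
  let ?M = "lebesgue_on \<Omega>"
  have iF: "integrable ?M (\<lambda>p. (F p)\<^sup>2)"
    by (rule integrable_bounded_continuous_on[OF \<Omega>, of _ "K\<^sup>2"])
       (use F in \<open>auto intro!: continuous_intros power2_abs_bound simp del: abs_power2\<close>)
  have bound: "\<bar>integral\<^sup>L ?M (\<lambda>p. F p * u' p)\<bar> \<le> (integral\<^sup>L ?M (\<lambda>p. (F p)\<^sup>2) + 1) / 2"
    if j: "W1_jet \<Omega> \<Gamma> u' v' w'" "jet_norm \<Omega> u' v' w' = 1" for u' v' w'
  proof -
    have m[measurable]: "u' \<in> borel_measurable ?M" "v' \<in> borel_measurable ?M" "w' \<in> borel_measurable ?M"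
      using j(1) unfolding W1_jet_def W1_conv_def by blast+
    have Fm[measurable]: "F \<in> borel_measurable ?M"
      by (rule measurable_bounded_continuous_on[OF \<Omega>(1) F(1)])
    have e1: "(\<integral>p. (\<bar>snd p\<bar> * (v' p)\<^sup>2 + (w' p)\<^sup>2 + (u' p)\<^sup>2) \<partial>?M) = 1"
      using j(2) by (simp add: jet_norm_def)
    \<comment> \<open>A function that is not integrable would have integral 0; the value 1 excludes
      this.\<close>
    then have i1: "integrable ?M (\<lambda>p. \<bar>snd p\<bar> * (v' p)\<^sup>2 + (w' p)\<^sup>2 + (u' p)\<^sup>2)"
      using not_integrable_integral_eq by fastforce
    have i2: "integrable ?M (\<lambda>p. (u' p)\<^sup>2)"
      by (rule Bochner_Integration.integrable_bound[OF i1]) auto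
    have le1: "integral\<^sup>L ?M (\<lambda>p. (u' p)\<^sup>2) \<le> 1"
      unfolding e1[symmetric] by (intro integral_mono i1 i2) simp
    have pt: "\<bar>F p * u' p\<bar> \<le> ((F p)\<^sup>2 + (u' p)\<^sup>2) / 2" for p
      using sum_squares_bound[of "\<bar>F p\<bar>" "\<bar>u' p\<bar>"] by (simp add: abs_mult)
    have i3: "integrable ?M (\<lambda>p. ((F p)\<^sup>2 + (u' p)\<^sup>2) / 2)" using iF i2 by simp
    have "\<bar>integral\<^sup>L ?M (\<lambda>p. F p * u' p)\<bar> \<le> integral\<^sup>L ?M (\<lambda>p. \<bar>F p * u' p\<bar>)"
      by (rule integral_abs_bound)
    also have "\<dots> \<le> integral\<^sup>L ?M (\<lambda>p. ((F p)\<^sup>2 + (u' p)\<^sup>2) / 2)"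
      by (rule integral_mono[OF Bochner_Integration.integrable_bound[OF i3] i3 pt])
         (use pt in auto)
    also have "\<dots> = (integral\<^sup>L ?M (\<lambda>p. (F p)\<^sup>2) + integral\<^sup>L ?M (\<lambda>p. (u' p)\<^sup>2)) / 2"
      using iF i2 by simp
    finally show ?thesis using le1 by simp
  qed
  show ?thesis unfolding Wm1_norm_def
  proof (rule cSup_upper)
    show "bdd_above {\<bar>\<integral>p. F p * u p \<partial>?M\<bar> |u v w. W1_jet \<Omega> \<Gamma> u v w \<and> jet_norm \<Omega> u v w = 1}"
      using bound by (intro bdd_aboveI) blast
  qed (use jet in blast)
qed

lemma C0_inf_scale:
  fixes \<phi> :: "real \<times> real \<Rightarrow> real"
  assumes "\<phi> \<in> test_alg" "\<phi> \<in> C0_inf \<Omega> \<Gamma>"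
  shows "(\<lambda>p. c * \<phi> p) \<in> C0_inf \<Omega> \<Gamma>"
proof -
  have "(\<lambda>p. c * \<phi> p) \<in> test_alg" by (rule test_mult[OF test_const assms(1)])
  then have "\<forall>k. Ck_closure k \<Omega> (\<lambda>p. c * \<phi> p)" using test_alg_Ck_closure by blast
  moreover obtain U where "open U" "\<Gamma> \<subseteq> U" "\<forall>p\<in>U \<inter> \<Omega>. \<phi> p = 0"
    using assms(2) unfolding C0_inf_def by blast
  then have "\<exists>U. open U \<and> \<Gamma> \<subseteq> U \<and> (\<forall>p\<in>U \<inter> \<Omega>. c * \<phi> p = 0)"
    by (intro exI[of _ U]) simp
  ultimately show ?thesis unfolding C0_inf_def by simp
qed

lemma test_alg_bounded_jet:
  assumes "bounded \<Omega>" "\<phi> \<in> test_alg"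
  shows "\<exists>K. \<forall>p\<in>\<Omega>. \<bar>\<bar>snd p\<bar> * (dx \<phi> p)\<^sup>2 + (dy \<phi> p)\<^sup>2 + (\<phi> p)\<^sup>2\<bar> \<le> K"
    and "continuous_on \<Omega> (\<lambda>p. \<bar>snd p\<bar> * (dx \<phi> p)\<^sup>2 + (dy \<phi> p)\<^sup>2 + (\<phi> p)\<^sup>2)"
proof -
  have c: "continuous_on S (\<lambda>p. \<bar>snd p\<bar> * (dx \<phi> p)\<^sup>2 + (dy \<phi> p)\<^sup>2 + (\<phi> p)\<^sup>2)" for S
    by (intro continuous_intros test_alg_continuous[OF assms(2)]
        test_alg_continuous[OF test_alg_dx_dy(1)[OF assms(2)]]
        test_alg_continuous[OF test_alg_dx_dy(2)[OF assms(2)]])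
  then show "continuous_on \<Omega> (\<lambda>p. \<bar>snd p\<bar> * (dx \<phi> p)\<^sup>2 + (dy \<phi> p)\<^sup>2 + (\<phi> p)\<^sup>2)" .
  have "compact (closure \<Omega>)" using assms(1) by simp
  then show "\<exists>K. \<forall>p\<in>\<Omega>. \<bar>\<bar>snd p\<bar> * (dx \<phi> p)\<^sup>2 + (dy \<phi> p)\<^sup>2 + (\<phi> p)\<^sup>2\<bar> \<le> K"
    using bounded_on_compact[OF _ c, of "closure \<Omega>"] closure_subset[of \<Omega>] by (meson subsetD)
qed

text \<open>Divided by its own jet norm, the test function becomes a competitor in the supremum. The
  constant is that norm, chosen before \<open>F\<close>, so one constant serves a whole sequence;
  positivity on \<open>R\<close> keeps it away from 0.\<close>

lemma Wm1_norm_test_bound: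
  fixes \<phi> :: "real \<times> real \<Rightarrow> real"
  assumes \<Omega>: "open \<Omega>" "bounded \<Omega>"
    and R: "open R" "R \<noteq> {}" "R \<subseteq> \<Omega>" "\<And>p. p \<in> R \<Longrightarrow> \<phi> p > 0"
    and \<phi>: "\<phi> \<in> test_alg" "\<phi> \<in> C0_inf \<Omega> \<Gamma>"
  shows "\<exists>c>0. \<forall>F K. continuous_on \<Omega> F \<longrightarrow> (\<forall>p\<in>\<Omega>. \<bar>F p\<bar> \<le> K) \<longrightarrow>
    \<bar>integral\<^sup>L (lebesgue_on \<Omega>) (\<lambda>p. F p * \<phi> p)\<bar> \<le> c * Wm1_norm \<Omega> \<Gamma> F"
proof -
  let ?M = "lebesgue_on \<Omega>"
  define J where "J = integral\<^sup>L ?M (\<lambda>p. \<bar>snd p\<bar> * (dx \<phi> p)\<^sup>2 + (dy \<phi> p)\<^sup>2 + (\<phi> p)\<^sup>2)"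
  obtain K where K: "\<And>p. p \<in> \<Omega> \<Longrightarrow> \<bar>\<bar>snd p\<bar> * (dx \<phi> p)\<^sup>2 + (dy \<phi> p)\<^sup>2 + (\<phi> p)\<^sup>2\<bar> \<le> K"
    using test_alg_bounded_jet(1)[OF \<Omega>(2) \<phi>(1)] by blast
  have int: "integrable ?M (\<lambda>p. \<bar>snd p\<bar> * (dx \<phi> p)\<^sup>2 + (dy \<phi> p)\<^sup>2 + (\<phi> p)\<^sup>2)"
    by (rule integrable_bounded_continuous_on[OF \<Omega> test_alg_bounded_jet(2)[OF \<Omega>(2) \<phi>(1)] K])
  have J: "J > 0" unfolding J_def
  proof (rule integral_pos_open[OF R(1,2,3) _ int])
    show "0 < \<bar>snd p\<bar> * (dx \<phi> p)\<^sup>2 + (dy \<phi> p)\<^sup>2 + (\<phi> p)\<^sup>2" if "p \<in> R" for p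
      using R(4)[OF that] by (intro add_nonneg_pos) auto
  qed (use \<Omega> in auto)
  define c where "c = sqrt J"
  have c: "c > 0" "c\<^sup>2 = J" using J by (simp_all add: c_def)
  define \<psi> where "\<psi> = (\<lambda>p. (1 / c) * \<phi> p)"
  have g: "has_grad \<psi> (1 / c * dx \<phi> p) (1 / c * dy \<phi> p) p" for p
    using has_grad_mult[OF has_grad_const[of "1 / c"] test_alg_dx_dy(3)[OF \<phi>(1)], of p]
    unfolding \<psi>_def by simp
  have d: "dx \<psi> = (\<lambda>p. 1 / c * dx \<phi> p)" "dy \<psi> = (\<lambda>p. 1 / c * dy \<phi> p)"
    by (intro ext has_grad_unique[OF g])+
  have \<psi>T: "\<psi> \<in> test_alg" unfolding \<psi>_def by (rule test_mult[OF test_const \<phi>(1)])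
  have m: "\<psi> \<in> borel_measurable ?M" "dx \<psi> \<in> borel_measurable ?M" "dy \<psi> \<in> borel_measurable ?M"
    using measurable_bounded_continuous_on[OF \<Omega>(1) test_alg_continuous] \<psi>T test_alg_dx_dy(1,2)[OF \<psi>T]
    by blast+
  have "W1_conv \<Omega> (\<lambda>n. \<psi>) \<psi> (dx \<psi>) (dy \<psi>)" unfolding W1_conv_def using m by simp
  moreover have "\<psi> \<in> C0_inf \<Omega> \<Gamma>" unfolding \<psi>_def using \<phi> by (rule C0_inf_scale)
  ultimately have jet: "W1_jet \<Omega> \<Gamma> \<psi> (dx \<psi>) (dy \<psi>)"
    unfolding W1_jet_def by (intro exI[of _ "\<lambda>n. \<psi>"]) simp
  have "integral\<^sup>L ?M (\<lambda>p. \<bar>snd p\<bar> * (dx \<psi> p)\<^sup>2 + (dy \<psi> p)\<^sup>2 + (\<psi> p)\<^sup>2)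
      = integral\<^sup>L ?M (\<lambda>p. (1 / c)\<^sup>2 * (\<bar>snd p\<bar> * (dx \<phi> p)\<^sup>2 + (dy \<phi> p)\<^sup>2 + (\<phi> p)\<^sup>2))"
    unfolding d unfolding \<psi>_def
    by (rule Bochner_Integration.integral_cong) (simp_all add: power_mult_distrib power_divide algebra_simps)
  also have "\<dots> = (1 / c)\<^sup>2 * J" unfolding J_def by (rule integral_mult_right_zero)
  also have "\<dots> = 1" using c by (simp add: power_divide c(2)[symmetric])
  finally have nrm: "jet_norm \<Omega> \<psi> (dx \<psi>) (dy \<psi>) = 1" unfolding jet_norm_def by simp
  show ?thesis
  proof (intro exI[of _ c] conjI allI impI c(1))
    fix F :: "real \<times> real \<Rightarrow> real" and K assume F': "continuous_on \<Omega> F" "\<forall>p\<in>\<Omega>. \<bar>F p\<bar> \<le> K"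
    then have F: "continuous_on \<Omega> F" "\<And>p. p \<in> \<Omega> \<Longrightarrow> \<bar>F p\<bar> \<le> K" by auto
    have "integral\<^sup>L ?M (\<lambda>p. F p * \<phi> p) = integral\<^sup>L ?M (\<lambda>p. c * (F p * \<psi> p))"
      unfolding \<psi>_def using c(1) by (intro Bochner_Integration.integral_cong) auto
    also have "\<dots> = c * integral\<^sup>L ?M (\<lambda>p. F p * \<psi> p)" by (rule integral_mult_right_zero)
    finally show "\<bar>integral\<^sup>L ?M (\<lambda>p. F p * \<phi> p)\<bar> \<le> c * Wm1_norm \<Omega> \<Gamma> F"
      using Wm1_norm_bound[OF \<Omega> F jet nrm] c(1) by (simp add: abs_mult)
  qed
qed

text \<open>If \<open>h = Tric u - lam * u\<close> is nonzero at \<open>p\<close>, it keeps its sign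
  on a small box, and its pairing \<open>X\<close> with a bump there is nonzero. By Green's formula,
  \<open>X\<close> is the pairing of \<open>Tric (f n) - lam * u\<close> with the bump plus that of
  \<open>u - f n\<close> with \<open>Tric \<phi>\<close>. The former tends to 0 in the dual norm,
  the latter by convergence in \<open>L2\<close>. The bump vanishes near \<open>BC\<close> and the
  arc, hence is admissible for the dual norm.\<close>

lemma gen_solution_pointwise:
  fixes u :: "real \<times> real \<Rightarrow> real"
  assumes \<Omega>: "open \<Omega>" "bounded \<Omega>" "(BC x0 \<union> sigma_arc \<alpha> \<beta> x0) \<inter> \<Omega> = {}"
    and sol: "gen_solution_real \<Omega> \<alpha> \<beta> x0 u (\<lambda>p. lam * u p)"
    and u: "Ck_open 2 \<Omega> u" "\<And>p. p \<in> \<Omega> \<Longrightarrow> \<bar>u p\<bar> \<le> K"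
    and p: "p \<in> \<Omega>"
  shows "Tric u p = lam * u p"
proof (rule ccontr)
  assume ne: "Tric u p \<noteq> lam * u p"
  let ?M = "lebesgue_on \<Omega>" and ?\<Gamma> = "BC x0 \<union> sigma_arc \<alpha> \<beta> x0"
  obtain f v w where f: "\<And>n. f n \<in> C0_inf \<Omega> (AC x0 \<union> sigma_arc \<alpha> \<beta> x0)" and conv: "W1_conv \<Omega> f u v w"
    and Wm: "(\<lambda>n. Wm1_norm \<Omega> ?\<Gamma> (\<lambda>p. Tric (f n) p - lam * u p)) \<longlonglongrightarrow> 0"
    using sol unfolding gen_solution_real_def by blast
  note reg = C0_inf_regular[OF \<Omega>(1,2) f]
  note cu = Ck_open_2_continuous[OF \<Omega>(1) u(1)]
  define h where "h = (\<lambda>q. Tric u q - lam * u q)"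
  define s where "s = sgn (h p)"
  have ch: "continuous_on \<Omega> h" unfolding h_def Tric_def by (intro continuous_intros cu)
  have sh: "s * h p > 0" using ne by (auto simp: s_def h_def sgn_if)
  define V where "V = \<Omega> \<inter> (\<lambda>q. s * h q) -` {0<..}"
  have V: "open V" "p \<in> V"
    unfolding V_def using p sh
    by (auto intro!: continuous_open_preimage \<Omega>(1) continuous_intros ch)
  obtain A B where AB: "cbox A B \<subseteq> V" "p \<in> box A B"
    by (rule open_contains_cbox[OF V])
  obtain a c b d where A: "A = (a, c)" and B: "B = (b, d)" by (cases A, cases B) auto
  define R where "R = {a<..<b} \<times> {c<..<d}"
  define \<phi> where "\<phi> = box_bump a b c d"
  have Rbox: "R = box A B" unfolding R_def A B by (auto simp: mem_box Basis_prod_def)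
  have pR: "p \<in> R" using AB(2) Rbox by simp
  have ab: "a < b" "c < d" using pR by (auto simp: R_def)
  have cb: "cbox (a, c) (b, d) \<subseteq> \<Omega>" using AB(1) unfolding A B V_def by blast
  have RV: "R \<subseteq> V" using AB(1) box_subset_cbox[of A B] Rbox by blast
  have R: "open R" "R \<noteq> {}" "R \<subseteq> \<Omega>"
    using pR RV by (auto simp: R_def V_def intro!: open_Times)
  have Rm: "R \<in> sets lebesgue" "\<Omega> \<in> sets lebesgue" using R(1) \<Omega>(1) by auto
  have \<phi>pos: "\<phi> q > 0" if "q \<in> R" for q
    using that unfolding R_def \<phi>_def by (cases q) (auto intro: box_bump_pos)
  have \<phi>0: "\<phi> q = 0" if "q \<notin> R" for q
    using that unfolding R_def \<phi>_def by (cases q) (auto intro: box_bump_zero)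
  have \<phi>T: "\<phi> \<in> test_alg" unfolding \<phi>_def by (rule box_bump_test_alg)
  have \<phi>C: "\<phi> \<in> C0_inf \<Omega> ?\<Gamma>" unfolding \<phi>_def by (rule box_bump_C0_inf[OF cb \<Omega>(3)])
  have restrict: "integral\<^sup>L ?M (\<lambda>q. g q * \<phi> q) = (LINT q:R|lebesgue. g q * \<phi> q)" for g
    unfolding set_lebesgue_integral_restrict[OF Rm(2)] set_lebesgue_integral_def
    by (rule Bochner_Integration.integral_cong) (use R(3) \<phi>0 in \<open>auto simp: indicator_def\<close>)
  obtain c' where c': "c' > 0" "\<forall>F K. continuous_on \<Omega> F \<longrightarrow>
      (\<forall>p\<in>\<Omega>. \<bar>F p\<bar> \<le> K) \<longrightarrow> \<bar>integral\<^sup>L ?M (\<lambda>p. F p * \<phi> p)\<bar> \<le> c' * Wm1_norm \<Omega> ?\<Gamma> F"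
    using Wm1_norm_test_bound[OF \<Omega>(1,2) R \<phi>pos \<phi>T \<phi>C] by blast
  note green_u = green_box_bump[OF \<Omega>(1) u(1) cb ab, folded \<phi>_def R_def]
  note green_f = green_box_bump[OF \<Omega>(1) reg(1) cb ab, folded \<phi>_def R_def]
  have ctp: "continuous_on S (Tric \<phi>)" for S
    unfolding Tric_def
    by (intro continuous_intros test_alg_continuous[OF test_alg_dx_dy(1)[OF test_alg_dx_dy(1)[OF \<phi>T]]]
        test_alg_continuous[OF test_alg_dx_dy(2)[OF test_alg_dx_dy(2)[OF \<phi>T]]])
  obtain M where M: "M > 0" "\<And>q. q \<in> closure \<Omega> \<Longrightarrow> \<bar>Tric \<phi> q\<bar> \<le> M"
    using bounded_on_compact[OF _ ctp, of "closure \<Omega>"] \<Omega>(2) by auto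
  define E where "E n = integral\<^sup>L ?M (\<lambda>q. (f n q - u q)\<^sup>2)" for n
  have E0: "E \<longlonglongrightarrow> 0" unfolding E_def[abs_def] by (rule W1_conv_bounds(1)[OF \<Omega>(1,2) f conv])
  define m where "m = measure lebesgue \<Omega>"
  define X where "X = (LINT q:R|lebesgue. h q * \<phi> q)"
  have iu: "set_integrable lebesgue R (\<lambda>q. lam * u q * \<phi> q)"
    unfolding R_def
    by (intro set_integrable_open_box continuous_intros continuous_on_subset[OF cu(1) cb] test_alg_continuous[OF \<phi>T])
  \<comment> \<open>The weight \<open>k\<close> is the one of \<open>abs_le_square_weighted\<close>:
    for fixed \<open>k\<close> the limit in \<open>n\<close> removes the dual norm and
    \<open>E n\<close>, and letting \<open>k\<close> tend to 0 removes the remaining multiple of the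
    measure \<open>m\<close>.\<close>
  have est: "\<bar>X\<bar> \<le> c' * Wm1_norm \<Omega> ?\<Gamma> (\<lambda>p. Tric (f n) p - lam * u p) + M * ((k * m + E n / k) / 2)"
    if k: "k > 0" for n k
  proof -
    obtain Kf where Kf: "Kf > 0" "\<And>q. q \<in> \<Omega> \<Longrightarrow> \<bar>f n q\<bar> \<le> Kf \<and> \<bar>Tric (f n) q\<bar> \<le> Kf" using reg(2)[of n] by blast
    note cf = Ck_open_2_continuous[OF \<Omega>(1) reg(1)[of n]]
    have 1: "\<bar>LINT q:R|lebesgue. (Tric (f n) q - lam * u q) * \<phi> q\<bar>
        \<le> c' * Wm1_norm \<Omega> ?\<Gamma> (\<lambda>p. Tric (f n) p - lam * u p)"
      unfolding restrict[symmetric]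
    proof (rule c'(2)[rule_format, where K="Kf + \<bar>lam\<bar> * K"])
      show "continuous_on \<Omega> (\<lambda>p. Tric (f n) p - lam * u p)"
        unfolding Tric_def by (intro continuous_intros cu cf)
      show "\<bar>Tric (f n) q - lam * u q\<bar> \<le> Kf + \<bar>lam\<bar> * K" if "q \<in> \<Omega>" for q
      proof -
        have "\<bar>lam * u q\<bar> \<le> \<bar>lam\<bar> * K" unfolding abs_mult by (intro mult_left_mono u(2) that) simp
        then show ?thesis using Kf(2)[OF that] by linarith
      qed
    qed
    have 2: "X - (LINT q:R|lebesgue. (Tric (f n) q - lam * u q) * \<phi> q)
        = (LINT q:R|lebesgue. (u q - f n q) * Tric \<phi> q)"
    proof -
      have "X = (LINT q:R|lebesgue. Tric u q * \<phi> q) - (LINT q:R|lebesgue. lam * u q * \<phi> q)"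
        unfolding X_def h_def left_diff_distrib by (rule set_integral_diff(2)[OF green_u(1) iu])
      moreover have "(LINT q:R|lebesgue. (Tric (f n) q - lam * u q) * \<phi> q)
        = (LINT q:R|lebesgue. Tric (f n) q * \<phi> q) - (LINT q:R|lebesgue. lam * u q * \<phi> q)"
        unfolding left_diff_distrib by (rule set_integral_diff(2)[OF green_f(1) iu])
      moreover have "(LINT q:R|lebesgue. (u q - f n q) * Tric \<phi> q)
        = (LINT q:R|lebesgue. u q * Tric \<phi> q) - (LINT q:R|lebesgue. f n q * Tric \<phi> q)"
        unfolding left_diff_distrib by (rule set_integral_diff(2)[OF green_u(2) green_f(2)])
      ultimately show ?thesis using green_u(3) green_f(3) by simp
    qed
    have cuf: "continuous_on \<Omega> (\<lambda>q. u q - f n q)" by (intro continuous_intros cu cf)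
    have buf: "\<bar>u q - f n q\<bar> \<le> K + Kf" if "q \<in> \<Omega>" for q using u(2)[OF that] Kf(2)[OF that] by linarith
    have i1: "integrable ?M (\<lambda>q. (f n q - u q)\<^sup>2)"
      by (rule integrable_bounded_continuous_on[OF \<Omega>(1,2), of _ "(K + Kf)\<^sup>2"])
         (use buf in \<open>auto intro!: continuous_intros cu cf power2_abs_bound simp: abs_minus_commute simp del: abs_power2\<close>)
    have "\<bar>LINT q:R|lebesgue. (u q - f n q) * Tric \<phi> q\<bar> \<le> (\<integral>q. \<bar>indicator R q * ((u q - f n q) * Tric \<phi> q)\<bar> \<partial>lebesgue)"
      unfolding set_lebesgue_integral_def real_scaleR_def by (rule integral_abs_bound)
    also have "\<dots> = integral\<^sup>L ?M (\<lambda>q. indicator R q * \<bar>(u q - f n q) * Tric \<phi> q\<bar>)"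
      unfolding set_lebesgue_integral_restrict[OF Rm(2)] set_lebesgue_integral_def
      by (rule Bochner_Integration.integral_cong) (use R(3) in \<open>auto simp: indicator_def\<close>)
    also have "\<dots> \<le> integral\<^sup>L ?M (\<lambda>q. M * ((k + (f n q - u q)\<^sup>2 / k) / 2))"
    proof (rule integral_mono)
      show ii: "integrable ?M (\<lambda>q. M * ((k + (f n q - u q)\<^sup>2 / k) / 2))"
        using i1 integrable_bounded_continuous_on[OF \<Omega>(1,2), of "\<lambda>_. k" "\<bar>k\<bar>"] by simp
      show pt: "indicator R q * \<bar>(u q - f n q) * Tric \<phi> q\<bar> \<le> M * ((k + (f n q - u q)\<^sup>2 / k) / 2)" if "q \<in> space ?M" for q
      proof -
        have "q \<in> \<Omega>" using that by simp
        then have "\<bar>Tric \<phi> q\<bar> \<le> M" using M(2) closure_subset by blast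
        moreover have "\<bar>u q - f n q\<bar> \<le> (k + (f n q - u q)\<^sup>2 / k) / 2"
          using abs_le_square_weighted[OF k, of "f n q - u q"] by (simp add: abs_minus_commute)
        ultimately have "\<bar>(u q - f n q) * Tric \<phi> q\<bar> \<le> M * ((k + (f n q - u q)\<^sup>2 / k) / 2)"
          unfolding abs_mult using M(1) by (subst mult.commute) (intro mult_mono; simp)
        moreover have "0 \<le> M * ((k + (f n q - u q)\<^sup>2 / k) / 2)" using M(1) k by simp
        ultimately show ?thesis by (cases "q \<in> R") simp_all
      qed
      show "integrable ?M (\<lambda>q. indicator R q * \<bar>(u q - f n q) * Tric \<phi> q\<bar>)"
      proof (rule Bochner_Integration.integrable_bound[OF ii])
        have [measurable]: "(\<lambda>q. (u q - f n q) * Tric \<phi> q) \<in> borel_measurable ?M"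
          by (intro measurable_bounded_continuous_on[OF \<Omega>(1)] continuous_intros cuf ctp)
        have [measurable]: "R \<in> sets ?M" using R(3) Rm by (simp add: sets_restrict_space_iff)
        show "(\<lambda>q. indicator R q * \<bar>(u q - f n q) * Tric \<phi> q\<bar>) \<in> borel_measurable ?M" by measurable
        show "AE q in ?M. norm (indicator R q * \<bar>(u q - f n q) * Tric \<phi> q\<bar>) \<le> norm (M * ((k + (f n q - u q)\<^sup>2 / k) / 2))"
        proof (rule AE_I2)
          fix q assume q: "q \<in> space ?M"
          have "norm (indicator R q * \<bar>(u q - f n q) * Tric \<phi> q\<bar>) = indicator R q * \<bar>(u q - f n q) * Tric \<phi> q\<bar>"
            by (simp add: indicator_def)
          then show "norm (indicator R q * \<bar>(u q - f n q) * Tric \<phi> q\<bar>) \<le> norm (M * ((k + (f n q - u q)\<^sup>2 / k) / 2))"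
            using pt[OF q] unfolding real_norm_def by linarith
        qed
      qed
    qed
    also have "\<dots> = M * ((k * m + E n / k) / 2)"
      using i1 integrable_bounded_continuous_on[OF \<Omega>(1,2), of "\<lambda>_. k" "\<bar>k\<bar>"]
      by (simp add: m_def E_def measure_restrict_space Rm mult.commute)
    finally show ?thesis using 1 2 by linarith
  qed
  have "\<bar>X\<bar> \<le> M * (k * m / 2)" if k: "k > 0" for k
  proof (rule tendsto_lowerbound[of _ _ sequentially])
    have "(\<lambda>n. c' * Wm1_norm \<Omega> ?\<Gamma> (\<lambda>p. Tric (f n) p - lam * u p) + (M * (k * m / 2) + M / (2 * k) * E n))
        \<longlonglongrightarrow> c' * 0 + (M * (k * m / 2) + M / (2 * k) * 0)"
      by (intro tendsto_add tendsto_mult tendsto_const Wm E0)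
    moreover have "M * (k * m / 2) + M / (2 * k) * E n = M * ((k * m + E n / k) / 2)" for n
      using k by (simp add: field_simps)
    ultimately show "(\<lambda>n. c' * Wm1_norm \<Omega> ?\<Gamma> (\<lambda>p. Tric (f n) p - lam * u p) + M * ((k * m + E n / k) / 2))
        \<longlonglongrightarrow> M * (k * m / 2)"
      by (simp only: mult_zero_right add_0_left add_0_right)
  qed (use est[OF k] in auto)
  then have "X = 0"
  proof -
    assume le: "\<And>k. 0 < k \<Longrightarrow> \<bar>X\<bar> \<le> M * (k * m / 2)"
    have "((\<lambda>k. M * (k * m / 2)) \<longlongrightarrow> M * (0 * m / 2)) (at_right 0)" by (intro tendsto_intros) simp
    then have "\<bar>X\<bar> \<le> M * (0 * m / 2)"
      by (rule tendsto_lowerbound) (use le in \<open>auto simp: eventually_at_right_less intro!: eventually_mono[OF eventually_at_right_less]\<close>)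
    then show ?thesis by simp
  qed
  have ih: "integrable ?M (\<lambda>q. s * h q * \<phi> q)"
  proof -
    have "set_integrable lebesgue R (\<lambda>q. s * (Tric u q * \<phi> q - lam * u q * \<phi> q))"
      by (intro set_integrable_mult_right set_integral_diff(1) green_u(1) iu)
    then have "integrable lebesgue (\<lambda>q. indicator \<Omega> q *\<^sub>R (s * h q * \<phi> q))"
      unfolding set_integrable_def
      by (rule Bochner_Integration.integrable_cong[THEN iffD1, OF refl, rotated])
         (use R(3) \<phi>0 in \<open>auto simp: indicator_def h_def algebra_simps\<close>)
    then show ?thesis using integrable_restrict_space[of \<Omega> lebesgue "\<lambda>q. s * h q * \<phi> q"] Rm by simp
  qed
  have "integral\<^sup>L ?M (\<lambda>q. s * h q * \<phi> q) > 0"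
  proof (rule integral_pos_open[OF R Rm(2) ih])
    show pos: "0 < s * h q * \<phi> q" if "q \<in> R" for q
      using RV that \<phi>pos[OF that] by (auto simp: V_def)
    show "0 \<le> s * h q * \<phi> q" for q
      using pos[of q] \<phi>0[of q] by (cases "q \<in> R") simp_all
  qed
  moreover have "integral\<^sup>L ?M (\<lambda>q. s * h q * \<phi> q) = s * X"
    unfolding restrict X_def by (simp add: mult.assoc)
  ultimately show False using \<open>X = 0\<close> by simp
qed

text \<open>On strips of width \<open>\<delta>\<close> on which every \<open>f n\<close> vanishes somewhere, the square integrals of \<open>f n\<close> are of
  order \<open>\<delta>\<^sup>2\<close> uniformly in \<open>n\<close>, whereas that of the limit would be at least of order \<open>\<delta>\<close>.\<close>

lemma strip_trace_contradiction:
  fixes u :: "real \<times> real \<Rightarrow> real" and l r :: "real \<Rightarrow> real \<Rightarrow> real"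
  assumes \<Omega>: "open \<Omega>" "bounded \<Omega>"
    and f: "\<And>n. f n \<in> C0_inf \<Omega> \<Gamma>" and conv: "W1_conv \<Omega> f u v w"
    and u: "continuous_on \<Omega> u" "\<And>p. p \<in> \<Omega> \<Longrightarrow> \<bar>u p\<bar> \<le> K"
    and ab: "a < b" and c: "c > 0" and d0: "\<delta>0 > 0"
    and S: "\<And>\<delta>. 0 < \<delta> \<Longrightarrow> \<delta> < \<delta>0 \<Longrightarrow> open (S \<delta>) \<and> S \<delta> \<subseteq> \<Omega> \<and> (\<forall>p\<in>S \<delta>. c \<le> \<bar>u p\<bar>)"
    and Sm: "\<And>\<delta> x y. (x, y) \<in> S \<delta> \<longleftrightarrow> x \<in> {a<..<b} \<and> l \<delta> x < y \<and> y < r \<delta> x"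
    and len: "\<And>\<delta> x. r \<delta> x - l \<delta> x = \<delta>"
    and zero: "\<And>n \<delta> x. 0 < \<delta> \<Longrightarrow> \<delta> < \<delta>0 \<Longrightarrow> x \<in> {a<..<b} \<Longrightarrow> \<exists>y. (x, y) \<in> S \<delta> \<and> f n (x, y) = 0"
  shows False
proof -
  let ?M = "lebesgue_on \<Omega>"
  have \<Omega>m: "\<Omega> \<in> sets lebesgue" using \<Omega>(1) by auto
  note reg = C0_inf_regular[OF \<Omega> f]
  define E where "E n = integral\<^sup>L ?M (\<lambda>q. (f n q - u q)\<^sup>2)" for n
  have E0: "E \<longlonglongrightarrow> 0" unfolding E_def[abs_def] by (rule W1_conv_bounds(1)[OF \<Omega> f conv])
  obtain B where B: "B \<ge> 0" "\<forall>\<^sub>F n in sequentially. integral\<^sup>L ?M (\<lambda>p. (dy (f n) p)\<^sup>2) \<le> B"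
    using W1_conv_bounds(2)[OF \<Omega> f conv] by blast
  define m where "m = b - a"
  have m: "m > 0" using ab by (simp add: m_def)
  have main: "c * m / 2 \<le> (k * m * \<delta> + B / k) / 2" if d: "0 < \<delta>" "\<delta> < \<delta>0" and k: "k > 0" for \<delta> k
  proof -
    let ?S = "S \<delta>"
    have So: "open ?S" and S\<Omega>: "?S \<subseteq> \<Omega>" and Sc: "\<And>p. p \<in> ?S \<Longrightarrow> c \<le> \<bar>u p\<bar>" using S[OF d] by auto
    have Sb: "bounded ?S" using \<Omega>(2) S\<Omega> by (rule bounded_subset)
    have Smm: "?S \<in> sets lebesgue" using So by auto
    have sl: "l \<delta> x \<le> r \<delta> x" for x using len[of \<delta> x] d by linarith
    have one: "(LINT p:?S|lebesgue. 1) = m * \<delta>"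
    proof -
      have "(LINT p:?S|lebesgue. 1) = (LINT x:{a<..<b}|lebesgue. snd (x, r \<delta> x) - snd (x, l \<delta> x))"
        by (rule slice_integral_y(3)[OF So Sb Sm sl, where Q=snd and Qy="\<lambda>p. 1" and K=1])
           (auto intro!: continuous_intros derivative_eq_intros)
      also have "\<dots> = m * \<delta>" using ab by (simp add: len set_lebesgue_integral_def m_def)
      finally show ?thesis .
    qed
    have int_c: "set_integrable lebesgue ?S (\<lambda>_. t)" for t :: real
      by (rule set_integrable_lebesgue_of_lborel(1)[OF set_integrable_bounded_continuous[OF So Sb, of _ "\<bar>t\<bar>"]]) auto
    have const: "(LINT p:?S|lebesgue. t) = t * (m * \<delta>)" for t :: real
      using one by (simp add: set_lebesgue_integral_def)
    have L1: "(LINT p:?S|lebesgue. \<bar>g p\<bar>) \<le> (k * (m * \<delta>) + integral\<^sup>L ?M (\<lambda>p. (g p)\<^sup>2) / k) / 2"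
      and I1: "set_integrable lebesgue ?S (\<lambda>p. \<bar>g p\<bar>)"
      if g: "continuous_on \<Omega> g" "\<And>p. p \<in> \<Omega> \<Longrightarrow> \<bar>g p\<bar> \<le> L" and k: "k > 0" for g L k
    proof -
      have c1: "continuous_on \<Omega> (\<lambda>p. \<bar>g p\<bar>)" "continuous_on \<Omega> (\<lambda>p. (g p)\<^sup>2)" using g(1) by (auto intro!: continuous_intros)
      show I: "set_integrable lebesgue ?S (\<lambda>p. \<bar>g p\<bar>)"
        by (rule set_integrable_lebesgue_of_lborel(1)[OF
            set_integrable_bounded_continuous[OF So Sb continuous_on_subset[OF c1(1) S\<Omega>], of L]])
           (use g(2) S\<Omega> in auto)
      have J: "set_integrable lebesgue \<Omega> (\<lambda>p. (g p)\<^sup>2)"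
        by (rule set_integrable_lebesgue_of_lborel(1)[OF
            set_integrable_bounded_continuous[OF \<Omega> c1(2), of "L\<^sup>2"]])
           (use g(2) in \<open>auto intro!: power2_abs_bound\<close>)
      have JS: "set_integrable lebesgue ?S (\<lambda>p. (g p)\<^sup>2)" by (rule set_integrable_subset[OF J Smm S\<Omega>])
      have "(LINT p:?S|lebesgue. \<bar>g p\<bar>) \<le> (LINT p:?S|lebesgue. (k + (g p)\<^sup>2 / k) / 2)"
        by (intro set_integral_mono I set_integrable_divide set_integral_add(1) int_c JS abs_le_square_weighted k)
      also have "\<dots> = (k * (m * \<delta>) + (LINT p:?S|lebesgue. (g p)\<^sup>2) / k) / 2"
        using set_integral_add(2)[OF int_c set_integrable_divide[OF JS], of k k] const[of k]
        by (simp add: set_integrable_divide JS)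
      also have "\<dots> \<le> (k * (m * \<delta>) + (LINT p:\<Omega>|lebesgue. (g p)\<^sup>2) / k) / 2"
      proof -
        have "(LINT p:?S|lebesgue. (g p)\<^sup>2) \<le> (LINT p:\<Omega>|lebesgue. (g p)\<^sup>2)"
          unfolding set_lebesgue_integral_def
          by (rule integral_mono) (use JS J S\<Omega> in \<open>auto simp: set_integrable_def indicator_def\<close>)
        then show ?thesis using k by (simp add: divide_right_mono)
      qed
      finally show "(LINT p:?S|lebesgue. \<bar>g p\<bar>) \<le> (k * (m * \<delta>) + integral\<^sup>L ?M (\<lambda>p. (g p)\<^sup>2) / k) / 2"
        by (simp add: set_lebesgue_integral_restrict[OF \<Omega>m])
    qed
    have est: "c * (m * \<delta>) \<le> (c * (m * \<delta>) + E n / c) / 2 + \<delta> * ((k * (m * \<delta>) + B / k) / 2)"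
      if n: "integral\<^sup>L ?M (\<lambda>p. (dy (f n) p)\<^sup>2) \<le> B" for n
    proof -
      note cf = Ck_open_2_continuous[OF \<Omega>(1) reg(1)[of n]]
      obtain Kf where Kf: "Kf > 0" "\<And>q. q \<in> \<Omega> \<Longrightarrow> \<bar>f n q\<bar> \<le> Kf" "\<And>q. q \<in> \<Omega> \<Longrightarrow> \<bar>dy (f n) q\<bar> \<le> Kf"
        using reg(2)[of n] by blast
      have cuf: "continuous_on \<Omega> (\<lambda>q. f n q - u q)" by (intro continuous_intros u(1) cf)
      have buf: "\<bar>f n q - u q\<bar> \<le> K + Kf" if "q \<in> \<Omega>" for q using u(2)[OF that] Kf(2)[OF that] by linarith
      have "c * (m * \<delta>) \<le> (LINT p:?S|lebesgue. \<bar>u p\<bar>)"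
        unfolding const[symmetric] by (intro set_integral_mono int_c I1[OF u zero_less_one] Sc)
      also have "\<dots> \<le> (LINT p:?S|lebesgue. \<bar>f n p - u p\<bar> + \<bar>f n p\<bar>)"
        by (intro set_integral_mono set_integral_add(1) I1[OF u zero_less_one]
            I1[OF cuf buf zero_less_one] I1[OF cf(1) Kf(2) zero_less_one]) auto
      also have "\<dots> = (LINT p:?S|lebesgue. \<bar>f n p - u p\<bar>) + (LINT p:?S|lebesgue. \<bar>f n p\<bar>)"
        by (rule set_integral_add(2)[OF I1[OF cuf buf zero_less_one] I1[OF cf(1) Kf(2) zero_less_one]])
      \<comment> \<open>With weight \<open>c\<close> this term contains only half of the lower bound
        \<open>c * (m * \<delta>)\<close>, so the other half survives on the left side once
        \<open>E n\<close> has tended to 0.\<close>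
      also have "(LINT p:?S|lebesgue. \<bar>f n p - u p\<bar>) \<le> (c * (m * \<delta>) + E n / c) / 2"
        unfolding E_def by (rule L1[OF cuf buf c])
      also have "(LINT p:?S|lebesgue. \<bar>f n p\<bar>) \<le> \<delta> * (LINT p:?S|lebesgue. \<bar>dy (f n) p\<bar>)"
      proof (rule slice_Poincare[OF So Sb Sm, where K=Kf])
        show "((\<lambda>t. f n (x, t)) has_real_derivative dy (f n) (x, y)) (at y)" if "(x, y) \<in> ?S" for x y
          using reg(3) S\<Omega> that by (blast intro: has_grad_slice_y_real)
      qed (use zero[OF d] len S\<Omega> Kf cf in \<open>auto intro: continuous_on_subset\<close>)
      also have "\<dots> \<le> \<delta> * ((k * (m * \<delta>) + integral\<^sup>L ?M (\<lambda>p. (dy (f n) p)\<^sup>2) / k) / 2)"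
        using d(1) by (intro mult_left_mono L1[OF cf(3) Kf(3) k]) auto
      also have "\<dots> \<le> \<delta> * ((k * (m * \<delta>) + B / k) / 2)"
        using d(1) k n by (intro mult_left_mono divide_right_mono add_left_mono) auto
      finally show ?thesis by simp
    qed
    have "c * (m * \<delta>) \<le> (c * (m * \<delta>) + 0 / c) / 2 + \<delta> * ((k * (m * \<delta>) + B / k) / 2)"
    proof (rule tendsto_lowerbound[of _ _ sequentially])
      show "(\<lambda>n. (c * (m * \<delta>) + E n / c) / 2 + \<delta> * ((k * (m * \<delta>) + B / k) / 2))
          \<longlonglongrightarrow> (c * (m * \<delta>) + 0 / c) / 2 + \<delta> * ((k * (m * \<delta>) + B / k) / 2)"
        using c by (intro tendsto_intros E0) auto
      show "\<forall>\<^sub>F n in sequentially. c * (m * \<delta>) \<le> (c * (m * \<delta>) + E n / c) / 2 + \<delta> * ((k * (m * \<delta>) + B / k) / 2)"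
        using B(2) by eventually_elim (rule est)
    qed simp
    moreover have "X \<le> Y" if "2 * X \<le> (2 * X + 0 / c) / 2 + Y" for X Y using that by simp
    moreover have "c * (m * \<delta>) = 2 * (\<delta> * (c * m / 2))" "k * (m * \<delta>) = k * m * \<delta>" by simp_all
    ultimately have "\<delta> * (c * m / 2) \<le> \<delta> * ((k * m * \<delta> + B / k) / 2)" by metis
    then show ?thesis using d(1) by simp
  qed
  \<comment> \<open>A large weight makes the derivative energy \<open>B / k\<close> smaller than
    \<open>c * m / 2\<close>; the strip width \<open>\<delta>\<close> is then small enough for
    \<open>k * m * \<delta>\<close> to stay below the same number, against \<open>main\<close>. The
    summand 1 keeps \<open>k\<close> positive when \<open>B = 0\<close>.\<close>
  define k where "k = 2 * (B + 1) / (c * m)"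
  have k: "k > 0" using B(1) c m by (simp add: k_def)
  have Bk: "B / k < c * m / 2"
  proof -
    have "B / k = (c * m / 2) * (B / (B + 1))" using B(1) c m by (simp add: k_def field_simps)
    also have "\<dots> < (c * m / 2) * 1" using B(1) c m by (intro mult_strict_left_mono) auto
    finally show ?thesis by simp
  qed
  define \<delta> where "\<delta> = min (\<delta>0 / 2) (c / (2 * k))"
  have d: "0 < \<delta>" "\<delta> < \<delta>0" using d0 c k by (auto simp: \<delta>_def min_def)
  have "k * m * \<delta> \<le> k * m * (c / (2 * k))" using k m by (intro mult_left_mono) (auto simp: \<delta>_def)
  also have "\<dots> = c * m / 2" using k by simp
  finally have "k * m * \<delta> \<le> c * m / 2" .
  moreover have False if "X \<le> Y" "Y \<le> (X + Z) / 2" "Z < Y" for X Y Z :: real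
    using that by argo
  ultimately show False using main[OF d k] Bk by blast
qed

section \<open>The bounds on the boundary coefficients\<close>

lemma powr_ge_tangent:
  fixes t p :: real
  assumes "t > 0" "p \<ge> 1"
  shows "t powr p \<ge> 1 + p * (t - 1)"
proof -
  have "t powr p - 1 powr p \<ge> p * (t - 1)"
  proof (rule convex_on_imp_above_tangent[OF powr_convex[OF assms(2)]])
    show "((\<lambda>x. x powr p) has_real_derivative p) (at 1 within {0<..})"
      by (auto intro!: derivative_eq_intros)
  qed (use assms in \<open>auto simp: interior_open\<close>)
  then show ?thesis by simp
qed

text \<open>The logarithm of the product is concave in \<open>X\<close>, and \<open>crit\<close> is
  the equation of its critical point \<open>Y\<close>. The bound ln z \<le> z - 1 is applied to both
  ratios; the resulting linear terms cancel by \<open>crit\<close>.\<close>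

lemma weighted_product_max:
  fixes A B L X Y :: real
  assumes "0 \<le> A" "0 \<le> B" "0 < X" "X < L" "0 < Y" "Y < L" and crit: "A * (L - Y) = B * Y"
  shows "X powr A * (L - X) powr B \<le> Y powr A * (L - Y) powr B"
proof -
  have 1: "ln X - ln Y \<le> X / Y - 1"
    using ln_le_minus_one[of "X / Y"] assms by (simp add: ln_div)
  have 2: "ln (L - X) - ln (L - Y) \<le> (L - X) / (L - Y) - 1"
    using ln_le_minus_one[of "(L - X) / (L - Y)"] assms by (simp add: ln_div)
  have "A * (ln X - ln Y) + B * (ln (L - X) - ln (L - Y)) \<le> A * (X / Y - 1) + B * ((L - X) / (L - Y) - 1)"
    using 1 2 assms by (intro add_mono mult_left_mono) auto
  also have "\<dots> = (X - Y) * (A / Y - B / (L - Y))"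
  proof -
    have "X / Y - 1 = (X - Y) / Y" "(L - X) / (L - Y) - 1 = - ((X - Y) / (L - Y))"
      using assms by (simp_all add: field_simps)
    then show ?thesis by (simp only:) (simp add: algebra_simps)
  qed
  also have "A / Y - B / (L - Y) = 0"
    using crit assms(5,6) by (simp add: frac_eq_eq)
  finally have "A * ln X + B * ln (L - X) \<le> A * ln Y + B * ln (L - Y)" by (simp add: algebra_simps)
  then have "exp (A * ln X + B * ln (L - X)) \<le> exp (A * ln Y + B * ln (L - Y))" by simp
  then show ?thesis using assms by (simp add: powr_def exp_add)
qed

section \<open>Extrema of the denominator on the arc\<close>

locale tricomi_params =
  fixes \<alpha> \<beta> x0 :: real
  assumes \<alpha>: "\<alpha> \<ge> 1/2" and \<beta>: "\<beta> < 0" and x0: "x0 < 0"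
begin

abbreviation "g \<equiv> g_fun \<alpha> \<beta> x0"

definition b where "b = \<bar>\<beta>\<bar>"
definition \<kappa> where "\<kappa> = (\<alpha> + 1) * b / 2"
text \<open>Up to the factor \<open>\<kappa>\<close> this is the power \<alpha> + 1 of
  \<open>g\<close> on the arc. Since \<open>q x = x0^2 - (x - x0)^2\<close>, minimizing
  \<open>h_fun\<close> becomes a problem in one variable t = \<open>q x\<close> on [0, x0^2];
  \<open>e\<close> is the exponent with which t enters through
  \<open>g powr (2 * \<alpha>)\<close>.\<close>

definition q where "q x = x * (2 * x0 - x)"
definition e where "e = 2 * \<alpha> / (\<alpha> + 1)"

text \<open>\<open>H\<close> is the square of \<open>h_fun\<close> as a function of \<open>q\<close>; all the extrema of \<open>h_fun\<close> come from its
  concavity (for \<open>\<alpha> \<le> 1\<close>) or convexity (for \<open>\<alpha> \<ge> 1\<close>).\<close>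

definition H where "H t = x0\<^sup>2 - t + (\<kappa> * t) powr e / b\<^sup>2"

lemma b: "b > 0" "\<beta>\<^sup>2 = b\<^sup>2" "\<bar>\<beta>\<bar> = b" using \<beta> by (auto simp: b_def)
lemma \<kappa>: "\<kappa> > 0" using b \<alpha> by (simp add: \<kappa>_def)
lemma e: "e > 0" "\<alpha> \<le> 1 \<Longrightarrow> e \<le> 1" "\<alpha> \<ge> 1 \<Longrightarrow> e \<ge> 1" using \<alpha> by (auto simp: e_def field_simps)

lemma q_alt: "q x = x0\<^sup>2 - (x - x0)\<^sup>2" by (simp add: q_def power2_eq_square algebra_simps)

lemma q_bounds: "q x \<le> x0\<^sup>2" "2 * x0 < x \<Longrightarrow> x < 0 \<Longrightarrow> 0 < q x" "2 * x0 \<le> x \<Longrightarrow> x \<le> 0 \<Longrightarrow> 0 \<le> q x"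
proof -
  show "q x \<le> x0\<^sup>2" by (simp add: q_alt)
  show "0 < q x" if "2 * x0 < x" "x < 0"
    unfolding q_def using that by (intro mult_neg_neg) auto
  show "0 \<le> q x" if "2 * x0 \<le> x" "x \<le> 0"
    unfolding q_def using that by (intro mult_nonpos_nonpos) auto
qed

lemma g_eq: "g x = (\<kappa> * q x) powr (1 / (\<alpha> + 1))"
  by (simp add: g_fun_def \<kappa>_def q_def b mult_ac)

lemma g_powr: "g x powr s = (\<kappa> * q x) powr (s / (\<alpha> + 1))"
  by (simp add: g_eq powr_powr)

lemma h_eq: "h_fun \<alpha> \<beta> x0 x = sqrt (H (q x))"
proof -
  have "(g x) powr (2 * \<alpha>) = (\<kappa> * q x) powr e" by (simp add: g_powr e_def)
  then show ?thesis by (simp add: h_fun_def H_def b q_alt)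
qed

lemma H_pos: "0 \<le> t \<Longrightarrow> t \<le> x0\<^sup>2 \<Longrightarrow> H t > 0"
proof (cases "t = x0\<^sup>2")
  case True
  then show ?thesis using x0 \<kappa> b by (simp add: H_def)
next
  case False
  moreover assume "0 \<le> t" "t \<le> x0\<^sup>2"
  ultimately show ?thesis unfolding H_def by (intro add_pos_nonneg) auto
qed

lemma H_0: "H 0 = x0\<^sup>2" by (simp add: H_def)

text \<open>For \<open>e \<le> 1\<close> the graph of \<open>H\<close> lies above its chord from t =
  0, where the value is \<open>x0^2\<close>, to t = T. The value at t thus dominates a convex
  combination of the two end values.\<close>

lemma H_concave:
  assumes "\<alpha> \<le> 1" "0 \<le> t" "t \<le> T"
  shows "H t \<ge> min (x0\<^sup>2) (H T)"
proof (cases "T = 0")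
  case True
  then show ?thesis using assms H_0 by simp
next
  case False
  then have T: "T > 0" using assms by simp
  define r where "r = t / T"
  have r: "0 \<le> r" "r \<le> 1" "t = r * T" using assms T by (auto simp: r_def)
  have "r powr e \<ge> r powr 1" using e assms r by (intro powr_mono') auto
  then have "r \<le> r powr e" using r by simp
  then have "(\<kappa> * t) powr e \<ge> r * (\<kappa> * T) powr e"
    unfolding r(3) using mult_right_mono[of r "r powr e" "(\<kappa> * T) powr e"]
    by (simp add: powr_mult mult_ac)
  then have "H t \<ge> x0\<^sup>2 - r * T + r * (\<kappa> * T) powr e / b\<^sup>2"
    unfolding H_def r(3) using b by (simp add: divide_right_mono)
  also have "x0\<^sup>2 - r * T + r * (\<kappa> * T) powr e / b\<^sup>2 = (1 - r) * x0\<^sup>2 + r * H T"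
    by (simp add: H_def algebra_simps)
  finally have "H t \<ge> (1 - r) * x0\<^sup>2 + r * H T" .
  moreover have "(1 - r) * x0\<^sup>2 + r * H T \<ge> (1 - r) * min (x0\<^sup>2) (H T) + r * min (x0\<^sup>2) (H T)"
    using r by (intro add_mono mult_left_mono) auto
  ultimately show ?thesis by (simp add: algebra_simps)
qed

text \<open>The tangent to \<open>H\<close> at \<open>T\<close>, written with the slope
  \<open>- (1 - e * (\<kappa> * T) powr e / (b^2 * T))\<close>. It is Bernoulli's inequality for the
  power \<open>e \<ge> 1\<close> of t / T.\<close>

lemma H_convex:
  assumes "\<alpha> \<ge> 1" "0 \<le> t" "T > 0"
  shows "H t \<ge> H T + (T - t) * (1 - e * (\<kappa> * T) powr e / (b\<^sup>2 * T))"
proof -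
  have "(t / T) powr e \<ge> 1 + e * (t / T - 1)"
  proof (cases "t = 0")
    case True
    then show ?thesis using e assms by simp
  next
    case False
    then show ?thesis using e assms by (intro powr_ge_tangent) auto
  qed
  then have "(\<kappa> * T) powr e * (t / T) powr e / b\<^sup>2 \<ge> (\<kappa> * T) powr e * (1 + e * (t / T - 1)) / b\<^sup>2"
    by (intro divide_right_mono mult_left_mono) auto
  moreover have "(\<kappa> * T) powr e * (t / T) powr e = (\<kappa> * t) powr e"
    using assms by (simp flip: powr_mult)
  moreover have "(\<kappa> * T) powr e * (1 + e * (t / T - 1)) / b\<^sup>2
      = (\<kappa> * T) powr e / b\<^sup>2 - (T - t) * (e * (\<kappa> * T) powr e / (b\<^sup>2 * T))"
    using assms b by (simp add: field_simps)
  ultimately show ?thesis unfolding H_def by (simp add: algebra_simps)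
qed

text \<open>The origin of \<open>D_num\<close>: its square is the positive solution of T = (\<kappa>
  T)^e / b^2, where \<open>H T\<close> returns to \<open>H 0 = x0^2\<close>. Taking logarithms makes
  the equation linear; the direction of the inequality is kept because \<open>1 - e\<close> is
  positive.\<close>

lemma D_crit:
  assumes "\<alpha> < 1" "T > 0"
  shows "T \<le> (\<kappa> * T) powr e / b\<^sup>2 \<longleftrightarrow> sqrt T \<le> D_num \<alpha> \<beta>"
proof -
  define k where "k = (1 - \<alpha>) / (1 + \<alpha>)"
  have k: "k > 0" "1 - e = k" using assms \<alpha> by (auto simp: k_def e_def field_simps)
  have D: "D_num \<alpha> \<beta> > 0" using \<alpha> b(1) by (simp add: D_num_def b(3))
  have "ln (2 powr \<alpha> * (\<alpha> + 1) powr (- \<alpha>) * b) = \<alpha> * ln 2 - \<alpha> * ln (\<alpha> + 1) + ln b"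
    using b(1) \<alpha> by (simp add: ln_mult ln_powr)
  then have lnD: "ln (D_num \<alpha> \<beta>) = (\<alpha> * ln 2 - \<alpha> * ln (\<alpha> + 1) + ln b) / (\<alpha> - 1)"
    using b(1) \<alpha> by (simp add: D_num_def b(3) ln_powr)
  have ln\<kappa>: "ln \<kappa> = ln (\<alpha> + 1) + ln b - ln 2"
    using b(1) \<alpha> by (simp add: \<kappa>_def ln_mult ln_div)
  have key: "e * ln \<kappa> - 2 * ln b = 2 * k * ln (D_num \<alpha> \<beta>)"
  proof -
    have "(\<alpha> + 1) * (e * ln \<kappa> - 2 * ln b) = 2 * \<alpha> * ln \<kappa> - 2 * (\<alpha> + 1) * ln b"
      using \<alpha> by (simp add: e_def field_simps)
    also have "\<dots> = - 2 * (\<alpha> * ln 2 - \<alpha> * ln (\<alpha> + 1) + ln b)" by (simp add: ln\<kappa> algebra_simps)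
    also have "\<dots> = (\<alpha> + 1) * (2 * k * ln (D_num \<alpha> \<beta>))"
    proof -
      have k1: "(\<alpha> + 1) * k = 1 - \<alpha>" using \<alpha> by (simp add: k_def field_simps)
      have "(\<alpha> + 1) * (2 * k * (N / (\<alpha> - 1))) = - 2 * N" for N
      proof -
        have "(\<alpha> + 1) * (2 * k * (N / (\<alpha> - 1))) = 2 * ((\<alpha> + 1) * k) * (N / (\<alpha> - 1))" by simp
        also have "\<dots> = - 2 * N" unfolding k1 using assms by (simp add: field_simps)
        finally show ?thesis .
      qed
      then show ?thesis unfolding lnD by simp
    qed
    finally show ?thesis using \<alpha> by simp
  qed
  have "T \<le> (\<kappa> * T) powr e / b\<^sup>2 \<longleftrightarrow> ln T \<le> ln ((\<kappa> * T) powr e / b\<^sup>2)"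
    using assms b \<kappa> by simp
  also have "ln ((\<kappa> * T) powr e / b\<^sup>2) = e * (ln \<kappa> + ln T) - 2 * ln b"
    using assms b \<kappa> by (simp add: ln_div ln_powr ln_mult ln_realpow)
  also have "ln T \<le> e * (ln \<kappa> + ln T) - 2 * ln b \<longleftrightarrow> (1 - e) * ln T \<le> e * ln \<kappa> - 2 * ln b"
    by (simp add: algebra_simps)
  also have "\<dots> \<longleftrightarrow> k * ln T \<le> k * (2 * ln (D_num \<alpha> \<beta>))"
    unfolding key k(2) by (simp add: mult_ac del: mult_le_cancel_left)
  also have "\<dots> \<longleftrightarrow> ln (sqrt T) \<le> ln (D_num \<alpha> \<beta>)" using k assms by (simp add: ln_sqrt mult.commute)
  also have "\<dots> \<longleftrightarrow> sqrt T \<le> D_num \<alpha> \<beta>" using assms D by simp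
  finally show ?thesis .
qed

text \<open>The origin of \<open>c_num\<close>: it is the point where the derivative of
  \<open>H\<close> vanishes, and its closed form is checked by taking logarithms.\<close>

lemma c_num_crit:
  assumes "\<alpha> > 1"
  shows "c_num \<alpha> \<beta> > 0" "e * (\<kappa> * c_num \<alpha> \<beta>) powr e = b\<^sup>2 * c_num \<alpha> \<beta>"
proof -
  let ?c = "c_num \<alpha> \<beta>" and ?\<gamma> = "gamma_num \<alpha>"
  show c: "?c > 0" unfolding c_num_def b(3) using assms b(1) by (intro mult_pos_pos) auto
  have "e - 1 = (\<alpha> - 1) / (\<alpha> + 1)" using assms by (simp add: e_def field_simps)
  then have e1: "(e - 1) * ?\<gamma> = 1" using assms by (simp add: gamma_num_def)
  have lnc: "ln ?c = ln 2 - ln (\<alpha> + 1) - ?\<gamma> * ln \<alpha> + (?\<gamma> - 1) * ln b"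
    using assms b(1) by (simp add: c_num_def b(3) ln_mult ln_div ln_powr)
  have "(e - 1) * ln ?c = (e - 1) * (ln 2 - ln (\<alpha> + 1)) - (e - 1) * ?\<gamma> * ln \<alpha>
      + ((e - 1) * ?\<gamma> - (e - 1)) * ln b"
    unfolding lnc by (simp add: algebra_simps)
  then have ec: "(e - 1) * ln ?c = (e - 1) * (ln 2 - ln (\<alpha> + 1)) - ln \<alpha> + (1 - (e - 1)) * ln b"
    by (simp only: e1 mult_1_left)
  have ln\<kappa>: "ln \<kappa> = ln (\<alpha> + 1) + ln b - ln 2"
    using b(1) \<alpha> by (simp add: \<kappa>_def ln_mult ln_div)
  have lne: "ln e = ln 2 + ln \<alpha> - ln (\<alpha> + 1)"
    using assms by (simp add: e_def ln_mult ln_div)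
  have "ln (e * (\<kappa> * ?c) powr e) = ln e + e * (ln \<kappa> + ln ?c)"
    using e(1) \<kappa> c by (simp add: ln_mult ln_powr)
  also have "\<dots> = ln e + e * ln \<kappa> + (e - 1) * ln ?c + ln ?c" by (simp add: algebra_simps)
  also have "\<dots> = 2 * ln b + ln ?c" unfolding ec lne ln\<kappa> by (simp add: algebra_simps)
  also have "\<dots> = ln (b\<^sup>2 * ?c)" using b c by (simp add: ln_mult ln_realpow)
  finally show "e * (\<kappa> * ?c) powr e = b\<^sup>2 * ?c"
    using e(1) \<kappa> c b by simp
qed

lemma H_ge_c:
  assumes "\<alpha> > 1" "0 \<le> t"
  shows "H t \<ge> H (c_num \<alpha> \<beta>)"
  using H_convex[of t "c_num \<alpha> \<beta>"] c_num_crit[OF assms(1)] assms b by simp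

text \<open>The quotient \<open>e * (\<kappa> * T) powr e / (b^2 * T)\<close> increases with
  \<open>T\<close> for \<open>e > 1\<close> and equals 1 at \<open>c_num\<close>. Up to that point
  the tangent slope is therefore nonpositive.\<close>

lemma H_antimono:
  assumes "\<alpha> > 1" "0 \<le> t" "t \<le> T" "T > 0" "T \<le> c_num \<alpha> \<beta>"
  shows "H t \<ge> H T"
proof -
  let ?c = "c_num \<alpha> \<beta>"
  have c: "?c > 0" "e * (\<kappa> * ?c) powr e = b\<^sup>2 * ?c" using c_num_crit[OF assms(1)] by auto
  define r where "r = T / ?c"
  have r: "0 < r" "r \<le> 1" "T = r * ?c" using assms c by (auto simp: r_def)
  have "r powr e \<le> r powr 1" using e assms r by (intro powr_mono') auto
  then have rr: "r powr e \<le> r" using r by simp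
  have "e * (\<kappa> * T) powr e = r powr e * (e * (\<kappa> * ?c) powr e)"
    unfolding r(3) by (simp add: powr_mult mult_ac)
  also have "\<dots> \<le> r * (b\<^sup>2 * ?c)" unfolding c(2) using rr c b by (intro mult_right_mono) auto
  also have "\<dots> = b\<^sup>2 * T" using r by simp
  finally have "e * (\<kappa> * T) powr e / (b\<^sup>2 * T) \<le> 1" using assms b by (simp add: field_simps)
  then have "(T - t) * (1 - e * (\<kappa> * T) powr e / (b\<^sup>2 * T)) \<ge> 0" using assms by simp
  then show ?thesis using H_convex[of t T] assms by linarith
qed

lemma q_points: "q x0 = x0\<^sup>2" "q 0 = 0" "q (2 * x0) = 0"
    "q (x_al \<alpha> x0) = d_num \<alpha> * (2 - d_num \<alpha>) * x0\<^sup>2"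
    "c_num \<alpha> \<beta> \<le> x0\<^sup>2 \<Longrightarrow> q (x_plus \<alpha> \<beta> x0) = c_num \<alpha> \<beta>"
    "c_num \<alpha> \<beta> \<le> x0\<^sup>2 \<Longrightarrow> q (x_minus \<alpha> \<beta> x0) = c_num \<alpha> \<beta>"
  by (simp_all add: q_alt x_al_def x_plus_def x_minus_def power2_eq_square algebra_simps)

lemma d_num: "1 \<le> d_num \<alpha>" "d_num \<alpha> < 2" using \<alpha> by (auto simp: d_num_def field_simps)

lemma M_num: "\<alpha> > 1 \<Longrightarrow> x0 \<ge> - M_num \<alpha> \<beta> \<longleftrightarrow> x0\<^sup>2 \<le> c_num \<alpha> \<beta>"
proof -
  have "x0 \<ge> - M_num \<alpha> \<beta> \<longleftrightarrow> sqrt (x0\<^sup>2) \<le> sqrt (c_num \<alpha> \<beta>)"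
    using x0 by (auto simp: M_num_def)
  then show ?thesis by (simp only: real_sqrt_le_iff)
qed

text \<open>A minimizer of \<open>h_fun\<close> over the arc. For \<alpha> < 1 concavity in t places
  the minimum at t = 0 or t = x0^2; for \<alpha> = 1 the function \<open>H\<close> is affine and the
  sign of its slope decides; for \<alpha> > 1 convexity places it at t = \<open>c_num\<close> if
  this value is reached, and at t = x0^2 otherwise.\<close>

definition hmin_pt where "hmin_pt =
  (if \<alpha> < 1 then (if x0 \<ge> - D_num \<alpha> \<beta> then 0 else x0)
   else if \<alpha> = 1 then (if \<beta> \<le> -1 then x0 else 0)
   else (if x0 \<ge> - M_num \<alpha> \<beta> then x0 else x_plus \<alpha> \<beta> x0))"

text \<open>The analogous minimizer over the part left of \<open>x_al\<close>, where
  \<open>theta_fun\<close> is nonnegative. There t only reaches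
  \<open>d_num * (2 - d_num) * x0^2\<close>, which rescales the thresholds \<open>D_num\<close> and
  \<open>M_num\<close> to \<open>L_num\<close> and \<open>E_num\<close>.\<close>

definition hmin_left_pt where "hmin_left_pt =
  (if \<alpha> < 1 then (if x0 \<ge> - L_num \<alpha> \<beta> then 2 * x0 else x_al \<alpha> x0)
   else if \<alpha> = 1 then (if \<beta> \<le> -1 then x_al \<alpha> x0 else 2 * x0)
   else (if x0 > - E_num \<alpha> \<beta> then x_al \<alpha> x0 else x_minus \<alpha> \<beta> x0))"

lemma H_min_lt1:
  assumes "\<alpha> < 1" "0 \<le> t" "t \<le> T" "T > 0"
  shows "H t \<ge> H (if sqrt T \<le> D_num \<alpha> \<beta> then 0 else T)"
proof -
  have "x0\<^sup>2 \<le> H T \<longleftrightarrow> sqrt T \<le> D_num \<alpha> \<beta>"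
    using D_crit[OF assms(1,4)] by (auto simp: H_def)
  then show ?thesis using H_concave[of t T] assms by (auto simp: H_0 min_def split: if_splits)
qed

text \<open>Here \<open>e = 1\<close> and \<open>\<kappa> = b\<close>, so
  \<open>H t = x0^2 - t * (1 - 1 / b)\<close>, and the sign of \<open>1 - 1 / b\<close> decides at
  which end the minimum lies.\<close>

lemma H_min_1:
  assumes "\<alpha> = 1" "0 \<le> t" "t \<le> T" "T > 0"
  shows "H t \<ge> H (if \<beta> \<le> -1 then T else 0)"
proof -
  have "e = 1" "\<kappa> = b" unfolding e_def \<kappa>_def using assms(1) by simp_all
  then have Hs: "H s = x0\<^sup>2 - s * (1 - 1 / b)" if "s \<ge> 0" for s
    using that b(1) by (simp add: H_def power2_eq_square right_diff_distrib)
  show ?thesis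
  proof (cases "\<beta> \<le> -1")
    case True
    then have "b \<ge> 1" by (simp add: b_def)
    then have "1 - 1 / b \<ge> 0" by simp
    then have "t * (1 - 1 / b) \<le> T * (1 - 1 / b)" using assms by (intro mult_right_mono)
    then show ?thesis using True Hs[of t] Hs[of T] assms by simp
  next
    case False
    then have "b \<le> 1" using \<beta> by (simp add: b_def)
    then have "1 - 1 / b \<le> 0" using b(1) by simp
    then have "t * (1 - 1 / b) \<le> 0" using assms by (intro mult_nonneg_nonpos)
    then show ?thesis using False Hs[of t] Hs[of 0] assms by simp
  qed
qed

lemma h_min:
  assumes "2 * x0 < x" "x < 0"
  shows "H (q hmin_pt) \<le> H (q x)" "0 \<le> q hmin_pt" "q hmin_pt \<le> x0\<^sup>2"
proof -
  have q: "0 < q x" "q x \<le> x0\<^sup>2" using q_bounds assms by auto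
  have X: "x0\<^sup>2 > 0" "sqrt (x0\<^sup>2) = - x0" using x0 by auto
  consider "\<alpha> < 1" | "\<alpha> = 1" | "\<alpha> > 1" by linarith
  then have "H (q hmin_pt) \<le> H (q x) \<and> 0 \<le> q hmin_pt \<and> q hmin_pt \<le> x0\<^sup>2"
  proof cases
    case 1
    then show ?thesis using H_min_lt1[OF 1, of "q x" "x0\<^sup>2"] q X
      by (auto simp: hmin_pt_def q_points split: if_splits)
  next
    case 2
    then have "hmin_pt = (if \<beta> \<le> -1 then x0 else 0)" unfolding hmin_pt_def by simp
    then show ?thesis using H_min_1[OF 2, of "q x" "x0\<^sup>2"] q X
      by (auto simp: q_points split: if_splits)
  next
    case 3
    then show ?thesis
      using H_ge_c[OF 3, of "q x"] H_antimono[OF 3, of "q x" "x0\<^sup>2"] c_num_crit(1)[OF 3] M_num[OF 3] q X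
      by (auto simp: hmin_pt_def q_points split: if_splits)
  qed
  then show "H (q hmin_pt) \<le> H (q x)" "0 \<le> q hmin_pt" "q hmin_pt \<le> x0\<^sup>2" by auto
qed

lemma h_min_left:
  assumes "2 * x0 < x" "x < x_al \<alpha> x0"
  shows "H (q hmin_left_pt) \<le> H (q x)" "0 \<le> q hmin_left_pt" "q hmin_left_pt \<le> x0\<^sup>2"
proof -
  let ?d = "d_num \<alpha>"
  \<comment> \<open>\<open>q\<close> increases up to \<open>x0\<close> and \<open>x_al\<close> lies
    left of \<open>x0\<close>; hence \<open>r * x0^2\<close>, the value of \<open>q\<close> at
    \<open>x_al\<close>, is the largest value of t on this part.\<close>
  define r where "r = ?d * (2 - ?d)"
  have r: "0 < r" "r \<le> 1"
  proof -
    show "0 < r" using d_num by (simp add: r_def)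
    have "r = 1 - (?d - 1)\<^sup>2" by (simp add: r_def power2_eq_square algebra_simps)
    then show "r \<le> 1" by simp
  qed
  have xd: "x_al \<alpha> x0 \<le> x0" using d_num x0 by (simp add: x_al_def)
  have "x < 0" using assms xd x0 by simp
  then have q0: "0 < q x" using q_bounds assms by auto
  have "(x_al \<alpha> x0 - x0)\<^sup>2 \<le> (x - x0)\<^sup>2"
    using assms xd by (simp add: abs_le_square_iff[symmetric])
  then have qT: "q x \<le> r * x0\<^sup>2" using q_points(4) by (simp add: q_alt r_def)
  have X: "r * x0\<^sup>2 > 0" "sqrt (r * x0\<^sup>2) = sqrt r * - x0" "r * x0\<^sup>2 \<le> x0\<^sup>2"
    using r x0 by (auto simp: real_sqrt_mult mult_left_le_one_le)
  have rs: "sqrt r > 0" "r powr (-1/2) = 1 / sqrt r"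
    using r powr_minus[of r "1/2"] by (auto simp: powr_half_sqrt inverse_eq_divide)
  consider "\<alpha> < 1" | "\<alpha> = 1" | "\<alpha> > 1" by linarith
  then have "H (q hmin_left_pt) \<le> H (q x) \<and> 0 \<le> q hmin_left_pt \<and> q hmin_left_pt \<le> x0\<^sup>2"
  proof cases
    case 1
    have "x0 \<ge> - L_num \<alpha> \<beta> \<longleftrightarrow> sqrt (r * x0\<^sup>2) \<le> D_num \<alpha> \<beta>"
      unfolding L_num_def r_def[symmetric] rs(2) X(2) using rs(1) by (auto simp: field_simps)
    then show ?thesis using H_min_lt1[OF 1, of "q x" "r * x0\<^sup>2"] q0 qT X 1
      by (auto simp: hmin_left_pt_def q_points r_def[symmetric] split: if_splits)
  next
    case 2
    then have "hmin_left_pt = (if \<beta> \<le> -1 then x_al \<alpha> x0 else 2 * x0)" unfolding hmin_left_pt_def by simp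
    then show ?thesis using H_min_1[OF 2, of "q x" "r * x0\<^sup>2"] q0 qT X
      by (auto simp: q_points r_def[symmetric] split: if_splits)
  next
    case 3
    have c: "c_num \<alpha> \<beta> > 0" using c_num_crit(1)[OF 3] .
    have "x0 > - E_num \<alpha> \<beta> \<longleftrightarrow> sqrt (r * x0\<^sup>2) < sqrt (c_num \<alpha> \<beta>)"
      unfolding E_num_def M_num_def r_def[symmetric] rs(2) X(2) using rs(1) by (auto simp: field_simps)
    then have E: "x0 > - E_num \<alpha> \<beta> \<longleftrightarrow> r * x0\<^sup>2 < c_num \<alpha> \<beta>" by simp
    show ?thesis
    proof (cases "r * x0\<^sup>2 < c_num \<alpha> \<beta>")
      case True
      then show ?thesis
        using H_antimono[OF 3, of "q x" "r * x0\<^sup>2"] q0 qT X 3 E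
        by (auto simp: hmin_left_pt_def q_points r_def[symmetric])
    next
      case False
      then have "c_num \<alpha> \<beta> \<le> x0\<^sup>2" using X by linarith
      then show ?thesis
        using H_ge_c[OF 3, of "q x"] q0 c 3 E False
        by (auto simp: hmin_left_pt_def q_points)
    qed
  qed
  then show "H (q hmin_left_pt) \<le> H (q x)" "0 \<le> q hmin_left_pt" "q hmin_left_pt \<le> x0\<^sup>2" by auto
qed

section \<open>Bounds for the coefficient \<Theta>\<close>

definition Theta_lo where "Theta_lo = (if \<alpha> < 1 then C10 \<alpha> \<beta> x0 else if \<alpha> = 1 then C6 \<beta> x0 else C8 \<alpha> \<beta> x0)"
definition Theta_hi where "Theta_hi = (if \<alpha> < 1 then C11 \<alpha> \<beta> x0 else if \<alpha> = 1 then C7 \<beta> x0 else C9 \<alpha> \<beta> x0)"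

lemma Theta_lo_eq: "Theta_lo = theta_fun \<alpha> x0 (x_al_tilde \<alpha> x0) / h_fun \<alpha> \<beta> x0 hmin_pt"
  by (simp add: Theta_lo_def C10_def C6_def C8_def hmin_pt_def)

lemma Theta_hi_eq: "Theta_hi = theta_fun \<alpha> x0 (2 * x0) / h_fun \<alpha> \<beta> x0 hmin_left_pt"
  by (simp add: Theta_hi_def C11_def C7_def C9_def hmin_left_pt_def Theta_fun_def)

lemma theta_min: "theta_fun \<alpha> x0 x \<ge> theta_fun \<alpha> x0 (x_al_tilde \<alpha> x0)" "theta_fun \<alpha> x0 (x_al_tilde \<alpha> x0) \<le> 0"
proof -
  have "theta_fun \<alpha> x0 x - theta_fun \<alpha> x0 (x_al_tilde \<alpha> x0) = (4 + \<alpha>) * (x - x_al_tilde \<alpha> x0)\<^sup>2"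
    by (simp add: theta_fun_def x_al_tilde_def x_al_def power2_eq_square field_simps)
  also have "\<dots> \<ge> 0" using \<alpha> by simp
  finally show "theta_fun \<alpha> x0 x \<ge> theta_fun \<alpha> x0 (x_al_tilde \<alpha> x0)" by simp
  have "theta_fun \<alpha> x0 (x_al_tilde \<alpha> x0) = - ((4 + \<alpha>) * (d_num \<alpha> * x0)\<^sup>2 / 4)"
    by (simp add: theta_fun_def x_al_tilde_def x_al_def power2_eq_square field_simps)
  then show "theta_fun \<alpha> x0 (x_al_tilde \<alpha> x0) \<le> 0" using \<alpha> by simp
qed

text \<open>The minimum of the numerator is nonpositive, so the quotient only decreases when the
  denominator is replaced by its minimum.\<close>

lemma Theta_ge:
  assumes "2 * x0 < x" "x < 0"
  shows "Theta_fun \<alpha> \<beta> x0 x \<ge> Theta_lo"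
proof -
  note m = h_min[OF assms]
  have h: "0 < h_fun \<alpha> \<beta> x0 hmin_pt" "h_fun \<alpha> \<beta> x0 hmin_pt \<le> h_fun \<alpha> \<beta> x0 x"
    using m H_pos[OF m(2,3)] by (auto simp: h_eq)
  have "Theta_lo \<le> theta_fun \<alpha> x0 (x_al_tilde \<alpha> x0) / h_fun \<alpha> \<beta> x0 x"
    unfolding Theta_lo_eq using h theta_min(2) by (intro divide_left_mono_neg mult_pos_pos) auto
  also have "\<dots> \<le> theta_fun \<alpha> x0 x / h_fun \<alpha> \<beta> x0 x"
    using theta_min(1) h by (intro divide_right_mono) auto
  finally show ?thesis by (simp add: Theta_fun_def)
qed

text \<open>Left of \<open>x_al\<close> the numerator is nonnegative and largest at
  \<open>2 * x0\<close>, and it is divided by the smallest denominator on that part. To the right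
  the numerator is nonpositive while the bound is nonnegative.\<close>

lemma Theta_le:
  assumes "2 * x0 < x" "x < 0"
  shows "Theta_fun \<alpha> \<beta> x0 x \<le> Theta_hi"
proof (cases "x < x_al \<alpha> x0")
  case True
  note m = h_min_left[OF assms(1) True]
  have h: "0 < h_fun \<alpha> \<beta> x0 hmin_left_pt" "h_fun \<alpha> \<beta> x0 hmin_left_pt \<le> h_fun \<alpha> \<beta> x0 x"
    using m H_pos[OF m(2,3)] by (auto simp: h_eq)
  have "x * (x - d_num \<alpha> * x0) = (- x) * (d_num \<alpha> * x0 - x)" by (simp add: algebra_simps)
  also have "\<dots> \<le> (- (2 * x0)) * (d_num \<alpha> * x0 - 2 * x0)"
    using assms True by (intro mult_mono) (auto simp: x_al_def)
  also have "\<dots> = 2 * x0 * (2 * x0 - d_num \<alpha> * x0)" by (simp add: algebra_simps)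
  finally have t: "theta_fun \<alpha> x0 x \<le> theta_fun \<alpha> x0 (2 * x0)"
    unfolding theta_fun_def mult.assoc using \<alpha> by (intro mult_left_mono) auto
  have t0: "0 \<le> theta_fun \<alpha> x0 x"
    using assms True \<alpha> by (auto simp: theta_fun_def x_al_def mult_nonneg_nonpos intro!: mult_nonpos_nonpos)
  have "Theta_fun \<alpha> \<beta> x0 x \<le> theta_fun \<alpha> x0 x / h_fun \<alpha> \<beta> x0 hmin_left_pt"
    unfolding Theta_fun_def using h t0 by (intro divide_left_mono mult_pos_pos) auto
  also have "\<dots> \<le> Theta_hi" unfolding Theta_hi_eq using h t by (intro divide_right_mono) auto
  finally show ?thesis .
next
  case False
  have "x * (x - d_num \<alpha> * x0) \<le> 0"
    using assms False by (intro mult_nonpos_nonneg) (auto simp: x_al_def)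
  then have "theta_fun \<alpha> x0 x \<le> 0"
    using mult_nonneg_nonpos[of "4 + \<alpha>"] \<alpha> by (simp add: theta_fun_def mult.assoc)
  moreover have "h_fun \<alpha> \<beta> x0 y \<ge> 0" for y by (simp add: h_fun_def)
  moreover have "theta_fun \<alpha> x0 (2 * x0) \<ge> 0"
  proof -
    have "2 * x0 - d_num \<alpha> * x0 = (2 - d_num \<alpha>) * x0" by (simp add: algebra_simps)
    also have "\<dots> \<le> 0" using d_num x0 by (intro mult_nonneg_nonpos) auto
    finally have nn: "2 * x0 * (2 * x0 - d_num \<alpha> * x0) \<ge> 0" using x0 by (intro mult_nonpos_nonpos) auto
    have th: "theta_fun \<alpha> x0 (2 * x0) = (4 + \<alpha>) * (2 * x0 * (2 * x0 - d_num \<alpha> * x0))"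
      by (simp add: theta_fun_def)
    show ?thesis unfolding th using \<alpha> by (intro mult_nonneg_nonneg[OF _ nn]) simp
  qed
  ultimately show ?thesis
    unfolding Theta_fun_def Theta_hi_eq by (meson divide_nonneg_nonneg divide_nonpos_nonneg order_trans)
qed

section \<open>Bounds for the coefficient \<Psi>\<close>

definition Psi_hi where "Psi_hi = C24 \<alpha> \<beta> x0"

text \<open>The bound for the numerator of \<Psi>. In general the extrema of its two summands, taken
  at different points, are added in \<open>S_num\<close>. For \<alpha> = 1/2 and \<alpha> = 2 the
  critical equation of the whole numerator reduces to a quadratic, and the maximum is exact.\<close>

definition psi_max where "psi_max =
  (if \<alpha> = 1/2 then (if x0 \<ge> - (1 / b) then \<bar>psi_fun \<alpha> \<beta> x0 (2 * x0)\<bar> else \<bar>psi_fun \<alpha> \<beta> x0 (x_be_tilde_minus \<beta> x0)\<bar>)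
   else if \<alpha> = 2 then \<bar>psi_fun \<alpha> \<beta> x0 (x_be_hat_minus \<beta> x0)\<bar>
   else \<bar>S_num \<alpha> \<beta> x0\<bar>)"

text \<open>In this form the threshold for the minimizer of \<open>h_fun\<close> can be compared
  with the threshold 1 / |\<beta>| for the maximizer of the numerator.\<close>

lemma D_num_half: "\<alpha> = 1/2 \<Longrightarrow> D_num (1/2) \<beta> = 3 / (4 * b\<^sup>2)"
proof -
  have "(2::real) powr (1/2) * (1/2 + 1) powr (- 1/2) = (4/3) powr (1/2)"
    by (simp add: powr_minus powr_half_sqrt real_sqrt_divide flip: powr_divide) 
  then have "D_num (1/2) \<beta> = ((4/3) powr (1/2) * b) powr (-2)"
    by (simp add: D_num_def b(3))
  also have "\<dots> = ((4/3) powr (1/2)) powr (-2) * b powr (-2)" by (simp only: powr_mult)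
  also have "((4/3::real) powr (1/2)) powr (-2) = (4/3) powr (-1)" by (simp add: powr_powr)
  also have "\<dots> = 3/4" by (simp add: powr_minus)
  also have "b powr (-2) = 1 / b\<^sup>2" using b(1) by (simp add: powr_minus powr_numeral inverse_eq_divide)
  finally show ?thesis by simp
qed

lemma hmin_pt_alt:
  "h_fun \<alpha> \<beta> x0 0 = h_fun \<alpha> \<beta> x0 (2 * x0)"
    "\<alpha> > 1 \<Longrightarrow> x0 < - M_num \<alpha> \<beta> \<Longrightarrow> h_fun \<alpha> \<beta> x0 (x_plus \<alpha> \<beta> x0) = h_fun \<alpha> \<beta> x0 (x_minus \<alpha> \<beta> x0)"
  using M_num by (auto simp: h_eq q_points)

text \<open>All cases of \<open>C24\<close> have one shape, a numerator bound over the minimum of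
  \<open>h_fun\<close>. Since \<open>h_fun\<close> is symmetric about \<open>x0\<close>, the points
  0 and \<open>2 * x0\<close> are interchangeable, as are \<open>x_plus\<close> and
  \<open>x_minus\<close>. For \<alpha> = 1/2 the order of the two thresholds depends on \<beta>
  against -3/4, which rules out the combinations that \<open>C12\<close> and \<open>C14\<close>
  omit.\<close>

lemma Psi_hi_eq: "Psi_hi = psi_max / h_fun \<alpha> \<beta> x0 hmin_pt"
proof -
  have h: "\<bar>h_fun \<alpha> \<beta> x0 x\<bar> = h_fun \<alpha> \<beta> x0 x" for x by (simp add: h_fun_def)
  consider "\<alpha> = 1/2" | "1/2 < \<alpha>" "\<alpha> < 1" | "\<alpha> = 1" | "\<alpha> > 1" "\<alpha> \<noteq> 2" | "\<alpha> = 2" using \<alpha> by linarith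
  then show ?thesis
  proof cases
    case 1
    note D = D_num_half[OF 1]
    have hp: "hmin_pt = (if x0 \<ge> - D_num (1/2) \<beta> then 0 else x0)" unfolding hmin_pt_def unfolding 1 by simp
    have pm: "psi_max = (if x0 \<ge> - (1 / b) then \<bar>psi_fun (1/2) \<beta> x0 (2 * x0)\<bar> else \<bar>psi_fun (1/2) \<beta> x0 (x_be_tilde_minus \<beta> x0)\<bar>)"
      unfolding psi_max_def unfolding 1 by simp
    have ph: "Psi_hi = (if x0 \<ge> - (1 / b) then \<bar>C12 \<beta> x0\<bar> else \<bar>C14 \<beta> x0\<bar>)"
      unfolding Psi_hi_def C24_def unfolding 1 by (simp add: b)
    have hh: "h_fun (1/2) \<beta> x0 0 = h_fun (1/2) \<beta> x0 (2 * x0)"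
      using hmin_pt_alt(1) 1 by simp
    have d1: "\<beta> \<ge> -3/4 \<Longrightarrow> 1 / b \<le> 3 / (4 * b\<^sup>2)" "\<beta> \<le> -3/4 \<Longrightarrow> 3 / (4 * b\<^sup>2) \<le> 1 / b"
      using \<beta> by (auto simp: b_def power2_eq_square field_simps)
    show ?thesis unfolding hp pm ph unfolding C12_def C14_def Psi_fun_def D unfolding 1
      using d1 h[unfolded 1] by (auto simp: hh abs_divide)
  next
    case 2
    then show ?thesis
      by (auto simp: Psi_hi_def C24_def psi_max_def hmin_pt_def C16_def abs_divide h hmin_pt_alt(1))
  next
    case 3
    have "hmin_pt = (if \<beta> \<le> -1 then x0 else 0)" unfolding hmin_pt_def using 3 by simp
    moreover have "psi_max = \<bar>S_num 1 \<beta> x0\<bar>" unfolding psi_max_def using 3 by simp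
    moreover have "Psi_hi = \<bar>C18 \<beta> x0\<bar>" unfolding Psi_hi_def C24_def using 3 by simp
    ultimately show ?thesis using h[unfolded 3] hmin_pt_alt(1)[unfolded 3]
      unfolding 3 by (auto simp: C18_def abs_divide)
  next
    case 4
    then show ?thesis
      by (auto simp: Psi_hi_def C24_def psi_max_def hmin_pt_def C20_def abs_divide h hmin_pt_alt(2))
  next
    case 5
    have "hmin_pt = (if x0 \<ge> - M_num 2 \<beta> then x0 else x_plus 2 \<beta> x0)" unfolding hmin_pt_def using 5 by simp
    moreover have "psi_max = \<bar>psi_fun 2 \<beta> x0 (x_be_hat_minus \<beta> x0)\<bar>" unfolding psi_max_def using 5 by simp
    moreover have "Psi_hi = \<bar>C22 \<beta> x0\<bar>" unfolding Psi_hi_def C24_def using 5 by simp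
    ultimately show ?thesis using h[unfolded 5] hmin_pt_alt(2)[unfolded 5]
      unfolding 5 by (auto simp: C22_def abs_divide)
  qed
qed

text \<open>In X = - x the function is a constant times X^(1+k) (2|x0| - X)^k, and
  \<open>x_al_bar\<close> solves the critical equation of
  \<open>weighted_product_max\<close>.\<close>

lemma varphi_max:
  assumes "\<alpha> > 1/2" "2 * x0 < x" "x < 0"
  shows "\<bar>varphi_fun \<alpha> \<beta> x0 x\<bar> \<le> - varphi_fun \<alpha> \<beta> x0 (x_al_bar \<alpha> x0)"
proof -
  define k where "k = (2 * \<alpha> - 1) / (2 * (\<alpha> + 1))"
  have k: "k > 0" using assms by (simp add: k_def)
  have v: "- varphi_fun \<alpha> \<beta> x0 z = 6 / b * \<kappa> powr k * ((- z) powr (1 + k) * (2 * (- x0) - (- z)) powr k)"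
    if "z < 0" for z
  proof -
    have "g z powr ((2 * \<alpha> - 1) / 2) = (\<kappa> * q z) powr k" by (simp add: g_powr k_def mult.commute)
    also have "q z = (- z) * (2 * (- x0) - (- z))" by (simp add: q_def algebra_simps)
    finally have "g z powr ((2 * \<alpha> - 1) / 2) = \<kappa> powr k * ((- z) powr k * (2 * (- x0) - (- z)) powr k)"
      by (simp only: powr_mult)
    moreover have "(- z) powr (1 + k) = (- z) * (- z) powr k" using that by (simp add: powr_add)
    ultimately show ?thesis using assms by (simp add: varphi_fun_def b)
  qed
  let ?Y = "- x_al_bar \<alpha> x0"
  have Y: "?Y = (4 * \<alpha> + 1) / (3 * \<alpha>) * (- x0)" by (simp add: x_al_bar_def)
  have r: "0 < (4 * \<alpha> + 1) / (3 * \<alpha>)" "(4 * \<alpha> + 1) / (3 * \<alpha>) < 2" using assms by (auto simp: field_simps)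
  have Yb: "0 < ?Y" "?Y < 2 * (- x0)"
  proof -
    show "0 < ?Y" unfolding Y using r(1) x0 by (intro mult_pos_pos) auto
    show "?Y < 2 * (- x0)" unfolding Y using r(2) x0 by (intro mult_strict_right_mono) auto
  qed
  have crit: "(1 + k) * (2 * (- x0) - ?Y) = k * ?Y"
  proof -
    have "1 + k = (4 * \<alpha> + 1) / (2 * (\<alpha> + 1))" using \<alpha> by (simp add: k_def field_simps)
    moreover have "2 * (- x0) - ?Y = (2 * \<alpha> - 1) / (3 * \<alpha>) * (- x0)" unfolding Y using \<alpha> by (simp add: field_simps)
    ultimately show ?thesis unfolding Y k_def by simp
  qed
  have "(- x) powr (1 + k) * (2 * (- x0) - (- x)) powr k \<le> ?Y powr (1 + k) * (2 * (- x0) - ?Y) powr k"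
    using assms k Yb by (intro weighted_product_max crit) auto
  then have "- varphi_fun \<alpha> \<beta> x0 x \<le> - varphi_fun \<alpha> \<beta> x0 (x_al_bar \<alpha> x0)"
    unfolding v[OF assms(3)] v[OF Yb(1)[unfolded neg_0_less_iff_less]] using b
    by (intro mult_left_mono) auto
  moreover have "varphi_fun \<alpha> \<beta> x0 x \<le> 0" using v[OF assms(3)] b by (simp add: mult_nonneg_nonneg flip: neg_0_le_iff_le)
  ultimately show ?thesis by simp
qed

text \<open>The modulus depends on X = (x - x0)^2 only, as a constant times X^(1/2) (x0^2 - X)^k.
  The critical value is X = (\<alpha> + 1) / (\<alpha> + 4) * x0^2, whose root to the left of
  \<open>x0\<close> is \<open>x_al_bar_minus\<close>.\<close>

lemma phi_max:
  assumes "2 * x0 < x" "x < 0"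
  shows "\<bar>phi_fun \<alpha> \<beta> x0 x\<bar> \<le> - phi_fun \<alpha> \<beta> x0 (x_al_bar_minus \<alpha> x0)"
proof -
  define k where "k = 3 / (2 * (\<alpha> + 1))"
  have k: "k > 0" using \<alpha> by (simp add: k_def)
  have v: "\<bar>phi_fun \<alpha> \<beta> x0 z\<bar> = 4 * \<kappa> powr k * (((z - x0)\<^sup>2) powr (1/2) * (x0\<^sup>2 - (z - x0)\<^sup>2) powr k)" for z
  proof -
    have "g z powr (3/2) = \<kappa> powr k * (x0\<^sup>2 - (z - x0)\<^sup>2) powr k"
      by (simp add: g_powr k_def q_alt powr_mult)
    moreover have "((z - x0)\<^sup>2) powr (1/2) = \<bar>z - x0\<bar>" by (simp add: powr_half_sqrt)
    ultimately show ?thesis unfolding phi_fun_def abs_mult by simp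
  qed
  let ?r = "(\<alpha> + 1) / (\<alpha> + 4)"
  have r: "0 < ?r" "?r < 1" using \<alpha> by (auto simp: field_simps)
  have Y: "(x_al_bar_minus \<alpha> x0 - x0)\<^sup>2 = ?r * x0\<^sup>2" using r by (simp add: x_al_bar_minus_def power_mult_distrib)
  have "\<bar>phi_fun \<alpha> \<beta> x0 x\<bar> \<le> \<bar>phi_fun \<alpha> \<beta> x0 (x_al_bar_minus \<alpha> x0)\<bar>"
  proof (cases "x = x0")
    case True
    then show ?thesis by (simp add: phi_fun_def)
  next
    case False
    have "((x - x0)\<^sup>2) powr (1/2) * (x0\<^sup>2 - (x - x0)\<^sup>2) powr k \<le> (?r * x0\<^sup>2) powr (1/2) * (x0\<^sup>2 - ?r * x0\<^sup>2) powr k"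
    proof (rule weighted_product_max)
      show "(x - x0)\<^sup>2 < x0\<^sup>2" using q_bounds(2)[OF assms] by (simp add: q_alt)
      show "1 / 2 * (x0\<^sup>2 - ?r * x0\<^sup>2) = k * (?r * x0\<^sup>2)"
      proof -
        have "1 - ?r = 3 / (\<alpha> + 4)" using \<alpha> by (simp add: field_simps)
        then have A: "x0\<^sup>2 - ?r * x0\<^sup>2 = 3 / (\<alpha> + 4) * x0\<^sup>2"
          using left_diff_distrib[of 1 ?r "x0\<^sup>2"] by simp
        have B: "k * ?r = 3 / (2 * (\<alpha> + 4))"
        proof -
          have "\<alpha> + 1 \<noteq> 0" "\<alpha> + 4 \<noteq> 0" using \<alpha> by auto
          then show ?thesis by (simp add: k_def divide_simps) (simp add: algebra_simps)
        qed
        show ?thesis unfolding A mult.assoc[symmetric] B by simp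
      qed
      show "?r * x0\<^sup>2 < x0\<^sup>2" using mult_strict_right_mono[OF r(2), of "x0\<^sup>2"] x0 by simp
      show "0 < ?r * x0\<^sup>2" using r(1) x0 by (intro mult_pos_pos) auto
    qed (use k False in auto)
    then show ?thesis unfolding v Y by (intro mult_left_mono) auto
  qed
  moreover have "phi_fun \<alpha> \<beta> x0 (x_al_bar_minus \<alpha> x0) \<le> 0"
  proof -
    have "0 \<le> 4 * (sqrt ?r * \<bar>x0\<bar>) * g (x_al_bar_minus \<alpha> x0) powr (3/2)"
      using r by (intro mult_nonneg_nonneg) auto
    moreover have "x_al_bar_minus \<alpha> x0 - x0 = - (sqrt ?r * \<bar>x0\<bar>)" by (simp add: x_al_bar_minus_def)
    ultimately show ?thesis unfolding phi_fun_def by simp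
  qed
  ultimately show ?thesis by simp
qed

text \<open>Centred at \<open>x0\<close>, the numerator is the negative constant
  \<open>6 * x0 / b\<close> plus an odd cubic \<open>W\<close>, so its modulus is at most 6|x0|/b +
  W(s) with s = |x - x0|. The derivative of \<open>W\<close> vanishes at T with T^2 = (6 + 3 b^2
  x0^2) / (9 b^2), and T \<ge> |x0| exactly when |x0| \<le> 1 / b; this separates the two
  cases.\<close>

lemma psi_half:
  assumes "\<alpha> = 1/2" "2 * x0 < x" "x < 0"
  shows "\<bar>psi_fun \<alpha> \<beta> x0 x\<bar> \<le> psi_max"
proof -
  define W where "W t = 6 * t / b + 3 * b * t * (x0\<^sup>2 - t\<^sup>2)" for t
  have \<kappa>1: "\<kappa> = 3/4 * b" unfolding \<kappa>_def using assms(1) by simp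
  have psi: "psi_fun \<alpha> \<beta> x0 z = 6 * x0 / b + W (z - x0)" if "q z \<ge> 0" for z
  proof -
    have "(3/2) / (\<alpha> + 1) = 1" using assms(1) by simp
    then have "g z powr (3/2) = \<kappa> * q z"
      using that \<kappa> by (simp add: g_powr)
    then have "psi_fun \<alpha> \<beta> x0 z = 6 / b * z + 4 * (z - x0) * (3/4 * b * (x0\<^sup>2 - (z - x0)\<^sup>2))"
      unfolding psi_fun_def varphi_fun_def phi_fun_def if_P[OF assms(1)] b(3) by (simp add: \<kappa>1 q_alt)
    also have "6 / b * z = 6 * x0 / b + 6 * (z - x0) / b" using b(1) by (simp add: field_simps)
    also have "4 * t * (3/4 * b * X) = 3 * b * t * X" for t X by simp
    finally show ?thesis by (simp only: W_def add.assoc)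
  qed
  have Wodd: "W (- t) = - W t" for t by (simp add: W_def)
  define s where "s = \<bar>x - x0\<bar>"
  have s: "0 \<le> s" "s < - x0" using assms by (auto simp: s_def)
  have sx: "s\<^sup>2 \<le> x0\<^sup>2" using power_mono[of s "- x0" 2] s by simp
  have W0: "W s \<ge> 0" unfolding W_def using s sx b(1) by (intro add_nonneg_nonneg mult_nonneg_nonneg) auto
  have "\<bar>W (x - x0)\<bar> = W s" using W0 Wodd[of s] by (cases "x \<ge> x0") (auto simp: s_def abs_if split: if_splits)
  then have le: "\<bar>psi_fun \<alpha> \<beta> x0 x\<bar> \<le> - (6 * x0 / b) + W s"
  proof -
    have "\<bar>6 * x0 / b\<bar> = - (6 * x0 / b)" using x0 b(1) by (intro abs_of_nonpos divide_nonpos_pos) auto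
    then show ?thesis
      using psi[OF less_imp_le[OF q_bounds(2)[OF assms(2,3)]]] \<open>\<bar>W (x - x0)\<bar> = W s\<close>
        abs_triangle_ineq[of "6 * x0 / b" "W (x - x0)"] by simp
  qed
  show ?thesis
  proof (cases "x0 \<ge> - (1 / b)")
    case True
    have pm: "psi_max = \<bar>psi_fun \<alpha> \<beta> x0 (2 * x0)\<bar>" unfolding psi_max_def using assms(1) True by simp
    have "psi_fun \<alpha> \<beta> x0 (2 * x0) = 6 * x0 / b + W x0" using psi[of "2 * x0"] by (simp add: q_points)
    also have "\<dots> = 12 * x0 / b" by (simp add: W_def)
    finally have p2: "psi_max = - (12 * x0 / b)" unfolding pm using x0 b(1) by (simp add: divide_neg_pos)
    have bx: "b * - x0 \<le> 1" using True b(1) by (simp add: field_simps)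
    then have "(b * - x0)\<^sup>2 \<le> 1" using b(1) x0 by (intro power_le_one) (auto simp: mult_nonneg_nonpos)
    then have bx2: "b\<^sup>2 * x0\<^sup>2 \<le> 1" by (simp add: power_mult_distrib)
    have "W (- x0) - W s = (- x0 - s) * (6 - 3 * b\<^sup>2 * (s * (- x0 + s))) / b"
      using b(1) by (simp add: W_def field_simps power2_eq_square)
    also have "\<dots> \<ge> 0"
    proof -
      have "s * (- x0 + s) \<le> (- x0) * (- x0 + - x0)" using s by (intro mult_mono) auto
      then have "b\<^sup>2 * (s * (- x0 + s)) \<le> b\<^sup>2 * (2 * x0\<^sup>2)" by (intro mult_left_mono) (auto simp: power2_eq_square)
      then have "3 * b\<^sup>2 * (s * (- x0 + s)) \<le> 6" using bx2 by (simp add: mult_ac)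
      then show ?thesis using s b(1) by simp
    qed
    finally have "W s \<le> - (6 * x0 / b)" by (simp add: W_def)
    then show ?thesis using le p2 by simp
  next
    case False
    define T where "T = sqrt (6 + 3 * \<bar>\<beta>\<bar>\<^sup>2 * x0\<^sup>2) / (3 * \<bar>\<beta>\<bar>)"
    have T: "T > 0" unfolding T_def b(3) using b(1) by (intro divide_pos_pos real_sqrt_gt_zero add_pos_nonneg) auto
    have "(sqrt (6 + 3 * b\<^sup>2 * x0\<^sup>2))\<^sup>2 = 6 + 3 * b\<^sup>2 * x0\<^sup>2" by (rule real_sqrt_pow2) (intro add_nonneg_nonneg; simp)
    then have "T\<^sup>2 * (9 * b\<^sup>2) = 6 + 3 * b\<^sup>2 * x0\<^sup>2" unfolding T_def b(3) using b(1) by (simp add: power_divide power_mult_distrib)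
    then have T2: "3 * b * x0\<^sup>2 = 9 * b * T\<^sup>2 - 6 / b" using b(1) by (simp add: field_simps power2_eq_square)
    have WT: "W t = 9 * b * T\<^sup>2 * t - 3 * b * t ^ 3" for t
    proof -
      have "W t = 6 * t / b + (3 * b * x0\<^sup>2) * t - 3 * b * t ^ 3" by (simp add: W_def algebra_simps power2_eq_square power3_eq_cube)
      then show ?thesis unfolding T2 by (simp add: algebra_simps)
    qed
    \<comment> \<open>The cubic has a critical point at \<open>T\<close>, hence a double zero of the
      difference there; the missing quadratic term forces the third zero to be
      \<open>- 2 * T\<close>.\<close>
    have "W T - W s = 3 * b * ((s - T)\<^sup>2 * (s + 2 * T))" unfolding WT by (simp add: algebra_simps power2_eq_square power3_eq_cube)
    also have "\<dots> \<ge> 0" using b(1) s T by (intro mult_nonneg_nonneg) auto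
    finally have WsT: "W s \<le> W T" by simp
    have "b * - x0 > 1" using False b(1) by (simp add: field_simps)
    from one_less_power[OF this, of 2] have "b\<^sup>2 * x0\<^sup>2 > 1" by (simp add: power_mult_distrib)
    moreover have "9 * b\<^sup>2 * (x0\<^sup>2 - T\<^sup>2) = 6 * (b\<^sup>2 * x0\<^sup>2 - 1)" using \<open>T\<^sup>2 * (9 * b\<^sup>2) = _\<close> by (simp add: algebra_simps)
    ultimately have "0 < 9 * b\<^sup>2 * (x0\<^sup>2 - T\<^sup>2)" by simp
    then have "x0\<^sup>2 - T\<^sup>2 \<ge> 0" using b(1) by (simp add: zero_less_mult_iff)
    have "x_be_tilde_minus \<beta> x0 - x0 = - T" by (simp add: x_be_tilde_minus_def T_def)
    moreover from this have "q (x_be_tilde_minus \<beta> x0) \<ge> 0" using \<open>x0\<^sup>2 - T\<^sup>2 \<ge> 0\<close> by (simp add: q_alt)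
    ultimately have "psi_fun \<alpha> \<beta> x0 (x_be_tilde_minus \<beta> x0) = 6 * x0 / b - W T" using psi Wodd by simp
    moreover have "psi_max = \<bar>psi_fun \<alpha> \<beta> x0 (x_be_tilde_minus \<beta> x0)\<bar>" unfolding psi_max_def using assms(1) False by simp
    ultimately show ?thesis using le WsT by linarith
  qed
qed

text \<open>For \<alpha> = 2 both summands contain the same power 3/2 of \<open>g\<close>, and this
  power squared is \<open>\<kappa> * q x\<close>. The squared numerator is thus
  \<open>\<kappa>\<close> times (a t - c)^2 (x0^2 - t^2) with t = x - x0, and it is larger for
  negative t than for positive t of the same modulus.\<close>

lemma psi_two:
  assumes "\<alpha> = 2" "2 * x0 < x" "x < 0"
  shows "\<bar>psi_fun \<alpha> \<beta> x0 x\<bar> \<le> psi_max"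
proof -
  define m where "m = 3 + 2 * b"
  define c where "c = 6 * - x0 / b"
  define a where "a = 2 * m / b"
  \<comment> \<open>The positive root of 2 m t^2 + 3|x0| t - m x0^2 = 0, which is the stationarity
    equation of (a t + c)^2 (x0^2 - t^2) cleared of denominators.\<close>
  define T where "T = - x0 * (sqrt (8 * m\<^sup>2 + 9) - 3) / (4 * m)"
  have m: "m > 0" using b(1) by (simp add: m_def)
  have c: "c > 0" unfolding c_def using b(1) x0 by (intro divide_pos_pos mult_pos_pos) auto
  have a: "a > 0" unfolding a_def using b(1) m by (intro divide_pos_pos mult_pos_pos) auto
  have sq3: "3 < sqrt (8 * m\<^sup>2 + 9)" using m by (intro real_less_rsqrt) auto
  then have T0: "T > 0" unfolding T_def using m x0 by (intro divide_pos_pos mult_pos_pos) auto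
  have sqm: "sqrt (8 * m\<^sup>2 + 9) < 4 * m + 3"
    using m by (intro real_less_lsqrt)
      (auto simp: power2_eq_square algebra_simps intro!: add_pos_pos mult_pos_pos)
  have "T < - x0"
  proof -
    have "- x0 * (sqrt (8 * m\<^sup>2 + 9) - 3) < - x0 * (4 * m)" using sqm x0 by (intro mult_strict_left_mono) auto
    then show ?thesis unfolding T_def using m by (simp add: field_simps)
  qed
  then have TX: "T\<^sup>2 < x0\<^sup>2" using power_strict_mono[of T "- x0" 2] T0 by simp
  \<comment> \<open>\<open>T\<close> is the critical point of \<open>(a t + c)\<^sup>2 (x0\<^sup>2 - t\<^sup>2)\<close> on the positive axis\<close>
  have crit: "a * (x0\<^sup>2 - T\<^sup>2) = T * (a * T + c)"
  proof -
    define R where "R = sqrt (8 * m\<^sup>2 + 9)"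
    have R2: "R\<^sup>2 = 8 * m\<^sup>2 + 9" unfolding R_def by (rule real_sqrt_pow2) simp
    have T4: "4 * m * T = - x0 * (R - 3)" unfolding T_def R_def using m by simp
    have "8 * m * (2 * m * T\<^sup>2 + 3 * (- x0) * T - m * x0\<^sup>2) = (4 * m * T)\<^sup>2 + 6 * (- x0) * (4 * m * T) - 8 * m\<^sup>2 * x0\<^sup>2"
      by (simp add: power2_eq_square algebra_simps)
    also have "\<dots> = x0\<^sup>2 * (R\<^sup>2 - 9 - 8 * m\<^sup>2)" unfolding T4 by (simp add: power2_eq_square algebra_simps)
    also have "\<dots> = 0" by (simp add: R2)
    finally have "2 * m * T\<^sup>2 + 3 * (- x0) * T - m * x0\<^sup>2 = 0" using m by simp
    then show ?thesis unfolding a_def c_def using b(1) by (simp add: field_simps power2_eq_square)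
  qed
  define F where "F t = (a * t + c)\<^sup>2 * (x0\<^sup>2 - t\<^sup>2)" for t
  \<comment> \<open>The logarithmic tangent argument of \<open>weighted_product_max\<close>. By
    \<open>crit\<close> the linear terms combine with the quadratic one to - (t - T)^2 / (x0^2 -
    T^2).\<close>
  have F: "F t \<le> F T" if "0 \<le> t" "t\<^sup>2 < x0\<^sup>2" for t
  proof -
    have p: "a * t + c > 0" "a * T + c > 0" "x0\<^sup>2 - t\<^sup>2 > 0" "x0\<^sup>2 - T\<^sup>2 > 0"
      using that a c T0 TX by (auto intro: add_nonneg_pos)
    have 1: "ln (a * t + c) - ln (a * T + c) \<le> (a * t + c) / (a * T + c) - 1"
      using ln_le_minus_one[of "(a * t + c) / (a * T + c)"] p by (simp add: ln_div)
    have 2: "ln (x0\<^sup>2 - t\<^sup>2) - ln (x0\<^sup>2 - T\<^sup>2) \<le> (x0\<^sup>2 - t\<^sup>2) / (x0\<^sup>2 - T\<^sup>2) - 1"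
      using ln_le_minus_one[of "(x0\<^sup>2 - t\<^sup>2) / (x0\<^sup>2 - T\<^sup>2)"] p by (simp add: ln_div)
    have 3: "(a * t + c) / (a * T + c) - 1 = (t - T) * (T / (x0\<^sup>2 - T\<^sup>2))"
    proof -
      have "a / (a * T + c) = T / (x0\<^sup>2 - T\<^sup>2)" using crit p by (simp add: frac_eq_eq)
      moreover have "(a * t + c) / (a * T + c) - 1 = (t - T) * (a / (a * T + c))" using p by (simp add: field_simps)
      ultimately show ?thesis by simp
    qed
    have 4: "(x0\<^sup>2 - t\<^sup>2) / (x0\<^sup>2 - T\<^sup>2) - 1 = (T\<^sup>2 - t\<^sup>2) / (x0\<^sup>2 - T\<^sup>2)" using p by (simp add: field_simps)
    have "2 * (ln (a * t + c) - ln (a * T + c)) + (ln (x0\<^sup>2 - t\<^sup>2) - ln (x0\<^sup>2 - T\<^sup>2))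
        \<le> 2 * ((t - T) * (T / (x0\<^sup>2 - T\<^sup>2))) + (T\<^sup>2 - t\<^sup>2) / (x0\<^sup>2 - T\<^sup>2)"
      using 1 2 unfolding 3 4 by (intro add_mono mult_left_mono) auto
    also have "\<dots> = - ((t - T)\<^sup>2) / (x0\<^sup>2 - T\<^sup>2)"
      by (simp add: power2_eq_square algebra_simps flip: add_divide_distrib diff_divide_distrib)
    also have "\<dots> \<le> 0" using p by simp
    finally have "ln (F t) \<le> ln (F T)" unfolding F_def using p by (simp add: ln_mult ln_realpow)
    then show ?thesis using p by (simp add: F_def)
  qed
  have psi2: "(psi_fun \<alpha> \<beta> x0 z)\<^sup>2 = \<kappa> * ((a * (z - x0) - c)\<^sup>2 * (x0\<^sup>2 - (z - x0)\<^sup>2))" if "q z \<ge> 0" for z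
  proof -
    have "g z powr (3/2) = (\<kappa> * q z) powr ((3/2) / (\<alpha> + 1))" by (rule g_powr)
    also have "(3/2) / (\<alpha> + 1) = 1/2" using assms(1) by simp
    finally have "(g z powr (3/2))\<^sup>2 = \<kappa> * q z"
      using that \<kappa> by (simp add: powr_half_sqrt)
    moreover have "psi_fun \<alpha> \<beta> x0 z = (a * (z - x0) - c) * g z powr (3/2)"
      using assms(1) b(1) by (simp add: psi_fun_def varphi_fun_def phi_fun_def b(3) a_def c_def m_def field_simps)
    ultimately show ?thesis by (simp add: power_mult_distrib q_alt mult_ac)
  qed
  define t where "t = \<bar>x - x0\<bar>"
  have t: "0 \<le> t" "t\<^sup>2 < x0\<^sup>2" using q_bounds(2)[OF assms(2,3)] by (auto simp: t_def q_alt)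
  have "(a * (x - x0) - c)\<^sup>2 \<le> (a * t + c)\<^sup>2"
  proof (rule abs_le_square_iff[THEN iffD1])
    have "\<bar>a * (x - x0) - c\<bar> \<le> \<bar>a * (x - x0)\<bar> + \<bar>c\<bar>" by (rule abs_triangle_ineq4)
    also have "\<dots> = a * t + c" using a c by (simp add: t_def abs_mult)
    finally show "\<bar>a * (x - x0) - c\<bar> \<le> \<bar>a * t + c\<bar>" by simp
  qed
  then have "(psi_fun \<alpha> \<beta> x0 x)\<^sup>2 \<le> \<kappa> * F t"
    unfolding psi2[OF less_imp_le[OF q_bounds(2)[OF assms(2,3)]]] F_def using \<kappa> t
    by (intro mult_left_mono) (auto simp: t_def intro!: mult_right_mono)
  also have "\<dots> \<le> \<kappa> * F T" using F[OF t] \<kappa> by simp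
  also have "\<kappa> * F T = (psi_fun \<alpha> \<beta> x0 (x_be_hat_minus \<beta> x0))\<^sup>2"
  proof -
    have "x_be_hat_minus \<beta> x0 - x0 = ((9 + 8 * b) * x0 - sqrt (8 * m\<^sup>2 + 9) * (- x0)) / (4 * m) - x0"
      unfolding x_be_hat_minus_def b(3) m_def using x0 by simp
    also have "\<dots> = - T" unfolding T_def using m by (simp add: field_simps) (simp add: m_def algebra_simps)
    finally have z: "x_be_hat_minus \<beta> x0 - x0 = - T" .
    then have "q (x_be_hat_minus \<beta> x0) \<ge> 0" using TX by (simp add: q_alt)
    from psi2[OF this] have e2: "(psi_fun \<alpha> \<beta> x0 (x_be_hat_minus \<beta> x0))\<^sup>2 = \<kappa> * ((a * - T - c)\<^sup>2 * (x0\<^sup>2 - (- T)\<^sup>2))"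
      unfolding z .
    show ?thesis unfolding e2 F_def by (simp add: power2_eq_square algebra_simps)
  qed
  finally have "\<bar>psi_fun \<alpha> \<beta> x0 x\<bar> \<le> \<bar>psi_fun \<alpha> \<beta> x0 (x_be_hat_minus \<beta> x0)\<bar>" by (simp add: abs_le_square_iff)
  then show ?thesis unfolding psi_max_def using assms(1) by simp
qed

lemma psi_le:
  assumes "2 * x0 < x" "x < 0"
  shows "\<bar>psi_fun \<alpha> \<beta> x0 x\<bar> \<le> psi_max"
proof -
  consider "\<alpha> = 1/2" | "\<alpha> = 2" | "\<alpha> > 1/2" "\<alpha> \<noteq> 2" using \<alpha> by linarith
  then show ?thesis
  proof cases
    case 3
    have "\<bar>psi_fun \<alpha> \<beta> x0 x\<bar> \<le> - S_num \<alpha> \<beta> x0"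
      using varphi_max[OF 3(1) assms] phi_max[OF assms] unfolding psi_fun_def S_num_def by linarith
    also have "\<dots> \<le> psi_max" unfolding psi_max_def using 3 by simp
    finally show ?thesis .
  qed (use psi_half[OF _ assms] psi_two[OF _ assms] in simp_all)
qed

lemma Psi_le:
  assumes "2 * x0 < x" "x < 0"
  shows "\<bar>Psi_fun \<alpha> \<beta> x0 x\<bar> \<le> C24 \<alpha> \<beta> x0"
proof -
  note m = h_min[OF assms]
  have h: "0 < h_fun \<alpha> \<beta> x0 hmin_pt" "h_fun \<alpha> \<beta> x0 hmin_pt \<le> h_fun \<alpha> \<beta> x0 x"
    using m H_pos[OF m(2,3)] by (auto simp: h_eq)
  have "\<bar>Psi_fun \<alpha> \<beta> x0 x\<bar> = \<bar>psi_fun \<alpha> \<beta> x0 x\<bar> / h_fun \<alpha> \<beta> x0 x"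
    unfolding Psi_fun_def abs_divide using h by simp
  also have "\<dots> \<le> psi_max / h_fun \<alpha> \<beta> x0 hmin_pt"
    by (rule frac_le[OF order_trans[OF abs_ge_zero psi_le[OF assms]] psi_le[OF assms] h])
  also have "\<dots> = C24 \<alpha> \<beta> x0" unfolding Psi_hi_eq[symmetric] by (rule Psi_hi_def)
  finally show ?thesis .
qed

end

section \<open>Geometry of the domain\<close>

lemma set_integral_split_at:
  fixes f :: "real \<Rightarrow> real"
  assumes "a < b" "b < c" "set_integrable lebesgue {a<..<b} f" "set_integrable lebesgue {b<..<c} f"
  shows "set_integrable lebesgue {a<..<c} f"
    and "(LINT x:{a<..<c}|lebesgue. f x) = (LINT x:{a<..<b}|lebesgue. f x) + (LINT x:{b<..<c}|lebesgue. f x)"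
proof -
  have U: "{a<..<c} = ({a<..<b} \<union> {b<..<c}) \<union> {b}" using assms(1,2) by auto
  have i1: "set_integrable lebesgue ({a<..<b} \<union> {b<..<c}) f"
    by (intro set_integrable_Un assms) auto
  have i2: "set_integrable lebesgue {b} f" by (rule absolutely_integrable_negligible) simp
  show "set_integrable lebesgue {a<..<c} f"
    unfolding U by (rule set_integrable_Un[OF i1 i2]) auto
  have "(LINT x:{b}|lebesgue. f x) = 0"
    using set_lebesgue_integral_eq_integral(2)[OF i2] by simp
  then have "(LINT x:{a<..<c}|lebesgue. f x) = (LINT x:{a<..<b} \<union> {b<..<c}|lebesgue. f x)"
    unfolding U by (subst set_integral_Un[OF _ i1 i2]) auto
  then show "(LINT x:{a<..<c}|lebesgue. f x) = (LINT x:{a<..<b}|lebesgue. f x) + (LINT x:{b<..<c}|lebesgue. f x)"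
    by (subst (asm) set_integral_Un[OF _ assms(3,4)]) auto
qed

lemma set_integral_change_of_variables:
  fixes f \<phi> :: "real \<Rightarrow> real"
  assumes "S \<in> sets lebesgue" "\<And>x. x \<in> S \<Longrightarrow> (\<phi> has_real_derivative \<phi>' x) (at x)" "inj_on \<phi> S"
    and "set_integrable lebesgue (\<phi> ` S) f"
  shows "set_integrable lebesgue S (\<lambda>x. \<bar>\<phi>' x\<bar> * f (\<phi> x))"
    and "(LINT x:S|lebesgue. \<bar>\<phi>' x\<bar> * f (\<phi> x)) = (LINT y:\<phi> ` S|lebesgue. f y)"
proof -
  have "(\<lambda>x. \<bar>\<phi>' x\<bar> * f (\<phi> x)) absolutely_integrable_on S \<and>
      integral S (\<lambda>x. \<bar>\<phi>' x\<bar> * f (\<phi> x)) = integral (\<phi> ` S) f"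
    using has_absolute_integral_change_of_variables_1'[OF assms(1) _ assms(3), of \<phi>' f "integral (\<phi> ` S) f"]
      has_field_derivative_at_within[OF assms(2)] assms(4) by blast
  then show "set_integrable lebesgue S (\<lambda>x. \<bar>\<phi>' x\<bar> * f (\<phi> x))"
    "(LINT x:S|lebesgue. \<bar>\<phi>' x\<bar> * f (\<phi> x)) = (LINT y:\<phi> ` S|lebesgue. f y)"
    using assms(4) by (simp_all add: set_lebesgue_integral_eq_integral)
qed

section \<open>The characteristics and the lower boundary graph\<close>

context tricomi_params
begin

text \<open>Horizontal distance travelled by a characteristic between height y and the axis.
  Clamping it to 0 above the axis lets inequalities in \<open>A\<close> and \<open>B\<close>
  describe the domain at every height.\<close>

definition rt :: "real \<Rightarrow> real" where "rt y = (2/3) * max 0 (- y) powr (3/2)"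
definition A where "A y = 2 * x0 + rt y"
definition B where "B y = - rt y"
text \<open>Both characteristics as one graph over [2 x0, 0]: the minimum selects AC left of
  \<open>x0\<close> and BC right of it.\<close>

definition low where "low x = - ((3/2 * min (x - 2 * x0) (- x)) powr (2/3))"
abbreviation "yC \<equiv> y_C x0"

lemma rt_nonneg: "rt y \<ge> 0" and rt_0: "y \<ge> 0 \<Longrightarrow> rt y = 0" by (simp_all add: rt_def)

lemma rt_less_iff:
  assumes "\<mu> > 0"
  shows "rt y < \<mu> \<longleftrightarrow> - ((3/2 * \<mu>) powr (2/3)) < y"
proof -
  define m where "m = max 0 (- y)"
  have m: "m \<ge> 0" unfolding m_def by simp
  have p: "((3/2 * \<mu>) powr (2/3)) powr (3/2) = 3/2 * \<mu>" using assms by (simp add: powr_powr)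
  have pos: "0 < (3/2 * \<mu>) powr (2/3)" using assms by simp
  have "rt y < \<mu> \<longleftrightarrow> m powr (3/2) < 3/2 * \<mu>" unfolding rt_def m_def by auto
  also have "\<dots> \<longleftrightarrow> m < (3/2 * \<mu>) powr (2/3)"
  proof
    assume "m < (3/2 * \<mu>) powr (2/3)"
    then have "m powr (3/2) < ((3/2 * \<mu>) powr (2/3)) powr (3/2)" using m by (intro powr_less_mono2) auto
    then show "m powr (3/2) < 3/2 * \<mu>" by (simp only: p)
  next
    assume "m powr (3/2) < 3/2 * \<mu>"
    then show "m < (3/2 * \<mu>) powr (2/3)"
      using powr_mono2[of "3/2" "(3/2 * \<mu>) powr (2/3)" m] p by force
  qed
  also have "\<dots> \<longleftrightarrow> - ((3/2 * \<mu>) powr (2/3)) < y" using pos by (auto simp: m_def)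
  finally show ?thesis .
qed

lemma rt_powr:
  assumes "\<mu> \<ge> 0"
  shows "rt (- ((3/2 * \<mu>) powr (2/3))) = \<mu>"
  using assms by (simp add: rt_def powr_powr)

lemma powr_rt: "y \<le> 0 \<Longrightarrow> - ((3/2 * rt y) powr (2/3)) = y"
  by (simp add: rt_def powr_powr)

lemma yC: "yC < 0" "rt yC = - x0" "low x0 = yC"
proof -
  have e: "3 * \<bar>x0\<bar> / 2 = 3/2 * (- x0)" using x0 by simp
  show "rt yC = - x0" unfolding y_C_def e using x0 by (intro rt_powr) simp
  show "yC < 0" unfolding y_C_def using x0 by simp
  show "low x0 = yC" unfolding y_C_def e low_def by simp
qed

lemma rt_lt_iff: "rt y < - x0 \<longleftrightarrow> yC < y"
proof -
  have e: "3 * \<bar>x0\<bar> / 2 = 3/2 * (- x0)" using x0 by simp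
  show ?thesis unfolding y_C_def e using x0 by (intro rt_less_iff) simp
qed

lemma rt_le: "yC \<le> y \<Longrightarrow> rt y \<le> - x0"
  using rt_lt_iff[of y] yC(2) by (cases "y = yC") auto

lemma low_less_iff:
  assumes "2 * x0 < x" "x < 0"
  shows "low x < y \<longleftrightarrow> A y < x \<and> x < B y"
  using rt_less_iff[of "min (x - 2 * x0) (- x)" y] assms by (auto simp: low_def A_def B_def)

lemma low_A: "yC \<le> y \<Longrightarrow> y \<le> 0 \<Longrightarrow> low (A y) = y"
proof -
  assume y: "yC \<le> y" "y \<le> 0"
  have "min (A y - 2 * x0) (- A y) = rt y" using rt_le[OF y(1)] by (auto simp: A_def min_def)
  then show ?thesis using powr_rt[OF y(2)] by (simp add: low_def)
qed

lemma low_B: "yC \<le> y \<Longrightarrow> y \<le> 0 \<Longrightarrow> low (B y) = y"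
proof -
  assume y: "yC \<le> y" "y \<le> 0"
  have "min (B y - 2 * x0) (- B y) = rt y" using rt_le[OF y(1)] by (auto simp: B_def min_def)
  then show ?thesis using powr_rt[OF y(2)] by (simp add: low_def)
qed

lemma A_low: "2 * x0 \<le> x \<Longrightarrow> x \<le> x0 \<Longrightarrow> A (low x) = x"
  using rt_powr[of "x - 2 * x0"] x0 by (simp add: low_def A_def min_def)

lemma B_low: "x0 \<le> x \<Longrightarrow> x \<le> 0 \<Longrightarrow> B (low x) = x"
  using rt_powr[of "- x"] x0 by (cases "x = x0") (simp_all add: low_def B_def min_def)

lemma low_neg: "2 * x0 < x \<Longrightarrow> x < 0 \<Longrightarrow> low x < 0" by (simp add: low_def)

lemma low_bounds: "yC \<le> low x" if "2 * x0 \<le> x" "x \<le> 0"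
proof -
  have "(3/2 * min (x - 2 * x0) (- x)) powr (2/3) \<le> (3/2 * (- x0)) powr (2/3)"
    using that by (intro powr_mono2) auto
  also have "3/2 * (- x0) = 3 * \<bar>x0\<bar> / 2" using x0 by simp
  finally show ?thesis by (simp add: low_def y_C_def)
qed

lemma g_pos: "2 * x0 < x \<Longrightarrow> x < 0 \<Longrightarrow> 0 < g x"
  using q_bounds(2)[of x] \<kappa> by (simp add: g_eq)

lemma g_nonneg: "0 \<le> g x" by (simp add: g_eq)

lemma AC_iff: "(x, y) \<in> AC x0 \<longleftrightarrow> yC \<le> y \<and> y \<le> 0 \<and> x = A y"
  by (auto simp: AC_def A_def rt_def max_def field_simps)

lemma BC_iff: "(x, y) \<in> BC x0 \<longleftrightarrow> yC \<le> y \<and> y \<le> 0 \<and> x = B y"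
  by (auto simp: BC_def B_def rt_def max_def field_simps)

lemma sigma_iff: "(x, y) \<in> sigma_arc \<alpha> \<beta> x0 \<longleftrightarrow> 2 * x0 \<le> x \<and> x \<le> 0 \<and> y = g x"
  by (auto simp: sigma_arc_def)

definition bdry where "bdry = AC x0 \<union> BC x0 \<union> sigma_arc \<alpha> \<beta> x0"

lemma bdry_strip: "(x, y) \<in> bdry \<Longrightarrow> 2 * x0 \<le> x \<and> x \<le> 0"
  unfolding bdry_def Un_iff AC_iff BC_iff sigma_iff A_def B_def
  using rt_le[of y] rt_nonneg[of y] x0 by auto

lemma bdry_inner:
  assumes "2 * x0 < x" "x < 0"
  shows "(x, y) \<in> bdry \<longleftrightarrow> y = low x \<or> y = g x"
proof
  assume "(x, y) \<in> bdry"
  then show "y = low x \<or> y = g x"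
    unfolding bdry_def Un_iff AC_iff BC_iff sigma_iff using low_A low_B by auto
next
  assume "y = low x \<or> y = g x"
  then show "(x, y) \<in> bdry"
  proof
    assume y: "y = low x"
    show ?thesis
    proof (cases "x \<le> x0")
      case True
      then show ?thesis unfolding bdry_def Un_iff AC_iff y
        using A_low[of x] low_neg[of x] low_bounds[of x] assms by simp
    next
      case False
      then show ?thesis unfolding bdry_def Un_iff BC_iff y
        using B_low[of x] low_neg[of x] low_bounds[of x] assms by simp
    qed
  qed (use assms in \<open>simp add: bdry_def sigma_iff\<close>)
qed

end

section \<open>The domain as the region between two graphs\<close>

locale tricomi_domain = tricomi_params +
  fixes \<Omega> :: "(real \<times> real) set"
  assumes dom: "is_tricomi_domain \<Omega> \<alpha> \<beta> x0"
begin

lemma dom_open: "open \<Omega>" and dom_bounded: "bounded \<Omega>" and frontier_dom: "frontier \<Omega> = bdry"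
  using dom by (auto simp: is_tricomi_domain_def bdry_def)

lemma dom_bdry: "\<Omega> \<inter> bdry = {}"
  using dom_open frontier_disjoint_eq[of \<Omega>] frontier_dom by blast

lemma ray:
  assumes "(x, y) \<in> \<Omega>" "(a, c) \<noteq> (0 :: real \<times> real)"
  obtains d where "d > 0" "(x + d * a, y + d * c) \<in> bdry"
proof -
  have "(x, y) \<in> interior \<Omega>" using assms(1) dom_open by (simp add: interior_open)
  from ray_to_frontier[OF dom_bounded this assms(2)] obtain d where
    "0 < d" "(x, y) + d *\<^sub>R (a, c) \<in> frontier \<Omega>" by blast
  then show ?thesis using that[of d] by (simp add: frontier_dom)
qed

text \<open>Every ray from a point of a bounded open set meets the frontier. The two horizontal rays
  confine x to the strip, and the two vertical rays can only meet the graphs of \<open>low\<close>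
  and \<open>g\<close>.\<close>

lemma dom_subset:
  assumes "(x, y) \<in> \<Omega>"
  shows "2 * x0 < x" "x < 0" "low x < y" "y < g x"
proof -
  have nz: "(1, 0) \<noteq> (0 :: real \<times> real)" "(- 1, 0) \<noteq> (0 :: real \<times> real)"
    "(0, 1) \<noteq> (0 :: real \<times> real)" "(0, - 1) \<noteq> (0 :: real \<times> real)"
    by (simp_all add: zero_prod_def)
  obtain d where "d > 0" "(x + d * 1, y + d * 0) \<in> bdry" by (rule ray[OF assms nz(1)])
  then show x1: "x < 0" using bdry_strip[of "x + d * 1" "y + d * 0"] by simp
  obtain d where "d > 0" "(x + d * - 1, y + d * 0) \<in> bdry" by (rule ray[OF assms nz(2)])
  then show x2: "2 * x0 < x" using bdry_strip[of "x + d * - 1" "y + d * 0"] by simp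
  have lg: "low x < g x" using low_neg[OF x2 x1] g_pos[OF x2 x1] by simp
  obtain d where "d > 0" "(x + d * 0, y + d * 1) \<in> bdry" by (rule ray[OF assms nz(3)])
  then show y1: "y < g x" using bdry_inner[OF x2 x1, of "y + d"] lg by auto
  obtain d where "d > 0" "(x + d * 0, y + d * - 1) \<in> bdry" by (rule ray[OF assms nz(4)])
  then show "low x < y" using bdry_inner[OF x2 x1, of "y - d"] y1 by auto
qed

text \<open>The region \<open>R\<close> between the graphs is connected and misses the frontier, so
  it cannot lie partly inside and partly outside \<Omega>. It contains \<Omega>, which is nonempty
  because its frontier is.\<close>

lemma dom_iff: "(x, y) \<in> \<Omega> \<longleftrightarrow> 2 * x0 < x \<and> x < 0 \<and> low x < y \<and> y < g x"
proof -
  define R where "R = {(x, y). 2 * x0 < x \<and> x < 0 \<and> low x < y \<and> y < g x}"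
  \<comment> \<open>Each \<open>S x\<close> is a vertical slice joined to the segment of the axis.
    All of them contain \<open>(x0, 0)\<close>, so their union is connected.\<close>
  define S where "S x = {x} \<times> {low x<..<g x} \<union> {2 * x0<..<0} \<times> {0}" for x
  have sub: "\<Omega> \<subseteq> R"
  proof
    fix p assume "p \<in> \<Omega>"
    then show "p \<in> R" using dom_subset[of "fst p" "snd p"] by (simp add: R_def case_prod_unfold)
  qed
  have axis: "low x < 0" "0 < g x" if "x \<in> {2 * x0<..<0}" for x
    using low_neg[of x] g_pos[of x] that by simp_all
  have R: "R = \<Union> (S ` {2 * x0<..<0})"
  proof (intro equalityI subsetI)
    fix p assume "p \<in> R"
    then have "fst p \<in> {2 * x0<..<0}" "p \<in> S (fst p)"
      by (cases p; simp add: R_def S_def)+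
    then show "p \<in> \<Union> (S ` {2 * x0<..<0})" by (rule UN_I)
  next
    fix p assume "p \<in> \<Union> (S ` {2 * x0<..<0})"
    then obtain x where "x \<in> {2 * x0<..<0}" "p \<in> S x" by (rule UN_E)
    then show "p \<in> R" using axis[of "fst p"] by (cases p) (auto simp: R_def S_def)
  qed
  have "connected R" unfolding R
  proof (rule connected_Union)
    fix s assume "s \<in> S ` {2 * x0<..<0}"
    then obtain x where x: "x \<in> {2 * x0<..<0}" "s = S x" by blast
    have "convex ({x} \<times> {low x<..<g x})" "convex ({2 * x0<..<0} \<times> {0::real})"
      by (rule convex_Times; simp)+
    note c = this(1)[THEN convex_connected] this(2)[THEN convex_connected]
    have "(x, 0) \<in> ({x} \<times> {low x<..<g x}) \<inter> ({2 * x0<..<0} \<times> {0})" using axis[OF x(1)] x(1) by simp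
    then have "({x} \<times> {low x<..<g x}) \<inter> ({2 * x0<..<0} \<times> {0}) \<noteq> {}" by blast
    then show "connected s" unfolding x(2) S_def by (rule connected_Un[OF c])
  next
    have "(x0, 0) \<in> S x" for x using x0 by (simp add: S_def)
    then have "(x0, 0) \<in> \<Inter> (S ` {2 * x0<..<0})" by blast
    then show "\<Inter> (S ` {2 * x0<..<0}) \<noteq> {}" by blast
  qed
  moreover have "p \<notin> bdry" if "p \<in> R" for p
    using that bdry_inner[of "fst p" "snd p"] by (cases p) (auto simp: R_def)
  then have "R \<inter> bdry = {}" by blast
  moreover have "\<Omega> \<noteq> {}"
  proof
    assume "\<Omega> = {}"
    moreover have "(0, 0) \<in> bdry" using x0 yC(1) by (simp add: bdry_def BC_iff B_def rt_0)
    ultimately show False using frontier_dom by simp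
  qed
  ultimately have "\<not> (R \<inter> \<Omega> \<noteq> {} \<and> R - \<Omega> \<noteq> {})" "\<Omega> \<noteq> {}"
    using connected_Int_frontier[of R \<Omega>] frontier_dom by auto
  then have "R = \<Omega>" using sub by auto
  then have "(x, y) \<in> \<Omega> \<longleftrightarrow> (x, y) \<in> R" by simp
  then show ?thesis by (simp add: R_def)
qed

lemma dom_iff_AB: "(x, y) \<in> \<Omega> \<longleftrightarrow> 2 * x0 < x \<and> x < 0 \<and> A y < x \<and> x < B y \<and> y < g x"
  by (auto simp: dom_iff low_less_iff)

lemma closure_dom_slice_y:
  assumes "2 * x0 < x" "x < 0" "low x \<le> y" "y \<le> g x"
  shows "(x, y) \<in> closure \<Omega>"
proof -
  have lg: "low x < g x" using low_neg[OF assms(1,2)] g_pos[OF assms(1,2)] by simp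
  have "(\<lambda>y. (x, y)) ` {low x<..<g x} \<subseteq> \<Omega>" using assms(1,2) by (auto simp: dom_iff)
  then have "(\<lambda>y. (x, y)) ` closure {low x<..<g x} \<subseteq> closure \<Omega>"
    using closure_subset[of \<Omega>]
    by (intro image_closure_subset continuous_intros closed_closure) (rule subset_trans)
  then show ?thesis using lg assms(3,4) by (auto simp: image_subset_iff)
qed

text \<open>The inverse of \<open>g\<close> on \<open>[x0, 0]\<close> is \<open>y \<mapsto> x0 + r y\<close>.\<close>

definition r where "r y = sqrt (x0\<^sup>2 - y powr (\<alpha> + 1) / \<kappa>)"

definition yM where "yM = g x0"

lemma yM_pos: "yM > 0" unfolding yM_def using x0 by (intro g_pos) auto

lemma g_powr_Suc: "2 * x0 \<le> x \<Longrightarrow> x \<le> 0 \<Longrightarrow> g x powr (\<alpha> + 1) = \<kappa> * q x"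
  using q_bounds(3) \<kappa> \<alpha> by (simp add: g_powr)

lemma less_g_iff:
  assumes "0 < y" "2 * x0 \<le> x" "x \<le> 0"
  shows "y < g x \<longleftrightarrow> (x - x0)\<^sup>2 < x0\<^sup>2 - y powr (\<alpha> + 1) / \<kappa>"
proof -
  have "y < g x \<longleftrightarrow> y powr (\<alpha> + 1) < g x powr (\<alpha> + 1)"
    using powr_less_mono2[of "\<alpha> + 1" y "g x"] powr_mono2[of "\<alpha> + 1" "g x" y] assms \<alpha> g_nonneg by fastforce
  also have "\<dots> \<longleftrightarrow> y powr (\<alpha> + 1) / \<kappa> < q x"
    using g_powr_Suc[OF assms(2,3)] \<kappa> by (simp add: field_simps)
  finally show ?thesis by (auto simp: q_alt)
qed

lemma r_bounds:
  assumes "0 < y" "y < yM"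
  shows "0 < r y" "r y < - x0"
proof -
  have "0 < x0\<^sup>2 - y powr (\<alpha> + 1) / \<kappa>" using less_g_iff[of y x0] assms x0 by (simp add: yM_def)
  then show "0 < r y" by (simp add: r_def)
  have "x0\<^sup>2 - y powr (\<alpha> + 1) / \<kappa> < (- x0)\<^sup>2" using assms \<kappa> by simp
  then show "r y < - x0" unfolding r_def using x0 by (intro real_less_lsqrt) auto
qed

lemma g_le_yM: "2 * x0 \<le> x \<Longrightarrow> x \<le> 0 \<Longrightarrow> g x \<le> yM"
  unfolding yM_def g_eq using q_bounds \<kappa> \<alpha> by (intro powr_mono2 mult_left_mono) (auto simp: q_points mult_nonneg_nonneg)

text \<open>The upper arc is symmetric about \<open>x0\<close>, and solving y < g x for x gives |x -
  x0| < r y.\<close>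

lemma dom_iff_upper:
  assumes "y > 0"
  shows "(x, y) \<in> \<Omega> \<longleftrightarrow> y < yM \<and> x0 - r y < x \<and> x < x0 + r y"
proof
  assume d: "(x, y) \<in> \<Omega>"
  then have x: "2 * x0 < x" "x < 0" "y < g x" by (auto simp: dom_iff)
  have y: "y < yM" using g_le_yM[of x] x by simp
  have "(x - x0)\<^sup>2 < x0\<^sup>2 - y powr (\<alpha> + 1) / \<kappa>" using less_g_iff[OF assms] x by auto
  then have "\<bar>x - x0\<bar> < r y" unfolding r_def by (intro real_less_rsqrt) simp
  then show "y < yM \<and> x0 - r y < x \<and> x < x0 + r y" using y by auto
next
  assume a: "y < yM \<and> x0 - r y < x \<and> x < x0 + r y"
  then have rb: "0 < r y" "r y < - x0" using r_bounds assms by auto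
  have x: "2 * x0 < x" "x < 0" using a rb by auto
  have "\<bar>x - x0\<bar> < r y" using a by auto
  then have "(x - x0)\<^sup>2 < (r y)\<^sup>2" using power_strict_mono[of "\<bar>x - x0\<bar>" "r y" 2] by simp
  also have "(r y)\<^sup>2 = x0\<^sup>2 - y powr (\<alpha> + 1) / \<kappa>" using rb unfolding r_def by (simp add: real_sqrt_gt_0_iff)
  finally have "y < g x" using less_g_iff[OF assms] x by auto
  moreover have "low x < y" using low_neg[of x] x assms by simp
  ultimately show "(x, y) \<in> \<Omega>" using x by (simp add: dom_iff)
qed

lemma dom_iff_lower:
  assumes "y \<le> 0"
  shows "(x, y) \<in> \<Omega> \<longleftrightarrow> yC < y \<and> A y < x \<and> x < B y"
proof
  assume "(x, y) \<in> \<Omega>"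
  then have "2 * x0 < x" "x < 0" "A y < x" "x < B y" by (auto simp: dom_iff_AB)
  then have "rt y < - x0" by (simp add: A_def B_def)
  then show "yC < y \<and> A y < x \<and> x < B y" using rt_lt_iff \<open>A y < x\<close> \<open>x < B y\<close> by simp
next
  assume a: "yC < y \<and> A y < x \<and> x < B y"
  then have x: "2 * x0 < x" "x < 0" using rt_nonneg[of y] by (auto simp: A_def B_def)
  then show "(x, y) \<in> \<Omega>" using a g_pos[OF x] assms by (auto simp: dom_iff_AB)
qed

definition lft where "lft y = (if y \<le> 0 then A y else x0 - r y)"
definition rgt where "rgt y = (if y \<le> 0 then B y else x0 + r y)"

lemma dom_iff_x: "(x, y) \<in> \<Omega> \<longleftrightarrow> y \<in> {yC<..<yM} \<and> lft y < x \<and> x < rgt y"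
  using dom_iff_upper[of y x] dom_iff_lower[of y x] yM_pos yC(1)
  by (auto simp: lft_def rgt_def)

lemma dom_iff_y: "(x, y) \<in> \<Omega> \<longleftrightarrow> x \<in> {2 * x0<..<0} \<and> low x < y \<and> y < g x"
  by (auto simp: dom_iff)

lemma lft_less_rgt: "y \<in> {yC<..<yM} \<Longrightarrow> lft y < rgt y"
  using rt_lt_iff[of y] r_bounds[of y] by (auto simp: lft_def rgt_def A_def B_def)

lemma closure_dom_slice_x:
  assumes "y \<in> {yC<..<yM}" "lft y \<le> x" "x \<le> rgt y"
  shows "(x, y) \<in> closure \<Omega>"
proof -
  have "(\<lambda>x. (x, y)) ` {lft y<..<rgt y} \<subseteq> \<Omega>" using assms(1) by (auto simp: dom_iff_x)
  then have "(\<lambda>x. (x, y)) ` closure {lft y<..<rgt y} \<subseteq> closure \<Omega>"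
    using closure_subset[of \<Omega>]
    by (intro image_closure_subset continuous_intros closed_closure) (rule subset_trans)
  then show ?thesis using lft_less_rgt[OF assms(1)] assms(2,3) by (auto simp: image_subset_iff)
qed

end

section \<open>Slopes and reparametrization of the arcs\<close>

context tricomi_params
begin

text \<open>The slope obtained by differentiating
  \<open>g x powr (\<alpha> + 1) = \<kappa> * q x\<close>. It is unbounded near both end points of
  the arc.\<close>

definition dg where "dg x = - b * (x - x0) / g x powr \<alpha>"

lemma g_deriv:
  assumes "2 * x0 < x" "x < 0"
  shows "(g has_real_derivative dg x) (at x)"
proof -
  have qp: "\<kappa> * q x > 0" using q_bounds(2)[OF assms] \<kappa> by simp
  have "((\<lambda>x. (\<kappa> * q x) powr (1 / (\<alpha> + 1))) has_real_derivative
      (1 / (\<alpha> + 1)) * (\<kappa> * q x) powr (1 / (\<alpha> + 1) - 1) * (\<kappa> * (2 * x0 - 2 * x))) (at x)"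
  proof -
    have "((\<lambda>x. \<kappa> * q x) has_real_derivative \<kappa> * (2 * x0 - 2 * x)) (at x)"
      unfolding q_def by (auto intro!: derivative_eq_intros simp: algebra_simps)
    from DERIV_chain2[where f="\<lambda>z. z powr (1 / (\<alpha> + 1))" and g="\<lambda>x. \<kappa> * q x",
        OF has_real_derivative_powr[OF qp] this] show ?thesis .
  qed
  also have "(\<lambda>x. (\<kappa> * q x) powr (1 / (\<alpha> + 1))) = g" by (auto simp: g_eq)
  also have "(1 / (\<alpha> + 1)) * (\<kappa> * q x) powr (1 / (\<alpha> + 1) - 1) * (\<kappa> * (2 * x0 - 2 * x)) = dg x"
  proof -
    have "1 / (\<alpha> + 1) - 1 = - (\<alpha> / (\<alpha> + 1))" using \<alpha> by (simp add: field_simps)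
    then have E1: "(\<kappa> * q x) powr (1 / (\<alpha> + 1) - 1) = 1 / g x powr \<alpha>"
      unfolding g_powr by (simp add: powr_minus inverse_eq_divide)
    have E2: "1 / (\<alpha> + 1) * (\<kappa> * (2 * x0 - 2 * x)) = - b * (x - x0)"
      using \<alpha> by (simp add: \<kappa>_def field_simps)
    have E3: "1 / (\<alpha> + 1) * z * (\<kappa> * (2 * x0 - 2 * x)) = 1 / (\<alpha> + 1) * (\<kappa> * (2 * x0 - 2 * x)) * z" for z by simp
    show ?thesis by (rule trans[OF E3]) (unfold E1 E2 dg_def, simp)
  qed
  finally show ?thesis .
qed

lemma rt_deriv:
  assumes "y < 0"
  shows "(rt has_real_derivative - sqrt (- y)) (at y)"
proof -
  have "((\<lambda>y. (2/3) * (- y) powr (3/2)) has_real_derivative - sqrt (- y)) (at y)"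
    using assms by (auto intro!: derivative_eq_intros simp: powr_half_sqrt)
  then show ?thesis
    by (rule has_field_derivative_transform_within_open[of _ _ _ "{..<0}"]) (use assms in \<open>auto simp: rt_def\<close>)
qed

lemma A_deriv: "y < 0 \<Longrightarrow> (A has_real_derivative - sqrt (- y)) (at y)"
  unfolding A_def by (auto intro!: derivative_eq_intros rt_deriv)

lemma B_deriv: "y < 0 \<Longrightarrow> (B has_real_derivative sqrt (- y)) (at y)"
  unfolding B_def by (auto intro!: derivative_eq_intros rt_deriv)

lemma rt_bounds: "yC < y \<Longrightarrow> y < 0 \<Longrightarrow> 0 < rt y \<and> rt y < - x0"
  using rt_lt_iff[of y] by (simp add: rt_def)

lemma A_image: "A ` {yC<..<0} = {2 * x0<..<x0}"
proof (intro equalityI subsetI)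
  fix x assume "x \<in> A ` {yC<..<0}"
  then obtain y where y: "y \<in> {yC<..<0}" "x = A y" by blast
  then show "x \<in> {2 * x0<..<x0}" using rt_bounds[of y] by (simp add: A_def)
next
  fix x assume x: "x \<in> {2 * x0<..<x0}"
  then have e: "A (low x) = x" using A_low[of x] by simp
  then have "rt (low x) < - x0" using x by (simp add: A_def)
  then have "low x \<in> {yC<..<0}" using rt_lt_iff low_neg[of x] x x0 by simp
  then show "x \<in> A ` {yC<..<0}" using e by (metis imageI)
qed

lemma B_image: "B ` {yC<..<0} = {x0<..<0}"
proof (intro equalityI subsetI)
  fix x assume "x \<in> B ` {yC<..<0}"
  then obtain y where y: "y \<in> {yC<..<0}" "x = B y" by blast
  then show "x \<in> {x0<..<0}" using rt_bounds[of y] by (simp add: B_def)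
next
  fix x assume x: "x \<in> {x0<..<0}"
  then have e: "B (low x) = x" using B_low[of x] by simp
  then have "rt (low x) < - x0" using x by (simp add: B_def)
  then have "low x \<in> {yC<..<0}" using rt_lt_iff low_neg[of x] x x0 by simp
  then show "x \<in> B ` {yC<..<0}" using e by (metis imageI)
qed

lemma A_inj: "inj_on A {yC<..<0}"
  using low_A by (intro inj_on_inverseI[of _ low]) auto

lemma B_inj: "inj_on B {yC<..<0}"
  using low_B by (intro inj_on_inverseI[of _ low]) auto

lemma low_continuous: "continuous_on {2 * x0<..<0} low"
  unfolding low_def by (intro continuous_intros) auto

lemma g_continuous: "continuous_on {2 * x0<..<0} g"
  by (intro continuous_at_imp_continuous_on ballI DERIV_isCont[OF g_deriv]) auto

lemma A_continuous: "continuous_on {yC<..<0} A" and B_continuous: "continuous_on {yC<..<0} B"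
  by (intro continuous_at_imp_continuous_on ballI DERIV_isCont[OF A_deriv] DERIV_isCont[OF B_deriv]; simp)+

end

context tricomi_domain
begin

lemma r_g: "2 * x0 \<le> x \<Longrightarrow> x \<le> 0 \<Longrightarrow> r (g x) = \<bar>x - x0\<bar>"
  using g_powr_Suc[of x] \<kappa> by (simp add: r_def q_alt)

lemma g_r:
  assumes "0 < y" "y < yM"
  shows "g (x0 + r y) = y" "g (x0 - r y) = y"
proof -
  have "(r y)\<^sup>2 = x0\<^sup>2 - y powr (\<alpha> + 1) / \<kappa>"
    using r_bounds(1)[OF assms] unfolding r_def by (simp add: real_sqrt_gt_0_iff)
  then have "\<kappa> * q (x0 + r y) = y powr (\<alpha> + 1)" "\<kappa> * q (x0 - r y) = y powr (\<alpha> + 1)"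
    using \<kappa> by (simp_all add: q_alt)
  then show "g (x0 + r y) = y" "g (x0 - r y) = y"
    using assms \<alpha> by (simp_all add: g_eq powr_powr)
qed

lemma g_less_yM:
  assumes "2 * x0 < x" "x < 0" "x \<noteq> x0"
  shows "g x < yM"
proof -
  have "q x < x0\<^sup>2" using assms by (simp add: q_alt)
  then show ?thesis unfolding yM_def g_eq q_points
    using q_bounds(2)[OF assms(1,2)] \<kappa> \<alpha> by (intro powr_less_mono2) auto
qed

lemma g_image_right: "g ` {x0<..<0} = {0<..<yM}"
proof (intro equalityI subsetI)
  fix y assume "y \<in> g ` {x0<..<0}"
  then obtain x where x: "x \<in> {x0<..<0}" "y = g x" by blast
  then show "y \<in> {0<..<yM}" using g_less_yM[of x] g_pos[of x] x0 by simp
next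
  fix y assume "y \<in> {0<..<yM}"
  then show "y \<in> g ` {x0<..<0}" using g_r[of y] r_bounds[of y] by (intro image_eqI[of _ _ "x0 + r y"]) auto
qed

lemma g_image_left: "g ` {2 * x0<..<x0} = {0<..<yM}"
proof (intro equalityI subsetI)
  fix y assume "y \<in> g ` {2 * x0<..<x0}"
  then obtain x where x: "x \<in> {2 * x0<..<x0}" "y = g x" by blast
  then show "y \<in> {0<..<yM}" using g_less_yM[of x] g_pos[of x] x0 by simp
next
  fix y assume "y \<in> {0<..<yM}"
  then show "y \<in> g ` {2 * x0<..<x0}" using g_r[of y] r_bounds[of y] by (intro image_eqI[of _ _ "x0 - r y"]) auto
qed

lemma r_continuous: "continuous_on {0<..<yM} r"
  unfolding r_def using \<kappa> by (intro continuous_intros) auto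

lemma arc_in_closure:
  "yC < y \<Longrightarrow> y < 0 \<Longrightarrow> (A y, y) \<in> closure \<Omega>"
  "yC < y \<Longrightarrow> y < 0 \<Longrightarrow> (B y, y) \<in> closure \<Omega>"
  "0 < y \<Longrightarrow> y < yM \<Longrightarrow> (x0 + r y, y) \<in> closure \<Omega>"
  "0 < y \<Longrightarrow> y < yM \<Longrightarrow> (x0 - r y, y) \<in> closure \<Omega>"
  "2 * x0 < x \<Longrightarrow> x < 0 \<Longrightarrow> (x, g x) \<in> closure \<Omega>"
  "2 * x0 < x \<Longrightarrow> x < 0 \<Longrightarrow> (x, low x) \<in> closure \<Omega>"
proof -
  show "(A y, y) \<in> closure \<Omega>" "(B y, y) \<in> closure \<Omega>" if "yC < y" "y < 0"
    using closure_dom_slice_x[of y] lft_less_rgt[of y] yM_pos that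
    by (auto simp: lft_def rgt_def)
  show "(x0 + r y, y) \<in> closure \<Omega>" "(x0 - r y, y) \<in> closure \<Omega>" if "0 < y" "y < yM"
    using closure_dom_slice_x[of y] lft_less_rgt[of y] yC(1) that
    by (auto simp: lft_def rgt_def)
  show "(x, g x) \<in> closure \<Omega>" "(x, low x) \<in> closure \<Omega>" if "2 * x0 < x" "x < 0"
    using closure_dom_slice_y[OF that] low_neg[OF that] g_pos[OF that] by auto
qed

section \<open>The divergence theorem on the domain\<close>

lemma compact_closure_dom: "compact (closure \<Omega>)" using dom_bounded by simp

lemma trace_integrable:
  fixes F :: "real \<times> real \<Rightarrow> real"
  assumes F: "continuous_on (closure \<Omega>) F" and "open S" "bounded S" "continuous_on S c"
    "\<And>t. t \<in> S \<Longrightarrow> c t \<in> closure \<Omega>"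
  shows "set_integrable lebesgue (S :: real set) (\<lambda>t. F (c t))"
proof -
  obtain K where K: "\<And>p. p \<in> closure \<Omega> \<Longrightarrow> \<bar>F p\<bar> \<le> K" using bounded_on_compact[OF compact_closure_dom F] by blast
  show ?thesis
  proof (rule set_integrable_lebesgue_of_lborel(1)[OF set_integrable_bounded_continuous[OF assms(2,3)]])
    show "continuous_on S (\<lambda>t. F (c t))"
      by (rule continuous_on_compose2[OF F assms(4)]) (use assms(5) in blast)
    show "\<bar>F (c t)\<bar> \<le> K" if "t \<in> S" for t using K assms(5) that by blast
  qed
qed

text \<open>Horizontal slices end on AC and BC below the axis and on the two halves of \<sigma>
  above it. The halves are reparametrized by y = g x; the sign of \<open>dg\<close> changes at
  \<open>x0\<close> just as the orientation does, so both merge into one integral of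
  \<open>- dg * P\<close>. Because \<open>dg\<close> is unbounded, the integrability of this
  integrand is taken from the change of variables.\<close>

lemma dom_divergence_x:
  fixes P Px :: "real \<times> real \<Rightarrow> real"
  assumes P: "continuous_on (closure \<Omega>) P"
    and D: "\<And>x y. (x, y) \<in> \<Omega> \<Longrightarrow> ((\<lambda>t. P (t, y)) has_real_derivative Px (x, y)) (at x)"
    and Px: "continuous_on \<Omega> Px" "\<And>p. p \<in> \<Omega> \<Longrightarrow> \<bar>Px p\<bar> \<le> K"
  shows "set_integrable lebesgue \<Omega> Px"
    and "set_integrable lebesgue {2 * x0<..<0} (\<lambda>x. dg x * P (x, g x))"
    and "set_integrable lebesgue {yC<..<0} (\<lambda>y. P (A y, y))"
    and "set_integrable lebesgue {yC<..<0} (\<lambda>y. P (B y, y))"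
    and "(LINT p:\<Omega>|lebesgue. Px p) = (LINT y:{yC<..<0}|lebesgue. P (B y, y)) - (LINT y:{yC<..<0}|lebesgue. P (A y, y))
      - (LINT x:{2 * x0<..<0}|lebesgue. dg x * P (x, g x))"
proof -
  let ?L = "{yC<..<0::real}" and ?U = "{0<..<yM}"
  have slice: "continuous_on {lft y..rgt y} (\<lambda>x. P (x, y))" if "y \<in> {yC<..<yM}" for y
    by (rule continuous_on_compose2[OF P])
       (use closure_dom_slice_x[OF that] in \<open>auto intro!: continuous_intros\<close>)
  note S = slice_integral_x[OF dom_open dom_bounded dom_iff_x less_imp_le[OF lft_less_rgt] slice D Px]
  show "set_integrable lebesgue \<Omega> Px" by (rule S(1))
  show iA: "set_integrable lebesgue ?L (\<lambda>y. P (A y, y))"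
    by (rule trace_integrable[OF P]) (use arc_in_closure in \<open>auto intro!: continuous_intros A_continuous\<close>)
  show iB: "set_integrable lebesgue ?L (\<lambda>y. P (B y, y))"
    by (rule trace_integrable[OF P]) (use arc_in_closure in \<open>auto intro!: continuous_intros B_continuous\<close>)
  have iR: "set_integrable lebesgue ?U (\<lambda>y. P (x0 + r y, y))"
    by (rule trace_integrable[OF P]) (use arc_in_closure in \<open>auto intro!: continuous_intros r_continuous\<close>)
  have iL: "set_integrable lebesgue ?U (\<lambda>y. P (x0 - r y, y))"
    by (rule trace_integrable[OF P]) (use arc_in_closure in \<open>auto intro!: continuous_intros r_continuous\<close>)
  have injr: "inj_on g {x0<..<0}" "inj_on g {2 * x0<..<x0}"
    using r_g x0 by (intro inj_on_inverseI[of _ "\<lambda>y. x0 + r y"] inj_on_inverseI[of _ "\<lambda>y. x0 - r y"]; simp)+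
  have gd: "\<And>x. x \<in> {x0<..<0} \<Longrightarrow> (g has_real_derivative dg x) (at x)"
    "\<And>x. x \<in> {2 * x0<..<x0} \<Longrightarrow> (g has_real_derivative dg x) (at x)"
    using g_deriv x0 by auto
  have C1: "set_integrable lebesgue {x0<..<0} (\<lambda>x. \<bar>dg x\<bar> * P (x0 + r (g x), g x))"
    "(LINT x:{x0<..<0}|lebesgue. \<bar>dg x\<bar> * P (x0 + r (g x), g x)) = (LINT y:?U|lebesgue. P (x0 + r y, y))"
    using set_integral_change_of_variables[OF _ gd(1) injr(1), of "\<lambda>y. P (x0 + r y, y)"] iR
    by (simp_all add: g_image_right)
  have C2: "set_integrable lebesgue {2 * x0<..<x0} (\<lambda>x. \<bar>dg x\<bar> * P (x0 - r (g x), g x))"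
    "(LINT x:{2 * x0<..<x0}|lebesgue. \<bar>dg x\<bar> * P (x0 - r (g x), g x)) = (LINT y:?U|lebesgue. P (x0 - r y, y))"
    using set_integral_change_of_variables[OF _ gd(2) injr(2), of "\<lambda>y. P (x0 - r y, y)"] iL
    by (simp_all add: g_image_left)
  have s1: "\<bar>dg x\<bar> * P (x0 + r (g x), g x) = - (dg x * P (x, g x))" if "x \<in> {x0<..<0}" for x
  proof -
    have "dg x \<le> 0" using that b(1) g_nonneg by (auto simp: dg_def intro!: divide_nonneg_nonneg mult_nonneg_nonneg)
    then show ?thesis using r_g[of x] that x0 by simp
  qed
  have s2: "\<bar>dg x\<bar> * P (x0 - r (g x), g x) = dg x * P (x, g x)" if "x \<in> {2 * x0<..<x0}" for x
  proof -
    have "b * (x - x0) \<le> 0" using that b(1) by (intro mult_nonneg_nonpos) auto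
    then have "dg x \<ge> 0" by (auto simp: dg_def intro!: divide_nonpos_nonneg)
    then show ?thesis using r_g[of x] that x0 by simp
  qed
  have J1: "set_integrable lebesgue {x0<..<0} (\<lambda>x. - (dg x * P (x, g x)))"
    using C1(1) set_integrable_cong[OF refl refl s1, of "{x0<..<0}"] by simp
  then have J1': "set_integrable lebesgue {x0<..<0} (\<lambda>x. dg x * P (x, g x))"
    using set_integrable_mult_right[of "-1" lebesgue "{x0<..<0}" "\<lambda>x. - (dg x * P (x, g x))"] by simp
  have J2: "set_integrable lebesgue {2 * x0<..<x0} (\<lambda>x. dg x * P (x, g x))"
    using C2(1) set_integrable_cong[OF refl refl s2, of "{2 * x0<..<x0}"] by simp
  have o: "2 * x0 < x0" using x0 by simp
  note SP = set_integral_split_at[OF o x0 J2 J1']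
  show "set_integrable lebesgue {2 * x0<..<0} (\<lambda>x. dg x * P (x, g x))" by (rule SP(1))
  have E1: "(LINT y:?U|lebesgue. P (x0 + r y, y)) = - (LINT x:{x0<..<0}|lebesgue. dg x * P (x, g x))"
    unfolding C1(2)[symmetric] set_integral_uminus[OF J1', symmetric]
    by (rule set_lebesgue_integral_cong) (use s1 in auto)
  have E2: "(LINT y:?U|lebesgue. P (x0 - r y, y)) = (LINT x:{2 * x0<..<x0}|lebesgue. dg x * P (x, g x))"
    unfolding C2(2)[symmetric] by (rule set_lebesgue_integral_cong) (use s2 in auto)
  let ?D = "\<lambda>y. P (rgt y, y) - P (lft y, y)"
  have d1: "?D y = P (B y, y) - P (A y, y)" if "y \<in> ?L" for y using that by (simp add: lft_def rgt_def)
  have d2: "?D y = P (x0 + r y, y) - P (x0 - r y, y)" if "y \<in> ?U" for y using that by (simp add: lft_def rgt_def)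
  have D1: "set_integrable lebesgue ?L ?D" "(LINT y:?L|lebesgue. ?D y) = (LINT y:?L|lebesgue. P (B y, y)) - (LINT y:?L|lebesgue. P (A y, y))"
    subgoal using set_integral_diff(1)[OF iB iA] d1
      by (subst set_integrable_cong[of lebesgue lebesgue ?L ?L ?D "\<lambda>y. P (B y, y) - P (A y, y)"]) auto
    subgoal unfolding set_integral_diff(2)[OF iB iA, symmetric]
      by (rule set_lebesgue_integral_cong) (use d1 in auto)
    done
  have D2: "set_integrable lebesgue ?U ?D" "(LINT y:?U|lebesgue. ?D y) = (LINT y:?U|lebesgue. P (x0 + r y, y)) - (LINT y:?U|lebesgue. P (x0 - r y, y))"
    subgoal using set_integral_diff(1)[OF iR iL] d2
      by (subst set_integrable_cong[of lebesgue lebesgue ?U ?U ?D "\<lambda>y. P (x0 + r y, y) - P (x0 - r y, y)"]) auto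
    subgoal unfolding set_integral_diff(2)[OF iR iL, symmetric]
      by (rule set_lebesgue_integral_cong) (use d2 in auto)
    done
  have "(LINT p:\<Omega>|lebesgue. Px p) = (LINT y:?L|lebesgue. ?D y) + (LINT y:?U|lebesgue. ?D y)"
    by (rule trans[OF S(3) set_integral_split_at(2)[OF yC(1) yM_pos D1(1) D2(1)]])
  then show "(LINT p:\<Omega>|lebesgue. Px p) = (LINT y:{yC<..<0}|lebesgue. P (B y, y)) - (LINT y:{yC<..<0}|lebesgue. P (A y, y))
      - (LINT x:{2 * x0<..<0}|lebesgue. dg x * P (x, g x))"
    unfolding D1(2) D2(2) E1 E2 SP(2) by simp
qed

text \<open>Vertical slices run from \<open>low\<close> to \<open>g\<close>. The integral over the
  lower graph is split at \<open>x0\<close> and rewritten in the variable y; on either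
  characteristic the Jacobian has modulus sqrt(-y).\<close>

lemma dom_divergence_y:
  fixes Q Qy :: "real \<times> real \<Rightarrow> real"
  assumes Q: "continuous_on (closure \<Omega>) Q"
    and D: "\<And>x y. (x, y) \<in> \<Omega> \<Longrightarrow> ((\<lambda>t. Q (x, t)) has_real_derivative Qy (x, y)) (at y)"
    and Qy: "continuous_on \<Omega> Qy" "\<And>p. p \<in> \<Omega> \<Longrightarrow> \<bar>Qy p\<bar> \<le> K"
  shows "set_integrable lebesgue \<Omega> Qy"
    and "set_integrable lebesgue {2 * x0<..<0} (\<lambda>x. Q (x, g x))"
    and "set_integrable lebesgue {yC<..<0} (\<lambda>y. sqrt (- y) * Q (A y, y))"
    and "set_integrable lebesgue {yC<..<0} (\<lambda>y. sqrt (- y) * Q (B y, y))"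
    and "(LINT p:\<Omega>|lebesgue. Qy p) = (LINT x:{2 * x0<..<0}|lebesgue. Q (x, g x))
      - (LINT y:{yC<..<0}|lebesgue. sqrt (- y) * Q (A y, y)) - (LINT y:{yC<..<0}|lebesgue. sqrt (- y) * Q (B y, y))"
proof -
  let ?L = "{yC<..<0::real}" and ?X = "{2 * x0<..<0}"
  have slice: "continuous_on {low x..g x} (\<lambda>y. Q (x, y))" if "x \<in> ?X" for x
    by (rule continuous_on_compose2[OF Q])
       (use closure_dom_slice_y[of x] that in \<open>auto intro!: continuous_intros\<close>)
  have lg: "low x \<le> g x" if "x \<in> ?X" for x using low_neg[of x] g_pos[of x] that by simp
  note S = slice_integral_y[OF dom_open dom_bounded dom_iff_y lg slice D Qy]
  show "set_integrable lebesgue \<Omega> Qy" by (rule S(1))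
  show ig: "set_integrable lebesgue ?X (\<lambda>x. Q (x, g x))"
    by (rule trace_integrable[OF Q]) (use arc_in_closure in \<open>auto intro!: continuous_intros g_continuous\<close>)
  have il: "set_integrable lebesgue ?X (\<lambda>x. Q (x, low x))"
    by (rule trace_integrable[OF Q]) (use arc_in_closure in \<open>auto intro!: continuous_intros low_continuous\<close>)
  have il1: "set_integrable lebesgue {2 * x0<..<x0} (\<lambda>x. Q (x, low x))"
    by (rule set_integrable_subset[OF il]) (use x0 in auto)
  have il2: "set_integrable lebesgue {x0<..<0} (\<lambda>x. Q (x, low x))"
    by (rule set_integrable_subset[OF il]) (use x0 in auto)
  have ad: "\<And>y. y \<in> ?L \<Longrightarrow> (A has_real_derivative - sqrt (- y)) (at y)" using A_deriv by auto
  have bd: "\<And>y. y \<in> ?L \<Longrightarrow> (B has_real_derivative sqrt (- y)) (at y)" using B_deriv by auto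
  have C1: "set_integrable lebesgue ?L (\<lambda>y. \<bar>- sqrt (- y)\<bar> * Q (A y, low (A y)))"
    "(LINT y:?L|lebesgue. \<bar>- sqrt (- y)\<bar> * Q (A y, low (A y))) = (LINT x:{2 * x0<..<x0}|lebesgue. Q (x, low x))"
    using set_integral_change_of_variables[OF _ ad A_inj, of "\<lambda>x. Q (x, low x)"] il1
    by (simp_all only: A_image) simp_all
  have C2: "set_integrable lebesgue ?L (\<lambda>y. \<bar>sqrt (- y)\<bar> * Q (B y, low (B y)))"
    "(LINT y:?L|lebesgue. \<bar>sqrt (- y)\<bar> * Q (B y, low (B y))) = (LINT x:{x0<..<0}|lebesgue. Q (x, low x))"
    using set_integral_change_of_variables[OF _ bd B_inj, of "\<lambda>x. Q (x, low x)"] il2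
    by (simp_all only: B_image) simp_all
  have s1: "\<bar>- sqrt (- y)\<bar> * Q (A y, low (A y)) = sqrt (- y) * Q (A y, y)" if "y \<in> ?L" for y
    using that low_A[of y] by simp
  have s2: "\<bar>sqrt (- y)\<bar> * Q (B y, low (B y)) = sqrt (- y) * Q (B y, y)" if "y \<in> ?L" for y
    using that low_B[of y] by simp
  show "set_integrable lebesgue ?L (\<lambda>y. sqrt (- y) * Q (A y, y))"
    using C1(1) set_integrable_cong[OF refl refl s1, of ?L] by simp
  show "set_integrable lebesgue ?L (\<lambda>y. sqrt (- y) * Q (B y, y))"
    using C2(1) set_integrable_cong[OF refl refl s2, of ?L] by simp
  have E1: "(LINT y:?L|lebesgue. sqrt (- y) * Q (A y, y)) = (LINT x:{2 * x0<..<x0}|lebesgue. Q (x, low x))"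
    unfolding C1(2)[symmetric] by (rule set_lebesgue_integral_cong) (use s1 in auto)
  have E2: "(LINT y:?L|lebesgue. sqrt (- y) * Q (B y, y)) = (LINT x:{x0<..<0}|lebesgue. Q (x, low x))"
    unfolding C2(2)[symmetric] by (rule set_lebesgue_integral_cong) (use s2 in auto)
  have o: "2 * x0 < x0" using x0 by simp
  have "(LINT p:\<Omega>|lebesgue. Qy p) = (LINT x:?X|lebesgue. Q (x, g x)) - (LINT x:?X|lebesgue. Q (x, low x))"
    by (rule trans[OF S(3) set_integral_diff(2)[OF ig il]])
  then show "(LINT p:\<Omega>|lebesgue. Qy p) = (LINT x:?X|lebesgue. Q (x, g x))
      - (LINT y:?L|lebesgue. sqrt (- y) * Q (A y, y)) - (LINT y:?L|lebesgue. sqrt (- y) * Q (B y, y))"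
    unfolding E1 E2 set_integral_split_at(2)[OF o x0 il1 il2] by simp
qed

end

section \<open>Regularity up to the boundary\<close>

text \<open>Carries the regularity of the complex function to its real and imaginary parts.
  Agreement with \<open>L (f p)\<close> is asked only on \<open>\<Omega>\<close>, since derivatives
  computed by choice are controlled only there.\<close>

lemma Ck_closure_linear:
  fixes f :: "real \<times> real \<Rightarrow> 'a::real_normed_vector" and h :: "real \<times> real \<Rightarrow> 'b::real_normed_vector"
  assumes "open \<Omega>" "bounded_linear L"
  shows "Ck_closure k \<Omega> f \<Longrightarrow> (\<And>p. p \<in> \<Omega> \<Longrightarrow> h p = L (f p)) \<Longrightarrow> Ck_closure k \<Omega> h"
proof (induction k arbitrary: f h)
  case 0
  then obtain F where F: "continuous_on (closure \<Omega>) F" "\<And>p. p \<in> \<Omega> \<Longrightarrow> F p = f p" by auto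
  have "continuous_on (closure \<Omega>) (\<lambda>p. L (F p))"
    by (rule bounded_linear.continuous_on[OF assms(2) F(1)])
  then show ?case using F(2) 0(2) by (auto intro!: exI[of _ "\<lambda>p. L (F p)"])
next
  case (Suc k)
  have G: "has_grad h (L (dx f p)) (L (dy f p)) p" if "p \<in> \<Omega>" for p
  proof (rule has_grad_cong_open[OF _ assms(1) that])
    have "f differentiable (at p)"
      using Suc.prems(1) that assms(1) by (simp add: differentiable_on_eq_differentiable_at)
    then show "has_grad (\<lambda>q. L (f q)) (L (dx f p)) (L (dy f p)) p"
      by (intro has_grad_bounded_linear[OF assms(2)] has_grad_dx_dy)
  qed (simp add: Suc.prems(2))
  have 0: "Ck_closure 0 \<Omega> h"
  proof -
    obtain F where F: "continuous_on (closure \<Omega>) F" "\<And>p. p \<in> \<Omega> \<Longrightarrow> F p = f p" using Suc.prems(1) by auto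
    have "continuous_on (closure \<Omega>) (\<lambda>p. L (F p))"
      by (rule bounded_linear.continuous_on[OF assms(2) F(1)])
    then show ?thesis using F(2) Suc.prems(2) by (auto intro!: exI[of _ "\<lambda>p. L (F p)"])
  qed
  have "h differentiable_on \<Omega>"
    using G has_grad_differentiable assms(1) by (simp add: differentiable_on_eq_differentiable_at) blast
  moreover have "Ck_closure k \<Omega> (dx h)"
    by (rule Suc.IH[of "dx f"]) (use Suc.prems(1) has_grad_unique(1)[OF G] in simp_all)
  moreover have "Ck_closure k \<Omega> (dy h)"
    by (rule Suc.IH[of "dy f"]) (use Suc.prems(1) has_grad_unique(2)[OF G] in simp_all)
  ultimately show ?case using 0 by simp
qed

lemma Ck_closure_1D:
  fixes f :: "real \<times> real \<Rightarrow> 'a::real_normed_vector"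
  assumes "open \<Omega>" "Ck_closure 1 \<Omega> f"
  shows "\<exists>F. continuous_on (closure \<Omega>) F \<and> (\<forall>p\<in>\<Omega>. F p = f p)"
    "\<exists>F. continuous_on (closure \<Omega>) F \<and> (\<forall>p\<in>\<Omega>. F p = dx f p)"
    "\<exists>F. continuous_on (closure \<Omega>) F \<and> (\<forall>p\<in>\<Omega>. F p = dy f p)"
    "\<And>p. p \<in> \<Omega> \<Longrightarrow> has_grad f (dx f p) (dy f p) p"
  using assms by (auto simp: differentiable_on_eq_differentiable_at intro!: has_grad_dx_dy)

context tricomi_domain
begin

lemma fst_neg: "p \<in> \<Omega> \<Longrightarrow> fst p < 0" using dom_subset(2)[of "fst p" "snd p"] by simp

text \<open>Boundary values are limits from inside. A point of the closure outside \<Omega> is a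
  limit point, so the limit is unique and the continuous extension computes it.\<close>

lemma closure_extension_eq:
  fixes F f :: "real \<times> real \<Rightarrow> 'a::real_normed_vector"
  assumes "continuous_on (closure \<Omega>) F" "\<And>p. p \<in> \<Omega> \<Longrightarrow> F p = f p" "p \<in> closure \<Omega>" "p \<notin> \<Omega>"
  shows "(f \<longlongrightarrow> F p) (at p within \<Omega>)" "bvalue \<Omega> f p = F p"
proof -
  have "(F \<longlongrightarrow> F p) (at p within closure \<Omega>)" using assms(1,3) by (simp add: continuous_on_def)
  then have "(F \<longlongrightarrow> F p) (at p within \<Omega>)" by (rule tendsto_within_subset) (rule closure_subset)
  then show t: "(f \<longlongrightarrow> F p) (at p within \<Omega>)"
    by (rule Lim_transform_eventually) (auto simp: eventually_at_filter assms(2))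
  have "p islimpt \<Omega>" using assms(3,4) by (simp add: closure_def)
  then have "at p within \<Omega> \<noteq> bot" by (simp add: trivial_limit_within)
  then show "bvalue \<Omega> f p = F p" unfolding bvalue_def using t by (rule tendsto_Lim)
qed

lemma arc_not_in_dom:
  "y < 0 \<Longrightarrow> yC < y \<Longrightarrow> (B y, y) \<notin> \<Omega>" "(x, g x) \<notin> \<Omega>"
  by (auto simp: dom_iff_AB)

text \<open>The domain is not assumed convex; two of its points are joined by a vertical, a
  horizontal and a vertical segment. The horizontal one runs at the height \<open>m\<close> between
  y and y' that is closest to the axis. As every vertical slice crosses the axis, the path stays
  inside, and its vertical parts add up to |y - y'|.\<close>

lemma lipschitz_L1:
  fixes v vx vy :: "real \<times> real \<Rightarrow> real"
  assumes G: "\<And>p. p \<in> \<Omega> \<Longrightarrow> has_grad v (vx p) (vy p) p"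
    and K: "\<And>p. p \<in> \<Omega> \<Longrightarrow> \<bar>vx p\<bar> \<le> K" "\<And>p. p \<in> \<Omega> \<Longrightarrow> \<bar>vy p\<bar> \<le> K"
    and p: "(x, y) \<in> \<Omega>" "(x', y') \<in> \<Omega>"
  shows "\<bar>v (x, y) - v (x', y')\<bar> \<le> K * (\<bar>x - x'\<bar> + \<bar>y - y'\<bar>)"
proof -
  define m where "m = (if 0 \<le> y \<and> 0 \<le> y' then min y y' else if y \<le> 0 \<and> y' \<le> 0 then max y y' else 0)"
  have len: "\<bar>y - m\<bar> + \<bar>y' - m\<bar> = \<bar>y - y'\<bar>" by (auto simp: m_def)
  have xb: "2 * x0 < x" "x < 0" "2 * x0 < x'" "x' < 0" using dom_subset(1,2) p by blast+
  have lg: "low x < 0" "0 < g x" "low x' < 0" "0 < g x'" using low_neg g_pos xb by blast+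
  have yb: "low x < y" "y < g x" "low x' < y'" "y' < g x'" using dom_subset(3,4) p by blast+
  have mb: "low x < m" "m < g x" "low x' < m" "m < g x'" using yb lg by (auto simp: m_def)
  have m\<Omega>: "(x, m) \<in> \<Omega>" "(x', m) \<in> \<Omega>" using mb xb by (auto simp: dom_iff)
  have vert: "\<bar>v (z, s) - v (z, t)\<bar> \<le> K * \<bar>s - t\<bar>"
    if "(z, s) \<in> \<Omega>" "(z, t) \<in> \<Omega>" for z s t
  proof -
    have I: "(z, a) \<in> \<Omega>" if "a \<in> {low z<..<g z}" for a
      using that \<open>(z, s) \<in> \<Omega>\<close> by (simp add: dom_iff)
    have "norm (v (z, s) - v (z, t)) \<le> K * norm (s - t)"
    proof (rule field_differentiable_bound[of "{low z<..<g z}" "\<lambda>t. v (z, t)" "\<lambda>t. vy (z, t)"])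
      show "((\<lambda>t. v (z, t)) has_real_derivative vy (z, a)) (at a within {low z<..<g z})" if "a \<in> {low z<..<g z}" for a
        by (rule has_field_derivative_at_within[OF has_grad_slice_y_real[OF G[OF I[OF that]]]])
      show "norm (vy (z, a)) \<le> K" if "a \<in> {low z<..<g z}" for a using K(2)[OF I[OF that]] by simp
    qed (use that in \<open>auto simp: dom_iff\<close>)
    then show ?thesis by simp
  qed
  have horiz: "\<bar>v (x, m) - v (x', m)\<bar> \<le> K * \<bar>x - x'\<bar>"
  proof -
    have mY: "m \<in> {yC<..<yM}" using m\<Omega>(1) by (simp add: dom_iff_x)
    have I: "(a, m) \<in> \<Omega>" if "a \<in> {lft m<..<rgt m}" for a
      using that mY by (simp add: dom_iff_x)
    have "norm (v (x, m) - v (x', m)) \<le> K * norm (x - x')"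
    proof (rule field_differentiable_bound[of "{lft m<..<rgt m}" "\<lambda>t. v (t, m)" "\<lambda>t. vx (t, m)"])
      show "((\<lambda>t. v (t, m)) has_real_derivative vx (a, m)) (at a within {lft m<..<rgt m})" if "a \<in> {lft m<..<rgt m}" for a
        by (rule has_field_derivative_at_within[OF has_grad_slice_x_real[OF G[OF I[OF that]]]])
      show "norm (vx (a, m)) \<le> K" if "a \<in> {lft m<..<rgt m}" for a using K(1)[OF I[OF that]] by simp
    qed (use m\<Omega> in \<open>auto simp: dom_iff_x\<close>)
    then show ?thesis by simp
  qed
  have "\<bar>v (x, y) - v (x', y')\<bar> \<le> K * \<bar>y - m\<bar> + K * \<bar>x - x'\<bar> + K * \<bar>y' - m\<bar>"
    using vert[OF p(1) m\<Omega>(1)] vert[OF p(2) m\<Omega>(2)] horiz by linarith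
  also have "\<dots> = K * (\<bar>x - x'\<bar> + (\<bar>y - m\<bar> + \<bar>y' - m\<bar>))" by (simp add: algebra_simps)
  finally show ?thesis unfolding len .
qed

lemma lipschitz_extension:
  fixes v vx vy :: "real \<times> real \<Rightarrow> real"
  assumes G: "\<And>p. p \<in> \<Omega> \<Longrightarrow> has_grad v (vx p) (vy p) p"
    and K: "\<And>p. p \<in> \<Omega> \<Longrightarrow> \<bar>vx p\<bar> \<le> K" "\<And>p. p \<in> \<Omega> \<Longrightarrow> \<bar>vy p\<bar> \<le> K" "K > 0"
  shows "\<exists>V. continuous_on (closure \<Omega>) V \<and> (\<forall>p\<in>\<Omega>. V p = v p)"
proof -
  have L: "dist (v p) (v p') \<le> 2 * K * dist p p'" if pp: "p \<in> \<Omega>" "p' \<in> \<Omega>" for p p'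
  proof -
    obtain x y x' y' where e: "p = (x, y)" "p' = (x', y')" by (cases p, cases p') blast
    have "\<bar>x - x'\<bar> \<le> dist p p'" "\<bar>y - y'\<bar> \<le> dist p p'"
      using dist_fst_le[of p p'] dist_snd_le[of p p'] by (auto simp: e dist_real_def)
    then have "K * (\<bar>x - x'\<bar> + \<bar>y - y'\<bar>) \<le> K * (2 * dist p p')" using K(3) by (intro mult_left_mono) auto
    then show ?thesis using lipschitz_L1[OF G K(1,2) pp[unfolded e]] by (simp add: e dist_real_def mult_ac)
  qed
  have "uniformly_continuous_on \<Omega> v"
    unfolding uniformly_continuous_on_def
  proof (intro allI impI)
    fix \<epsilon> :: real assume \<epsilon>: "\<epsilon> > 0"
    show "\<exists>d>0. \<forall>p\<in>\<Omega>. \<forall>p'\<in>\<Omega>. dist p' p < d \<longrightarrow> dist (v p') (v p) < \<epsilon>"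
    proof (intro exI[of _ "\<epsilon> / (2 * K)"] conjI ballI impI)
      fix p p' assume pp: "p \<in> \<Omega>" "p' \<in> \<Omega>" "dist p' p < \<epsilon> / (2 * K)"
      have "2 * K * dist p' p < 2 * K * (\<epsilon> / (2 * K))" using K(3) pp(3) by (intro mult_strict_left_mono) auto
      also have "\<dots> = \<epsilon>" using K(3) by simp
      finally show "dist (v p') (v p) < \<epsilon>" using L[OF pp(2,1)] by linarith
    qed (use \<epsilon> K(3) in simp)
  qed
  then obtain V where "uniformly_continuous_on (closure \<Omega>) V" "\<And>p. p \<in> \<Omega> \<Longrightarrow> v p = V p"
    by (rule uniformly_continuous_on_extension_on_closure) blast
  then show ?thesis using uniformly_continuous_imp_continuous by (intro exI[of _ V]) auto
qed

text \<open>First derivatives are continuous up to the boundary, second ones only inside. The bound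
  on \<open>vxx\<close> carries a factor x or y, which leaves the origin as the only place where it
  may blow up; a single \<open>vxy\<close> stands for both mixed derivatives.\<close>

definition regular where
  "regular v vx vy vxx vxy vyy \<longleftrightarrow>
     continuous_on (closure \<Omega>) v \<and> continuous_on (closure \<Omega>) vx \<and> continuous_on (closure \<Omega>) vy \<and>
     (\<forall>p\<in>\<Omega>. has_grad v (vx p) (vy p) p \<and> has_grad vx (vxx p) (vxy p) p \<and> has_grad vy (vxy p) (vyy p) p) \<and>
     continuous_on \<Omega> vxx \<and> continuous_on \<Omega> vxy \<and> continuous_on \<Omega> vyy \<and>
     (\<exists>K. \<forall>p\<in>\<Omega>. \<bar>fst p * vxx p\<bar> \<le> K \<and> \<bar>snd p * vxx p\<bar> \<le> K \<and> \<bar>vxy p\<bar> \<le> K \<and> \<bar>vyy p\<bar> \<le> K)"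

text \<open>The first derivative in \<open>x\<close> extends continuously because \<open>u\<^sub>x = (y u\<^sub>x)\<^sub>y - y (u\<^sub>y)\<^sub>x\<close>; neither
  \<open>x u\<^sub>x\<close> nor \<open>y u\<^sub>x\<close> alone controls \<open>u\<^sub>x\<close> at the origin.\<close>

lemma regular_extension:
  fixes v :: "real \<times> real \<Rightarrow> real"
  assumes v: "\<And>p. p \<in> \<Omega> \<Longrightarrow> v differentiable (at p)"
    and C: "Ck_closure 1 \<Omega> (dy v)" "Ck_closure 1 \<Omega> (\<lambda>p. fst p * dx v p)" "Ck_closure 1 \<Omega> (\<lambda>p. snd p * dx v p)"
  obtains V Vx Vy Vxx Vxy Vyy where "regular V Vx Vy Vxx Vxy Vyy"
    "\<And>p. p \<in> \<Omega> \<Longrightarrow> V p = v p" "\<And>p. p \<in> \<Omega> \<Longrightarrow> Vx p = dx v p" "\<And>p. p \<in> \<Omega> \<Longrightarrow> Vy p = dy v p"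
    "Ck_open 2 \<Omega> v" "\<And>p. p \<in> \<Omega> \<Longrightarrow> Vxx p = dx (dx v) p \<and> Vyy p = dy (dy v) p"
proof -
  note O = dom_open
  note Cy = Ck_closure_1D[OF O C(1)] and Cf = Ck_closure_1D[OF O C(2)] and Cs = Ck_closure_1D[OF O C(3)]
  obtain Vy where Vy: "continuous_on (closure \<Omega>) Vy" "\<And>p. p \<in> \<Omega> \<Longrightarrow> Vy p = dy v p" using Cy(1) by blast
  obtain F1 where F1: "continuous_on (closure \<Omega>) F1" "\<And>p. p \<in> \<Omega> \<Longrightarrow> F1 p = dx (dy v) p" using Cy(2) by blast
  obtain F2 where F2: "continuous_on (closure \<Omega>) F2" "\<And>p. p \<in> \<Omega> \<Longrightarrow> F2 p = dy (dy v) p" using Cy(3) by blast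
  obtain X1 where X1: "continuous_on (closure \<Omega>) X1" "\<And>p. p \<in> \<Omega> \<Longrightarrow> X1 p = dx (\<lambda>p. fst p * dx v p) p" using Cf(2) by blast
  obtain X2 where X2: "continuous_on (closure \<Omega>) X2" "\<And>p. p \<in> \<Omega> \<Longrightarrow> X2 p = dy (\<lambda>p. fst p * dx v p) p" using Cf(3) by blast
  obtain Y1 where Y1: "continuous_on (closure \<Omega>) Y1" "\<And>p. p \<in> \<Omega> \<Longrightarrow> Y1 p = dx (\<lambda>p. snd p * dx v p) p" using Cs(2) by blast
  obtain Y2 where Y2: "continuous_on (closure \<Omega>) Y2" "\<And>p. p \<in> \<Omega> \<Longrightarrow> Y2 p = dy (\<lambda>p. snd p * dx v p) p" using Cs(3) by blast
  have gv: "has_grad v (dx v p) (dy v p) p" if "p \<in> \<Omega>" for p by (rule has_grad_dx_dy[OF v[OF that]])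
  \<comment> \<open>On \<Omega> the coordinate x is negative, so \<open>dx v\<close> is the
    differentiable function x v_x divided by x.\<close>
  have gx: "has_grad (dx v) (dx (dx v) p) (dy (dx v) p) p" if p: "p \<in> \<Omega>" for p
  proof -
    have "fst differentiable (at p)" using has_grad_differentiable[OF has_grad_fst] .
    then have "(\<lambda>p. inverse (fst p)) differentiable (at p)"
      by (rule differentiable_inverse) (use fst_neg[OF p] in simp)
    from differentiable_mult[OF this has_grad_differentiable[OF Cf(4)[OF p]]]
    have "(\<lambda>p. inverse (fst p) * (fst p * dx v p)) differentiable (at p)" .
    then have "has_grad (\<lambda>p. inverse (fst p) * (fst p * dx v p)) (dx (\<lambda>p. inverse (fst p) * (fst p * dx v p)) p)
      (dy (\<lambda>p. inverse (fst p) * (fst p * dx v p)) p) p" by (rule has_grad_dx_dy)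
    then have "has_grad (dx v) (dx (\<lambda>p. inverse (fst p) * (fst p * dx v p)) p)
      (dy (\<lambda>p. inverse (fst p) * (fst p * dx v p)) p) p"
      by (rule has_grad_cong_open[OF _ O p]) (use fst_neg in \<open>force simp: field_simps\<close>)
    then show ?thesis by (intro has_grad_dx_dy has_grad_differentiable)
  qed
  have pf: "X1 p = dx v p + fst p * dx (dx v) p" "X2 p = fst p * dy (dx v) p" if p: "p \<in> \<Omega>" for p
    using has_grad_unique[OF has_grad_mult[OF has_grad_fst gx[OF p]]] X1(2)[OF p] X2(2)[OF p] by simp_all
  have ps: "Y1 p = snd p * dx (dx v) p" "Y2 p = dx v p + snd p * dy (dx v) p" if p: "p \<in> \<Omega>" for p
    using has_grad_unique[OF has_grad_mult[OF has_grad_snd gx[OF p]]] Y1(2)[OF p] Y2(2)[OF p] by simp_all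
  note sub = continuous_on_subset[OF _ closure_subset]
  have cont_dx: "continuous_on \<Omega> (dx v)"
    by (intro continuous_at_imp_continuous_on ballI has_grad_continuous[OF gx])
  have cont_dy: "continuous_on \<Omega> (dy v)"
    by (intro continuous_at_imp_continuous_on ballI has_grad_continuous[OF Cy(4)])
  have cyx: "continuous_on \<Omega> (dy (dx v))"
  proof (rule continuous_on_eq)
    show "continuous_on \<Omega> (\<lambda>p. X2 p / fst p)"
      using fst_neg by (intro continuous_intros sub[OF X2(1)]) force
  qed (use pf fst_neg in force)
  have cxx: "continuous_on \<Omega> (dx (dx v))"
  proof (rule continuous_on_eq)
    show "continuous_on \<Omega> (\<lambda>p. (X1 p - dx v p) / fst p)"
      using fst_neg by (intro continuous_intros sub[OF X1(1)] cont_dx) force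
  qed (use pf fst_neg in force)
  have cxy: "continuous_on \<Omega> (dx (dy v))" by (rule continuous_on_eq[OF sub[OF F1(1)] F1(2)])
  have cyy: "continuous_on \<Omega> (dy (dy v))" by (rule continuous_on_eq[OF sub[OF F2(1)] F2(2)])
  have mixed: "dy (dx v) p = dx (dy v) p" if "p \<in> \<Omega>" for p
    by (rule mixed_partials_eq[OF O that has_grad_slice_x_real[OF gv] has_grad_slice_y_real[OF gv]
          has_grad_slice_y_real[OF gx] has_grad_slice_x_real[OF Cy(4)] cyx cxy])
  have open2: "Ck_open 2 \<Omega> v"
    unfolding numeral_2_eq_2 Ck_open.simps
    using has_grad_differentiable[OF gv] has_grad_differentiable[OF gx] has_grad_differentiable[OF Cy(4)] cxx cyx cxy cyy O
    by (simp add: differentiable_on_eq_differentiable_at)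
  define Vx where "Vx = (\<lambda>p. Y2 p - snd p * F1 p)"
  have Vx: "continuous_on (closure \<Omega>) Vx" "\<And>p. p \<in> \<Omega> \<Longrightarrow> Vx p = dx v p"
    unfolding Vx_def using ps mixed F1(2) by (auto intro!: continuous_intros Y2(1) F1(1))
  obtain K1 where K1: "K1 > 0" "\<And>p. p \<in> closure \<Omega> \<Longrightarrow> \<bar>Vx p\<bar> \<le> K1" using bounded_on_compact[OF compact_closure_dom Vx(1)] by blast
  obtain K2 where K2: "K2 > 0" "\<And>p. p \<in> closure \<Omega> \<Longrightarrow> \<bar>Vy p\<bar> \<le> K2" using bounded_on_compact[OF compact_closure_dom Vy(1)] by blast
  obtain K3 where K3: "\<And>p. p \<in> closure \<Omega> \<Longrightarrow> \<bar>F1 p\<bar> \<le> K3" using bounded_on_compact[OF compact_closure_dom F1(1)] by blast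
  obtain K4 where K4: "\<And>p. p \<in> closure \<Omega> \<Longrightarrow> \<bar>F2 p\<bar> \<le> K4" using bounded_on_compact[OF compact_closure_dom F2(1)] by blast
  obtain K5 where K5: "\<And>p. p \<in> closure \<Omega> \<Longrightarrow> \<bar>X1 p\<bar> \<le> K5" using bounded_on_compact[OF compact_closure_dom X1(1)] by blast
  obtain K6 where K6: "\<And>p. p \<in> closure \<Omega> \<Longrightarrow> \<bar>Y1 p\<bar> \<le> K6" using bounded_on_compact[OF compact_closure_dom Y1(1)] by blast
  have cl: "p \<in> closure \<Omega>" if "p \<in> \<Omega>" for p using that closure_subset by blast
  \<comment> \<open>Continuity of the function itself up to the boundary is not given. It follows
    from the bounds on the gradient, which make \<open>v\<close> Lipschitz.\<close>
  have "\<exists>V. continuous_on (closure \<Omega>) V \<and> (\<forall>p\<in>\<Omega>. V p = v p)"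
  proof (rule lipschitz_extension[OF gv, of "max K1 K2"])
    show "\<bar>dx v p\<bar> \<le> max K1 K2" "\<bar>dy v p\<bar> \<le> max K1 K2" if "p \<in> \<Omega>" for p
      using K1(2)[OF cl[OF that]] K2(2)[OF cl[OF that]] Vx(2)[OF that] Vy(2)[OF that] by auto
  qed (use K1(1) in auto)
  then obtain V where V: "continuous_on (closure \<Omega>) V" "\<And>p. p \<in> \<Omega> \<Longrightarrow> V p = v p" by blast
  have gV: "has_grad V (Vx p) (Vy p) p" if p: "p \<in> \<Omega>" for p
    unfolding Vx(2)[OF p] Vy(2)[OF p] by (rule has_grad_cong_open[OF gv[OF p] O p]) (simp add: V(2))
  have gVx: "has_grad Vx (dx (dx v) p) (dx (dy v) p) p" if p: "p \<in> \<Omega>" for p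
    unfolding mixed[OF p, symmetric] by (rule has_grad_cong_open[OF gx[OF p] O p]) (simp add: Vx(2))
  have gVy: "has_grad Vy (dx (dy v) p) (dy (dy v) p) p" if p: "p \<in> \<Omega>" for p
    by (rule has_grad_cong_open[OF Cy(4)[OF p] O p]) (simp add: Vy(2))
  define K where "K = max (max (K5 + K1) K6) (max K3 K4)"
  have K: "\<bar>fst p * dx (dx v) p\<bar> \<le> K \<and> \<bar>snd p * dx (dx v) p\<bar> \<le> K \<and> \<bar>dx (dy v) p\<bar> \<le> K \<and> \<bar>dy (dy v) p\<bar> \<le> K"
    if p: "p \<in> \<Omega>" for p
  proof -
    have "fst p * dx (dx v) p = X1 p - Vx p" using pf(1)[OF p] Vx(2)[OF p] by simp
    then have "\<bar>fst p * dx (dx v) p\<bar> \<le> K5 + K1" using K5[OF cl[OF p]] K1(2)[OF cl[OF p]] by linarith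
    then show ?thesis using K6[OF cl[OF p]] K3[OF cl[OF p]] K4[OF cl[OF p]] ps(1)[OF p] F1(2)[OF p] F2(2)[OF p]
      unfolding K_def by (simp add: le_max_iff_disj)
  qed
  have "regular V Vx Vy (dx (dx v)) (dx (dy v)) (dy (dy v))"
    unfolding regular_def
    by (intro conjI ballI V(1) Vx(1) Vy(1) gV gVx gVy cxx cxy cyy exI[of _ K] K) 
  then show thesis by (rule that[OF _ V(2) Vx(2) Vy(2) open2]) auto
qed

section \<open>Boundary values on AC and \<sigma>\<close>

text \<open>If the extension were nonzero at a boundary point, then |v| \<ge> c on strips of every
  small width along the graph nearby. Each \<open>f n\<close> vanishes near \<open>\<Gamma>\<close>,
  hence has a zero on every vertical slice of such a strip, as
  \<open>strip_trace_contradiction\<close> requires. The sign \<open>\<tau>\<close> says on which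
  side of the graph the domain lies.\<close>

lemma trace_zero_at:
  fixes v V :: "real \<times> real \<Rightarrow> real"
  assumes f: "\<And>n. f n \<in> C0_inf \<Omega> \<Gamma>" and conv: "W1_conv \<Omega> f v v1 v2"
    and V: "continuous_on (closure \<Omega>) V" "\<And>p. p \<in> \<Omega> \<Longrightarrow> V p = v p"
    and \<gamma>: "continuous_on {a0<..<b0} \<gamma>" and x1: "x1 \<in> {a0<..<b0}" and \<tau>: "\<tau> = 1 \<or> \<tau> = -1" and \<delta>1: "\<delta>1 > 0"
    and in\<Omega>: "\<And>x t. x \<in> {a0<..<b0} \<Longrightarrow> 0 < t \<Longrightarrow> t < \<delta>1 \<Longrightarrow> (x, \<gamma> x + \<tau> * t) \<in> \<Omega>"
    and \<Gamma>: "\<And>x. x \<in> {a0<..<b0} \<Longrightarrow> (x, \<gamma> x) \<in> \<Gamma>"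
    and cl: "(x1, \<gamma> x1) \<in> closure \<Omega>"
  shows "V (x1, \<gamma> x1) = 0"
proof (rule ccontr)
  assume ne: "V (x1, \<gamma> x1) \<noteq> 0"
  define c where "c = \<bar>V (x1, \<gamma> x1)\<bar> / 2"
  have c: "c > 0" using ne by (simp add: c_def)
  obtain \<rho> where \<rho>: "\<rho> > 0" "\<And>p. p \<in> closure \<Omega> \<Longrightarrow> dist p (x1, \<gamma> x1) < \<rho> \<Longrightarrow> dist (V p) (V (x1, \<gamma> x1)) < c"
    using V(1)[unfolded continuous_on_iff, rule_format, OF cl c] by blast
  have "isCont \<gamma> x1" using \<gamma> x1 by (simp add: continuous_on_eq_continuous_at)
  then obtain d where d: "d > 0" "\<And>x. \<bar>x - x1\<bar> < d \<Longrightarrow> \<bar>\<gamma> x - \<gamma> x1\<bar> < \<rho> / 4"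
    unfolding continuous_at_eps_delta dist_real_def using \<rho>(1) by (meson divide_pos_pos zero_less_numeral)
  define e where "e = min (min d (\<rho> / 4)) (min (x1 - a0) (b0 - x1))"
  have e: "e > 0" "e \<le> d" "e \<le> x1 - a0" "e \<le> b0 - x1" using d(1) \<rho>(1) x1 by (auto simp: e_def)
  have e4: "e \<le> \<rho> / 4" unfolding e_def by (meson min.cobounded1 min.cobounded2 order_trans)
  define a b where "a = x1 - e" and "b = x1 + e"
  have ab: "a < b" and sub: "{a<..<b} \<subseteq> {a0<..<b0}" using e by (auto simp: a_def b_def)
  define \<delta>0 where "\<delta>0 = min \<delta>1 (\<rho> / 4)"
  have \<delta>0: "\<delta>0 > 0" using \<delta>1 \<rho>(1) by (simp add: \<delta>0_def)
  \<comment> \<open>The minimum treats both signs at once: the strip lies above the graph for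
    \<open>\<tau> = 1\<close> and below it for \<open>\<tau> = -1\<close>, with width
    \<open>\<delta>\<close> in either case.\<close>
  define l where "l \<delta> x = min (\<gamma> x) (\<gamma> x + \<tau> * \<delta>)" for \<delta> x
  define r where "r \<delta> x = l \<delta> x + \<delta>" for \<delta> x :: real
  define S where "S \<delta> = {(x, y). x \<in> {a<..<b} \<and> l \<delta> x < y \<and> y < r \<delta> x}" for \<delta>
  have mem: "\<exists>t. 0 < t \<and> t < \<delta> \<and> y = \<gamma> x + \<tau> * t" if "l \<delta> x < y" "y < r \<delta> x" "\<delta> > 0" for x y \<delta>
    using \<tau>
  proof
    assume "\<tau> = 1"
    then show ?thesis using that by (intro exI[of _ "y - \<gamma> x"]) (auto simp: l_def r_def)
  next
    assume "\<tau> = -1"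
    then show ?thesis using that by (intro exI[of _ "\<gamma> x - y"]) (auto simp: l_def r_def)
  qed
  have near: "(x, y) \<in> \<Omega> \<and> c \<le> \<bar>v (x, y)\<bar>" if d': "0 < \<delta>" "\<delta> < \<delta>0" "(x, y) \<in> S \<delta>" for x y \<delta>
  proof -
    have xy: "x \<in> {a<..<b}" "l \<delta> x < y" "y < r \<delta> x" using d'(3) by (auto simp: S_def)
    obtain t where t: "0 < t" "t < \<delta>" "y = \<gamma> x + \<tau> * t" using mem[OF xy(2,3) d'(1)] by blast
    have \<Omega>: "(x, y) \<in> \<Omega>" unfolding t(3) using in\<Omega>[of x t] t xy(1) sub d' by (auto simp: \<delta>0_def)
    have "\<bar>x - x1\<bar> < e" using xy(1) by (auto simp: a_def b_def)
    then have "\<bar>x - x1\<bar> < d" "\<bar>x - x1\<bar> < \<rho> / 4" using e(2) e4 by linarith+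
    moreover have "\<bar>\<gamma> x - \<gamma> x1\<bar> < \<rho> / 4" by (rule d(2)) fact
    moreover have "\<bar>y - \<gamma> x\<bar> < \<rho> / 4" using t d' \<tau> by (auto simp: \<delta>0_def)
    moreover have "dist (x, y) (x1, \<gamma> x1) \<le> \<bar>x - x1\<bar> + \<bar>y - \<gamma> x1\<bar>"
      unfolding dist_Pair_Pair dist_real_def power2_abs by (rule sqrt_sum_squares_le_sum_abs)
    ultimately have "dist (x, y) (x1, \<gamma> x1) < \<rho>" using \<rho>(1) by linarith
    then have "dist (V (x, y)) (V (x1, \<gamma> x1)) < c" using \<rho>(2) closure_subset \<Omega> by blast
    then have "c \<le> \<bar>V (x, y)\<bar>" unfolding c_def dist_real_def by linarith
    then show ?thesis using V(2)[OF \<Omega>] \<Omega> by simp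
  qed
  obtain K where K: "\<And>p. p \<in> closure \<Omega> \<Longrightarrow> \<bar>V p\<bar> \<le> K" using bounded_on_compact[OF compact_closure_dom V(1)] by blast
  have cv: "continuous_on \<Omega> v" by (rule continuous_on_eq[OF continuous_on_subset[OF V(1) closure_subset] V(2)])
  have bv: "\<bar>v p\<bar> \<le> K" if "p \<in> \<Omega>" for p using K[of p] V(2)[OF that] closure_subset that by auto
  have cl': "continuous_on {a<..<b} (l \<delta>)" for \<delta>
    unfolding l_def by (intro continuous_intros continuous_on_subset[OF \<gamma> sub])
  have So: "open (S \<delta>)" for \<delta>
  proof -
    have eq: "S \<delta> = {p \<in> {a<..<b} \<times> UNIV. snd p - l \<delta> (fst p) \<in> {0<..}}
        \<inter> {p \<in> {a<..<b} \<times> UNIV. l \<delta> (fst p) + \<delta> - snd p \<in> {0<..}}"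
      by (auto simp: S_def r_def)
    have c1: "continuous_on ({a<..<b} \<times> UNIV) (\<lambda>p::real\<times>real. l \<delta> (fst p))"
      by (rule continuous_on_compose2[OF cl']) (auto intro!: continuous_intros)
    have op: "open {p \<in> {a<..<b} \<times> UNIV. h p \<in> {0<..}}" if "continuous_on ({a<..<b} \<times> UNIV) h" for h :: "real \<times> real \<Rightarrow> real"
      using continuous_open_preimage[OF that, of "{0<..}"] by (simp add: open_Times vimage_def Int_def)
    show ?thesis unfolding eq by (intro open_Int op continuous_intros c1)
  qed
  show False
  proof (rule strip_trace_contradiction[OF dom_open dom_bounded f conv cv bv ab c \<delta>0, of S l r])
    show "open (S \<delta>) \<and> S \<delta> \<subseteq> \<Omega> \<and> (\<forall>p\<in>S \<delta>. c \<le> \<bar>v p\<bar>)" if "0 < \<delta>" "\<delta> < \<delta>0" for \<delta>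
      using So near[OF that] by auto
    show "(x, y) \<in> S \<delta> \<longleftrightarrow> x \<in> {a<..<b} \<and> l \<delta> x < y \<and> y < r \<delta> x" for \<delta> x y by (simp add: S_def)
    show "r \<delta> x - l \<delta> x = \<delta>" for \<delta> x by (simp add: r_def)
    show "\<exists>y. (x, y) \<in> S \<delta> \<and> f n (x, y) = 0" if "0 < \<delta>" "\<delta> < \<delta>0" "x \<in> {a<..<b}" for n \<delta> x
    proof -
      obtain U where U: "open U" "\<Gamma> \<subseteq> U" "\<And>p. p \<in> U \<Longrightarrow> p \<in> \<Omega> \<Longrightarrow> f n p = 0"
        using f[of n] unfolding C0_inf_def by blast
      have "(x, \<gamma> x) \<in> U" using U(2) \<Gamma> that(3) sub by blast
      then obtain \<eta> where \<eta>: "\<eta> > 0" "ball (x, \<gamma> x) \<eta> \<subseteq> U" using U(1) open_contains_ball by blast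
      define t where "t = min \<eta> \<delta> / 2"
      have t: "0 < t" "t < \<delta>" "t < \<eta>" using \<eta>(1) that by (auto simp: t_def min_def)
      have "(x, \<gamma> x + \<tau> * t) \<in> S \<delta>" using t that(3) \<tau> by (auto simp: S_def l_def r_def)
      moreover have "(x, \<gamma> x + \<tau> * t) \<in> ball (x, \<gamma> x) \<eta>"
        using t \<tau> by (auto simp: dist_Pair_Pair dist_real_def)
      ultimately show ?thesis using U(3) \<eta>(2) near[OF that(1,2)] by (intro exI[of _ "\<gamma> x + \<tau> * t"]) blast
    qed
  qed
qed

lemma trace_zero:
  fixes v V :: "real \<times> real \<Rightarrow> real"
  assumes W: "v \<in> W1 \<Omega> (AC x0 \<union> sigma_arc \<alpha> \<beta> x0)"
    and V: "continuous_on (closure \<Omega>) V" "\<And>p. p \<in> \<Omega> \<Longrightarrow> V p = v p"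
  shows "2 * x0 < x \<Longrightarrow> x < 0 \<Longrightarrow> V (x, g x) = 0"
    and "yC < y \<Longrightarrow> y < 0 \<Longrightarrow> V (A y, y) = 0"
proof -
  obtain v1 v2 f where f: "\<And>n. f n \<in> C0_inf \<Omega> (AC x0 \<union> sigma_arc \<alpha> \<beta> x0)" and conv: "W1_conv \<Omega> f v v1 v2"
    using W unfolding W1_def W1_jet_def by blast
  \<comment> \<open>Selects a parameter interval on which the graph stays away from the axis, so
    that strips of one fixed height fit into the domain.\<close>
  have nbhd: "\<exists>a0 b0. x \<in> {a0<..<b0} \<and> {a0<..<b0} \<subseteq> J \<and> (\<forall>z\<in>{a0<..<b0}. h z < k)"
    if J: "J = {j1<..<j2}" "x \<in> J" and h: "continuous_on J h" "h x < k" for x h J and j1 j2 k :: real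
  proof -
    have "open (J \<inter> h -` {..<k})" using h(1) J by (intro continuous_open_preimage) auto
    moreover have "x \<in> J \<inter> h -` {..<k}" using J h by simp
    ultimately obtain \<epsilon> where "\<epsilon> > 0" "ball x \<epsilon> \<subseteq> J \<inter> h -` {..<k}" using open_contains_ball by blast
    then show ?thesis by (intro exI[of _ "x - \<epsilon>"] exI[of _ "x + \<epsilon>"]) (auto simp: ball_eq_greaterThanLessThan)
  qed
  show "V (x, g x) = 0" if x: "2 * x0 < x" "x < 0"
  proof -
    have gp: "g x > 0" using g_pos[OF x] .
    have xJ: "x \<in> {2 * x0<..<0}" using x by simp
    have "continuous_on {2 * x0<..<0} (\<lambda>z. - g z)" by (intro continuous_intros g_continuous)
    from nbhd[OF refl xJ this, of "- (g x / 2)"] gp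
    obtain a0 b0 where ab: "x \<in> {a0<..<b0}" "{a0<..<b0} \<subseteq> {2 * x0<..<0}" "\<And>z. z \<in> {a0<..<b0} \<Longrightarrow> - g z < - (g x / 2)"
      by auto
    show ?thesis
    proof (rule trace_zero_at[OF f conv V continuous_on_subset[OF g_continuous ab(2)] ab(1), of "-1" "g x / 2"])
      show "(z, g z + -1 * t) \<in> \<Omega>" if "z \<in> {a0<..<b0}" "0 < t" "t < g x / 2" for z t
        using ab(3)[OF that(1)] ab(2) that low_neg[of z] by (auto simp: dom_iff)
      show "(z, g z) \<in> AC x0 \<union> sigma_arc \<alpha> \<beta> x0" if "z \<in> {a0<..<b0}" for z
        using that ab(2) by (auto simp: sigma_iff)
    qed (use gp arc_in_closure(5)[OF x] in auto)
  qed
  show "V (A y, y) = 0" if y: "yC < y" "y < 0"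
  proof -
    define x where "x = A y"
    have x: "x \<in> {2 * x0<..<x0}" using A_image y by (auto simp: x_def)
    have lx: "low x = y" using low_A y by (simp add: x_def)
    have "continuous_on {2 * x0<..<x0} low"
      by (rule continuous_on_subset[OF low_continuous]) (use x0 in auto)
    from nbhd[OF refl x this, of "y / 2"] lx y
    obtain a0 b0 where ab: "x \<in> {a0<..<b0}" "{a0<..<b0} \<subseteq> {2 * x0<..<x0}" "\<And>z. z \<in> {a0<..<b0} \<Longrightarrow> low z < y / 2"
      by auto
    have sub: "{a0<..<b0} \<subseteq> {2 * x0<..<0}" using ab(2) x0 by auto
    have "V (x, low x) = 0"
    proof (rule trace_zero_at[OF f conv V continuous_on_subset[OF low_continuous sub] ab(1), of 1 "- (y / 2)"])
      show "(z, low z + 1 * t) \<in> \<Omega>" if "z \<in> {a0<..<b0}" "0 < t" "t < - (y / 2)" for z t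
        using ab(3)[OF that(1)] sub that g_pos[of z] by (auto simp: dom_iff)
      show "(z, low z) \<in> AC x0 \<union> sigma_arc \<alpha> \<beta> x0" if "z \<in> {a0<..<b0}" for z
        using that ab(2) A_low[of z] low_bounds[of z] low_neg[of z] x0 by (auto simp: AC_iff)
    qed (use y arc_in_closure(6)[of x] x x0 in auto)
    then show ?thesis unfolding lx by (simp add: x_def)
  qed
qed

text \<open>\<open>V\<close> is differentiable only inside, so the equation V = 0 cannot be
  differentiated along AC. The characteristic is shifted into the domain by \<open>\<eta>\<close>;
  there V has derivative \<open>G\<close>, and if \<open>G\<close> were nonzero at the boundary
  point, V would change by more than \<open>h * c\<close> between heights y and y + h, although both
  end values tend to 0 with \<open>\<eta>\<close>.\<close>

lemma tangential_derivative_AC: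
  assumes reg: "regular V Vx Vy Vxx Vxy Vyy"
    and zero: "\<And>y. yC < y \<Longrightarrow> y < 0 \<Longrightarrow> V (A y, y) = 0"
    and y: "yC < y" "y < 0"
  shows "Vy (A y, y) = sqrt (- y) * Vx (A y, y)"
proof (rule ccontr)
  assume ne: "Vy (A y, y) \<noteq> sqrt (- y) * Vx (A y, y)"
  define G where "G = (\<lambda>p. Vy p - sqrt (- snd p) * Vx p)"
  have cV: "continuous_on (closure \<Omega>) V" and cG: "continuous_on (closure \<Omega>) G"
    using reg unfolding regular_def G_def by (auto intro!: continuous_intros)
  define c where "c = \<bar>G (A y, y)\<bar> / 2"
  have c: "c > 0" using ne by (simp add: c_def G_def)
  obtain \<rho> where \<rho>: "\<rho> > 0" "\<And>p. p \<in> closure \<Omega> \<Longrightarrow> dist p (A y, y) < \<rho> \<Longrightarrow> dist (G p) (G (A y, y)) < c"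
    using cG[unfolded continuous_on_iff, rule_format, OF arc_in_closure(1)[OF y] c] by blast
  have "isCont A y" using A_deriv[OF y(2)] by (rule DERIV_isCont)
  then obtain d where d: "d > 0" "\<And>z. \<bar>z - y\<bar> < d \<Longrightarrow> \<bar>A z - A y\<bar> < \<rho> / 4"
    unfolding continuous_at_eps_delta dist_real_def using \<rho>(1) by (meson divide_pos_pos zero_less_numeral)
  define h where "h = min (min d (\<rho> / 4)) (- y) / 2"
  have h: "h > 0" "h < d" "h < \<rho> / 4" "y + h < 0" using d(1) \<rho>(1) y(2) by (auto simp: h_def min_def)
  \<comment> \<open>The width \<open>B y - A y\<close> of the horizontal slice at height y. Slices
    above it, up to the axis, are at least as wide, so any shift below \<open>gap\<close> stays
    inside.\<close>
  define gap where "gap = - 2 * x0 - 2 * rt y"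
  have gap: "gap > 0" using rt_bounds[OF y] by (simp add: gap_def)
  have in\<Omega>: "(A z + \<eta>, z) \<in> \<Omega>" if "y \<le> z" "z \<le> y + h" "0 < \<eta>" "\<eta> < gap" for z \<eta>
  proof -
    have "rt z \<le> rt y" unfolding rt_def using that h by (intro mult_left_mono powr_mono2) auto
    then show ?thesis using that y h dom_iff_lower[of z] by (auto simp: A_def B_def gap_def)
  qed
  have lim: "\<exists>d>0. \<forall>\<eta>. 0 < \<eta> \<and> \<eta> < d \<and> \<eta> < gap \<longrightarrow> \<bar>V (A z + \<eta>, z)\<bar> < c * h / 2" if z: "y \<le> z" "z \<le> y + h" for z
  proof -
    have zz: "yC < z" "z < 0" using z y h by auto
    obtain d where d: "d > 0" "\<And>p. p \<in> closure \<Omega> \<Longrightarrow> dist p (A z, z) < d \<Longrightarrow> dist (V p) (V (A z, z)) < c * h / 2"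
      using cV[unfolded continuous_on_iff, rule_format, OF arc_in_closure(1)[OF zz], of "c * h / 2"] c h by auto
    show ?thesis
    proof (intro exI[of _ d] conjI allI impI d(1))
      fix \<eta> assume \<eta>: "0 < \<eta> \<and> \<eta> < d \<and> \<eta> < gap"
      have "(A z + \<eta>, z) \<in> closure \<Omega>" using in\<Omega>[OF z] \<eta> closure_subset by blast
      moreover have "dist (A z + \<eta>, z) (A z, z) < d" using \<eta> by (simp add: dist_Pair_Pair dist_real_def)
      ultimately show "\<bar>V (A z + \<eta>, z)\<bar> < c * h / 2" using d(2) zero[OF zz] by (fastforce simp: dist_real_def)
    qed
  qed
  obtain d1 where d1: "d1 > 0" "\<And>\<eta>. 0 < \<eta> \<Longrightarrow> \<eta> < d1 \<Longrightarrow> \<eta> < gap \<Longrightarrow> \<bar>V (A y + \<eta>, y)\<bar> < c * h / 2"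
    using lim[of y] h by auto
  obtain d2 where d2: "d2 > 0" "\<And>\<eta>. 0 < \<eta> \<Longrightarrow> \<eta> < d2 \<Longrightarrow> \<eta> < gap \<Longrightarrow> \<bar>V (A (y + h) + \<eta>, y + h)\<bar> < c * h / 2"
    using lim[of "y + h"] h by auto
  define \<eta> where "\<eta> = min (min d1 d2) (min gap (\<rho> / 4)) / 2"
  have \<eta>: "0 < \<eta>" "\<eta> < d1" "\<eta> < d2" "\<eta> < gap" "\<eta> < \<rho> / 4"
    using d1(1) d2(1) gap \<rho>(1) by (auto simp: \<eta>_def min_def)
  have deriv: "((\<lambda>z. V (A z + \<eta>, z)) has_real_derivative G (A z + \<eta>, z)) (at z)" if z: "y \<le> z" "z \<le> y + h" for z
  proof -
    have "has_grad V (Vx (A z + \<eta>, z)) (Vy (A z + \<eta>, z)) (A z + \<eta>, z)"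
      using reg in\<Omega>[OF z \<eta>(1,4)] unfolding regular_def by blast
    moreover have "((\<lambda>z. A z + \<eta>) has_real_derivative - sqrt (- z)) (at z)"
      using A_deriv[of z] z h by (auto intro!: derivative_eq_intros)
    moreover have "((\<lambda>z. z) has_real_derivative 1) (at z)" by (rule DERIV_ident)
    ultimately have "((\<lambda>z. V (A z + \<eta>, z)) has_vector_derivative
        (- sqrt (- z)) *\<^sub>R Vx (A z + \<eta>, z) + 1 *\<^sub>R Vy (A z + \<eta>, z)) (at z)"
      by (rule has_grad_curve)
    then show ?thesis by (simp add: has_real_derivative_iff_has_vector_derivative G_def)
  qed
  obtain z where z: "y < z" "z < y + h"
    "V (A (y + h) + \<eta>, y + h) - V (A y + \<eta>, y) = (y + h - y) * G (A z + \<eta>, z)"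
    using MVT2[of y "y + h" "\<lambda>z. V (A z + \<eta>, z)" "\<lambda>z. G (A z + \<eta>, z)"] deriv h(1) by auto
  have "dist (A z + \<eta>, z) (A y, y) \<le> \<bar>A z + \<eta> - A y\<bar> + \<bar>z - y\<bar>"
    unfolding dist_Pair_Pair dist_real_def power2_abs by (rule sqrt_sum_squares_le_sum_abs)
  moreover have "\<bar>A z - A y\<bar> < \<rho> / 4" by (rule d(2)) (use z h in auto)
  ultimately have "dist (A z + \<eta>, z) (A y, y) < \<rho>" using z h \<eta>(1,5) \<rho>(1) by linarith
  moreover have "(A z + \<eta>, z) \<in> closure \<Omega>" using in\<Omega>[of z \<eta>] z \<eta> closure_subset by auto
  ultimately have "dist (G (A z + \<eta>, z)) (G (A y, y)) < c" by (intro \<rho>(2))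
  then have "c < \<bar>G (A z + \<eta>, z)\<bar>" unfolding c_def dist_real_def by linarith
  then have "h * c < \<bar>V (A (y + h) + \<eta>, y + h) - V (A y + \<eta>, y)\<bar>"
    using z(3) h(1) by (simp add: abs_mult)
  also have "\<dots> < c * h / 2 + c * h / 2"
    using d1(2)[OF \<eta>(1,2,4)] d2(2)[OF \<eta>(1,3,4)] by linarith
  finally show False by (simp add: mult.commute)
qed

end

section \<open>The Pohozaev identity\<close>

text \<open>Boundedness as a predicate closed under sums and products, so that the long divergence
  polynomials are handled by introduction rules without explicit constants.\<close>

definition bdd_fun :: "'a set \<Rightarrow> ('a \<Rightarrow> real) \<Rightarrow> bool" where
  "bdd_fun S f \<longleftrightarrow> (\<exists>K. \<forall>p\<in>S. \<bar>f p\<bar> \<le> K)"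

lemma bdd_fun_const: "bdd_fun S (\<lambda>p. c)" by (auto simp: bdd_fun_def)

lemma bdd_fun_add:
  assumes "bdd_fun S f" "bdd_fun S h"
  shows "bdd_fun S (\<lambda>p. f p + h p)"
proof -
  obtain K L where "\<forall>p\<in>S. \<bar>f p\<bar> \<le> K" "\<forall>p\<in>S. \<bar>h p\<bar> \<le> L" using assms unfolding bdd_fun_def by blast
  then have "\<forall>p\<in>S. \<bar>f p + h p\<bar> \<le> K + L" by (meson abs_triangle_ineq add_mono order_trans)
  then show ?thesis unfolding bdd_fun_def by blast
qed

lemma bdd_fun_mult:
  assumes "bdd_fun S f" "bdd_fun S h"
  shows "bdd_fun S (\<lambda>p. f p * h p)"
proof -
  obtain K L where K: "\<forall>p\<in>S. \<bar>f p\<bar> \<le> K" and L: "\<forall>p\<in>S. \<bar>h p\<bar> \<le> L" using assms unfolding bdd_fun_def by blast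
  have "\<bar>f p * h p\<bar> \<le> \<bar>K\<bar> * \<bar>L\<bar>" if "p \<in> S" for p
  proof -
    have "\<bar>f p\<bar> \<le> \<bar>K\<bar>" "\<bar>h p\<bar> \<le> \<bar>L\<bar>" using K L that by fastforce+
    then show ?thesis unfolding abs_mult by (intro mult_mono) auto
  qed
  then show ?thesis unfolding bdd_fun_def by blast
qed

lemma bdd_fun_power2: "bdd_fun S f \<Longrightarrow> bdd_fun S (\<lambda>p. (f p)\<^sup>2)"
  unfolding power2_eq_square by (rule bdd_fun_mult)

lemma bdd_fun_diff: "bdd_fun S f \<Longrightarrow> bdd_fun S h \<Longrightarrow> bdd_fun S (\<lambda>p. f p - h p)"
  using bdd_fun_add[of S f "\<lambda>p. (-1) * h p"] bdd_fun_mult[OF bdd_fun_const[of S "-1"], of h] by simp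

context tricomi_domain
begin

lemma bdd_fun_closure: "continuous_on (closure \<Omega>) f \<Longrightarrow> bdd_fun \<Omega> f"
proof -
  assume "continuous_on (closure \<Omega>) f"
  then obtain K where "\<And>p. p \<in> closure \<Omega> \<Longrightarrow> \<bar>f p\<bar> \<le> K"
    using bounded_on_compact[OF compact_closure_dom] by blast
  then show ?thesis unfolding bdd_fun_def using closure_subset by blast
qed

section \<open>The flux on the three arcs\<close>

text \<open>With u = 0 only the quadratic terms of the flux are left. The equation of the arc, in
  the form \<open>y * y powr \<alpha> = \<kappa> * q x\<close>, turns the coefficient of
  \<open>y * p^2 - r^2\<close> into \<open>theta_fun\<close> and that of
  \<open>sqrt y * p * r\<close> into \<open>psi_fun\<close>. The common factor
  \<open>b / y powr \<alpha>\<close> is the density of arclength divided by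
  \<open>h_fun\<close>.\<close>

lemma sigma_flux_algebra:
  fixes p r :: real
  assumes x: "2 * x0 < x" "x < 0"
  defines "y \<equiv> g x"
  shows "(6 * x * p * r - 2 * y\<^sup>2 * p\<^sup>2 + 2 * y * r\<^sup>2) - dg x * (3 * x * y * p\<^sup>2 - 3 * x * r\<^sup>2 + 4 * y\<^sup>2 * p * r)
    = b / y powr \<alpha> * (theta_fun \<alpha> x0 x * (y * p\<^sup>2 - r\<^sup>2) + psi_fun \<alpha> \<beta> x0 x * (sqrt y * p * r))"
proof -
  have y: "y > 0" using g_pos[OF x] by (simp add: y_def)
  define Z where "Z = y powr \<alpha>"
  have Z: "Z > 0" using y by (simp add: Z_def)
  have yZ: "y * Z = \<kappa> * q x"
    using g_powr_Suc[of x] x y by (simp add: Z_def y_def powr_add mult.commute)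
  have "y powr (3/2) * sqrt y = y powr (3/2 + 1/2)" using y by (simp only: powr_add powr_half_sqrt[OF less_imp_le[OF y]])
  then have y32: "y powr (3/2) * sqrt y = y\<^sup>2" using y by (simp add: powr_numeral)
  \<comment> \<open>After multiplication by \<open>sqrt y\<close> the case distinction of
    \<open>varphi_fun\<close> disappears: both branches give \<open>y powr \<alpha>\<close>.\<close>
  have "(if \<alpha> = 1/2 then 1 else y powr ((2 * \<alpha> - 1) / 2)) * sqrt y = Z"
  proof (cases "\<alpha> = 1/2")
    case True
    then show ?thesis unfolding Z_def True using y by (simp add: powr_half_sqrt)
  next
    case False
    have "y powr ((2 * \<alpha> - 1) / 2) * sqrt y = y powr ((2 * \<alpha> - 1) / 2 + 1/2)"
      using y by (simp only: powr_add powr_half_sqrt[OF less_imp_le[OF y]])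
    also have "(2 * \<alpha> - 1) / 2 + 1/2 = \<alpha>" by (simp add: field_simps)
    finally show ?thesis using False by (simp add: Z_def)
  qed
  then have ps: "psi_fun \<alpha> \<beta> x0 x * sqrt y = 6 / b * x * Z + 4 * (x - x0) * y\<^sup>2"
    unfolding psi_fun_def varphi_fun_def phi_fun_def y_def[symmetric] b(3)
    by (simp add: distrib_right mult.assoc y32)
  have th: "theta_fun \<alpha> x0 x = 3 * x * (x - x0) - 2 * (y * Z) / b"
  proof -
    have "2 * (y * Z) / b = (\<alpha> + 1) * (x * (2 * x0 - x))" unfolding yZ using b(1) by (simp add: \<kappa>_def q_def)
    moreover have "(4 + \<alpha>) * d_num \<alpha> = 5 + 2 * \<alpha>" using \<alpha> by (simp add: d_num_def)
    moreover have "theta_fun \<alpha> x0 x = (4 + \<alpha>) * x\<^sup>2 - ((4 + \<alpha>) * d_num \<alpha>) * (x * x0)"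
      by (simp add: theta_fun_def power2_eq_square algebra_simps)
    ultimately show ?thesis by (simp add: algebra_simps power2_eq_square)
  qed
  have "psi_fun \<alpha> \<beta> x0 x * (sqrt y * p * r) = (psi_fun \<alpha> \<beta> x0 x * sqrt y) * (p * r)" by simp
  then have 1: "b / Z * (theta_fun \<alpha> x0 x * (y * p\<^sup>2 - r\<^sup>2) + psi_fun \<alpha> \<beta> x0 x * (sqrt y * p * r))
      = b / Z * ((3 * x * (x - x0) - 2 * (y * Z) / b) * (y * p\<^sup>2 - r\<^sup>2) + (6 / b * x * Z + 4 * (x - x0) * y\<^sup>2) * (p * r))"
    by (simp only: ps th)
  have 2: "b / Z * ((3 * x * (x - x0) - 2 * (y * Z) / b) * (y * p\<^sup>2 - r\<^sup>2) + (6 / b * x * Z + 4 * (x - x0) * y\<^sup>2) * (p * r))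
      = (b / Z) * (3 * x * (x - x0) * (y * p\<^sup>2 - r\<^sup>2) + 4 * (x - x0) * y\<^sup>2 * (p * r))
        - 2 * y * (y * p\<^sup>2 - r\<^sup>2) + 6 * x * (p * r)"
    using b(1) Z by (simp add: divide_simps) (simp add: algebra_simps)
  have 3: "dg x = - (b / Z) * (x - x0)" by (simp add: dg_def y_def Z_def)
  define c where "c = b / Z"
  show ?thesis
    unfolding Z_def[symmetric] 1 2 3 unfolding c_def[symmetric] by (simp add: algebra_simps power2_eq_square)
qed

text \<open>The dilation field (3x, 2y) is tangent to BC, so the terms with \<open>lam\<close>
  cancel. On a characteristic the quadratic part degenerates to the square of
  \<open>s * p + r\<close>, which is the derivative of u along BC with respect to y.\<close>

lemma BC_flux_algebra:
  fixes v p r lam :: real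
  assumes y: "y < 0"
  defines "s \<equiv> sqrt (- y)" and "x \<equiv> B y"
  shows "(3 * lam * x * v\<^sup>2 + y * v * p + 3 * x * y * p\<^sup>2 - 3 * x * r\<^sup>2 + 4 * y\<^sup>2 * p * r)
    - s * (2 * lam * y * v\<^sup>2 + v * r + 6 * x * p * r - 2 * y\<^sup>2 * p\<^sup>2 + 2 * y * r\<^sup>2)
    = 4 * s ^ 3 * (s * p + r)\<^sup>2 - s * v * (s * p + r)"
    and "3 * x = - 2 * s ^ 3"
proof -
  have s: "s \<ge> 0" "y = - s\<^sup>2" using y by (simp_all add: s_def)
  have "(- y) powr (3/2) = s ^ 3"
  proof -
    have "(- y) powr (3/2) = ((- y) powr (1/2)) powr 3" using y by (simp add: powr_powr)
    also have "\<dots> = s ^ 3" using y s(1) by (simp add: powr_half_sqrt s_def powr_numeral)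
    finally show ?thesis .
  qed
  then show 3: "3 * x = - 2 * s ^ 3" using y by (simp add: x_def B_def rt_def)
  then have "x = - 2 / 3 * s ^ 3" by simp
  then show "(3 * lam * x * v\<^sup>2 + y * v * p + 3 * x * y * p\<^sup>2 - 3 * x * r\<^sup>2 + 4 * y\<^sup>2 * p * r)
    - s * (2 * lam * y * v\<^sup>2 + v * r + 6 * x * p * r - 2 * y\<^sup>2 * p\<^sup>2 + 2 * y * r\<^sup>2)
    = 4 * s ^ 3 * (s * p + r)\<^sup>2 - s * v * (s * p + r)"
    unfolding s(2) by (simp add: algebra_simps power2_eq_square power3_eq_cube)
qed

text \<open>Substituting \<open>y = - s^2\<close> and \<open>r = s * p\<close> cancels the terms
  with x among themselves, and likewise those without x. Thus no relation between x and y is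
  involved, although AC is not invariant under the dilations.\<close>

lemma AC_flux_algebra:
  fixes p r :: real
  assumes y: "y < 0" and r: "r = sqrt (- y) * p"
  shows "(3 * x * y * p\<^sup>2 - 3 * x * r\<^sup>2 + 4 * y\<^sup>2 * p * r)
    + sqrt (- y) * (6 * x * p * r - 2 * y\<^sup>2 * p\<^sup>2 + 2 * y * r\<^sup>2) = 0"
proof -
  define s where "s = sqrt (- y)"
  have s: "y = - s\<^sup>2" using y by (simp add: s_def)
  show ?thesis unfolding r s_def[symmetric] unfolding s by (simp add: algebra_simps power2_eq_square)
qed

text \<open>\<open>(F1, F2)\<close> is the flux field of the multiplier identity. The differential
  equation enters only through its divergence, and the boundary conditions only through the flux on
  AC and \<sigma>.\<close>

lemma pohozaev:
  fixes lam :: real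
  assumes reg: "regular V Vx Vy Vxx Vxy Vyy"
    and pde: "\<And>p. p \<in> \<Omega> \<Longrightarrow> - snd p * Vxx p - Vyy p = lam * V p"
    and zg: "\<And>x. 2 * x0 < x \<Longrightarrow> x < 0 \<Longrightarrow> V (x, g x) = 0"
    and zA: "\<And>y. yC < y \<Longrightarrow> y < 0 \<Longrightarrow> V (A y, y) = 0"
  defines "fBC \<equiv> \<lambda>y. 4 * sqrt (- y) ^ 3 * (sqrt (- y) * Vx (B y, y) + Vy (B y, y))\<^sup>2
      - sqrt (- y) * V (B y, y) * (sqrt (- y) * Vx (B y, y) + Vy (B y, y))"
    and "f\<sigma> \<equiv> \<lambda>x. b / g x powr \<alpha> * (theta_fun \<alpha> x0 x * (g x * (Vx (x, g x))\<^sup>2 - (Vy (x, g x))\<^sup>2)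
      + psi_fun \<alpha> \<beta> x0 x * (sqrt (g x) * Vx (x, g x) * Vy (x, g x)))"
  shows "set_integrable lebesgue {yC<..<0} fBC" "set_integrable lebesgue {2 * x0<..<0} f\<sigma>"
    "4 * lam * (LINT p:\<Omega>|lebesgue. (V p)\<^sup>2)
      = (LINT y:{yC<..<0}|lebesgue. fBC y) + (LINT x:{2 * x0<..<0}|lebesgue. f\<sigma> x)"
proof -
  define F1 where "F1 = (\<lambda>p. 3 * lam * fst p * (V p)\<^sup>2 + snd p * V p * Vx p + 3 * fst p * snd p * (Vx p)\<^sup>2
    - 3 * fst p * (Vy p)\<^sup>2 + 4 * (snd p)\<^sup>2 * Vx p * Vy p)"
  define F2 where "F2 = (\<lambda>p. 2 * lam * snd p * (V p)\<^sup>2 + V p * Vy p + 6 * fst p * Vx p * Vy p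
    - 2 * (snd p)\<^sup>2 * (Vx p)\<^sup>2 + 2 * snd p * (Vy p)\<^sup>2)"
  \<comment> \<open>The second derivative in x is written only inside the product
    \<open>snd p * Vxx p\<close>, the form in which it is bounded.\<close>
  define F1x where "F1x = (\<lambda>p. 3 * lam * ((V p)\<^sup>2 + 2 * fst p * V p * Vx p)
    + (snd p * (Vx p)\<^sup>2 + V p * (snd p * Vxx p)) + 3 * (snd p * (Vx p)\<^sup>2 + 2 * fst p * Vx p * (snd p * Vxx p))
    - 3 * ((Vy p)\<^sup>2 + 2 * fst p * Vy p * Vxy p) + 4 * (snd p * (snd p * Vxx p) * Vy p + (snd p)\<^sup>2 * Vx p * Vxy p))"
  define F2y where "F2y = (\<lambda>p. 2 * lam * ((V p)\<^sup>2 + 2 * snd p * V p * Vy p) + ((Vy p)\<^sup>2 + V p * Vyy p)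
    + 6 * fst p * (Vxy p * Vy p + Vx p * Vyy p) - 2 * (2 * snd p * (Vx p)\<^sup>2 + 2 * (snd p)\<^sup>2 * Vx p * Vxy p)
    + 2 * ((Vy p)\<^sup>2 + 2 * snd p * Vy p * Vyy p))"
  have cont: "continuous_on (closure \<Omega>) V" "continuous_on (closure \<Omega>) Vx" "continuous_on (closure \<Omega>) Vy"
    and cont2: "continuous_on \<Omega> Vxx" "continuous_on \<Omega> Vxy" "continuous_on \<Omega> Vyy"
    and G: "\<And>p. p \<in> \<Omega> \<Longrightarrow> has_grad V (Vx p) (Vy p) p" "\<And>p. p \<in> \<Omega> \<Longrightarrow> has_grad Vx (Vxx p) (Vxy p) p"
      "\<And>p. p \<in> \<Omega> \<Longrightarrow> has_grad Vy (Vxy p) (Vyy p) p"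
    using reg unfolding regular_def by blast+
  obtain K0 where K0: "\<forall>p\<in>\<Omega>. \<bar>fst p * Vxx p\<bar> \<le> K0 \<and> \<bar>snd p * Vxx p\<bar> \<le> K0 \<and> \<bar>Vxy p\<bar> \<le> K0 \<and> \<bar>Vyy p\<bar> \<le> K0"
    using reg unfolding regular_def by blast
  note cont' = cont[THEN continuous_on_subset, OF closure_subset]
  have bd: "bdd_fun \<Omega> V" "bdd_fun \<Omega> Vx" "bdd_fun \<Omega> Vy" "bdd_fun \<Omega> fst" "bdd_fun \<Omega> snd"
    "bdd_fun \<Omega> (\<lambda>p. snd p * Vxx p)" "bdd_fun \<Omega> Vxy" "bdd_fun \<Omega> Vyy"
  proof -
    show "bdd_fun \<Omega> V" "bdd_fun \<Omega> Vx" "bdd_fun \<Omega> Vy" by (rule bdd_fun_closure, rule cont)+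
    show "bdd_fun \<Omega> fst" "bdd_fun \<Omega> snd" by (rule bdd_fun_closure, intro continuous_intros)+
    show "bdd_fun \<Omega> (\<lambda>p. snd p * Vxx p)" "bdd_fun \<Omega> Vxy" "bdd_fun \<Omega> Vyy"
      using K0 unfolding bdd_fun_def by blast+
  qed
  have "bdd_fun \<Omega> F1x" unfolding F1x_def
    by (intro bdd_fun_add bdd_fun_diff bdd_fun_mult bdd_fun_power2 bdd_fun_const bd)
  then obtain K1 where K1: "\<And>p. p \<in> \<Omega> \<Longrightarrow> \<bar>F1x p\<bar> \<le> K1" unfolding bdd_fun_def by blast
  have "bdd_fun \<Omega> F2y" unfolding F2y_def
    by (intro bdd_fun_add bdd_fun_diff bdd_fun_mult bdd_fun_power2 bdd_fun_const bd)
  then obtain K2 where K2: "\<And>p. p \<in> \<Omega> \<Longrightarrow> \<bar>F2y p\<bar> \<le> K2" unfolding bdd_fun_def by blast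
  have cF: "continuous_on (closure \<Omega>) F1" "continuous_on (closure \<Omega>) F2"
    unfolding F1_def F2_def by (intro continuous_intros cont)+
  have cFd: "continuous_on \<Omega> F1x" "continuous_on \<Omega> F2y"
    unfolding F1x_def F2y_def by (intro continuous_intros cont' cont2)+
  have D1: "((\<lambda>t. F1 (t, y)) has_real_derivative F1x (x, y)) (at x)" if p: "(x, y) \<in> \<Omega>" for x y
    unfolding F1_def F1x_def
    using has_grad_slice_x_real[OF G(1)[OF p]] has_grad_slice_x_real[OF G(2)[OF p]] has_grad_slice_x_real[OF G(3)[OF p]]
    by (auto intro!: derivative_eq_intros simp: algebra_simps power2_eq_square)
  have D2: "((\<lambda>t. F2 (x, t)) has_real_derivative F2y (x, y)) (at y)" if p: "(x, y) \<in> \<Omega>" for x y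
    unfolding F2_def F2y_def
    using has_grad_slice_y_real[OF G(1)[OF p]] has_grad_slice_y_real[OF G(2)[OF p]] has_grad_slice_y_real[OF G(3)[OF p]]
    by (auto intro!: derivative_eq_intros simp: algebra_simps power2_eq_square)
  let ?L = "{yC<..<0::real}" and ?X = "{2 * x0<..<0}"
  have X1: "set_integrable lebesgue \<Omega> F1x"
    by (rule dom_divergence_x(1)[OF cF(1) D1 cFd(1) K1])
  have X2: "set_integrable lebesgue ?X (\<lambda>x. dg x * F1 (x, g x))"
    by (rule dom_divergence_x(2)[OF cF(1) D1 cFd(1) K1])
  have X3: "set_integrable lebesgue ?L (\<lambda>y. F1 (A y, y))"
    by (rule dom_divergence_x(3)[OF cF(1) D1 cFd(1) K1])
  have X4: "set_integrable lebesgue ?L (\<lambda>y. F1 (B y, y))"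
    by (rule dom_divergence_x(4)[OF cF(1) D1 cFd(1) K1])
  have X5: "(LINT p:\<Omega>|lebesgue. F1x p) = (LINT y:?L|lebesgue. F1 (B y, y)) - (LINT y:?L|lebesgue. F1 (A y, y))
      - (LINT x:?X|lebesgue. dg x * F1 (x, g x))"
    by (rule dom_divergence_x(5)[OF cF(1) D1 cFd(1) K1])
  have Y1: "set_integrable lebesgue \<Omega> F2y"
    by (rule dom_divergence_y(1)[OF cF(2) D2 cFd(2) K2])
  have Y2: "set_integrable lebesgue ?X (\<lambda>x. F2 (x, g x))"
    by (rule dom_divergence_y(2)[OF cF(2) D2 cFd(2) K2])
  have Y3: "set_integrable lebesgue ?L (\<lambda>y. sqrt (- y) * F2 (A y, y))"
    by (rule dom_divergence_y(3)[OF cF(2) D2 cFd(2) K2])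
  have Y4: "set_integrable lebesgue ?L (\<lambda>y. sqrt (- y) * F2 (B y, y))"
    by (rule dom_divergence_y(4)[OF cF(2) D2 cFd(2) K2])
  have Y5: "(LINT p:\<Omega>|lebesgue. F2y p) = (LINT x:?X|lebesgue. F2 (x, g x))
      - (LINT y:?L|lebesgue. sqrt (- y) * F2 (A y, y)) - (LINT y:?L|lebesgue. sqrt (- y) * F2 (B y, y))"
    by (rule dom_divergence_y(5)[OF cF(2) D2 cFd(2) K2])
  have div: "F1x p + F2y p = 4 * lam * (V p)\<^sup>2" if "p \<in> \<Omega>" for p
  proof -
    \<comment> \<open>The equation expresses \<open>snd p * Vxx p\<close> through V and
      \<open>Vyy\<close>. All quadratic terms in the derivatives then cancel, and so do the products
      of V with first derivatives.\<close>
    define W where "W = Vyy p"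
    have W: "snd p * Vxx p = - lam * V p - W" using pde[OF that] by (simp add: W_def)
    show ?thesis unfolding F1x_def F2y_def W W_def[symmetric] by (simp add: algebra_simps power2_eq_square)
  qed
  have eB: "F1 (B y, y) - sqrt (- y) * F2 (B y, y) = fBC y" if "y \<in> ?L" for y
    unfolding F1_def F2_def fBC_def fst_conv snd_conv
    using BC_flux_algebra(1)[of y lam "V (B y, y)" "Vx (B y, y)" "Vy (B y, y)"] that by simp
  have eA: "F1 (A y, y) + sqrt (- y) * F2 (A y, y) = 0" if "y \<in> ?L" for y
    unfolding F1_def F2_def fst_conv snd_conv
    using AC_flux_algebra[of y "Vy (A y, y)" "Vx (A y, y)" "A y"] that
      tangential_derivative_AC[OF reg zA, of y] zA[of y] by simp
  have eS: "F2 (x, g x) - dg x * F1 (x, g x) = f\<sigma> x" if "x \<in> ?X" for x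
    unfolding F1_def F2_def f\<sigma>_def fst_conv snd_conv
    using sigma_flux_algebra[of x "Vx (x, g x)" "Vy (x, g x)"] that zg[of x] by simp
  have IB: "set_integrable lebesgue ?L (\<lambda>y. F1 (B y, y) - sqrt (- y) * F2 (B y, y))"
    by (rule set_integral_diff(1)[OF X4 Y4])
  have IS: "set_integrable lebesgue ?X (\<lambda>x. F2 (x, g x) - dg x * F1 (x, g x))"
    by (rule set_integral_diff(1)[OF Y2 X2])
  show "set_integrable lebesgue ?L fBC"
    using IB eB by (subst (asm) set_integrable_cong[of lebesgue lebesgue ?L ?L _ fBC]) auto
  show "set_integrable lebesgue ?X f\<sigma>"
    using IS eS by (subst (asm) set_integrable_cong[of lebesgue lebesgue ?X ?X _ f\<sigma>]) auto
  have "4 * lam * (LINT p:\<Omega>|lebesgue. (V p)\<^sup>2) = (LINT p:\<Omega>|lebesgue. 4 * lam * (V p)\<^sup>2)" by simp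
  also have "\<dots> = (LINT p:\<Omega>|lebesgue. F1x p + F2y p)"
    by (rule set_lebesgue_integral_cong) (use div dom_open in auto)
  also have "\<dots> = (LINT p:\<Omega>|lebesgue. F1x p) + (LINT p:\<Omega>|lebesgue. F2y p)"
    by (rule set_integral_add(2)[OF X1 Y1])
  also have "\<dots> = ((LINT y:?L|lebesgue. F1 (B y, y)) - (LINT y:?L|lebesgue. sqrt (- y) * F2 (B y, y)))
      - ((LINT y:?L|lebesgue. F1 (A y, y)) + (LINT y:?L|lebesgue. sqrt (- y) * F2 (A y, y)))
      + ((LINT x:?X|lebesgue. F2 (x, g x)) - (LINT x:?X|lebesgue. dg x * F1 (x, g x)))"
    unfolding X5 Y5 by simp
  also have "\<dots> = (LINT y:?L|lebesgue. F1 (B y, y) - sqrt (- y) * F2 (B y, y))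
      - (LINT y:?L|lebesgue. F1 (A y, y) + sqrt (- y) * F2 (A y, y))
      + (LINT x:?X|lebesgue. F2 (x, g x) - dg x * F1 (x, g x))"
    unfolding set_integral_diff(2)[OF X4 Y4] set_integral_add(2)[OF X3 Y3] set_integral_diff(2)[OF Y2 X2] ..
  also have "(LINT y:?L|lebesgue. F1 (B y, y) - sqrt (- y) * F2 (B y, y)) = (LINT y:?L|lebesgue. fBC y)"
    by (rule set_lebesgue_integral_cong) (use eB in auto)
  also have "(LINT y:?L|lebesgue. F1 (A y, y) + sqrt (- y) * F2 (A y, y)) = (LINT y:?L|lebesgue. 0)"
    by (rule set_lebesgue_integral_cong) (use eA in auto)
  also have "(LINT x:?X|lebesgue. F2 (x, g x) - dg x * F1 (x, g x)) = (LINT x:?X|lebesgue. f\<sigma> x)"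
    by (rule set_lebesgue_integral_cong) (use eS in auto)
  finally show "4 * lam * (LINT p:\<Omega>|lebesgue. (V p)\<^sup>2)
      = (LINT y:?L|lebesgue. fBC y) + (LINT x:?X|lebesgue. f\<sigma> x)" by simp
qed

end

section \<open>The boundary estimate\<close>

lemma arc_norm_eq:
  assumes "\<And>t. a < t \<Longrightarrow> t < b \<Longrightarrow> (norm (bvalue \<Omega> f (c t)))\<^sup>2 * norm (vector_derivative c (at t)) = F t"
  shows "(arc_norm \<Omega> c a b f)\<^sup>2 = (LINT t:{a<..<b}|lebesgue. F t)"
    and "arc_L2 \<Omega> c a b f \<Longrightarrow> set_integrable lebesgue {a<..<b} F"
proof -
  let ?F = "\<lambda>t. (norm (bvalue \<Omega> f (c t)))\<^sup>2 * norm (vector_derivative c (at t))"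
  have S: "{a<..<b} \<in> sets lebesgue" by simp
  have "(arc_norm \<Omega> c a b f)\<^sup>2 = integral\<^sup>L (lebesgue_on {a<..<b}) ?F"
    unfolding arc_norm_def by (intro real_sqrt_pow2 integral_nonneg_AE) auto
  also have "\<dots> = (LINT t:{a<..<b}|lebesgue. ?F t)" by (rule set_lebesgue_integral_restrict[OF S])
  also have "\<dots> = (LINT t:{a<..<b}|lebesgue. F t)"
    by (rule set_lebesgue_integral_cong[OF S]) (use assms in auto)
  finally show "(arc_norm \<Omega> c a b f)\<^sup>2 = (LINT t:{a<..<b}|lebesgue. F t)" .
  assume "arc_L2 \<Omega> c a b f"
  then have "integrable (lebesgue_on {a<..<b}) ?F" by (simp add: arc_L2_def)
  then have "set_integrable lebesgue {a<..<b} ?F"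
    by (simp add: integrable_restrict_space set_integrable_def)
  then show "set_integrable lebesgue {a<..<b} F"
    using assms by (subst (asm) set_integrable_cong[of lebesgue lebesgue "{a<..<b}" "{a<..<b}" _ F]) auto
qed

lemma arc_norm_nonneg: "arc_norm \<Omega> c a b f \<ge> 0"
  unfolding arc_norm_def by (intro real_sqrt_ge_zero integral_nonneg_AE) auto

lemma quadratic_discriminant_le:
  fixes X F G :: real
  assumes "\<And>k. 0 \<le> F * k\<^sup>2 - 2 * X * k + G" "F \<ge> 0"
  shows "X\<^sup>2 \<le> F * G"
proof (cases "F = 0")
  case True
  have "X = 0"
  proof (rule ccontr)
    assume "X \<noteq> 0"
    then show False using assms(1)[of "(G + 1) / (2 * X)"] True by simp
  qed
  then show ?thesis using True by simp
next
  case False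
  then have "F > 0" using assms(2) by simp
  then show ?thesis using assms(1)[of "X / F"] by (simp add: field_simps power2_eq_square)
qed

lemma set_integral_Cauchy_Schwarz:
  fixes f h :: "'a \<Rightarrow> real"
  assumes "set_integrable M S (\<lambda>x. (f x)\<^sup>2)" "set_integrable M S (\<lambda>x. (h x)\<^sup>2)" "set_integrable M S (\<lambda>x. f x * h x)"
  shows "(LINT x:S|M. f x * h x) \<le> sqrt (LINT x:S|M. (f x)\<^sup>2) * sqrt (LINT x:S|M. (h x)\<^sup>2)"
proof -
  let ?F = "LINT x:S|M. (f x)\<^sup>2" and ?H = "LINT x:S|M. (h x)\<^sup>2" and ?X = "LINT x:S|M. f x * h x"
  have "0 \<le> ?F * k\<^sup>2 - 2 * ?X * k + ?H" for k
  proof -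
    have I: "set_integrable M S (\<lambda>x. k\<^sup>2 * (f x)\<^sup>2 - (2 * k) * (f x * h x))"
      by (intro set_integral_diff(1) set_integrable_mult_right assms)
    have "0 \<le> (LINT x:S|M. (k * f x - h x)\<^sup>2)"
      unfolding set_lebesgue_integral_def by (intro integral_nonneg_AE AE_I2) (simp add: indicator_def)
    also have "\<dots> = (LINT x:S|M. (k\<^sup>2 * (f x)\<^sup>2 - (2 * k) * (f x * h x)) + (h x)\<^sup>2)"
      unfolding set_lebesgue_integral_def
      by (intro Bochner_Integration.integral_cong refl) (simp add: power2_eq_square algebra_simps)
    also have "\<dots> = (LINT x:S|M. k\<^sup>2 * (f x)\<^sup>2 - (2 * k) * (f x * h x)) + ?H"
      by (rule set_integral_add(2)[OF I assms(2)])
    also have "(LINT x:S|M. k\<^sup>2 * (f x)\<^sup>2 - (2 * k) * (f x * h x)) = k\<^sup>2 * ?F - (2 * k) * ?X"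
      by (subst set_integral_diff(2)) (use assms in \<open>auto intro!: set_integrable_mult_right\<close>)
    finally show ?thesis by (simp add: mult_ac)
  qed
  moreover have "?F \<ge> 0"
    unfolding set_lebesgue_integral_def by (intro integral_nonneg_AE AE_I2) (simp add: indicator_def)
  ultimately have "?X\<^sup>2 \<le> ?F * ?H" by (rule quadratic_discriminant_le)
  then show ?thesis unfolding real_sqrt_mult[symmetric] by (rule real_le_rsqrt)
qed

context tricomi_domain
begin

definition BC_flux where
  "BC_flux V Vx Vy y = 4 * sqrt (- y) ^ 3 * (sqrt (- y) * Vx (B y, y) + Vy (B y, y))\<^sup>2
      - sqrt (- y) * V (B y, y) * (sqrt (- y) * Vx (B y, y) + Vy (B y, y))"

definition sigma_flux where
  "sigma_flux Vx Vy x = b / g x powr \<alpha> * (theta_fun \<alpha> x0 x * (g x * (Vx (x, g x))\<^sup>2 - (Vy (x, g x))\<^sup>2)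
      + psi_fun \<alpha> \<beta> x0 x * (sqrt (g x) * Vx (x, g x) * Vy (x, g x)))"

lemma BC_param_eq: "y < 0 \<Longrightarrow> BC_param y = (B y, y)"
  by (simp add: BC_param_def B_def rt_def)

lemma BC_param_speed:
  assumes "y < 0"
  shows "norm (vector_derivative BC_param (at y)) = sqrt (1 - y)"
proof -
  have "((\<lambda>y. (B y, y)) has_vector_derivative (sqrt (- y), 1)) (at y)"
    using B_deriv[OF assms] unfolding has_real_derivative_iff_has_vector_derivative
    by (intro has_vector_derivative_Pair) (auto simp: has_vector_derivative_id)
  then have "(BC_param has_vector_derivative (sqrt (- y), 1)) (at y)"
    by (rule has_vector_derivative_transform_within_open[of _ _ _ "{..<0}"]) (use assms in \<open>auto simp: BC_param_eq\<close>)
  then show ?thesis using assms by (simp add: vector_derivative_at norm_Pair)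
qed

text \<open>This is where \<open>h_fun\<close> comes from: sqrt(1 + dg^2) is \<open>h_fun\<close>
  times the factor \<open>b / g x powr \<alpha>\<close> that also stands in front of the flux, so
  dividing the flux by the arclength density leaves \<Theta> and \<Psi>.\<close>

lemma sigma_param_speed:
  assumes x: "2 * x0 < x" "x < 0"
  shows "norm (vector_derivative (sigma_param \<alpha> \<beta> x0) (at x)) = b / g x powr \<alpha> * h_fun \<alpha> \<beta> x0 x"
proof -
  have "((\<lambda>x. (x, g x)) has_vector_derivative (1, dg x)) (at x)"
    using g_deriv[OF x] unfolding has_real_derivative_iff_has_vector_derivative
    by (intro has_vector_derivative_Pair) (auto simp: has_vector_derivative_id)
  then have "vector_derivative (sigma_param \<alpha> \<beta> x0) (at x) = (1, dg x)"
    unfolding sigma_param_def[abs_def] by (rule vector_derivative_at)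
  moreover have "b / g x powr \<alpha> * h_fun \<alpha> \<beta> x0 x = sqrt (1 + (dg x)\<^sup>2)"
  proof -
    define Z where "Z = g x powr \<alpha>"
    have Z: "Z > 0" using g_pos[OF x] by (simp add: Z_def)
    have "g x powr (2 * \<alpha>) = Z\<^sup>2" by (simp add: Z_def power2_eq_square powr_add[symmetric])
    then have "b / Z * h_fun \<alpha> \<beta> x0 x = sqrt ((b / Z)\<^sup>2) * sqrt ((x - x0)\<^sup>2 + Z\<^sup>2 / b\<^sup>2)"
      using b Z by (simp add: h_fun_def)
    also have "\<dots> = sqrt ((b / Z)\<^sup>2 * ((x - x0)\<^sup>2 + Z\<^sup>2 / b\<^sup>2))" by (simp only: real_sqrt_mult)
    also have "(b / Z)\<^sup>2 * ((x - x0)\<^sup>2 + Z\<^sup>2 / b\<^sup>2) = 1 + (dg x)\<^sup>2"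
      using b(1) Z unfolding dg_def Z_def[symmetric]
      by (simp add: power_divide power_mult_distrib distrib_left add.commute)
    finally show ?thesis by (simp add: Z_def)
  qed
  ultimately show ?thesis by (simp add: norm_Pair)
qed

text \<open>As x is negative in the domain, u is recovered as the product x u divided by x.\<close>

lemma differentiable_of_fst_scaleR:
  fixes u :: "real \<times> real \<Rightarrow> 'a::real_normed_vector"
  assumes "Ck_open 2 \<Omega> (\<lambda>p. fst p *\<^sub>R u p)" "p \<in> \<Omega>"
  shows "u differentiable (at p)"
proof -
  have "fst differentiable (at p)" using has_grad_differentiable[OF has_grad_fst] .
  then have "(\<lambda>p. inverse (fst p)) differentiable (at p)"
    by (rule differentiable_inverse) (use fst_neg[OF assms(2)] in simp)
  from has_grad_scaleR[OF has_grad_dx_dy[OF this] Ck_open_2_has_grad(1)[OF dom_open assms]]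
  have "\<exists>a b. has_grad (\<lambda>q. inverse (fst q) *\<^sub>R (fst q *\<^sub>R u q)) a b p" by blast
  then obtain a b where G: "has_grad (\<lambda>q. inverse (fst q) *\<^sub>R (fst q *\<^sub>R u q)) a b p" by blast
  have "has_grad u a b p"
    by (rule has_grad_cong_open[OF G dom_open assms(2)]) (use fst_neg in force)
  then show ?thesis by (rule has_grad_differentiable)
qed

text \<open>\<open>L\<close> stands for \<open>Re\<close> or \<open>Im\<close>. It commutes with
  \<open>dx\<close> and \<open>dy\<close>, so the traces of the component derivatives are the
  components of the traces of \<open>dx u\<close> and \<open>dy u\<close>.\<close>

lemma component_identity:
  fixes u :: "real \<times> real \<Rightarrow> complex"
  assumes L: "bounded_linear L"
    and W: "(\<lambda>p. L (u p)) \<in> W1 \<Omega> (AC x0 \<union> sigma_arc \<alpha> \<beta> x0)"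
    and sol: "gen_solution_real \<Omega> \<alpha> \<beta> x0 (\<lambda>p. L (u p)) (\<lambda>p. lam * L (u p))"
    and C: "Ck_closure 1 \<Omega> (dy u)" "Ck_closure 1 \<Omega> (\<lambda>p. fst p *\<^sub>R dx u p)"
      "Ck_closure 1 \<Omega> (\<lambda>p. snd p *\<^sub>R dx u p)" "Ck_open 2 \<Omega> (\<lambda>p. fst p *\<^sub>R u p)"
  obtains V Vx Vy where "continuous_on (closure \<Omega>) V" "continuous_on (closure \<Omega>) Vx" "continuous_on (closure \<Omega>) Vy"
    "\<And>p. p \<in> \<Omega> \<Longrightarrow> V p = L (u p)" "\<And>p. p \<in> \<Omega> \<Longrightarrow> Vx p = L (dx u p)" "\<And>p. p \<in> \<Omega> \<Longrightarrow> Vy p = L (dy u p)"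
    "set_integrable lebesgue {yC<..<0} (BC_flux V Vx Vy)" "set_integrable lebesgue {2 * x0<..<0} (sigma_flux Vx Vy)"
    "4 * lam * (LINT p:\<Omega>|lebesgue. (V p)\<^sup>2)
      = (LINT y:{yC<..<0}|lebesgue. BC_flux V Vx Vy y) + (LINT x:{2 * x0<..<0}|lebesgue. sigma_flux Vx Vy x)"
proof -
  interpret L: bounded_linear L by fact
  let ?v = "\<lambda>p. L (u p)"
  have G: "has_grad ?v (L (dx u p)) (L (dy u p)) p" if "p \<in> \<Omega>" for p
    by (rule has_grad_bounded_linear[OF L has_grad_dx_dy[OF differentiable_of_fst_scaleR[OF C(4) that]]])
  note d = has_grad_unique[OF G]
  have v: "?v differentiable (at p)" if "p \<in> \<Omega>" for p by (rule has_grad_differentiable[OF G[OF that]])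
  have 1: "Ck_closure 1 \<Omega> (dy ?v)" by (rule Ck_closure_linear[OF dom_open L C(1)]) (rule d(2))
  have 2: "Ck_closure 1 \<Omega> (\<lambda>p. fst p * dx ?v p)"
    by (rule Ck_closure_linear[OF dom_open L C(2)]) (simp add: d(1) L.scaleR)
  have 3: "Ck_closure 1 \<Omega> (\<lambda>p. snd p * dx ?v p)"
    by (rule Ck_closure_linear[OF dom_open L C(3)]) (simp add: d(1) L.scaleR)
  obtain V Vx Vy Vxx Vxy Vyy where reg: "regular V Vx Vy Vxx Vxy Vyy"
    and V: "\<And>p. p \<in> \<Omega> \<Longrightarrow> V p = ?v p" and Vx: "\<And>p. p \<in> \<Omega> \<Longrightarrow> Vx p = dx ?v p"
    and Vy: "\<And>p. p \<in> \<Omega> \<Longrightarrow> Vy p = dy ?v p"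
    and v2: "Ck_open 2 \<Omega> ?v" and V2: "\<And>p. p \<in> \<Omega> \<Longrightarrow> Vxx p = dx (dx ?v) p \<and> Vyy p = dy (dy ?v) p"
    by (rule regular_extension[of ?v, OF v 1 2 3]; (assumption | (rule that, assumption+)))
  have cont: "continuous_on (closure \<Omega>) V" "continuous_on (closure \<Omega>) Vx" "continuous_on (closure \<Omega>) Vy"
    using reg unfolding regular_def by blast+
  obtain K where K: "\<And>p. p \<in> closure \<Omega> \<Longrightarrow> \<bar>V p\<bar> \<le> K" using bounded_on_compact[OF compact_closure_dom cont(1)] by blast
  have bd: "\<bar>?v p\<bar> \<le> K" if "p \<in> \<Omega>" for p using K[of p] V[OF that] that closure_subset[of \<Omega>] by auto
  have dis: "(BC x0 \<union> sigma_arc \<alpha> \<beta> x0) \<inter> \<Omega> = {}" using dom_bdry bdry_def by auto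
  have pde: "- snd p * Vxx p - Vyy p = lam * V p" if p: "p \<in> \<Omega>" for p
    using gen_solution_pointwise[OF dom_open dom_bounded dis sol v2 bd p] V2[OF p] V[OF p] by (simp add: Tric_def)
  note z = trace_zero[OF W cont(1) V]
  note P = pohozaev[OF reg pde z]
  show thesis
  proof (rule that[OF cont V])
    show "Vx p = L (dx u p)" "Vy p = L (dy u p)" if "p \<in> \<Omega>" for p using Vx Vy d that by auto
    show "set_integrable lebesgue {yC<..<0} (BC_flux V Vx Vy)"
      unfolding BC_flux_def[abs_def] by (rule P(1))
    show "set_integrable lebesgue {2 * x0<..<0} (sigma_flux Vx Vy)"
      unfolding sigma_flux_def[abs_def] by (rule P(2))
    show "4 * lam * (LINT p:\<Omega>|lebesgue. (V p)\<^sup>2)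
      = (LINT y:{yC<..<0}|lebesgue. BC_flux V Vx Vy y) + (LINT x:{2 * x0<..<0}|lebesgue. sigma_flux Vx Vy x)"
      unfolding BC_flux_def sigma_flux_def by (rule P(3))
  qed
qed

section \<open>Estimates of the flux against arclength\<close>

text \<open>The coefficient \<Theta> multiplies \<open>y * p^2\<close> with a plus sign and
  \<open>r^2\<close> with a minus sign, so \<open>C25\<close> receives its upper bound and
  \<open>C26\<close> minus its lower bound. The mixed term is split by Young's inequality with
  weight \<open>\<epsilon>\<close>.\<close>

lemma sigma_flux_le:
  assumes x: "2 * x0 < x" "x < 0" and \<epsilon>: "\<epsilon> > 0"
  shows "sigma_flux Vx Vy x \<le>
    C25 \<alpha> \<beta> x0 \<epsilon> * (g x * (Vx (x, g x))\<^sup>2 * (b / g x powr \<alpha> * h_fun \<alpha> \<beta> x0 x))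
      + C26 \<alpha> \<beta> x0 \<epsilon> * ((Vy (x, g x))\<^sup>2 * (b / g x powr \<alpha> * h_fun \<alpha> \<beta> x0 x))"
proof -
  define p r where "p = Vx (x, g x)" and "r = Vy (x, g x)"
  define n where "n = b / g x powr \<alpha> * h_fun \<alpha> \<beta> x0 x"
  have y: "g x > 0" by (rule g_pos[OF x])
  have h: "h_fun \<alpha> \<beta> x0 x > 0" unfolding h_eq using H_pos q_bounds[of x] x by simp
  have n: "n > 0" unfolding n_def using h b(1) y by simp
  have fl: "sigma_flux Vx Vy x = n * (Theta_fun \<alpha> \<beta> x0 x * (g x * p\<^sup>2 - r\<^sup>2) + Psi_fun \<alpha> \<beta> x0 x * ((sqrt (g x) * p) * r))"
  proof -
    have t: "theta_fun \<alpha> x0 x = Theta_fun \<alpha> \<beta> x0 x * h_fun \<alpha> \<beta> x0 x"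
      "psi_fun \<alpha> \<beta> x0 x = Psi_fun \<alpha> \<beta> x0 x * h_fun \<alpha> \<beta> x0 x"
      using h by (simp_all add: Theta_fun_def Psi_fun_def)
    show ?thesis unfolding sigma_flux_def t n_def p_def r_def by (simp only: ring_distribs mult_ac)
  qed
  have 1: "Theta_fun \<alpha> \<beta> x0 x * (g x * p\<^sup>2) \<le> Theta_hi * (g x * p\<^sup>2)"
    by (intro mult_right_mono Theta_le[OF x]) (use y in simp)
  have 2: "Theta_lo * r\<^sup>2 \<le> Theta_fun \<alpha> \<beta> x0 x * r\<^sup>2" by (intro mult_right_mono Theta_ge[OF x]) simp
  have pp: "\<bar>(sqrt (g x) * p) * r\<bar> \<le> \<epsilon> / 2 * (g x * p\<^sup>2) + 1 / (2 * \<epsilon>) * r\<^sup>2"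
  proof -
    define a where "a = sqrt (g x) * p"
    have a2: "a\<^sup>2 = g x * p\<^sup>2" using y by (simp add: a_def power_mult_distrib)
    have "0 \<le> (\<epsilon> * \<bar>a\<bar> - \<bar>r\<bar>)\<^sup>2 / (2 * \<epsilon>)" using \<epsilon> by simp
    also have "\<dots> = \<epsilon> / 2 * a\<^sup>2 + 1 / (2 * \<epsilon>) * r\<^sup>2 - \<bar>a\<bar> * \<bar>r\<bar>"
      using \<epsilon> by (simp add: field_simps power2_eq_square)
    finally show ?thesis unfolding a2 a_def[symmetric] abs_mult by simp
  qed
  have "Psi_fun \<alpha> \<beta> x0 x * ((sqrt (g x) * p) * r) \<le> \<bar>Psi_fun \<alpha> \<beta> x0 x\<bar> * \<bar>(sqrt (g x) * p) * r\<bar>"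
    by (metis abs_ge_self abs_mult)
  also have "\<dots> \<le> C24 \<alpha> \<beta> x0 * (\<epsilon> / 2 * (g x * p\<^sup>2) + 1 / (2 * \<epsilon>) * r\<^sup>2)"
    by (intro mult_mono Psi_le[OF x] pp) (use Psi_le[OF x] in auto)
  finally have 3: "Psi_fun \<alpha> \<beta> x0 x * ((sqrt (g x) * p) * r) \<le> C24 \<alpha> \<beta> x0 * (\<epsilon> / 2 * (g x * p\<^sup>2) + 1 / (2 * \<epsilon>) * r\<^sup>2)" .
  have C: "C25 \<alpha> \<beta> x0 \<epsilon> = Theta_hi + \<epsilon> / 2 * C24 \<alpha> \<beta> x0" "C26 \<alpha> \<beta> x0 \<epsilon> = - Theta_lo + 1 / (2 * \<epsilon>) * C24 \<alpha> \<beta> x0"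
    by (simp_all add: C25_def C26_def Theta_hi_def Theta_lo_def)
  define P R c where "P = g x * p\<^sup>2" and "R = r\<^sup>2" and "c = C24 \<alpha> \<beta> x0"
  have "Theta_fun \<alpha> \<beta> x0 x * (P - R) + Psi_fun \<alpha> \<beta> x0 x * ((sqrt (g x) * p) * r)
      \<le> Theta_hi * P - Theta_lo * R + c * (\<epsilon> / 2 * P + 1 / (2 * \<epsilon>) * R)"
    using 1 2 3 unfolding P_def[symmetric] R_def[symmetric] c_def[symmetric] right_diff_distrib by linarith
  also have "\<dots> = C25 \<alpha> \<beta> x0 \<epsilon> * P + C26 \<alpha> \<beta> x0 \<epsilon> * R"
    unfolding C c_def[symmetric] by (simp add: algebra_simps)
  finally have "n * (Theta_fun \<alpha> \<beta> x0 x * (P - R) + Psi_fun \<alpha> \<beta> x0 x * ((sqrt (g x) * p) * r))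
      \<le> n * (C25 \<alpha> \<beta> x0 \<epsilon> * P + C26 \<alpha> \<beta> x0 \<epsilon> * R)" using n by (intro mult_left_mono) auto
  then show ?thesis unfolding fl n_def[symmetric] p_def[symmetric] r_def[symmetric] P_def[symmetric] R_def[symmetric]
    by (simp add: algebra_simps)
qed

text \<open>Put s = sqrt(-y) and n = sqrt(1 - y), the arclength density. The quotient s / n
  increases with -y, and its value at the vertex C is \<open>C3\<close>. With M =
  sqrt(-\<open>yC\<close>) one has M^3 = 3|x0|/2, so 4 s^3 \<le> 4 M^2 * C3 * n turns 4 M^3 into the
  factor 6|x0| of \<open>C1\<close> and \<open>C2\<close>. The square is split by Young's
  inequality.\<close>

lemma BC_flux_le:
  assumes y: "yC < y" "y < 0" and \<epsilon>: "\<epsilon> > 0"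
  shows "BC_flux V Vx Vy y \<le> C1 x0 \<epsilon> * (- y * (Vx (B y, y))\<^sup>2 * sqrt (1 - y)) + C2 x0 \<epsilon> * ((Vy (B y, y))\<^sup>2 * sqrt (1 - y))
    + C3 x0 * (\<bar>V (B y, y)\<bar> * (sqrt (- y) * \<bar>Vx (B y, y)\<bar>) * sqrt (1 - y))
    + C3 x0 * (\<bar>V (B y, y)\<bar> * \<bar>Vy (B y, y)\<bar> * sqrt (1 - y))"
proof -
  define v p r where "v = V (B y, y)" and "p = sqrt (- y) * Vx (B y, y)" and "r = Vy (B y, y)"
  define s n where "s = sqrt (- y)" and "n = sqrt (1 - y)"
  define m where "m = (3 * \<bar>x0\<bar> / 2) powr (2/3)"
  define M where "M = sqrt m"
  have m: "m = - yC" "m > 0" using x0 by (simp_all add: m_def y_C_def)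
  have s: "s \<ge> 0" "s\<^sup>2 = - y" using y by (simp_all add: s_def)
  have n: "n > 0" "n\<^sup>2 = 1 - y" using y by (simp_all add: n_def)
  have M: "M > 0" "M\<^sup>2 = m" using m by (simp_all add: M_def)
  have M3: "M ^ 3 = 3 * \<bar>x0\<bar> / 2"
  proof -
    have "M = (3 * \<bar>x0\<bar> / 2) powr (1/3)" unfolding M_def m_def using x0
      by (simp add: powr_half_sqrt[symmetric] powr_powr)
    then show ?thesis using x0 by (simp add: powr_realpow[symmetric] powr_powr)
  qed
  have c3: "C3 x0 = M / sqrt (1 + m)"
  proof -
    have "M = (3 * \<bar>x0\<bar> / 2) powr (1/3)" unfolding M_def m_def using x0
      by (simp add: powr_half_sqrt[symmetric] powr_powr)
    then show ?thesis by (simp add: C3_def m_def)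
  qed
  define k where "k = 6 * \<bar>x0\<bar> / sqrt (1 + m)"
  have k: "k = 4 * M\<^sup>2 * C3 x0" unfolding k_def c3 using M3 by (simp add: power3_eq_cube power2_eq_square)
  have c12: "C1 x0 \<epsilon> = k * (1 + \<epsilon>)" "C2 x0 \<epsilon> = k * (1 + 1 / \<epsilon>)"
    by (simp_all add: C1_def C2_def k_def m_def)
  have c3p: "C3 x0 > 0" unfolding c3 using M m by simp
  have sM: "s\<^sup>2 \<le> M\<^sup>2" unfolding s(2) M(2) m(1) using y by simp
  have sn: "s \<le> C3 x0 * n"
  proof -
    have "(s * sqrt (1 + m))\<^sup>2 \<le> (M * n)\<^sup>2"
      using m y unfolding power_mult_distrib s(2) M(2) n(2) by (simp add: algebra_simps)
    then have "s * sqrt (1 + m) \<le> M * n" by (rule power2_le_imp_le) (use M n in simp)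
    then show ?thesis unfolding c3 using m by (simp add: field_simps)
  qed
  have s3: "4 * s ^ 3 \<le> k * n"
  proof -
    have "s\<^sup>2 * s \<le> M\<^sup>2 * (C3 x0 * n)" by (intro mult_mono sM sn) (use s in auto)
    then show ?thesis unfolding k by (simp add: power3_eq_cube power2_eq_square)
  qed
  have w2: "(p + r)\<^sup>2 \<le> (1 + \<epsilon>) * p\<^sup>2 + (1 + 1 / \<epsilon>) * r\<^sup>2"
  proof -
    have "0 \<le> (\<epsilon> * p - r)\<^sup>2 / \<epsilon>" using \<epsilon> by simp
    also have "\<dots> = (1 + \<epsilon>) * p\<^sup>2 + (1 + 1 / \<epsilon>) * r\<^sup>2 - (p + r)\<^sup>2"
      using \<epsilon> by (simp add: field_simps power2_eq_square)
    finally show ?thesis by simp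
  qed
  have "4 * s ^ 3 * (p + r)\<^sup>2 \<le> k * n * ((1 + \<epsilon>) * p\<^sup>2 + (1 + 1 / \<epsilon>) * r\<^sup>2)"
    by (intro mult_mono s3 w2) (use s n k c3p in auto)
  moreover have "- s * v * (p + r) \<le> (C3 x0 * n) * (\<bar>v\<bar> * (\<bar>p\<bar> + \<bar>r\<bar>))"
  proof -
    have "- s * v * (p + r) \<le> s * (\<bar>v\<bar> * \<bar>p + r\<bar>)" using s(1)
      by (metis abs_ge_self abs_minus_cancel abs_mult abs_of_nonneg mult.assoc)
    also have "\<dots> \<le> (C3 x0 * n) * (\<bar>v\<bar> * (\<bar>p\<bar> + \<bar>r\<bar>))"
      by (intro mult_mono sn abs_triangle_ineq) (use c3p n in auto)
    finally show ?thesis .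
  qed
  ultimately have "BC_flux V Vx Vy y \<le> k * n * ((1 + \<epsilon>) * p\<^sup>2 + (1 + 1 / \<epsilon>) * r\<^sup>2) + (C3 x0 * n) * (\<bar>v\<bar> * (\<bar>p\<bar> + \<bar>r\<bar>))"
    unfolding BC_flux_def p_def s_def v_def r_def by linarith
  also have "\<dots> = k * (1 + \<epsilon>) * (p\<^sup>2 * n) + k * (1 + 1 / \<epsilon>) * (r\<^sup>2 * n) + C3 x0 * (\<bar>v\<bar> * \<bar>p\<bar> * n) + C3 x0 * (\<bar>v\<bar> * \<bar>r\<bar> * n)"
    by (simp only: ring_distribs mult_ac)
  finally show ?thesis unfolding c12 n_def[symmetric] v_def[symmetric] r_def[symmetric]
    using y by (simp add: p_def abs_mult power_mult_distrib)
qed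

lemma BC_trace_integrable:
  fixes F :: "real \<times> real \<Rightarrow> real"
  assumes "continuous_on (closure \<Omega>) F"
  shows "set_integrable lebesgue {yC<..<0} (\<lambda>y. F (B y, y))"
  by (rule trace_integrable[OF assms, of _ "\<lambda>y. (B y, y)"])
    (auto intro!: continuous_intros B_continuous arc_in_closure(2))

lemma BC_flux_integral_le:
  assumes c: "continuous_on (closure \<Omega>) V" "continuous_on (closure \<Omega>) Vx" "continuous_on (closure \<Omega>) Vy"
    and I: "set_integrable lebesgue {yC<..<0} (BC_flux V Vx Vy)" and \<epsilon>: "\<epsilon> > 0"
  defines "P \<equiv> LINT y:{yC<..<0}|lebesgue. - y * (Vx (B y, y))\<^sup>2 * sqrt (1 - y)"
    and "R \<equiv> LINT y:{yC<..<0}|lebesgue. (Vy (B y, y))\<^sup>2 * sqrt (1 - y)"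
    and "T \<equiv> LINT y:{yC<..<0}|lebesgue. (V (B y, y))\<^sup>2 * sqrt (1 - y)"
  shows "(LINT y:{yC<..<0}|lebesgue. BC_flux V Vx Vy y)
    \<le> C1 x0 \<epsilon> * P + C2 x0 \<epsilon> * R + C3 x0 * (sqrt T * (sqrt P + sqrt R))"
proof -
  let ?L = "{yC<..<0::real}"
  note tr = BC_trace_integrable
  have iP: "set_integrable lebesgue ?L (\<lambda>y. - y * (Vx (B y, y))\<^sup>2 * sqrt (1 - y))"
    using tr[of "\<lambda>p. - snd p * (Vx p)\<^sup>2 * sqrt (1 - snd p)"] by (simp add: continuous_intros c)
  have iR: "set_integrable lebesgue ?L (\<lambda>y. (Vy (B y, y))\<^sup>2 * sqrt (1 - y))"
    using tr[of "\<lambda>p. (Vy p)\<^sup>2 * sqrt (1 - snd p)"] by (simp add: continuous_intros c)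
  have iT: "set_integrable lebesgue ?L (\<lambda>y. (V (B y, y))\<^sup>2 * sqrt (1 - y))"
    using tr[of "\<lambda>p. (V p)\<^sup>2 * sqrt (1 - snd p)"] by (simp add: continuous_intros c)
  have iVP: "set_integrable lebesgue ?L (\<lambda>y. \<bar>V (B y, y)\<bar> * (sqrt (- y) * \<bar>Vx (B y, y)\<bar>) * sqrt (1 - y))"
    using tr[of "\<lambda>p. \<bar>V p\<bar> * (sqrt (- snd p) * \<bar>Vx p\<bar>) * sqrt (1 - snd p)"] by (simp add: continuous_intros c)
  have iVR: "set_integrable lebesgue ?L (\<lambda>y. \<bar>V (B y, y)\<bar> * \<bar>Vy (B y, y)\<bar> * sqrt (1 - y))"
    using tr[of "\<lambda>p. \<bar>V p\<bar> * \<bar>Vy p\<bar> * sqrt (1 - snd p)"] by (simp add: continuous_intros c)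
  have CS: "(LINT y:?L|lebesgue. \<bar>V (B y, y)\<bar> * k y * sqrt (1 - y))
      \<le> sqrt T * sqrt (LINT y:?L|lebesgue. (k y)\<^sup>2 * sqrt (1 - y))"
    if k: "set_integrable lebesgue ?L (\<lambda>y. (k y)\<^sup>2 * sqrt (1 - y))"
      "set_integrable lebesgue ?L (\<lambda>y. \<bar>V (B y, y)\<bar> * k y * sqrt (1 - y))" for k
  proof -
    \<comment> \<open>Half of the arclength density is given to each factor, so that Cauchy-Schwarz
      in y becomes Cauchy-Schwarz in arclength.\<close>
    define w where "w y = sqrt (sqrt (1 - y))" for y :: real
    have w: "(w y)\<^sup>2 = sqrt (1 - y)" if "y \<in> ?L" for y using that by (simp add: w_def)
    have e: "(\<bar>V (B y, y)\<bar> * w y)\<^sup>2 = (V (B y, y))\<^sup>2 * sqrt (1 - y)"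
      "(k y * w y)\<^sup>2 = (k y)\<^sup>2 * sqrt (1 - y)"
      "(\<bar>V (B y, y)\<bar> * w y) * (k y * w y) = \<bar>V (B y, y)\<bar> * k y * sqrt (1 - y)" if "y \<in> ?L" for y
      unfolding power_mult_distrib w[OF that, symmetric] by (simp_all add: power2_eq_square)
    note ci = set_integrable_cong[of lebesgue lebesgue ?L ?L] and cl = set_lebesgue_integral_cong[of ?L lebesgue]
    have "(LINT y:?L|lebesgue. (\<bar>V (B y, y)\<bar> * w y) * (k y * w y))
      \<le> sqrt (LINT y:?L|lebesgue. (\<bar>V (B y, y)\<bar> * w y)\<^sup>2) * sqrt (LINT y:?L|lebesgue. (k y * w y)\<^sup>2)"
    proof (rule set_integral_Cauchy_Schwarz)
      show "set_integrable lebesgue ?L (\<lambda>y. (\<bar>V (B y, y)\<bar> * w y)\<^sup>2)" using iT e(1) by (subst ci) auto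
      show "set_integrable lebesgue ?L (\<lambda>y. (k y * w y)\<^sup>2)" using k(1) e(2) by (subst ci) auto
      show "set_integrable lebesgue ?L (\<lambda>y. (\<bar>V (B y, y)\<bar> * w y) * (k y * w y))" using k(2) e(3) by (subst ci) auto
    qed
    moreover have "(LINT y:?L|lebesgue. (\<bar>V (B y, y)\<bar> * w y)\<^sup>2) = T"
      unfolding T_def by (rule cl) (use e(1) in auto)
    moreover have "(LINT y:?L|lebesgue. (k y * w y)\<^sup>2) = (LINT y:?L|lebesgue. (k y)\<^sup>2 * sqrt (1 - y))"
      by (rule cl) (use e(2) in auto)
    moreover have "(LINT y:?L|lebesgue. (\<bar>V (B y, y)\<bar> * w y) * (k y * w y))
      = (LINT y:?L|lebesgue. \<bar>V (B y, y)\<bar> * k y * sqrt (1 - y))"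
      by (rule cl) (use e(3) in auto)
    ultimately show ?thesis by simp
  qed
  have eP: "(sqrt (- y) * \<bar>Vx (B y, y)\<bar>)\<^sup>2 * sqrt (1 - y) = - y * (Vx (B y, y))\<^sup>2 * sqrt (1 - y)" if "y \<in> ?L" for y
    using that by (simp add: power_mult_distrib)
  have "(LINT y:?L|lebesgue. (sqrt (- y) * \<bar>Vx (B y, y)\<bar>)\<^sup>2 * sqrt (1 - y)) = P"
    unfolding P_def by (rule set_lebesgue_integral_cong) (use eP in auto)
  moreover have "set_integrable lebesgue ?L (\<lambda>y. (sqrt (- y) * \<bar>Vx (B y, y)\<bar>)\<^sup>2 * sqrt (1 - y))"
    using iP eP by (subst set_integrable_cong[of lebesgue lebesgue ?L ?L]) auto
  ultimately have CSP: "(LINT y:?L|lebesgue. \<bar>V (B y, y)\<bar> * (sqrt (- y) * \<bar>Vx (B y, y)\<bar>) * sqrt (1 - y)) \<le> sqrt T * sqrt P"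
    using CS[OF _ iVP] by simp
  have CSR: "(LINT y:?L|lebesgue. \<bar>V (B y, y)\<bar> * \<bar>Vy (B y, y)\<bar> * sqrt (1 - y)) \<le> sqrt T * sqrt R"
    using CS[OF _ iVR] iR by (simp add: R_def)
  have c3: "C3 x0 \<ge> 0" by (simp add: C3_def)
  let ?p = "\<lambda>y. - y * (Vx (B y, y))\<^sup>2 * sqrt (1 - y)" and ?r = "\<lambda>y. (Vy (B y, y))\<^sup>2 * sqrt (1 - y)"
    and ?vp = "\<lambda>y. \<bar>V (B y, y)\<bar> * (sqrt (- y) * \<bar>Vx (B y, y)\<bar>) * sqrt (1 - y)"
    and ?vr = "\<lambda>y. \<bar>V (B y, y)\<bar> * \<bar>Vy (B y, y)\<bar> * sqrt (1 - y)"
  note i1 = set_integrable_mult_right[OF iP, of "C1 x0 \<epsilon>"] and i2 = set_integrable_mult_right[OF iR, of "C2 x0 \<epsilon>"]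
    and i3 = set_integrable_mult_right[OF iVP, of "C3 x0"] and i4 = set_integrable_mult_right[OF iVR, of "C3 x0"]
  note j1 = set_integral_add[OF i1 i2] note j2 = set_integral_add[OF j1(1) i3] note j3 = set_integral_add[OF j2(1) i4]
  have "(LINT y:?L|lebesgue. BC_flux V Vx Vy y)
      \<le> (LINT y:?L|lebesgue. C1 x0 \<epsilon> * ?p y + C2 x0 \<epsilon> * ?r y + C3 x0 * ?vp y + C3 x0 * ?vr y)"
    by (rule set_integral_mono[OF I j3(1)]) (use BC_flux_le[OF _ _ \<epsilon>] in auto)
  also have "\<dots> = C1 x0 \<epsilon> * P + C2 x0 \<epsilon> * R
      + C3 x0 * (LINT y:?L|lebesgue. ?vp y) + C3 x0 * (LINT y:?L|lebesgue. ?vr y)"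
    unfolding j3(2) j2(2) j1(2) set_integral_mult_right P_def R_def ..
  also have "\<dots> \<le> C1 x0 \<epsilon> * P + C2 x0 \<epsilon> * R + C3 x0 * (sqrt T * sqrt P) + C3 x0 * (sqrt T * sqrt R)"
    by (intro add_mono order_refl mult_left_mono CSP CSR c3)
  finally show ?thesis by (simp add: algebra_simps)
qed

text \<open>Both components are treated under one integral, because the square integrability of a
  complex function on the arc provides the sum of the squares of its components.\<close>

lemma sigma_flux_integral_le:
  assumes I: "set_integrable lebesgue {2 * x0<..<0} (sigma_flux X1 Y1)" "set_integrable lebesgue {2 * x0<..<0} (sigma_flux X2 Y2)"
    and \<epsilon>: "\<epsilon> > 0"
  defines "n \<equiv> \<lambda>x. b / g x powr \<alpha> * h_fun \<alpha> \<beta> x0 x"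
  assumes J: "set_integrable lebesgue {2 * x0<..<0} (\<lambda>x. g x * ((X1 (x, g x))\<^sup>2 + (X2 (x, g x))\<^sup>2) * n x)"
    "set_integrable lebesgue {2 * x0<..<0} (\<lambda>x. ((Y1 (x, g x))\<^sup>2 + (Y2 (x, g x))\<^sup>2) * n x)"
  shows "(LINT x:{2 * x0<..<0}|lebesgue. sigma_flux X1 Y1 x) + (LINT x:{2 * x0<..<0}|lebesgue. sigma_flux X2 Y2 x)
    \<le> C25 \<alpha> \<beta> x0 \<epsilon> * (LINT x:{2 * x0<..<0}|lebesgue. g x * ((X1 (x, g x))\<^sup>2 + (X2 (x, g x))\<^sup>2) * n x)
      + C26 \<alpha> \<beta> x0 \<epsilon> * (LINT x:{2 * x0<..<0}|lebesgue. ((Y1 (x, g x))\<^sup>2 + (Y2 (x, g x))\<^sup>2) * n x)"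
    (is "_ \<le> ?a * (LINT x:?X|lebesgue. ?F x) + ?c * (LINT x:?X|lebesgue. ?G x)")
proof -
  note s = set_integral_add[OF I]
  note j = set_integral_add[OF set_integrable_mult_right[OF J(1), of ?a] set_integrable_mult_right[OF J(2), of ?c]]
  have "(LINT x:?X|lebesgue. sigma_flux X1 Y1 x + sigma_flux X2 Y2 x) \<le> (LINT x:?X|lebesgue. ?a * ?F x + ?c * ?G x)"
  proof (rule set_integral_mono[OF s(1) j(1)])
    fix x assume "x \<in> ?X"
    then have x: "2 * x0 < x" "x < 0" by auto
    have "sigma_flux X1 Y1 x + sigma_flux X2 Y2 x
      \<le> (?a * (g x * (X1 (x, g x))\<^sup>2 * n x) + ?c * ((Y1 (x, g x))\<^sup>2 * n x))
        + (?a * (g x * (X2 (x, g x))\<^sup>2 * n x) + ?c * ((Y2 (x, g x))\<^sup>2 * n x))"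
      unfolding n_def by (intro add_mono sigma_flux_le x \<epsilon>)
    also have "\<dots> = ?a * ?F x + ?c * ?G x" by (simp only: ring_distribs)
    finally show "sigma_flux X1 Y1 x + sigma_flux X2 Y2 x \<le> ?a * ?F x + ?c * ?G x" .
  qed
  then show ?thesis unfolding s(2) j(2) set_integral_mult_right .
qed

end

theorem theorem4p20:
  fixes \<alpha> \<beta> x0 lam0 lam \<epsilon>1 \<epsilon>2 :: real
    and \<Omega> :: "(real \<times> real) set"
    and u :: "real \<times> real \<Rightarrow> complex"
  assumes "\<alpha> \<ge> 1/2" and "\<beta> < 0" and "x0 < 0"
    and "is_tricomi_domain \<Omega> \<alpha> \<beta> x0"
    and "is_principal_eigenvalue \<Omega> \<alpha> \<beta> x0 lam0"
    and "lam \<ge> lam0"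
    and "(\<lambda>p. Re (u p)) \<in> W1 \<Omega> (AC x0 \<union> sigma_arc \<alpha> \<beta> x0)"
    and "(\<lambda>p. Im (u p)) \<in> W1 \<Omega> (AC x0 \<union> sigma_arc \<alpha> \<beta> x0)"
    and "gen_solution \<Omega> \<alpha> \<beta> x0 u (\<lambda>p. complex_of_real lam * u p)"
    and "\<not> (AE p in lebesgue_on \<Omega>. u p = 0)"
    and "Ck_closure 1 \<Omega> (dy u)"
    and "Ck_closure 1 \<Omega> (\<lambda>p. fst p *\<^sub>R dx u p)"
    and "Ck_closure 1 \<Omega> (\<lambda>p. snd p *\<^sub>R dx u p)"
    and "Ck_open 2 \<Omega> (\<lambda>p. fst p *\<^sub>R u p)"
    and "L2_BC \<Omega> x0 u"
    and "L2_BC \<Omega> x0 (wdx u)" and "L2_sigma \<Omega> \<alpha> \<beta> x0 (wdx u)"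
    and "L2_BC \<Omega> x0 (dy u)" and "L2_sigma \<Omega> \<alpha> \<beta> x0 (dy u)"
    and "\<epsilon>1 > 0" and "\<epsilon>2 > 0"
  shows "0 < 2 * sqrt lam * L2_norm \<Omega> u \<and>
         2 * sqrt lam * L2_norm \<Omega> u \<le>
           sqrt (C1 x0 \<epsilon>1 * (norm_BC \<Omega> x0 (wdx u))\<^sup>2
               + C2 x0 \<epsilon>1 * (norm_BC \<Omega> x0 (dy u))\<^sup>2
               + C3 x0 * (norm_BC \<Omega> x0 (\<lambda>p. Re (u p)) + norm_BC \<Omega> x0 (\<lambda>p. Im (u p)))
                       * (norm_BC \<Omega> x0 (wdx u) + norm_BC \<Omega> x0 (dy u))
               + C25 \<alpha> \<beta> x0 \<epsilon>2 * (norm_sigma \<Omega> \<alpha> \<beta> x0 (wdx u))\<^sup>2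
               + C26 \<alpha> \<beta> x0 \<epsilon>2 * (norm_sigma \<Omega> \<alpha> \<beta> x0 (dy u))\<^sup>2)"
proof -
  interpret tricomi_domain \<alpha> \<beta> x0 \<Omega> using assms(1-4) by unfold_locales auto
  have sol: "gen_solution_real \<Omega> \<alpha> \<beta> x0 (\<lambda>p. Re (u p)) (\<lambda>p. lam * Re (u p))"
    "gen_solution_real \<Omega> \<alpha> \<beta> x0 (\<lambda>p. Im (u p)) (\<lambda>p. lam * Im (u p))"
    using assms(9) by (simp_all add: gen_solution_def)
  let ?L = "{yC<..<0::real}" and ?X = "{2 * x0<..<0}"
  obtain V1 X1 Y1 where c1: "continuous_on (closure \<Omega>) V1" "continuous_on (closure \<Omega>) X1" "continuous_on (closure \<Omega>) Y1"
    and e1: "\<And>p. p \<in> \<Omega> \<Longrightarrow> V1 p = Re (u p)" "\<And>p. p \<in> \<Omega> \<Longrightarrow> X1 p = Re (dx u p)" "\<And>p. p \<in> \<Omega> \<Longrightarrow> Y1 p = Re (dy u p)"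
    and i1: "set_integrable lebesgue ?L (BC_flux V1 X1 Y1)" "set_integrable lebesgue ?X (sigma_flux X1 Y1)"
    and p1: "4 * lam * (LINT p:\<Omega>|lebesgue. (V1 p)\<^sup>2)
      = (LINT y:?L|lebesgue. BC_flux V1 X1 Y1 y) + (LINT x:?X|lebesgue. sigma_flux X1 Y1 x)"
    by (rule component_identity[OF bounded_linear_Re assms(7) sol(1) assms(11-14)]) (rule that, assumption+)
  obtain V2 X2 Y2 where c2: "continuous_on (closure \<Omega>) V2" "continuous_on (closure \<Omega>) X2" "continuous_on (closure \<Omega>) Y2"
    and e2: "\<And>p. p \<in> \<Omega> \<Longrightarrow> V2 p = Im (u p)" "\<And>p. p \<in> \<Omega> \<Longrightarrow> X2 p = Im (dx u p)" "\<And>p. p \<in> \<Omega> \<Longrightarrow> Y2 p = Im (dy u p)"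
    and i2: "set_integrable lebesgue ?L (BC_flux V2 X2 Y2)" "set_integrable lebesgue ?X (sigma_flux X2 Y2)"
    and p2: "4 * lam * (LINT p:\<Omega>|lebesgue. (V2 p)\<^sup>2)
      = (LINT y:?L|lebesgue. BC_flux V2 X2 Y2 y) + (LINT x:?X|lebesgue. sigma_flux X2 Y2 x)"
    by (rule component_identity[OF bounded_linear_Im assms(8) sol(2) assms(11-14)]) (rule that, assumption+)
  have bv: "bvalue \<Omega> (\<lambda>p. Re (u p)) p = V1 p" "bvalue \<Omega> (\<lambda>p. Im (u p)) p = V2 p"
    "(norm (bvalue \<Omega> (wdx u) p))\<^sup>2 = \<bar>snd p\<bar> * ((X1 p)\<^sup>2 + (X2 p)\<^sup>2)"
    "(norm (bvalue \<Omega> (dy u) p))\<^sup>2 = (Y1 p)\<^sup>2 + (Y2 p)\<^sup>2" if p: "p \<in> closure \<Omega>" "p \<notin> \<Omega>" for p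
  proof -
    show "bvalue \<Omega> (\<lambda>p. Re (u p)) p = V1 p" by (rule closure_extension_eq(2)[OF c1(1) e1(1) p])
    show "bvalue \<Omega> (\<lambda>p. Im (u p)) p = V2 p" by (rule closure_extension_eq(2)[OF c2(1) e2(1) p])
    have "bvalue \<Omega> (wdx u) p = sqrt \<bar>snd p\<bar> *\<^sub>R (complex_of_real (X1 p) + \<i> * complex_of_real (X2 p))"
      by (rule closure_extension_eq(2)[OF _ _ p])
        (auto intro!: continuous_intros c1 c2 simp: wdx_def e1 e2 complex_eq_iff)
    then show "(norm (bvalue \<Omega> (wdx u) p))\<^sup>2 = \<bar>snd p\<bar> * ((X1 p)\<^sup>2 + (X2 p)\<^sup>2)"
      by (simp add: power_mult_distrib cmod_power2)
    have "bvalue \<Omega> (dy u) p = complex_of_real (Y1 p) + \<i> * complex_of_real (Y2 p)"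
      by (rule closure_extension_eq(2)[OF _ _ p])
        (auto intro!: continuous_intros c1 c2 simp: e1 e2 complex_eq_iff)
    then show "(norm (bvalue \<Omega> (dy u) p))\<^sup>2 = (Y1 p)\<^sup>2 + (Y2 p)\<^sup>2" by (simp add: cmod_power2)
  qed
  note bvB = bv[OF arc_in_closure(2) arc_not_in_dom(1)] and bvS = bv[OF arc_in_closure(5) arc_not_in_dom(2)]
  define P R where "P X = (LINT y:?L|lebesgue. - y * (X (B y, y))\<^sup>2 * sqrt (1 - y))"
    and "R Y = (LINT y:?L|lebesgue. (Y (B y, y))\<^sup>2 * sqrt (1 - y))" for X Y :: "real \<times> real \<Rightarrow> real"
  have pos: "P X \<ge> 0" "R X \<ge> 0" for X
    unfolding P_def R_def set_lebesgue_integral_def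
    by (intro integral_nonneg_AE AE_I2; simp add: indicator_def mult_nonpos_nonneg)+
  have nT: "(norm_BC \<Omega> x0 (\<lambda>p. Re (u p)))\<^sup>2 = R V1" "(norm_BC \<Omega> x0 (\<lambda>p. Im (u p)))\<^sup>2 = R V2"
    unfolding R_def by (rule arc_norm_eq(1), simp add: BC_param_eq BC_param_speed bvB)+
  have "(norm_BC \<Omega> x0 (wdx u))\<^sup>2
      = (LINT y:?L|lebesgue. - y * (X1 (B y, y))\<^sup>2 * sqrt (1 - y) + - y * (X2 (B y, y))\<^sup>2 * sqrt (1 - y))"
    by (rule arc_norm_eq(1)) (simp add: BC_param_eq BC_param_speed bvB algebra_simps)
  also have "\<dots> = P X1 + P X2" unfolding P_def
    using BC_trace_integrable[of "\<lambda>p. - snd p * (X1 p)\<^sup>2 * sqrt (1 - snd p)"]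
      BC_trace_integrable[of "\<lambda>p. - snd p * (X2 p)\<^sup>2 * sqrt (1 - snd p)"]
    by (intro set_integral_add(2)) (simp_all add: continuous_intros c1 c2)
  finally have nP: "(norm_BC \<Omega> x0 (wdx u))\<^sup>2 = P X1 + P X2" .
  have "(norm_BC \<Omega> x0 (dy u))\<^sup>2
      = (LINT y:?L|lebesgue. (Y1 (B y, y))\<^sup>2 * sqrt (1 - y) + (Y2 (B y, y))\<^sup>2 * sqrt (1 - y))"
    by (rule arc_norm_eq(1)) (simp add: BC_param_eq BC_param_speed bvB algebra_simps)
  also have "\<dots> = R Y1 + R Y2" unfolding R_def
    using BC_trace_integrable[of "\<lambda>p. (Y1 p)\<^sup>2 * sqrt (1 - snd p)"]
      BC_trace_integrable[of "\<lambda>p. (Y2 p)\<^sup>2 * sqrt (1 - snd p)"]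
    by (intro set_integral_add(2)) (simp_all add: continuous_intros c1 c2)
  finally have nR: "(norm_BC \<Omega> x0 (dy u))\<^sup>2 = R Y1 + R Y2" .
  let ?n = "\<lambda>x. b / g x powr \<alpha> * h_fun \<alpha> \<beta> x0 x"
  have sP: "(norm (bvalue \<Omega> (wdx u) (sigma_param \<alpha> \<beta> x0 x)))\<^sup>2 * norm (vector_derivative (sigma_param \<alpha> \<beta> x0) (at x))
      = g x * ((X1 (x, g x))\<^sup>2 + (X2 (x, g x))\<^sup>2) * ?n x"
    and sR: "(norm (bvalue \<Omega> (dy u) (sigma_param \<alpha> \<beta> x0 x)))\<^sup>2 * norm (vector_derivative (sigma_param \<alpha> \<beta> x0) (at x))
      = ((Y1 (x, g x))\<^sup>2 + (Y2 (x, g x))\<^sup>2) * ?n x" if x: "2 * x0 < x" "x < 0" for x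
  proof -
    have s: "sigma_param \<alpha> \<beta> x0 x = (x, g x)" by (simp add: sigma_param_def)
    show "(norm (bvalue \<Omega> (wdx u) (sigma_param \<alpha> \<beta> x0 x)))\<^sup>2 * norm (vector_derivative (sigma_param \<alpha> \<beta> x0) (at x))
      = g x * ((X1 (x, g x))\<^sup>2 + (X2 (x, g x))\<^sup>2) * ?n x"
      unfolding s sigma_param_speed[OF x] bvS(3)[OF x] using g_pos[OF x] by simp
    show "(norm (bvalue \<Omega> (dy u) (sigma_param \<alpha> \<beta> x0 x)))\<^sup>2 * norm (vector_derivative (sigma_param \<alpha> \<beta> x0) (at x))
      = ((Y1 (x, g x))\<^sup>2 + (Y2 (x, g x))\<^sup>2) * ?n x"
      unfolding s sigma_param_speed[OF x] bvS(4)[OF x] ..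
  qed
  have nS: "(norm_sigma \<Omega> \<alpha> \<beta> x0 (wdx u))\<^sup>2 = (LINT x:?X|lebesgue. g x * ((X1 (x, g x))\<^sup>2 + (X2 (x, g x))\<^sup>2) * ?n x)"
      "(norm_sigma \<Omega> \<alpha> \<beta> x0 (dy u))\<^sup>2 = (LINT x:?X|lebesgue. ((Y1 (x, g x))\<^sup>2 + (Y2 (x, g x))\<^sup>2) * ?n x)"
    by (rule arc_norm_eq(1)[OF sP], assumption+) (rule arc_norm_eq(1)[OF sR], assumption+)
  \<comment> \<open>The arclength density is unbounded near the vertices, so bounded traces alone do
    not settle integrability on \<sigma>; the square integrability of the derivatives on this arc
    does.\<close>
  have iS: "set_integrable lebesgue ?X (\<lambda>x. g x * ((X1 (x, g x))\<^sup>2 + (X2 (x, g x))\<^sup>2) * ?n x)"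
    "set_integrable lebesgue ?X (\<lambda>x. ((Y1 (x, g x))\<^sup>2 + (Y2 (x, g x))\<^sup>2) * ?n x)"
    by (rule arc_norm_eq(2)[OF sP assms(17)], assumption+) (rule arc_norm_eq(2)[OF sR assms(19)], assumption+)
  have \<sigma>: "(LINT x:?X|lebesgue. sigma_flux X1 Y1 x) + (LINT x:?X|lebesgue. sigma_flux X2 Y2 x)
    \<le> C25 \<alpha> \<beta> x0 \<epsilon>2 * (norm_sigma \<Omega> \<alpha> \<beta> x0 (wdx u))\<^sup>2 + C26 \<alpha> \<beta> x0 \<epsilon>2 * (norm_sigma \<Omega> \<alpha> \<beta> x0 (dy u))\<^sup>2"
    unfolding nS by (rule sigma_flux_integral_le[OF i1(2) i2(2) assms(21) iS])
  let ?NP = "norm_BC \<Omega> x0 (wdx u)" and ?NR = "norm_BC \<Omega> x0 (dy u)"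
    and ?T1 = "norm_BC \<Omega> x0 (\<lambda>p. Re (u p))" and ?T2 = "norm_BC \<Omega> x0 (\<lambda>p. Im (u p))"
  have n0: "?NP \<ge> 0" "?NR \<ge> 0" "?T1 \<ge> 0" "?T2 \<ge> 0" by (rule arc_norm_nonneg)+
  \<comment> \<open>The squared norms on BC are sums over the two components, so each component of a
    derivative is bounded by the full norm. This is why the mixed term has the separate norms of Re
    u and Im u but the complex norms of the derivatives.\<close>
  have sq: "sqrt (P X1) \<le> ?NP" "sqrt (P X2) \<le> ?NP" "sqrt (R Y1) \<le> ?NR" "sqrt (R Y2) \<le> ?NR"
    using pos nP nR n0 by (auto intro!: real_le_lsqrt)
  have sT: "sqrt (R V1) = ?T1" "sqrt (R V2) = ?T2" unfolding nT[symmetric] using n0 by simp_all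
  have c3: "C3 x0 \<ge> 0" by (simp add: C3_def)
  note b1 = BC_flux_integral_le[OF c1 i1(1) assms(20), folded P_def R_def]
    and b2 = BC_flux_integral_le[OF c2 i2(1) assms(20), folded P_def R_def]
  have "C3 x0 * (sqrt (R V1) * (sqrt (P X1) + sqrt (R Y1))) \<le> C3 x0 * (?T1 * (?NP + ?NR))"
    "C3 x0 * (sqrt (R V2) * (sqrt (P X2) + sqrt (R Y2))) \<le> C3 x0 * (?T2 * (?NP + ?NR))"
    unfolding sT by (intro mult_left_mono add_mono sq n0 c3)+
  then have BCs: "(LINT y:?L|lebesgue. BC_flux V1 X1 Y1 y) + (LINT y:?L|lebesgue. BC_flux V2 X2 Y2 y)
    \<le> C1 x0 \<epsilon>1 * ?NP\<^sup>2 + C2 x0 \<epsilon>1 * ?NR\<^sup>2 + C3 x0 * (?T1 + ?T2) * (?NP + ?NR)"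
    using b1 b2 unfolding nP nR ring_distribs mult.assoc by linarith
  have KV: "continuous_on (closure \<Omega>) (\<lambda>p. (V1 p)\<^sup>2 + (V2 p)\<^sup>2)" by (intro continuous_intros c1 c2)
  obtain K where K: "\<And>p. p \<in> closure \<Omega> \<Longrightarrow> \<bar>(V1 p)\<^sup>2 + (V2 p)\<^sup>2\<bar> \<le> K"
    using bounded_on_compact[OF compact_closure_dom KV] by blast
  have intV: "integrable (lebesgue_on \<Omega>) (\<lambda>p. (V p)\<^sup>2)" if "continuous_on (closure \<Omega>) V" for V :: "real \<times> real \<Rightarrow> real"
  proof -
    have c: "continuous_on (closure \<Omega>) (\<lambda>p. (V p)\<^sup>2)" by (intro continuous_intros that)
    obtain K where K: "\<And>p. p \<in> closure \<Omega> \<Longrightarrow> \<bar>(V p)\<^sup>2\<bar> \<le> K"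
      using bounded_on_compact[OF compact_closure_dom c] by blast
    show ?thesis
      by (rule integrable_bounded_continuous_on[OF dom_open dom_bounded continuous_on_subset[OF c closure_subset] K])
        (use closure_subset in blast)
  qed
  have nu: "(norm (u p))\<^sup>2 = (V1 p)\<^sup>2 + (V2 p)\<^sup>2" if "p \<in> \<Omega>" for p
    using e1(1)[OF that] e2(1)[OF that] by (simp add: cmod_power2)
  have O: "\<Omega> \<in> sets lebesgue" using dom_open by simp
  have iu: "integrable (lebesgue_on \<Omega>) (\<lambda>p. (norm (u p))\<^sup>2)"
    using Bochner_Integration.integrable_add[OF intV[OF c1(1)] intV[OF c2(1)]]
    by (rule Bochner_Integration.integrable_cong[THEN iffD1, OF refl, rotated]) (simp add: nu)
  have "integral\<^sup>L (lebesgue_on \<Omega>) (\<lambda>p. (norm (u p))\<^sup>2) = integral\<^sup>L (lebesgue_on \<Omega>) (\<lambda>p. (V1 p)\<^sup>2 + (V2 p)\<^sup>2)"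
    by (rule Bochner_Integration.integral_cong) (simp_all add: nu)
  also have "\<dots> = (LINT p:\<Omega>|lebesgue. (V1 p)\<^sup>2) + (LINT p:\<Omega>|lebesgue. (V2 p)\<^sup>2)"
    using Bochner_Integration.integral_add[OF intV[OF c1(1)] intV[OF c2(1)]]
    by (simp add: set_lebesgue_integral_restrict[OF O])
  finally have iuV: "integral\<^sup>L (lebesgue_on \<Omega>) (\<lambda>p. (norm (u p))\<^sup>2)
    = (LINT p:\<Omega>|lebesgue. (V1 p)\<^sup>2) + (LINT p:\<Omega>|lebesgue. (V2 p)\<^sup>2)" .
  have ge: "integral\<^sup>L (lebesgue_on \<Omega>) (\<lambda>p. (norm (u p))\<^sup>2) \<ge> 0" by (intro integral_nonneg_AE) simp
  have "integral\<^sup>L (lebesgue_on \<Omega>) (\<lambda>p. (norm (u p))\<^sup>2) \<noteq> 0"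
    using integral_nonneg_eq_0_iff_AE[OF iu] assms(10) by simp
  with ge have "integral\<^sup>L (lebesgue_on \<Omega>) (\<lambda>p. (norm (u p))\<^sup>2) > 0" by linarith
  then have N: "L2_norm \<Omega> u > 0" "(L2_norm \<Omega> u)\<^sup>2 = (LINT p:\<Omega>|lebesgue. (V1 p)\<^sup>2) + (LINT p:\<Omega>|lebesgue. (V2 p)\<^sup>2)"
    using ge by (simp_all add: L2_norm_def iuV[symmetric])
  have lam: "lam > 0" using assms(5,6) by (simp add: is_principal_eigenvalue_def)
  have "(2 * sqrt lam * L2_norm \<Omega> u)\<^sup>2 = 4 * lam * (L2_norm \<Omega> u)\<^sup>2" using lam by (simp add: power_mult_distrib)
  also have "\<dots> = 4 * lam * (LINT p:\<Omega>|lebesgue. (V1 p)\<^sup>2) + 4 * lam * (LINT p:\<Omega>|lebesgue. (V2 p)\<^sup>2)"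
    unfolding N(2) by (rule distrib_left)
  also have "\<dots> \<le> C1 x0 \<epsilon>1 * ?NP\<^sup>2 + C2 x0 \<epsilon>1 * ?NR\<^sup>2 + C3 x0 * (?T1 + ?T2) * (?NP + ?NR)
      + C25 \<alpha> \<beta> x0 \<epsilon>2 * (norm_sigma \<Omega> \<alpha> \<beta> x0 (wdx u))\<^sup>2 + C26 \<alpha> \<beta> x0 \<epsilon>2 * (norm_sigma \<Omega> \<alpha> \<beta> x0 (dy u))\<^sup>2"
    unfolding p1 p2 using BCs \<sigma> by linarith
  finally have "2 * sqrt lam * L2_norm \<Omega> u \<le> sqrt (C1 x0 \<epsilon>1 * ?NP\<^sup>2 + C2 x0 \<epsilon>1 * ?NR\<^sup>2 + C3 x0 * (?T1 + ?T2) * (?NP + ?NR)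
      + C25 \<alpha> \<beta> x0 \<epsilon>2 * (norm_sigma \<Omega> \<alpha> \<beta> x0 (wdx u))\<^sup>2 + C26 \<alpha> \<beta> x0 \<epsilon>2 * (norm_sigma \<Omega> \<alpha> \<beta> x0 (dy u))\<^sup>2)"
    by (rule real_le_rsqrt)
  moreover have "0 < 2 * sqrt lam * L2_norm \<Omega> u" using lam N(1) by simp
  ultimately show ?thesis by blast
qed

end
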